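(* Let $\Gamma$ be a discrete group. Then the following are equivalent: (i) $\Gamma$ is amenable; (ii) $PF_p(\Gamma)$ is amenable for all $p\in(1,\infty)$; (iii) $PF_p(\Gamma)$ is approximately amenable for some $p\in(1,\infty)$; (iv) $PF_p(\Gamma)$ is pseudo-amenable for some $p\in(1,\infty)$.
   Context: For $p\in(1,\infty)$ let $\theta_p:\ell^1(\Gamma)\to\mathcal B(\ell^p(\Gamma))$ be the injective continuous homomorphism induced by the left regular representation of $\Gamma$ on $\ell^p(\Gamma)$ (left translation/convolution). $PF_p(\Gamma)$, the algebra of $p$-pseudofunctions, is the norm closure of $\theta_p(\ell^1(\Gamma))$ in $\mathcal B(\ell^p(\Gamma))$. A Banach algebra $A$ is amenable if every bounded derivation from $A$ into a dual Banach $A$-bimodule $X^*$ is inner. It is approximately amenable if for every Banach $A$-bimodule $X$ and every bounded derivation $D:A\to X^*$ there is a net $(D_\alpha)$ of inner derivations $A\to X^*$ with $D_\alpha(a)\to D(a)$ in norm for all $a\in A$. It is pseudo-amenable if it has an approximate diagonal: a net $(M_i)$ in the projective tensor product $A\widehat\otimes A$ with $aM_i-M_ia\to0$ and $a\pi(M_i)\to a$ in norm for each $a\in A$, where $\pi(a\otimes b)=ab$, $c(a\otimes b)=ca\otimes b$ and $(a\otimes b)c=a\otimes bc$. *)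

theory Defs
  imports "HOL-Analysis.Analysis" "HOL-Algebra.Module"
begin

section \<open>Complex normed spaces and Banach algebras with explicit carriers\<close>

text \<open>
  The spaces below depend on the exponent \<open>p\<close> and on quantified bimodules, so they are
  HOL-Algebra structures with a carrier. The ring part of the record supplies addition; its
  multiplication is meaningful for algebras only, and its unit is never used in an axiom
  (Banach algebras are not assumed unital).
\<close>

record 'x normed_module = "(complex, 'x) module" +
  nrm :: "'x \<Rightarrow> real"

definition complex_alg :: "complex normed_module" where
  "complex_alg = \<lparr>carrier = UNIV, mult = (*), one = 1, zero = 0, add = (+), smult = (*), nrm = cmod\<rparr>"

text \<open>The value \<open>0\<close> off the carrier is needed because \<^locale>\<open>Metric_space\<close> requires
  symmetry and nonnegativity of the distance on the whole type.\<close>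

definition norm_dist :: "('x, 'm) normed_module_scheme \<Rightarrow> 'x \<Rightarrow> 'x \<Rightarrow> real" where
  "norm_dist X x y =
     (if x \<in> carrier X \<and> y \<in> carrier X then nrm X (x \<ominus>\<^bsub>X\<^esub> y) else 0)"

locale complex_normed_space = module complex_alg X
  for X :: "('x, 'm) normed_module_scheme" (structure) +
  assumes nrm_nonneg: "x \<in> carrier X \<Longrightarrow> 0 \<le> nrm X x"
    and nrm_eq_zero: "x \<in> carrier X \<Longrightarrow> nrm X x = 0 \<longleftrightarrow> x = \<zero>"
    and nrm_smult: "x \<in> carrier X \<Longrightarrow> nrm X (c \<odot> x) = cmod c * nrm X x"
    and nrm_triangle:
      "\<lbrakk>x \<in> carrier X; y \<in> carrier X\<rbrakk> \<Longrightarrow> nrm X (x \<oplus> y) \<le> nrm X x + nrm X y"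

lemma module_complex_alg: "module complex_alg complex_alg"
proof -
  have c: "cring complex_alg"
    by (rule cringI; (rule abelian_groupI comm_monoidI)?)
      (auto simp: complex_alg_def algebra_simps intro: exI[of _ "- x" for x])
  then have "abelian_group complex_alg"
    by (simp add: cring_def ring.is_abelian_group)
  with c show ?thesis
    by (rule moduleI) (auto simp: complex_alg_def algebra_simps)
qed

lemma (in complex_normed_space) nrm_uminus:
  assumes x: "x \<in> carrier X"
  shows "nrm X (\<ominus> x) = nrm X x"
proof -
  have "\<ominus>\<^bsub>complex_alg\<^esub> 1 = (- 1 :: complex)"
    by (rule R.minus_equality) (auto simp: complex_alg_def)
  moreover have "1 \<odot> x = x"
    using smult_one[OF x] by (simp add: complex_alg_def)
  ultimately have "\<ominus> x = (- 1) \<odot> x"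
    using smult_l_minus[of 1 x] x by (simp add: complex_alg_def)
  with x show ?thesis by (simp add: nrm_smult)
qed

sublocale complex_normed_space \<subseteq> norm: Metric_space "carrier X" "norm_dist X"
proof
  fix x y
  show "0 \<le> norm_dist X x y"
    by (simp add: norm_dist_def nrm_nonneg)
  show "norm_dist X x y = norm_dist X y x"
  proof (cases "x \<in> carrier X \<and> y \<in> carrier X")
    case True
    then have "\<ominus> (x \<ominus> y) = y \<ominus> x"
      by (simp add: M.minus_eq M.minus_add M.a_comm)
    with True nrm_uminus[of "x \<ominus> y"] show ?thesis
      by (simp add: norm_dist_def)
  qed (auto simp: norm_dist_def)
next
  fix x y assume "x \<in> carrier X" "y \<in> carrier X"
  then show "norm_dist X x y = 0 \<longleftrightarrow> x = y"
    by (simp add: norm_dist_def nrm_eq_zero) (metis M.add.inv_closed M.add.inv_equality M.minus_eq M.minus_minus M.r_neg)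
next
  fix x y z assume c: "x \<in> carrier X" "y \<in> carrier X" "z \<in> carrier X"
  then have "x \<ominus> z = (x \<ominus> y) \<oplus> (y \<ominus> z)"
    by (simp add: M.minus_eq M.a_assoc M.r_neg1 M.l_neg)
  with c show "norm_dist X x z \<le> norm_dist X x y + norm_dist X y z"
    by (simp add: norm_dist_def nrm_triangle)
qed

locale complex_banach_space = complex_normed_space +
  assumes norm_complete: "Metric_space.mcomplete (carrier X) (norm_dist X)"

locale banach_algebra = complex_banach_space A
  for A :: "('a, 'm) normed_module_scheme" (structure) +
  assumes mult_closed: "\<lbrakk>a \<in> carrier A; b \<in> carrier A\<rbrakk> \<Longrightarrow> a \<otimes> b \<in> carrier A"
    and mult_assoc: "\<lbrakk>a \<in> carrier A; b \<in> carrier A; c \<in> carrier A\<rbrakk> \<Longrightarrow>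
      (a \<otimes> b) \<otimes> c = a \<otimes> (b \<otimes> c)"
    and mult_distrib_left: "\<lbrakk>a \<in> carrier A; b \<in> carrier A; c \<in> carrier A\<rbrakk> \<Longrightarrow>
      a \<otimes> (b \<oplus> c) = a \<otimes> b \<oplus> a \<otimes> c"
    and mult_distrib_right: "\<lbrakk>a \<in> carrier A; b \<in> carrier A; c \<in> carrier A\<rbrakk> \<Longrightarrow>
      (a \<oplus> b) \<otimes> c = a \<otimes> c \<oplus> b \<otimes> c"
    and mult_smult_left: "\<lbrakk>a \<in> carrier A; b \<in> carrier A\<rbrakk> \<Longrightarrow>
      (k \<odot> a) \<otimes> b = k \<odot> (a \<otimes> b)"
    and mult_smult_right: "\<lbrakk>a \<in> carrier A; b \<in> carrier A\<rbrakk> \<Longrightarrow>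
      a \<otimes> (k \<odot> b) = k \<odot> (a \<otimes> b)"
    and nrm_mult: "\<lbrakk>a \<in> carrier A; b \<in> carrier A\<rbrakk> \<Longrightarrow>
      nrm A (a \<otimes> b) \<le> nrm A a * nrm A b"

text \<open>
  Maps between carriers are extended by zero, so that equality of maps is equality on the carrier.
\<close>

definition bounded_maps ::
    "('x, 'm) normed_module_scheme \<Rightarrow> ('y, 'n) normed_module_scheme \<Rightarrow> ('x \<Rightarrow> 'y) normed_module" where
  "bounded_maps X Y =
     \<lparr>carrier = {T. T \<in> carrier X \<rightarrow> carrier Y \<and>
        (\<forall>x. x \<notin> carrier X \<longrightarrow> T x = \<zero>\<^bsub>Y\<^esub>) \<and>
        (\<forall>x\<in>carrier X. \<forall>y\<in>carrier X. T (x \<oplus>\<^bsub>X\<^esub> y) = T x \<oplus>\<^bsub>Y\<^esub> T y) \<and>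
        (\<forall>c. \<forall>x\<in>carrier X. T (c \<odot>\<^bsub>X\<^esub> x) = c \<odot>\<^bsub>Y\<^esub> T x) \<and>
        (\<exists>K. \<forall>x\<in>carrier X. nrm Y (T x) \<le> K * nrm X x)},
      mult = undefined, one = undefined,
      zero = (\<lambda>_. \<zero>\<^bsub>Y\<^esub>), add = (\<lambda>S T x. S x \<oplus>\<^bsub>Y\<^esub> T x),
      smult = (\<lambda>c T x. c \<odot>\<^bsub>Y\<^esub> T x),
      nrm = (\<lambda>T. SUP x\<in>{x \<in> carrier X. nrm X x \<le> 1}. nrm Y (T x))\<rparr>"

definition dual_space :: "('x, 'm) normed_module_scheme \<Rightarrow> ('x \<Rightarrow> complex) normed_module" where
  "dual_space X = bounded_maps X complex_alg"

definition bounded_operators :: "('x, 'm) normed_module_scheme \<Rightarrow> ('x \<Rightarrow> 'x) normed_module" where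
  "bounded_operators X = (bounded_maps X X)
     \<lparr>mult := (\<circ>), one := (\<lambda>x. if x \<in> carrier X then x else \<zero>\<^bsub>X\<^esub>)\<rparr>"

section \<open>Banach bimodules and derivations\<close>

record ('a, 'x) bimodule = "'x normed_module" +
  lact :: "'a \<Rightarrow> 'x \<Rightarrow> 'x"
  ract :: "'x \<Rightarrow> 'a \<Rightarrow> 'x"

locale banach_bimodule = A: banach_algebra A + X: complex_banach_space X
  for A :: "('a, 'm) normed_module_scheme" and X :: "('a, 'x, 'n) bimodule_scheme" +
  assumes lact_closed: "\<lbrakk>a \<in> carrier A; x \<in> carrier X\<rbrakk> \<Longrightarrow> lact X a x \<in> carrier X"
    and ract_closed: "\<lbrakk>a \<in> carrier A; x \<in> carrier X\<rbrakk> \<Longrightarrow> ract X x a \<in> carrier X"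
    and lact_add_left: "\<lbrakk>a \<in> carrier A; b \<in> carrier A; x \<in> carrier X\<rbrakk> \<Longrightarrow>
      lact X (a \<oplus>\<^bsub>A\<^esub> b) x = lact X a x \<oplus>\<^bsub>X\<^esub> lact X b x"
    and lact_add_right: "\<lbrakk>a \<in> carrier A; x \<in> carrier X; y \<in> carrier X\<rbrakk> \<Longrightarrow>
      lact X a (x \<oplus>\<^bsub>X\<^esub> y) = lact X a x \<oplus>\<^bsub>X\<^esub> lact X a y"
    and ract_add_left: "\<lbrakk>a \<in> carrier A; x \<in> carrier X; y \<in> carrier X\<rbrakk> \<Longrightarrow>
      ract X (x \<oplus>\<^bsub>X\<^esub> y) a = ract X x a \<oplus>\<^bsub>X\<^esub> ract X y a"
    and ract_add_right: "\<lbrakk>a \<in> carrier A; b \<in> carrier A; x \<in> carrier X\<rbrakk> \<Longrightarrow>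
      ract X x (a \<oplus>\<^bsub>A\<^esub> b) = ract X x a \<oplus>\<^bsub>X\<^esub> ract X x b"
    and lact_smult_left: "\<lbrakk>a \<in> carrier A; x \<in> carrier X\<rbrakk> \<Longrightarrow>
      lact X (c \<odot>\<^bsub>A\<^esub> a) x = c \<odot>\<^bsub>X\<^esub> lact X a x"
    and lact_smult_right: "\<lbrakk>a \<in> carrier A; x \<in> carrier X\<rbrakk> \<Longrightarrow>
      lact X a (c \<odot>\<^bsub>X\<^esub> x) = c \<odot>\<^bsub>X\<^esub> lact X a x"
    and ract_smult_left: "\<lbrakk>a \<in> carrier A; x \<in> carrier X\<rbrakk> \<Longrightarrow>
      ract X (c \<odot>\<^bsub>X\<^esub> x) a = c \<odot>\<^bsub>X\<^esub> ract X x a"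
    and ract_smult_right: "\<lbrakk>a \<in> carrier A; x \<in> carrier X\<rbrakk> \<Longrightarrow>
      ract X x (c \<odot>\<^bsub>A\<^esub> a) = c \<odot>\<^bsub>X\<^esub> ract X x a"
    and lact_assoc: "\<lbrakk>a \<in> carrier A; b \<in> carrier A; x \<in> carrier X\<rbrakk> \<Longrightarrow>
      lact X (a \<otimes>\<^bsub>A\<^esub> b) x = lact X a (lact X b x)"
    and ract_assoc: "\<lbrakk>a \<in> carrier A; b \<in> carrier A; x \<in> carrier X\<rbrakk> \<Longrightarrow>
      ract X x (a \<otimes>\<^bsub>A\<^esub> b) = ract X (ract X x a) b"
    and lact_ract: "\<lbrakk>a \<in> carrier A; b \<in> carrier A; x \<in> carrier X\<rbrakk> \<Longrightarrow>
      ract X (lact X a x) b = lact X a (ract X x b)"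
    and act_bounded: "\<exists>K. \<forall>a\<in>carrier A. \<forall>x\<in>carrier X.
      nrm X (lact X a x) \<le> K * nrm A a * nrm X x \<and> nrm X (ract X x a) \<le> K * nrm A a * nrm X x"

text \<open>The dual actions are \<open>(a \<cdot> f)(x) = f (x \<cdot> a)\<close> and \<open>(f \<cdot> a)(x) = f (a \<cdot> x)\<close>.\<close>

definition dual_bimodule :: "('a, 'x, 'n) bimodule_scheme \<Rightarrow> ('a, 'x \<Rightarrow> complex) bimodule" where
  "dual_bimodule X = normed_module.extend (dual_space X) (bimodule.fields
     (\<lambda>a f x. if x \<in> carrier X then f (ract X x a) else 0)
     (\<lambda>f a x. if x \<in> carrier X then f (lact X a x) else 0))"

definition bounded_derivation ::
    "('a, 'm) normed_module_scheme \<Rightarrow> ('a, 'y, 'n) bimodule_scheme \<Rightarrow> ('a \<Rightarrow> 'y) \<Rightarrow> bool" where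
  "bounded_derivation A Y D \<longleftrightarrow> D \<in> carrier (bounded_maps A Y) \<and>
     (\<forall>a\<in>carrier A. \<forall>b\<in>carrier A.
        D (a \<otimes>\<^bsub>A\<^esub> b) = lact Y a (D b) \<oplus>\<^bsub>Y\<^esub> ract Y (D a) b)"

definition inner_derivation ::
    "('a, 'm) normed_module_scheme \<Rightarrow> ('a, 'y, 'n) bimodule_scheme \<Rightarrow> ('a \<Rightarrow> 'y) \<Rightarrow> bool" where
  "inner_derivation A Y D \<longleftrightarrow> bounded_derivation A Y D \<and>
     (\<exists>y\<in>carrier Y. \<forall>a\<in>carrier A. D a = lact Y a y \<ominus>\<^bsub>Y\<^esub> ract Y y a)"

section \<open>Amenability and approximate amenability of Banach algebras\<close>

text \<open>
  HOL cannot quantify over types inside a formula. The type \<open>'x\<close> is the universe from which the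
  carriers of the bimodules are taken; it is passed explicitly.
\<close>

definition amenable :: "'x itself \<Rightarrow> ('a, 'm) normed_module_scheme \<Rightarrow> bool" where
  "amenable (_ :: 'x itself) A \<longleftrightarrow> banach_algebra A \<and>
     (\<forall>X :: ('a, 'x) bimodule. banach_bimodule A X \<longrightarrow>
       (\<forall>D. bounded_derivation A (dual_bimodule X) D \<longrightarrow> inner_derivation A (dual_bimodule X) D))"

text \<open>
  Nets are rendered by proper filters: a net of inner derivations induces its eventuality filter on
  the type of maps, and conversely every proper filter is the eventuality filter of a net. This
  leaves the index sets of the nets unrestricted.
\<close>

definition approximately_amenable :: "'x itself \<Rightarrow> ('a, 'm) normed_module_scheme \<Rightarrow> bool" where
  "approximately_amenable (_ :: 'x itself) A \<longleftrightarrow> banach_algebra A \<and>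
     (\<forall>X :: ('a, 'x) bimodule. banach_bimodule A X \<longrightarrow>
       (\<forall>D. bounded_derivation A (dual_bimodule X) D \<longrightarrow>
         (\<exists>F. F \<noteq> bot \<and>
            (\<forall>\<^sub>F E in F. inner_derivation A (dual_bimodule X) E) \<and>
            (\<forall>a\<in>carrier A.
               ((\<lambda>E. nrm (dual_bimodule X) (E a \<ominus>\<^bsub>dual_bimodule X\<^esub> D a)) \<longlongrightarrow> 0) F))))"

section \<open>The projective tensor product and pseudo-amenability\<close>

text \<open>
  Every element of the projective tensor product of \<open>X\<close> and \<open>Y\<close> is a series of elementary tensors
  \<open>\<Sum>n. x n \<otimes> y n\<close> with \<open>\<Sum>n. \<parallel>x n\<parallel> * \<parallel>y n\<parallel> < \<infinity>\<close>, its norm is the infimum of these sums over all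
  representations, and its dual is the space of bounded bilinear forms. Accordingly \<open>x \<otimes> y\<close>
  is the evaluation \<open>\<phi> \<mapsto> \<phi> x y\<close>, and two series are identified when they agree on all bounded
  bilinear forms.
\<close>

type_synonym ('x, 'y) tensor = "('x \<Rightarrow> 'y \<Rightarrow> complex) \<Rightarrow> complex"

definition bounded_bilinear_forms ::
    "('x, 'm) normed_module_scheme \<Rightarrow> ('y, 'n) normed_module_scheme \<Rightarrow> ('x \<Rightarrow> 'y \<Rightarrow> complex) set" where
  "bounded_bilinear_forms X Y = {\<phi>.
     (\<forall>x\<in>carrier X. \<forall>x'\<in>carrier X. \<forall>y\<in>carrier Y. \<phi> (x \<oplus>\<^bsub>X\<^esub> x') y = \<phi> x y + \<phi> x' y) \<and>
     (\<forall>x\<in>carrier X. \<forall>y\<in>carrier Y. \<forall>y'\<in>carrier Y. \<phi> x (y \<oplus>\<^bsub>Y\<^esub> y') = \<phi> x y + \<phi> x y') \<and>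
     (\<forall>c. \<forall>x\<in>carrier X. \<forall>y\<in>carrier Y.
        \<phi> (c \<odot>\<^bsub>X\<^esub> x) y = c * \<phi> x y \<and> \<phi> x (c \<odot>\<^bsub>Y\<^esub> y) = c * \<phi> x y) \<and>
     (\<exists>K. \<forall>x\<in>carrier X. \<forall>y\<in>carrier Y. cmod (\<phi> x y) \<le> K * nrm X x * nrm Y y)}"

definition tensor_sequences ::
    "('x, 'm) normed_module_scheme \<Rightarrow> ('y, 'n) normed_module_scheme \<Rightarrow>
     ((nat \<Rightarrow> 'x) \<times> (nat \<Rightarrow> 'y)) set" where
  "tensor_sequences X Y = {(x, y). range x \<subseteq> carrier X \<and> range y \<subseteq> carrier Y \<and>
     summable (\<lambda>n. nrm X (x n) * nrm Y (y n))}"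

definition tensor_series ::
    "('x, 'm) normed_module_scheme \<Rightarrow> ('y, 'n) normed_module_scheme \<Rightarrow>
     (nat \<Rightarrow> 'x) \<Rightarrow> (nat \<Rightarrow> 'y) \<Rightarrow> ('x, 'y) tensor" where
  "tensor_series X Y x y =
     (\<lambda>\<phi>. if \<phi> \<in> bounded_bilinear_forms X Y then \<Sum>n. \<phi> (x n) (y n) else 0)"

definition projective_tensor ::
    "('x, 'm) normed_module_scheme \<Rightarrow> ('y, 'n) normed_module_scheme \<Rightarrow>
     ('x, 'y) tensor normed_module" where
  "projective_tensor X Y =
     \<lparr>carrier = {tensor_series X Y x y | x y. (x, y) \<in> tensor_sequences X Y},
      mult = undefined, one = undefined,
      zero = (\<lambda>_. 0), add = (\<lambda>u v \<phi>. u \<phi> + v \<phi>), smult = (\<lambda>c u \<phi>. c * u \<phi>),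
      nrm = (\<lambda>u. Inf {(\<Sum>n. nrm X (x n) * nrm Y (y n)) | x y.
        (x, y) \<in> tensor_sequences X Y \<and> tensor_series X Y x y = u})\<rparr>"

text \<open>On elementary tensors, \<open>c (a \<otimes> b) = c a \<otimes> b\<close> and \<open>(a \<otimes> b) c = a \<otimes> b c\<close>.\<close>

definition tensor_square ::
    "('a, 'm) normed_module_scheme \<Rightarrow> ('a, ('a, 'a) tensor) bimodule" where
  "tensor_square A = normed_module.extend (projective_tensor A A) (bimodule.fields
     (\<lambda>c u \<phi>. if \<phi> \<in> bounded_bilinear_forms A A then u (\<lambda>a b. \<phi> (c \<otimes>\<^bsub>A\<^esub> a) b) else 0)
     (\<lambda>u c \<phi>. if \<phi> \<in> bounded_bilinear_forms A A then u (\<lambda>a b. \<phi> a (b \<otimes>\<^bsub>A\<^esub> c)) else 0))"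

text \<open>The product map \<open>\<pi>\<close>: the sum of \<open>a n \<otimes> b n\<close> is sent to the norm limit of the partial sums
  of the products \<open>a n b n\<close>, independently of the chosen representation.\<close>

definition tensor_product_map :: "('a, 'm) normed_module_scheme \<Rightarrow> ('a, 'a) tensor \<Rightarrow> 'a" where
  "tensor_product_map A u = (THE z. z \<in> carrier A \<and>
     (\<exists>a b. (a, b) \<in> tensor_sequences A A \<and> tensor_series A A a b = u \<and>
        (\<lambda>n. nrm A ((\<Oplus>\<^bsub>A\<^esub>k\<in>{..<n}. a k \<otimes>\<^bsub>A\<^esub> b k) \<ominus>\<^bsub>A\<^esub> z)) \<longlonglongrightarrow> 0))"

definition pseudo_amenable :: "('a, 'm) normed_module_scheme \<Rightarrow> bool" where
  "pseudo_amenable A \<longleftrightarrow> banach_algebra A \<and>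
     (\<exists>F. F \<noteq> bot \<and> (\<forall>\<^sub>F M in F. M \<in> carrier (tensor_square A)) \<and>
        (\<forall>a\<in>carrier A.
           ((\<lambda>M. nrm (tensor_square A)
              (lact (tensor_square A) a M \<ominus>\<^bsub>tensor_square A\<^esub> ract (tensor_square A) M a)) \<longlongrightarrow> 0) F \<and>
           ((\<lambda>M. nrm A (a \<otimes>\<^bsub>A\<^esub> tensor_product_map A M \<ominus>\<^bsub>A\<^esub> a)) \<longlongrightarrow> 0) F))"

section \<open>Amenable groups and pseudofunctions\<close>

text \<open>Functions on the group are extended by zero outside its carrier.\<close>

definition linf :: "('g, 'b) monoid_scheme \<Rightarrow> ('g \<Rightarrow> complex) normed_module" where
  "linf G =
     \<lparr>carrier = {f. (\<forall>s. s \<notin> carrier G \<longrightarrow> f s = 0) \<and> bounded (f ` carrier G)},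
      mult = undefined, one = undefined,
      zero = (\<lambda>_. 0), add = (\<lambda>f h s. f s + h s), smult = (\<lambda>c f s. c * f s),
      nrm = (\<lambda>f. SUP s\<in>carrier G. cmod (f s))\<rparr>"

text \<open>Existence of a left-invariant mean on \<open>\<ell>\<^sup>\<infinity>(G)\<close>.\<close>

definition amenable_group :: "('g, 'b) monoid_scheme \<Rightarrow> bool" where
  "amenable_group G \<longleftrightarrow> (\<exists>m\<in>carrier (dual_space (linf G)).
     nrm (dual_space (linf G)) m = 1 \<and>
     m (\<lambda>s. if s \<in> carrier G then 1 else 0) = 1 \<and>
     (\<forall>g\<in>carrier G. \<forall>f\<in>carrier (linf G).
        m (\<lambda>s. if s \<in> carrier G then f (g \<otimes>\<^bsub>G\<^esub> s) else 0) = m f))"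

definition lp :: "('g, 'b) monoid_scheme \<Rightarrow> real \<Rightarrow> ('g \<Rightarrow> complex) normed_module" where
  "lp G p =
     \<lparr>carrier = {f. (\<forall>s. s \<notin> carrier G \<longrightarrow> f s = 0) \<and>
        (\<lambda>s. cmod (f s) powr p) summable_on carrier G},
      mult = undefined, one = undefined,
      zero = (\<lambda>_. 0), add = (\<lambda>f h s. f s + h s), smult = (\<lambda>c f s. c * f s),
      nrm = (\<lambda>f. (\<Sum>\<^sub>\<infinity>s\<in>carrier G. cmod (f s) powr p) powr (1 / p))\<rparr>"

definition convolution ::
    "('g, 'b) monoid_scheme \<Rightarrow> ('g \<Rightarrow> complex) \<Rightarrow> ('g \<Rightarrow> complex) \<Rightarrow> ('g \<Rightarrow> complex)" where
  "convolution G f h = (\<lambda>s. if s \<in> carrier G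
     then \<Sum>\<^sub>\<infinity>t\<in>carrier G. f t * h (inv\<^bsub>G\<^esub> t \<otimes>\<^bsub>G\<^esub> s) else 0)"

type_synonym 'g operator = "('g \<Rightarrow> complex) \<Rightarrow> ('g \<Rightarrow> complex)"

definition left_regular ::
    "('g, 'b) monoid_scheme \<Rightarrow> real \<Rightarrow> ('g \<Rightarrow> complex) \<Rightarrow> 'g operator" where
  "left_regular G p f = (\<lambda>h. if h \<in> carrier (lp G p) then convolution G f h else (\<lambda>_. 0))"

definition norm_closure :: "('x, 'm) normed_module_scheme \<Rightarrow> 'x set \<Rightarrow> 'x set" where
  "norm_closure X S =
     Abstract_Topology.closure_of (Metric_space.mtopology (carrier X) (norm_dist X)) S"

definition PF :: "('g, 'b) monoid_scheme \<Rightarrow> real \<Rightarrow> 'g operator normed_module" where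
  "PF G p = (bounded_operators (lp G p))
     \<lparr>carrier := norm_closure (bounded_operators (lp G p)) (left_regular G p ` carrier (lp G 1))\<rparr>"

text \<open>
  A type of carriers for bimodules: a copy of an arbitrary type \<open>'x\<close>, so that every Banach bimodule
  (up to isomorphism) is covered as \<open>'x\<close> varies, together with a copy of the functions on tensors
  over \<open>'a\<close>, without which a small \<open>'x\<close> would provide too few bimodules over an algebra with
  elements of type \<open>'a\<close>.
\<close>

type_synonym ('a, 'x) bimodule_universe = "'x + (('a, 'a) tensor \<Rightarrow> complex)"

end

theory Submission
  imports Defs
begin

text \<open>
  Write \<open>\<tau> a = a \<delta>\<^sub>1 1\<close> for the canonical trace of an operator on \<open>\<ell>\<^sup>p\<close>. A bounded function \<open>f\<close> on the group
  gives a bounded bilinear form \<open>(a, b) \<mapsto> \<tau> (a f b)\<close> on the algebra of pseudofunctions, with \<open>f\<close> acting by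
  multiplication. Pseudofunctions commute with right translations, so translating \<open>f\<close> amounts to replacing \<open>a \<otimes> b\<close> by
  \<open>g a \<otimes> b g\<inverse>\<close>. Evaluating an approximate diagonal at these forms therefore gives functionals
  \<open>m\<close> on \<open>\<ell>\<^sup>\<infinity>\<close> that are almost invariant and satisfy \<open>m 1 \<approx> 1\<close>; the same holds for the functionals that almost
  implement the derivation \<open>a \<mapsto> a \<otimes> 1 - 1 \<otimes> a\<close> into the second dual of the kernel of the product map. Nothing is known
  about their norms, but passing to the total variation \<open>\<bar>m\<bar>\<close> keeps almost invariance, and a separation argument
  then yields an invariant mean.

  Conversely, an invariant mean averages a derivation over the group to an implementing functional,
  and by separation in \<open>\<ell>\<^sup>1\<close> it provides finitely supported probabilities \<open>\<phi>\<close> that are almost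
  invariant in norm; \<open>\<Sum>s. \<phi> s (\<lambda> s \<otimes> \<lambda> (s\<inverse>))\<close> is then an approximate diagonal.
\<close>

section \<open>Normed spaces with carriers\<close>

text \<open>The obstacle is the missing norm bound: the functionals \<open>m\<close> may be
  arbitrarily large, so no weak-star limit of them is at hand. Their invariance errors are absolute,
  however, while \<open>m 1\<close> is bounded below. If a finite sum of shift differences were at
  most \<open>- c\<close> everywhere, monotonicity and additivity of the variation would produce a
  gap of at least \<open>c / 2\<close>, whereas almost invariance bounds the gap by the tolerance
  times a constant that depends on the sum alone. Hence 1 plus such a coboundary always has supremum
  norm at least 1, and Hahn-Banach gives the mean without a limit of the \<open>m\<close>.
  Additivity holds on nonnegative functions only, so coboundaries are treated as differences of such
  functions. A second constraint is that bimodules range over one fixed type. The dual of the kernel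
  of the product map is therefore modelled by bilinear forms on the algebra, which inject into that
  type. Finally, bimodules need not be unital: averaging implements a derivation only up to
  multiplication by the unit, and the remainder is treated algebraically.\<close>

lemma complex_alg_simps [simp]:
  "carrier complex_alg = UNIV" "add complex_alg = (+)" "zero complex_alg = 0"
  "one complex_alg = 1" "mult complex_alg = (*)" "smult complex_alg = (*)" "nrm complex_alg = cmod"
  by (simp_all add: complex_alg_def)

text \<open>Homogeneity of the norm is asked for as an inequality only: applied to
  \<open>inverse c\<close>, it yields the reverse one. Negatives come from \<open>l_neg\<close>, and
  the norm of zero from scaling by 0.\<close>

lemma complex_normed_spaceI:
  fixes X :: "('x, 'm) normed_module_scheme" (structure)
  assumes zero: "\<zero> \<in> carrier X"
    and add: "\<And>x y. \<lbrakk>x \<in> carrier X; y \<in> carrier X\<rbrakk> \<Longrightarrow> x \<oplus> y \<in> carrier X"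
    and smult: "\<And>c x. x \<in> carrier X \<Longrightarrow> c \<odot> x \<in> carrier X"
    and assoc: "\<And>x y z. \<lbrakk>x \<in> carrier X; y \<in> carrier X; z \<in> carrier X\<rbrakk> \<Longrightarrow> (x \<oplus> y) \<oplus> z = x \<oplus> (y \<oplus> z)"
    and comm: "\<And>x y. \<lbrakk>x \<in> carrier X; y \<in> carrier X\<rbrakk> \<Longrightarrow> x \<oplus> y = y \<oplus> x"
    and l_zero: "\<And>x. x \<in> carrier X \<Longrightarrow> \<zero> \<oplus> x = x"
    and l_neg: "\<And>x. x \<in> carrier X \<Longrightarrow> (- 1) \<odot> x \<oplus> x = \<zero>"
    and smult_l: "\<And>a b x. x \<in> carrier X \<Longrightarrow> (a + b) \<odot> x = a \<odot> x \<oplus> b \<odot> x"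
    and smult_r: "\<And>a x y. \<lbrakk>x \<in> carrier X; y \<in> carrier X\<rbrakk> \<Longrightarrow> a \<odot> (x \<oplus> y) = a \<odot> x \<oplus> a \<odot> y"
    and smult_mult: "\<And>a b x. x \<in> carrier X \<Longrightarrow> (a * b) \<odot> x = a \<odot> (b \<odot> x)"
    and smult_1: "\<And>x. x \<in> carrier X \<Longrightarrow> 1 \<odot> x = x"
    and nonneg: "\<And>x. x \<in> carrier X \<Longrightarrow> 0 \<le> nrm X x"
    and eq_zero: "\<And>x. \<lbrakk>x \<in> carrier X; nrm X x = 0\<rbrakk> \<Longrightarrow> x = \<zero>"
    and nrm_smult_le: "\<And>c x. x \<in> carrier X \<Longrightarrow> nrm X (c \<odot> x) \<le> cmod c * nrm X x"
    and triangle: "\<And>x y. \<lbrakk>x \<in> carrier X; y \<in> carrier X\<rbrakk> \<Longrightarrow> nrm X (x \<oplus> y) \<le> nrm X x + nrm X y"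
  shows "complex_normed_space X"
proof -
  have ab: "abelian_group X"
  proof (rule abelian_groupI)
    show "\<exists>y\<in>carrier X. y \<oplus> x = \<zero>" if "x \<in> carrier X" for x
      using l_neg smult that by blast
  qed (use assms in auto)
  have c: "cring complex_alg"
    using module_complex_alg by (simp add: module_def)
  have m: "module complex_alg X"
    by (rule moduleI[OF c ab]) (use assms in auto)
  have nrm_smult: "nrm X (c \<odot> x) = cmod c * nrm X x" if x: "x \<in> carrier X" for c x
  proof (cases "c = 0")
    case True
    then show ?thesis
      using nrm_smult_le[OF x, of 0] nonneg[OF smult[OF x], of 0] by simp
  next
    case False
    have "nrm X x \<le> cmod (inverse c) * nrm X (c \<odot> x)"
      using nrm_smult_le[OF smult[OF x], of "inverse c" c] False x
      by (simp add: smult_1 flip: smult_mult)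
    from mult_left_mono[OF this norm_ge_zero[of c]]
    have "cmod c * nrm X x \<le> nrm X (c \<odot> x)"
      using False by (simp only: norm_inverse mult.assoc[symmetric]) simp
    with nrm_smult_le[OF x, of c] show ?thesis by simp
  qed
  have "nrm X (0 \<odot> \<zero>) = 0"
    using nrm_smult[OF zero, of 0] by simp
  with eq_zero[OF smult[OF zero]] have "nrm X \<zero> = 0"
    by metis
  with m show ?thesis
    unfolding complex_normed_space_def complex_normed_space_axioms_def
    using nonneg eq_zero nrm_smult triangle by auto
qed

context complex_normed_space
begin

lemma smult_mem [simp, intro]: "x \<in> carrier X \<Longrightarrow> c \<odot> x \<in> carrier X"
  using smult_closed[of c x] by simp

lemma smult_add_left: "x \<in> carrier X \<Longrightarrow> (a + b) \<odot> x = a \<odot> x \<oplus> b \<odot> x"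
  using smult_l_distr[of a b x] by simp

lemma smult_add_right: "\<lbrakk>x \<in> carrier X; y \<in> carrier X\<rbrakk> \<Longrightarrow> a \<odot> (x \<oplus> y) = a \<odot> x \<oplus> a \<odot> y"
  using smult_r_distr[of a x y] by simp

lemma smult_mult: "x \<in> carrier X \<Longrightarrow> (a * b) \<odot> x = a \<odot> (b \<odot> x)"
  using smult_assoc1[of a b x] by simp

lemma smult_1 [simp]: "x \<in> carrier X \<Longrightarrow> 1 \<odot> x = x"
  using smult_one[of x] by simp

lemma smult_0 [simp]: "x \<in> carrier X \<Longrightarrow> 0 \<odot> x = \<zero>"
  using smult_l_null[of x] by simp

lemma uminus_smult: "x \<in> carrier X \<Longrightarrow> \<ominus> x = (- 1) \<odot> x"
  by (rule M.minus_equality) (use smult_add_left[of x "- 1" 1] in auto)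

lemma smult_minus: "\<lbrakk>x \<in> carrier X; y \<in> carrier X\<rbrakk> \<Longrightarrow> c \<odot> (x \<ominus> y) = c \<odot> x \<ominus> c \<odot> y"
  by (simp add: M.minus_eq uminus_smult smult_add_right flip: smult_mult)

lemma minus_mem [simp, intro]: "\<lbrakk>x \<in> carrier X; y \<in> carrier X\<rbrakk> \<Longrightarrow> x \<ominus> y \<in> carrier X"
  by (rule M.minus_closed)

lemma nrm_zero [simp]: "nrm X \<zero> = 0"
  using nrm_eq_zero[of \<zero>] by simp

lemma minus_self [simp]: "x \<in> carrier X \<Longrightarrow> x \<ominus> x = \<zero>"
  by (simp add: M.minus_eq M.r_neg)

lemma minus_zero_right [simp]: "x \<in> carrier X \<Longrightarrow> x \<ominus> \<zero> = x"
  by (simp add: M.minus_eq)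

lemma minus_eq_zero_iff: "\<lbrakk>x \<in> carrier X; y \<in> carrier X\<rbrakk> \<Longrightarrow> x \<ominus> y = \<zero> \<longleftrightarrow> x = y"
  using norm.zero[of x y] nrm_eq_zero[of "x \<ominus> y"] by (simp add: norm_dist_def)

lemma nrm_minus_commute: "\<lbrakk>x \<in> carrier X; y \<in> carrier X\<rbrakk> \<Longrightarrow> nrm X (x \<ominus> y) = nrm X (y \<ominus> x)"
  using norm.commute[of x y] by (simp add: norm_dist_def)

lemma nrm_minus_trans:
  "\<lbrakk>x \<in> carrier X; y \<in> carrier X; z \<in> carrier X\<rbrakk> \<Longrightarrow> nrm X (x \<ominus> z) \<le> nrm X (x \<ominus> y) + nrm X (y \<ominus> z)"
  using norm.triangle[of x y z] by (simp add: norm_dist_def)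

lemma nrm_minus_le: "\<lbrakk>x \<in> carrier X; y \<in> carrier X\<rbrakk> \<Longrightarrow> nrm X (x \<ominus> y) \<le> nrm X x + nrm X y"
  using nrm_triangle[of x "\<ominus> y"] by (simp add: M.minus_eq nrm_uminus)

lemma nrm_le_minus: "\<lbrakk>x \<in> carrier X; y \<in> carrier X\<rbrakk> \<Longrightarrow> nrm X x \<le> nrm X (x \<ominus> y) + nrm X y"
  using nrm_minus_trans[of x y \<zero>] by simp

lemma nrm_diff_le: "\<lbrakk>x \<in> carrier X; y \<in> carrier X\<rbrakk> \<Longrightarrow> \<bar>nrm X x - nrm X y\<bar> \<le> nrm X (x \<ominus> y)"
  using nrm_le_minus[of x y] nrm_le_minus[of y x] nrm_minus_commute[of x y] by linarith

lemma minus_add_add: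
  assumes "a \<in> carrier X" "b \<in> carrier X" "c \<in> carrier X" "d \<in> carrier X"
  shows "(a \<oplus> b) \<ominus> (c \<oplus> d) = (a \<ominus> c) \<oplus> (b \<ominus> d)"
  using assms by (simp add: M.minus_eq M.minus_add M.a_ac)

lemma minus_add_trans:
  assumes "a \<in> carrier X" "b \<in> carrier X" "c \<in> carrier X"
  shows "(a \<ominus> b) \<oplus> (b \<ominus> c) = a \<ominus> c"
  using assms by (simp add: M.minus_eq M.a_assoc) (simp add: M.l_neg flip: M.a_assoc)

lemma minus_add_cancel:
  assumes "a \<in> carrier X" "b \<in> carrier X"
  shows "(a \<ominus> b) \<oplus> b = a"
  using minus_add_trans[of a b \<zero>] assms by simp

lemma eq_if_nrm_minus_zero: "\<lbrakk>x \<in> carrier X; y \<in> carrier X; nrm X (x \<ominus> y) \<le> 0\<rbrakk> \<Longrightarrow> x = y"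
  using nrm_nonneg[of "x \<ominus> y"] nrm_eq_zero[of "x \<ominus> y"] by (simp add: minus_eq_zero_iff)

end

text \<open>Convergence in the metric topology only forces the terms into the carrier eventually.
  Requiring it of every term allows the algebraic laws, which hold on the carrier, to be used
  termwise.\<close>

definition nconv :: "('x, 'm) normed_module_scheme \<Rightarrow> (nat \<Rightarrow> 'x) \<Rightarrow> 'x \<Rightarrow> bool" where
  "nconv X \<sigma> x \<longleftrightarrow> (\<forall>n. \<sigma> n \<in> carrier X) \<and> x \<in> carrier X \<and>
     (\<lambda>n. nrm X (\<sigma> n \<ominus>\<^bsub>X\<^esub> x)) \<longlonglongrightarrow> 0"

context complex_normed_space
begin

lemma nconv_mem: "nconv X \<sigma> x \<Longrightarrow> \<sigma> n \<in> carrier X" "nconv X \<sigma> x \<Longrightarrow> x \<in> carrier X"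
  by (auto simp: nconv_def)

lemma nconv_null: "nconv X \<sigma> x \<Longrightarrow> (\<lambda>n. nrm X (\<sigma> n \<ominus> x)) \<longlonglongrightarrow> 0"
  by (auto simp: nconv_def)

lemma nconvI:
  assumes "\<And>n. \<sigma> n \<in> carrier X" "x \<in> carrier X" "\<And>n. nrm X (\<sigma> n \<ominus> x) \<le> r n" "r \<longlonglongrightarrow> 0"
  shows "nconv X \<sigma> x"
  unfolding nconv_def
proof (intro conjI allI)
  show "(\<lambda>n. nrm X (\<sigma> n \<ominus> x)) \<longlonglongrightarrow> 0"
    by (rule tendsto_sandwich[OF _ _ tendsto_const assms(4)]) (use assms in \<open>auto intro!: always_eventually nrm_nonneg\<close>)
qed (use assms in auto)

lemma nconv_const: "x \<in> carrier X \<Longrightarrow> nconv X (\<lambda>_. x) x"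
  by (simp add: nconv_def)

lemma nconv_add:
  assumes "nconv X \<sigma> x" "nconv X \<tau> y"
  shows "nconv X (\<lambda>n. \<sigma> n \<oplus> \<tau> n) (x \<oplus> y)"
proof (rule nconvI)
  show "(\<lambda>n. nrm X (\<sigma> n \<ominus> x) + nrm X (\<tau> n \<ominus> y)) \<longlonglongrightarrow> 0"
    using tendsto_add[OF assms[THEN nconv_null]] by simp
qed (use assms[THEN nconv_mem(1)] assms[THEN nconv_mem(2)] in \<open>auto simp: minus_add_add intro!: nrm_triangle\<close>)

lemma nconv_smult:
  assumes "nconv X \<sigma> x"
  shows "nconv X (\<lambda>n. c \<odot> \<sigma> n) (c \<odot> x)"
proof (rule nconvI)
  show "(\<lambda>n. cmod c * nrm X (\<sigma> n \<ominus> x)) \<longlonglongrightarrow> 0"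
    using tendsto_mult_left[OF nconv_null[OF assms], of "cmod c"] by simp
qed (use nconv_mem[OF assms] in \<open>auto simp: nrm_smult simp flip: smult_minus\<close>)

lemma nconv_unique:
  assumes "nconv X \<sigma> x" "nconv X \<sigma> y"
  shows "x = y"
proof (rule eq_if_nrm_minus_zero)
  note m = assms[THEN nconv_mem(1)] assms[THEN nconv_mem(2)]
  show "x \<in> carrier X" "y \<in> carrier X" by fact+
  have "(\<lambda>n. nrm X (\<sigma> n \<ominus> x) + nrm X (\<sigma> n \<ominus> y)) \<longlonglongrightarrow> 0 + 0"
    by (intro tendsto_add nconv_null assms)
  moreover have "nrm X (x \<ominus> y) \<le> nrm X (\<sigma> n \<ominus> x) + nrm X (\<sigma> n \<ominus> y)" for n
    using nrm_minus_trans[of x "\<sigma> n" y] m by (simp add: nrm_minus_commute)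
  ultimately show "nrm X (x \<ominus> y) \<le> 0"
    using LIMSEQ_le_const by fastforce
qed

lemma nconv_nrm:
  assumes "nconv X \<sigma> x"
  shows "(\<lambda>n. nrm X (\<sigma> n)) \<longlonglongrightarrow> nrm X x"
proof (rule LIM_zero_cancel)
  show "(\<lambda>n. nrm X (\<sigma> n) - nrm X x) \<longlonglongrightarrow> 0"
    by (rule tendsto_rabs_zero_cancel, rule tendsto_sandwich[OF _ _ tendsto_const nconv_null[OF assms]])
      (use nconv_mem[OF assms] in \<open>auto intro!: always_eventually nrm_diff_le\<close>)
qed

definition ncauchy :: "(nat \<Rightarrow> 'x) \<Rightarrow> bool" where
  "ncauchy \<sigma> \<longleftrightarrow> (\<forall>n. \<sigma> n \<in> carrier X) \<and>
     (\<forall>e>0. \<exists>N. \<forall>m\<ge>N. \<forall>n\<ge>N. nrm X (\<sigma> m \<ominus> \<sigma> n) < e)"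

lemma ncauchy_iff: "ncauchy \<sigma> \<longleftrightarrow> norm.MCauchy \<sigma>"
  unfolding ncauchy_def norm.MCauchy_def by (auto simp: norm_dist_def image_subset_iff cong: conj_cong)

lemma nconv_iff: "(\<forall>n. \<sigma> n \<in> carrier X) \<and> limitin norm.mtopology \<sigma> x sequentially \<longleftrightarrow> nconv X \<sigma> x"
  unfolding norm.limitin_metric_dist_null nconv_def by (auto simp: norm_dist_def cong: conj_cong)

lemma banachI:
  assumes "\<And>\<sigma>. ncauchy \<sigma> \<Longrightarrow> \<exists>x. nconv X \<sigma> x"
  shows "complex_banach_space X"
proof unfold_locales
  show "norm.mcomplete"
    unfolding norm.mcomplete_def using assms nconv_iff ncauchy_iff by blast
qed

text \<open>Replaces the topological closure in the definition of \<open>PF\<close> by approximation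
  in norm, the only form in which it is used.\<close>

lemma mem_norm_closure_iff:
  assumes "S \<subseteq> carrier X"
  shows "x \<in> norm_closure X S \<longleftrightarrow> x \<in> carrier X \<and> (\<forall>e>0. \<exists>y\<in>S. nrm X (x \<ominus> y) < e)"
  unfolding norm_closure_def norm.metric_closure_of norm.mball_def
  using assms by (auto simp: norm_dist_def subset_iff Bex_def) 

end

lemma (in complex_banach_space) ncauchy_nconv:
  assumes "ncauchy \<sigma>"
  obtains x where "nconv X \<sigma> x"
  using norm_complete assms nconv_iff ncauchy_iff unfolding norm.mcomplete_def norm.MCauchy_def
  by (metis UNIV_I image_subset_iff)

lemma complex_alg_banach: "complex_banach_space complex_alg"
proof -
  interpret X: complex_normed_space complex_alg
    by (rule complex_normed_spaceI) (auto simp: algebra_simps norm_mult norm_triangle_ineq)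
  have minus: "x \<ominus>\<^bsub>complex_alg\<^esub> y = x - y" for x y :: complex
    by (simp add: X.R.minus_eq X.uminus_smult)
  show ?thesis
  proof (rule X.banachI)
    fix \<sigma> assume "X.ncauchy \<sigma>"
    then have "Cauchy \<sigma>"
      unfolding X.ncauchy_def minus by (auto simp: Cauchy_def dist_norm)
    then obtain x where "\<sigma> \<longlonglongrightarrow> x" using Cauchy_convergent convergent_def by blast
    then show "\<exists>x. nconv complex_alg \<sigma> x"
      unfolding nconv_def minus by (auto simp: LIM_zero intro!: exI[of _ x] tendsto_norm_zero)
  qed
qed

lemma complex_alg_minus [simp]: "x \<ominus>\<^bsub>complex_alg\<^esub> y = x - y"
proof -
  interpret X: complex_banach_space complex_alg by (rule complex_alg_banach)
  show ?thesis by (simp add: X.R.minus_eq X.uminus_smult)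
qed

lemma (in complex_normed_space) nconv_minus:
  assumes "nconv X \<sigma> x" "nconv X \<tau> y"
  shows "nconv X (\<lambda>n. \<sigma> n \<ominus> \<tau> n) (x \<ominus> y)"
  using nconv_add[OF assms(1) nconv_smult[OF assms(2), of "- 1"]] nconv_mem[OF assms(2)]
  by (simp add: M.minus_eq uminus_smult)

section \<open>Spaces of bounded linear maps and their completeness\<close>

lemma bounded_maps_simps [simp]:
  "zero (bounded_maps X Y) = (\<lambda>_. \<zero>\<^bsub>Y\<^esub>)"
  "add (bounded_maps X Y) S T = (\<lambda>x. S x \<oplus>\<^bsub>Y\<^esub> T x)"
  "smult (bounded_maps X Y) c T = (\<lambda>x. c \<odot>\<^bsub>Y\<^esub> T x)"
  by (simp_all add: bounded_maps_def)

lemma bounded_maps_carrier_iff: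
  "T \<in> carrier (bounded_maps X Y) \<longleftrightarrow> T \<in> carrier X \<rightarrow> carrier Y \<and>
     (\<forall>x. x \<notin> carrier X \<longrightarrow> T x = \<zero>\<^bsub>Y\<^esub>) \<and>
     (\<forall>x\<in>carrier X. \<forall>y\<in>carrier X. T (x \<oplus>\<^bsub>X\<^esub> y) = T x \<oplus>\<^bsub>Y\<^esub> T y) \<and>
     (\<forall>c. \<forall>x\<in>carrier X. T (c \<odot>\<^bsub>X\<^esub> x) = c \<odot>\<^bsub>Y\<^esub> T x) \<and>
     (\<exists>K. \<forall>x\<in>carrier X. nrm Y (T x) \<le> K * nrm X x)"
  by (simp add: bounded_maps_def)

lemma bounded_mapsD:
  assumes "T \<in> carrier (bounded_maps X Y)"
  shows "x \<in> carrier X \<Longrightarrow> T x \<in> carrier Y"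
    and "x \<notin> carrier X \<Longrightarrow> T x = \<zero>\<^bsub>Y\<^esub>"
    and "\<lbrakk>x \<in> carrier X; y \<in> carrier X\<rbrakk> \<Longrightarrow> T (x \<oplus>\<^bsub>X\<^esub> y) = T x \<oplus>\<^bsub>Y\<^esub> T y"
    and "x \<in> carrier X \<Longrightarrow> T (c \<odot>\<^bsub>X\<^esub> x) = c \<odot>\<^bsub>Y\<^esub> T x"
  using assms by (auto simp: bounded_maps_carrier_iff)

lemma bounded_maps_carrierI:
  assumes "\<And>x. x \<in> carrier X \<Longrightarrow> T x \<in> carrier Y"
    and "\<And>x. x \<notin> carrier X \<Longrightarrow> T x = \<zero>\<^bsub>Y\<^esub>"
    and "\<And>x y. \<lbrakk>x \<in> carrier X; y \<in> carrier X\<rbrakk> \<Longrightarrow> T (x \<oplus>\<^bsub>X\<^esub> y) = T x \<oplus>\<^bsub>Y\<^esub> T y"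
    and "\<And>c x. x \<in> carrier X \<Longrightarrow> T (c \<odot>\<^bsub>X\<^esub> x) = c \<odot>\<^bsub>Y\<^esub> T x"
    and "\<And>x. x \<in> carrier X \<Longrightarrow> nrm Y (T x) \<le> K * nrm X x"
  shows "T \<in> carrier (bounded_maps X Y)"
  using assms unfolding bounded_maps_carrier_iff by blast

locale normed_pair = X: complex_normed_space X + Y: complex_normed_space Y
  for X :: "('x, 'm) normed_module_scheme" and Y :: "('y, 'n) normed_module_scheme"
begin

lemma bounded_maps_zero: "T \<in> carrier (bounded_maps X Y) \<Longrightarrow> T \<zero>\<^bsub>X\<^esub> = \<zero>\<^bsub>Y\<^esub>"
  using bounded_mapsD(4)[of T X Y "\<zero>\<^bsub>X\<^esub>" 0] bounded_mapsD(1)[of T X Y "\<zero>\<^bsub>X\<^esub>"] by simp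

lemma bounded_maps_apply_minus:
  assumes "T \<in> carrier (bounded_maps X Y)" "x \<in> carrier X" "y \<in> carrier X"
  shows "T (x \<ominus>\<^bsub>X\<^esub> y) = T x \<ominus>\<^bsub>Y\<^esub> T y"
  using bounded_mapsD[OF assms(1)] assms by (simp add: X.M.minus_eq Y.M.minus_eq X.uminus_smult Y.uminus_smult)

lemma bounded_maps_bound_pos:
  assumes "T \<in> carrier (bounded_maps X Y)"
  obtains K where "K > 0" "\<And>x. x \<in> carrier X \<Longrightarrow> nrm Y (T x) \<le> K * nrm X x"
proof -
  obtain K where K: "\<And>x. x \<in> carrier X \<Longrightarrow> nrm Y (T x) \<le> K * nrm X x"
    using assms unfolding bounded_maps_carrier_iff by blast
  have "nrm Y (T x) \<le> (\<bar>K\<bar> + 1) * nrm X x" if "x \<in> carrier X" for x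
    using K[OF that] mult_right_mono[of K "\<bar>K\<bar> + 1" "nrm X x"] X.nrm_nonneg[OF that] by linarith
  then show ?thesis using that[of "\<bar>K\<bar> + 1"] by auto
qed

lemma bounded_maps_bdd_above:
  assumes "T \<in> carrier (bounded_maps X Y)"
  shows "bdd_above ((\<lambda>x. nrm Y (T x)) ` {x \<in> carrier X. nrm X x \<le> 1})"
proof -
  obtain K where "K > 0" "\<And>x. x \<in> carrier X \<Longrightarrow> nrm Y (T x) \<le> K * nrm X x"
    using bounded_maps_bound_pos[OF assms] by blast
  then show ?thesis
    by (intro bdd_aboveI2[of _ _ K]) (smt (verit) mem_Collect_eq mult_left_le)
qed

lemma bounded_maps_nrm_nonneg:
  assumes "T \<in> carrier (bounded_maps X Y)"
  shows "0 \<le> nrm (bounded_maps X Y) T"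
  using cSUP_upper[OF _ bounded_maps_bdd_above[OF assms], of "\<zero>\<^bsub>X\<^esub>"]
  by (simp add: bounded_maps_def bounded_maps_zero[OF assms])

lemma nrm_apply_le:
  assumes T: "T \<in> carrier (bounded_maps X Y)" and x: "x \<in> carrier X"
  shows "nrm Y (T x) \<le> nrm (bounded_maps X Y) T * nrm X x"
proof (cases "nrm X x = 0")
  case True
  then have "x = \<zero>\<^bsub>X\<^esub>" using X.nrm_eq_zero x by blast
  then show ?thesis by (simp add: bounded_maps_zero[OF T])
next
  case False
  then have pos: "nrm X x > 0" using X.nrm_nonneg[OF x] by simp
  define y where "y = complex_of_real (1 / nrm X x) \<odot>\<^bsub>X\<^esub> x"
  have y: "y \<in> carrier X" "nrm X y = 1"
    using x pos by (auto simp: y_def X.nrm_smult norm_divide)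
  have "nrm Y (T y) \<le> nrm (bounded_maps X Y) T"
    unfolding bounded_maps_def using cSUP_upper[OF _ bounded_maps_bdd_above[OF T], of y] y by simp
  moreover have "nrm Y (T y) = nrm Y (T x) / nrm X x"
    using bounded_mapsD[OF T] x pos by (simp add: y_def Y.nrm_smult norm_divide)
  ultimately show ?thesis using pos by (simp add: field_simps)
qed

lemma bounded_maps_nrm_le:
  assumes K: "0 \<le> K" "\<And>x. x \<in> carrier X \<Longrightarrow> nrm Y (T x) \<le> K * nrm X x"
  shows "nrm (bounded_maps X Y) T \<le> K"
proof -
  have "nrm Y (T x) \<le> K" if "x \<in> carrier X" "nrm X x \<le> 1" for x
    using K(2)[OF that(1)] mult_left_mono[OF that(2) K(1)] by linarith
  moreover have "{x \<in> carrier X. nrm X x \<le> 1} \<noteq> {}"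
    using X.M.zero_closed by (auto intro!: exI[of _ "\<zero>\<^bsub>X\<^esub>"])
  ultimately show ?thesis
    unfolding bounded_maps_def by (auto intro!: cSUP_least)
qed

lemma bounded_maps_add:
  assumes "S \<in> carrier (bounded_maps X Y)" "T \<in> carrier (bounded_maps X Y)"
  shows "(\<lambda>x. S x \<oplus>\<^bsub>Y\<^esub> T x) \<in> carrier (bounded_maps X Y)"
    "nrm (bounded_maps X Y) (\<lambda>x. S x \<oplus>\<^bsub>Y\<^esub> T x) \<le> nrm (bounded_maps X Y) S + nrm (bounded_maps X Y) T"
proof -
  note D = bounded_mapsD[OF assms(1)] bounded_mapsD[OF assms(2)]
  have le: "nrm Y (S x \<oplus>\<^bsub>Y\<^esub> T x) \<le> (nrm (bounded_maps X Y) S + nrm (bounded_maps X Y) T) * nrm X x"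
    if "x \<in> carrier X" for x
    using nrm_apply_le[OF assms(1) that] nrm_apply_le[OF assms(2) that] Y.nrm_triangle[of "S x" "T x"] D that
    by (simp add: distrib_right)
  show "(\<lambda>x. S x \<oplus>\<^bsub>Y\<^esub> T x) \<in> carrier (bounded_maps X Y)"
    by (rule bounded_maps_carrierI[OF _ _ _ _ le]) (use D in \<open>auto simp: Y.M.a_ac Y.smult_add_right\<close>)
  show "nrm (bounded_maps X Y) (\<lambda>x. S x \<oplus>\<^bsub>Y\<^esub> T x) \<le> nrm (bounded_maps X Y) S + nrm (bounded_maps X Y) T"
    by (rule bounded_maps_nrm_le[OF _ le]) (auto intro!: add_nonneg_nonneg bounded_maps_nrm_nonneg assms)
qed

lemma bounded_maps_smult:
  assumes T: "T \<in> carrier (bounded_maps X Y)"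
  shows "(\<lambda>x. c \<odot>\<^bsub>Y\<^esub> T x) \<in> carrier (bounded_maps X Y)"
    "nrm (bounded_maps X Y) (\<lambda>x. c \<odot>\<^bsub>Y\<^esub> T x) \<le> cmod c * nrm (bounded_maps X Y) T"
proof -
  have le: "nrm Y (c \<odot>\<^bsub>Y\<^esub> T x) \<le> (cmod c * nrm (bounded_maps X Y) T) * nrm X x" if "x \<in> carrier X" for x
    using nrm_apply_le[OF T that] bounded_mapsD[OF T] that
    by (simp add: Y.nrm_smult mult.assoc mult_left_mono)
  show "(\<lambda>x. c \<odot>\<^bsub>Y\<^esub> T x) \<in> carrier (bounded_maps X Y)"
    by (rule bounded_maps_carrierI[OF _ _ _ _ le])
      (use bounded_mapsD[OF T] in \<open>auto simp: Y.smult_add_right mult.commute simp flip: Y.smult_mult\<close>)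
  show "nrm (bounded_maps X Y) (\<lambda>x. c \<odot>\<^bsub>Y\<^esub> T x) \<le> cmod c * nrm (bounded_maps X Y) T"
    by (rule bounded_maps_nrm_le[OF _ le]) (auto intro!: mult_nonneg_nonneg bounded_maps_nrm_nonneg T)
qed

lemma bounded_maps_value: "T \<in> carrier (bounded_maps X Y) \<Longrightarrow> T x \<in> carrier Y"
  using bounded_mapsD(1,2)[of T X Y x] by (cases "x \<in> carrier X") auto

lemma bounded_maps_zero_mem: "(\<lambda>_. \<zero>\<^bsub>Y\<^esub>) \<in> carrier (bounded_maps X Y)"
  by (rule bounded_maps_carrierI[of _ _ _ 0]) (auto simp: Y.nrm_nonneg)

sublocale bm: complex_normed_space "bounded_maps X Y"
proof (rule complex_normed_spaceI)
  note V = bounded_maps_value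
  show "T = \<zero>\<^bsub>bounded_maps X Y\<^esub>" if T: "T \<in> carrier (bounded_maps X Y)" and "nrm (bounded_maps X Y) T = 0" for T
  proof
    fix x
    show "T x = \<zero>\<^bsub>bounded_maps X Y\<^esub> x"
      using nrm_apply_le[OF T, of x] that bounded_mapsD(2)[OF T, of x] V[OF T, of x] Y.nrm_nonneg[of "T x"] Y.nrm_eq_zero[of "T x"]
      by (cases "x \<in> carrier X") auto
  qed
  show "(- 1) \<odot>\<^bsub>bounded_maps X Y\<^esub> T \<oplus>\<^bsub>bounded_maps X Y\<^esub> T = \<zero>\<^bsub>bounded_maps X Y\<^esub>"
    if "T \<in> carrier (bounded_maps X Y)" for T
    using V[OF that] by (simp add: Y.M.l_neg Y.M.r_neg flip: Y.uminus_smult)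
qed (simp_all add: fun_eq_iff bounded_maps_add bounded_maps_smult bounded_maps_zero_mem bounded_maps_nrm_nonneg
    Y.M.a_ac Y.smult_add_left Y.smult_add_right Y.smult_mult bounded_maps_value)

lemma bounded_maps_minus_apply:
  assumes "S \<in> carrier (bounded_maps X Y)" "T \<in> carrier (bounded_maps X Y)"
  shows "(S \<ominus>\<^bsub>bounded_maps X Y\<^esub> T) x = S x \<ominus>\<^bsub>Y\<^esub> T x"
proof -
  have "T x \<in> carrier Y"
    using bounded_mapsD[OF assms(2)] by (cases "x \<in> carrier X") auto
  then show ?thesis
    using assms by (simp add: bm.M.minus_eq bm.uminus_smult Y.M.minus_eq Y.uminus_smult)
qed

lemma nconv_apply:
  assumes "nconv (bounded_maps X Y) \<sigma> T" "x \<in> carrier X"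
  shows "nconv Y (\<lambda>n. \<sigma> n x) (T x)"
proof (rule Y.nconvI)
  note m = bm.nconv_mem[OF assms(1)]
  show "(\<lambda>n. nrm (bounded_maps X Y) (\<sigma> n \<ominus>\<^bsub>bounded_maps X Y\<^esub> T) * nrm X x) \<longlonglongrightarrow> 0"
    using tendsto_mult_right[OF bm.nconv_null[OF assms(1)], of "nrm X x"] by simp
  show "nrm Y (\<sigma> n x \<ominus>\<^bsub>Y\<^esub> T x) \<le> nrm (bounded_maps X Y) (\<sigma> n \<ominus>\<^bsub>bounded_maps X Y\<^esub> T) * nrm X x" for n
    using nrm_apply_le[OF _ assms(2), of "\<sigma> n \<ominus>\<^bsub>bounded_maps X Y\<^esub> T"] m
    by (simp add: bounded_maps_minus_apply)
  show "\<sigma> n x \<in> carrier Y" "T x \<in> carrier Y" for n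
    by (intro bounded_maps_value m)+
qed

text \<open>The Cauchy condition is kept as a bound by \<open>e * nrm X x\<close>, with an index
  independent of \<open>x\<close>. Letting \<open>n\<close> tend to infinity in it controls
  \<open>\<sigma> m - T\<close>, which gives both the boundedness of the pointwise limit
  \<open>T\<close> and convergence in norm.\<close>

lemma bounded_maps_banach:
  assumes "complex_banach_space Y"
  shows "complex_banach_space (bounded_maps X Y)"
proof (rule bm.banachI)
  interpret Yb: complex_banach_space Y by fact
  fix \<sigma> assume c: "bm.ncauchy \<sigma>"
  then have mem: "\<sigma> n \<in> carrier (bounded_maps X Y)" for n
    by (simp add: bm.ncauchy_def)
  note D = bounded_mapsD[OF mem]
  have V: "\<sigma> n x \<in> carrier Y" for n x
    using D(1,2)[of x n] by (cases "x \<in> carrier X") auto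
  have cauchy: "\<exists>N. \<forall>m\<ge>N. \<forall>n\<ge>N. \<forall>x\<in>carrier X. nrm Y (\<sigma> m x \<ominus>\<^bsub>Y\<^esub> \<sigma> n x) \<le> e * nrm X x" if "e > 0" for e
  proof -
    have "\<exists>N. \<forall>m\<ge>N. \<forall>n\<ge>N. nrm (bounded_maps X Y) (\<sigma> m \<ominus>\<^bsub>bounded_maps X Y\<^esub> \<sigma> n) < e"
      using c that by (simp add: bm.ncauchy_def)
    then obtain N where N: "\<And>m n. m \<ge> N \<Longrightarrow> n \<ge> N \<Longrightarrow> nrm (bounded_maps X Y) (\<sigma> m \<ominus>\<^bsub>bounded_maps X Y\<^esub> \<sigma> n) < e"
      by blast
    have "nrm Y (\<sigma> m x \<ominus>\<^bsub>Y\<^esub> \<sigma> n x) \<le> e * nrm X x" if "m \<ge> N" "n \<ge> N" "x \<in> carrier X" for m n x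
    proof -
      have "nrm Y (\<sigma> m x \<ominus>\<^bsub>Y\<^esub> \<sigma> n x) \<le> nrm (bounded_maps X Y) (\<sigma> m \<ominus>\<^bsub>bounded_maps X Y\<^esub> \<sigma> n) * nrm X x"
        using nrm_apply_le[OF _ that(3), of "\<sigma> m \<ominus>\<^bsub>bounded_maps X Y\<^esub> \<sigma> n"] mem
        by (simp add: bounded_maps_minus_apply)
      also have "\<dots> \<le> e * nrm X x"
        using N[OF that(1,2)] X.nrm_nonneg[OF that(3)] by (simp add: mult_right_mono)
      finally show ?thesis .
    qed
    then show ?thesis by blast
  qed
  have "\<exists>y. nconv Y (\<lambda>n. \<sigma> n x) y" for x
  proof (cases "x \<in> carrier X")
    case True
    have "Y.ncauchy (\<lambda>n. \<sigma> n x)"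
      unfolding Y.ncauchy_def
    proof (intro conjI allI impI)
      fix e :: real assume "e > 0"
      \<comment> \<open>The summand 1 keeps the denominator positive when \<open>x\<close> is
        zero.\<close>
      define e' where "e' = e / (nrm X x + 1)"
      have nn: "nrm X x \<ge> 0" using X.nrm_nonneg[OF True] .
      have "e' > 0" using \<open>e > 0\<close> nn by (simp add: e'_def)
      then obtain N where N: "\<forall>m\<ge>N. \<forall>n\<ge>N. \<forall>x\<in>carrier X. nrm Y (\<sigma> m x \<ominus>\<^bsub>Y\<^esub> \<sigma> n x) \<le> e' * nrm X x"
        using cauchy by blast
      have "e' * nrm X x < e"
        using nn \<open>e > 0\<close> by (simp add: e'_def field_simps)
      with N True show "\<exists>N. \<forall>m\<ge>N. \<forall>n\<ge>N. nrm Y (\<sigma> m x \<ominus>\<^bsub>Y\<^esub> \<sigma> n x) < e"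
        by (meson order_le_less_trans)
    qed (rule V)
    then show ?thesis using Yb.ncauchy_nconv by blast
  next
    case False
    then show ?thesis using D(2) Y.nconv_const[OF Y.M.zero_closed] by auto
  qed
  then obtain T where T: "\<And>x. nconv Y (\<lambda>n. \<sigma> n x) (T x)" by metis
  have TV: "T x \<in> carrier Y" for x using Y.nconv_mem(2)[OF T] .
  have lim: "\<exists>N. \<forall>m\<ge>N. \<forall>x\<in>carrier X. nrm Y (\<sigma> m x \<ominus>\<^bsub>Y\<^esub> T x) \<le> e * nrm X x" if e: "e > 0" for e
  proof -
    obtain N where N: "\<forall>m\<ge>N. \<forall>n\<ge>N. \<forall>x\<in>carrier X. nrm Y (\<sigma> m x \<ominus>\<^bsub>Y\<^esub> \<sigma> n x) \<le> e * nrm X x"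
      using cauchy[OF e] by blast
    have "nrm Y (\<sigma> m x \<ominus>\<^bsub>Y\<^esub> T x) \<le> e * nrm X x" if "m \<ge> N" "x \<in> carrier X" for m x
    proof (rule LIMSEQ_le_const2)
      show "(\<lambda>n. nrm Y (\<sigma> m x \<ominus>\<^bsub>Y\<^esub> \<sigma> n x)) \<longlonglongrightarrow> nrm Y (\<sigma> m x \<ominus>\<^bsub>Y\<^esub> T x)"
        by (intro Y.nconv_nrm Y.nconv_minus T Y.nconv_const V)
      show "\<exists>N. \<forall>n\<ge>N. nrm Y (\<sigma> m x \<ominus>\<^bsub>Y\<^esub> \<sigma> n x) \<le> e * nrm X x"
        using N that by blast
    qed
    then show ?thesis by blast
  qed
  have Tmem: "T \<in> carrier (bounded_maps X Y)"
  proof -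
    obtain N where N: "\<forall>m\<ge>N. \<forall>x\<in>carrier X. nrm Y (\<sigma> m x \<ominus>\<^bsub>Y\<^esub> T x) \<le> 1 * nrm X x"
      using lim[of 1] by auto
    show ?thesis
    proof (rule bounded_maps_carrierI)
      show "T x = \<zero>\<^bsub>Y\<^esub>" if "x \<notin> carrier X" for x
        using T[of x] D(2)[OF that] Y.nconv_const[OF Y.M.zero_closed] Y.nconv_unique by fastforce
      show "T (x \<oplus>\<^bsub>X\<^esub> y) = T x \<oplus>\<^bsub>Y\<^esub> T y" if "x \<in> carrier X" "y \<in> carrier X" for x y
        using Y.nconv_unique[OF T[of "x \<oplus>\<^bsub>X\<^esub> y"]] Y.nconv_add[OF T[of x] T[of y]] D(3) that by simp
      show "T (c \<odot>\<^bsub>X\<^esub> x) = c \<odot>\<^bsub>Y\<^esub> T x" if "x \<in> carrier X" for c x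
        using Y.nconv_unique[OF T[of "c \<odot>\<^bsub>X\<^esub> x"]] Y.nconv_smult[OF T[of x]] D(4) that by simp
      show "nrm Y (T x) \<le> (nrm (bounded_maps X Y) (\<sigma> N) + 1) * nrm X x" if "x \<in> carrier X" for x
        using Y.nrm_le_minus[OF TV V, of x N x] nrm_apply_le[OF mem that, of N] N[rule_format, OF order_refl that] that
        by (simp add: distrib_right Y.nrm_minus_commute[OF TV V])
    qed (rule TV)
  qed
  have "nconv (bounded_maps X Y) \<sigma> T"
    unfolding nconv_def
  proof (intro conjI allI LIMSEQ_I)
    fix e :: real assume "e > 0"
    then obtain N where N: "\<forall>m\<ge>N. \<forall>x\<in>carrier X. nrm Y (\<sigma> m x \<ominus>\<^bsub>Y\<^esub> T x) \<le> (e/2) * nrm X x"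
      using lim[of "e/2"] by auto
    have "nrm (bounded_maps X Y) (\<sigma> n \<ominus>\<^bsub>bounded_maps X Y\<^esub> T) \<le> e/2" if "n \<ge> N" for n
      by (rule bounded_maps_nrm_le) (use \<open>e > 0\<close> N that mem Tmem in \<open>auto simp: bounded_maps_minus_apply\<close>)
    then show "\<exists>N. \<forall>n\<ge>N. norm (nrm (bounded_maps X Y) (\<sigma> n \<ominus>\<^bsub>bounded_maps X Y\<^esub> T) - 0) < e"
      using bm.nrm_nonneg[OF bm.minus_mem[OF mem Tmem]] \<open>e > 0\<close> by (intro exI[of _ N]) force
  qed (use mem Tmem in auto)
  then show "\<exists>T. nconv (bounded_maps X Y) \<sigma> T" by (intro exI)
qed

end

text \<open>Negatives are definite descriptions over the carrier that mention only addition and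
  zero, so structures that differ in their other fields share their subtraction.\<close>

lemma a_minus_cong:
  assumes "carrier X = carrier Y" "add X = add Y" "zero X = zero Y"
  shows "a_minus X = a_minus Y"
  by (intro ext) (simp add: a_minus_def a_inv_def m_inv_def assms)

lemma complex_normed_space_cong:
  assumes Y: "complex_normed_space Y"
    and eq: "carrier X = carrier Y" "add X = add Y" "zero X = zero Y" "smult X = smult Y" "nrm X = nrm Y"
  shows "complex_normed_space X"
proof -
  interpret Y: complex_normed_space Y by fact
  show ?thesis
    by (rule complex_normed_spaceI)
      (simp_all add: eq Y.M.a_ac Y.smult_add_left Y.smult_add_right Y.smult_mult Y.nrm_nonneg
        Y.nrm_eq_zero Y.nrm_smult Y.nrm_triangle Y.M.l_neg Y.M.r_neg flip: Y.uminus_smult)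
qed

lemma complex_banach_space_cong:
  assumes Y: "complex_banach_space Y"
    and eq: "carrier X = carrier Y" "add X = add Y" "zero X = zero Y" "smult X = smult Y" "nrm X = nrm Y"
  shows "complex_banach_space X"
proof -
  interpret Y: complex_banach_space Y by fact
  interpret X: complex_normed_space X
    using Y.complex_normed_space_axioms eq by (rule complex_normed_space_cong)
  have "norm_dist X = norm_dist Y"
    using a_minus_cong[OF eq(1-3)] by (intro ext) (simp add: norm_dist_def eq)
  then show ?thesis
    by unfold_locales (use Y.norm_complete eq(1) in simp)
qed

lemma (in complex_normed_space) subspace_normed:
  assumes S: "S \<subseteq> carrier X" "\<zero> \<in> S" "\<And>x y. \<lbrakk>x \<in> S; y \<in> S\<rbrakk> \<Longrightarrow> x \<oplus> y \<in> S" "\<And>c x. x \<in> S \<Longrightarrow> c \<odot> x \<in> S"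
  shows "complex_normed_space (X\<lparr>carrier := S\<rparr>)"
proof -
  have *: "x \<in> carrier X" if "x \<in> S" for x using that S(1) by auto
  show ?thesis
    by (rule complex_normed_spaceI)
      (simp_all add: * S(2-4) M.a_ac smult_add_left smult_add_right smult_mult nrm_nonneg
        nrm_eq_zero nrm_smult nrm_triangle M.l_neg M.r_neg flip: uminus_smult)
qed

text \<open>Shrinking the carrier changes the range of the description that defines negatives. The
  result is the same because a negative is the multiple by \<open>- 1\<close> in either
  space.\<close>

lemma (in complex_normed_space) subspace_minus:
  assumes S: "S \<subseteq> carrier X" "\<zero> \<in> S" "\<And>x y. \<lbrakk>x \<in> S; y \<in> S\<rbrakk> \<Longrightarrow> x \<oplus> y \<in> S" "\<And>c x. x \<in> S \<Longrightarrow> c \<odot> x \<in> S"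
    and x: "x \<in> S" "y \<in> S"
  shows "x \<ominus>\<^bsub>X\<lparr>carrier := S\<rparr>\<^esub> y = x \<ominus> y"
proof -
  interpret S: complex_normed_space "X\<lparr>carrier := S\<rparr>"
    using S by (rule subspace_normed)
  show ?thesis
    using x S(1) S.M.minus_eq[of x y] S.uminus_smult[of y] M.minus_eq[of x y] uminus_smult[of y]
    by auto
qed

lemma (in complex_banach_space) closed_subspace_banach:
  assumes S: "S \<subseteq> carrier X" "\<zero> \<in> S" "\<And>x y. \<lbrakk>x \<in> S; y \<in> S\<rbrakk> \<Longrightarrow> x \<oplus> y \<in> S" "\<And>c x. x \<in> S \<Longrightarrow> c \<odot> x \<in> S"
    and closed: "\<And>\<sigma> x. \<lbrakk>nconv X \<sigma> x; \<And>n. \<sigma> n \<in> S\<rbrakk> \<Longrightarrow> x \<in> S"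
  shows "complex_banach_space (X\<lparr>carrier := S\<rparr>)"
proof -
  interpret S: complex_normed_space "X\<lparr>carrier := S\<rparr>"
    using S by (rule subspace_normed)
  note minus = subspace_minus[OF S]
  show ?thesis
  proof (rule S.banachI)
    fix \<sigma> assume c: "S.ncauchy \<sigma>"
    then have mem: "\<sigma> n \<in> S" for n by (simp add: S.ncauchy_def)
    have "ncauchy \<sigma>"
      using c mem S(1) unfolding S.ncauchy_def ncauchy_def by (auto simp: minus)
    then obtain x where x: "nconv X \<sigma> x" using ncauchy_nconv by blast
    with closed mem have "x \<in> S" by blast
    with x mem have "nconv (X\<lparr>carrier := S\<rparr>) \<sigma> x"
      unfolding nconv_def by (auto simp: minus)
    then show "\<exists>x. nconv (X\<lparr>carrier := S\<rparr>) \<sigma> x" ..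
  qed
qed

lemma bounded_operators_simps [simp]:
  "carrier (bounded_operators X) = carrier (bounded_maps X X)"
  "zero (bounded_operators X) = zero (bounded_maps X X)"
  "add (bounded_operators X) = add (bounded_maps X X)"
  "smult (bounded_operators X) = smult (bounded_maps X X)"
  "nrm (bounded_operators X) = nrm (bounded_maps X X)"
  "mult (bounded_operators X) = (\<circ>)"
  "one (bounded_operators X) = (\<lambda>x. if x \<in> carrier X then x else \<zero>\<^bsub>X\<^esub>)"
  by (simp_all add: bounded_operators_def)

lemma bounded_operators_minus [simp]:
  "a_minus (bounded_operators X) = a_minus (bounded_maps X X)"
  by (rule a_minus_cong) simp_all

context complex_normed_space
begin

lemma comp_bounded:
  assumes "S \<in> carrier (bounded_maps X X)" "T \<in> carrier (bounded_maps X X)"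
  shows "S \<circ> T \<in> carrier (bounded_maps X X)"
    "nrm (bounded_maps X X) (S \<circ> T) \<le> nrm (bounded_maps X X) S * nrm (bounded_maps X X) T"
proof -
  interpret P: normed_pair X X ..
  note D = bounded_mapsD[OF assms(1)] bounded_mapsD[OF assms(2)]
  have le: "nrm X ((S \<circ> T) x) \<le> nrm (bounded_maps X X) S * nrm (bounded_maps X X) T * nrm X x"
    if "x \<in> carrier X" for x
    using P.nrm_apply_le[OF assms(1), of "T x"] mult_left_mono[OF P.nrm_apply_le[OF assms(2) that] P.bounded_maps_nrm_nonneg[OF assms(1)]] D(5)[OF that]
    by (simp add: mult.assoc)
  show "S \<circ> T \<in> carrier (bounded_maps X X)"
    by (rule bounded_maps_carrierI[OF _ _ _ _ le]) (use D P.bounded_maps_zero[OF assms(1)] in auto)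
  show "nrm (bounded_maps X X) (S \<circ> T) \<le> nrm (bounded_maps X X) S * nrm (bounded_maps X X) T"
    by (rule P.bounded_maps_nrm_le[OF _ le]) (auto intro!: mult_nonneg_nonneg P.bounded_maps_nrm_nonneg assms)
qed

end

lemma (in complex_banach_space) bounded_operators_banach_algebra:
  "banach_algebra (bounded_operators X)"
proof -
  interpret P: normed_pair X X ..
  interpret B: complex_banach_space "bounded_operators X"
    by (rule complex_banach_space_cong[OF P.bounded_maps_banach])
      (simp_all add: complex_banach_space_axioms fun_eq_iff)
  note V = P.bounded_maps_value
  show ?thesis
  proof (intro banach_algebra.intro B.complex_banach_space_axioms banach_algebra_axioms.intro)
    fix R S T assume m: "R \<in> carrier (bounded_operators X)" "S \<in> carrier (bounded_operators X)"
      "T \<in> carrier (bounded_operators X)"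
    then have m': "R \<in> carrier (bounded_maps X X)" "S \<in> carrier (bounded_maps X X)"
      "T \<in> carrier (bounded_maps X X)"
      by simp_all
    show "R \<otimes>\<^bsub>bounded_operators X\<^esub> (S \<oplus>\<^bsub>bounded_operators X\<^esub> T) =
        R \<otimes>\<^bsub>bounded_operators X\<^esub> S \<oplus>\<^bsub>bounded_operators X\<^esub> R \<otimes>\<^bsub>bounded_operators X\<^esub> T"
      by (simp add: fun_eq_iff bounded_mapsD(3)[OF m'(1) V[OF m'(2)] V[OF m'(3)]])
  next
    fix R S k assume m: "R \<in> carrier (bounded_operators X)" "S \<in> carrier (bounded_operators X)"
    then have m': "R \<in> carrier (bounded_maps X X)" "S \<in> carrier (bounded_maps X X)"
      by simp_all
    show "R \<otimes>\<^bsub>bounded_operators X\<^esub> (k \<odot>\<^bsub>bounded_operators X\<^esub> S) =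
        k \<odot>\<^bsub>bounded_operators X\<^esub> (R \<otimes>\<^bsub>bounded_operators X\<^esub> S)"
      by (simp add: fun_eq_iff bounded_mapsD(4)[OF m'(1) V[OF m'(2)]])
  next
    fix S T assume "S \<in> carrier (bounded_operators X)" "T \<in> carrier (bounded_operators X)"
    then show "S \<otimes>\<^bsub>bounded_operators X\<^esub> T \<in> carrier (bounded_operators X)"
      "nrm (bounded_operators X) (S \<otimes>\<^bsub>bounded_operators X\<^esub> T) \<le> nrm (bounded_operators X) S * nrm (bounded_operators X) T"
      using comp_bounded by simp_all
  qed (simp_all add: fun_eq_iff)
qed

section \<open>The algebra of pseudofunctions\<close>

text \<open>Convexity of the power function, with the endpoint 0 included: when \<open>a\<close> or
  \<open>b\<close> vanishes, the claim is \<open>w powr p \<le> w\<close> for a weight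
  \<open>w\<close> in the unit interval.\<close>

lemma powr_convex_ineq:
  fixes a b u v p :: real
  assumes "0 \<le> a" "0 \<le> b" "0 \<le> u" "0 \<le> v" "u + v = 1" "1 \<le> p"
  shows "(u * a + v * b) powr p \<le> u * a powr p + v * b powr p"
proof -
  have *: "(w * c) powr p \<le> w * c powr p" if "0 \<le> w" "w \<le> 1" "0 \<le> c" for w c :: real
  proof -
    have "w powr p \<le> w"
      using powr_mono'[of 1 p w] that assms(6) by (cases "w = 0") auto
    then show ?thesis using that by (simp add: powr_mult mult_right_mono)
  qed
  consider "a = 0" | "b = 0" | "a > 0" "b > 0" using assms by linarith
  then show ?thesis
  proof cases
    case 1 then show ?thesis using *[of v b] assms by simp
  next
    case 2 then show ?thesis using *[of u a] assms by simp
  next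
    case 3
    have u: "u = 1 - v" using assms by simp
    show ?thesis
      using convex_onD[OF powr_convex[OF assms(6)], of v a b] assms 3 by (simp add: u)
  qed
qed

section \<open>The Banach spaces \<open>lp G p\<close>\<close>

lemma lp_simps [simp]:
  "zero (lp G p) = (\<lambda>_. 0)" "add (lp G p) f h = (\<lambda>s. f s + h s)" "smult (lp G p) c f = (\<lambda>s. c * f s)"
  by (simp_all add: lp_def)

lemma lp_outside: "\<lbrakk>f \<in> carrier (lp G p); s \<notin> carrier G\<rbrakk> \<Longrightarrow> f s = 0"
  by (simp add: lp_def)

lemma lp_nrm_nonneg [simp]: "0 \<le> nrm (lp G p) f"
  by (simp add: lp_def)

text \<open>Trades summability and the infinite sum for finite sums, so that the estimates on
  \<open>lp\<close> below can be made termwise and deliver membership together with the norm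
  bound.\<close>

lemma lp_le_iff:
  assumes p: "p > 0" and C: "C \<ge> 0"
  shows "f \<in> carrier (lp G p) \<and> nrm (lp G p) f \<le> C \<longleftrightarrow>
     (\<forall>s. s \<notin> carrier G \<longrightarrow> f s = 0) \<and>
     (\<forall>F. finite F \<longrightarrow> F \<subseteq> carrier G \<longrightarrow> (\<Sum>s\<in>F. cmod (f s) powr p) \<le> C powr p)"
    (is "?L \<longleftrightarrow> ?R")
proof
  assume L: ?L
  let ?I = "\<Sum>\<^sub>\<infinity>s\<in>carrier G. cmod (f s) powr p"
  have sm: "(\<lambda>s. cmod (f s) powr p) summable_on carrier G" and I: "?I powr (1/p) \<le> C"
    using L by (auto simp: lp_def)
  have nn: "0 \<le> ?I" by (rule infsum_nonneg) simp
  have "?I = (?I powr (1/p)) powr p" using nn p by (simp add: powr_powr)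
  also have "\<dots> \<le> C powr p" using I p by (intro powr_mono2) auto
  finally have "?I \<le> C powr p" .
  then have "(\<Sum>s\<in>F. cmod (f s) powr p) \<le> C powr p" if "finite F" "F \<subseteq> carrier G" for F
    using finite_sum_le_infsum[OF sm that] by fastforce
  then show ?R
    using L by (auto simp: lp_def)
next
  assume R: ?R
  have sm: "(\<lambda>s. cmod (f s) powr p) summable_on carrier G"
    using R by (intro nonneg_bdd_above_summable_on bdd_aboveI2[of _ _ "C powr p"]) auto
  have "(\<Sum>\<^sub>\<infinity>s\<in>carrier G. cmod (f s) powr p) \<le> C powr p"
    using R by (intro infsum_le_finite_sums sm) auto
  then have "(\<Sum>\<^sub>\<infinity>s\<in>carrier G. cmod (f s) powr p) powr (1/p) \<le> (C powr p) powr (1/p)"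
    using p by (intro powr_mono2 infsum_nonneg) auto
  also have "\<dots> = C" using p C by (simp add: powr_powr)
  finally show ?L using sm R by (auto simp: lp_def)
qed

lemma lp_leI:
  assumes "p > 0" "C \<ge> 0" "\<And>s. s \<notin> carrier G \<Longrightarrow> f s = 0"
    "\<And>F. \<lbrakk>finite F; F \<subseteq> carrier G\<rbrakk> \<Longrightarrow> (\<Sum>s\<in>F. cmod (f s) powr p) \<le> C powr p"
  shows "f \<in> carrier (lp G p)" "nrm (lp G p) f \<le> C"
  using assms lp_le_iff[of p C f G] by auto

lemma lp_leD:
  assumes "p > 0" "f \<in> carrier (lp G p)" "nrm (lp G p) f \<le> C" "finite F" "F \<subseteq> carrier G"
  shows "(\<Sum>s\<in>F. cmod (f s) powr p) \<le> C powr p"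
  using lp_le_iff[of p C f G] lp_nrm_nonneg[of G p f] assms by (meson order_trans)

lemma lp_coordinate_le:
  assumes "p > 0" "f \<in> carrier (lp G p)"
  shows "cmod (f s) \<le> nrm (lp G p) f"
proof (cases "s \<in> carrier G")
  case True
  have "cmod (f s) powr p \<le> nrm (lp G p) f powr p"
    using lp_leD[OF assms order_refl, of "{s}"] True by simp
  then show ?thesis
    using assms(1) powr_mono2'[of p] by (smt (verit) lp_nrm_nonneg powr_less_mono2)
qed (use assms lp_outside in fastforce)

text \<open>Minkowski's inequality: the sum of the moduli is \<open>C + D\<close> times a convex
  combination of \<open>cmod (f s) / C\<close> and \<open>cmod (h s) / D\<close>, to which convexity
  of the power applies.\<close>

lemma lp_add:
  assumes p: "p \<ge> 1" and f: "f \<in> carrier (lp G p)" and h: "h \<in> carrier (lp G p)"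
  shows "(\<lambda>s. f s + h s) \<in> carrier (lp G p)"
    "nrm (lp G p) (\<lambda>s. f s + h s) \<le> nrm (lp G p) f + nrm (lp G p) h"
proof -
  \<comment> \<open>Positive upper bounds \<open>C\<close>, \<open>D\<close> replace the norms,
    which may vanish and could not be divided by. The norms themselves are reached by letting the
    excess tend to 0.\<close>
  have main: "(\<lambda>s. f s + h s) \<in> carrier (lp G p) \<and> nrm (lp G p) (\<lambda>s. f s + h s) \<le> C + D"
    if C: "nrm (lp G p) f \<le> C" "C > 0" and D: "nrm (lp G p) h \<le> D" "D > 0" for C D
  proof (rule lp_le_iff[THEN iffD2])
    show "(\<forall>s. s \<notin> carrier G \<longrightarrow> f s + h s = 0) \<and>
      (\<forall>F. finite F \<longrightarrow> F \<subseteq> carrier G \<longrightarrow> (\<Sum>s\<in>F. cmod (f s + h s) powr p) \<le> (C + D) powr p)"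
    proof (intro conjI allI impI)
      fix F assume F: "finite F" "F \<subseteq> carrier G"
      \<comment> \<open>With these weights the factor \<open>C + D\<close> can be pulled out of the
        sum of the moduli.\<close>
      define u v where "u = C / (C + D)" "v = D / (C + D)"
      have uv: "0 \<le> u" "0 \<le> v" "u + v = 1" using C D by (auto simp: u_v_def simp flip: add_divide_distrib)
      have "cmod (f s + h s) powr p \<le>
          (C + D) powr p * (u * (cmod (f s) powr p / C powr p) + v * (cmod (h s) powr p / D powr p))" for s
      proof -
        have "cmod (f s + h s) powr p \<le> (cmod (f s) + cmod (h s)) powr p"
          using p by (intro powr_mono2 norm_triangle_ineq) auto
        also have "cmod (f s) + cmod (h s) = (C + D) * (u * (cmod (f s) / C) + v * (cmod (h s) / D))"
          using C D by (simp add: u_v_def add_divide_distrib[symmetric])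
        also have "\<dots> powr p = (C + D) powr p * (u * (cmod (f s) / C) + v * (cmod (h s) / D)) powr p"
          using C D uv by (intro powr_mult)
        also have "\<dots> \<le> (C + D) powr p * (u * (cmod (f s) / C) powr p + v * (cmod (h s) / D) powr p)"
          using C D uv p by (intro mult_left_mono powr_convex_ineq) auto
        finally show ?thesis using C D by (simp add: powr_divide)
      qed
      then have "(\<Sum>s\<in>F. cmod (f s + h s) powr p) \<le>
         (\<Sum>s\<in>F. (C + D) powr p * (u * (cmod (f s) powr p / C powr p) + v * (cmod (h s) powr p / D powr p)))"
        by (rule sum_mono)
      also have "\<dots> = (C + D) powr p * (u * ((\<Sum>s\<in>F. cmod (f s) powr p) / C powr p) + v * ((\<Sum>s\<in>F. cmod (h s) powr p) / D powr p))"
        by (simp add: sum_distrib_left sum.distrib sum_divide_distrib distrib_left)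
      also have "\<dots> \<le> (C + D) powr p * (u * 1 + v * 1)"
        using lp_leD[OF _ f C(1) F] lp_leD[OF _ h D(1) F] p uv C D
        by (intro mult_left_mono add_mono) auto
      finally show "(\<Sum>s\<in>F. cmod (f s + h s) powr p) \<le> (C + D) powr p"
        using uv by simp
    qed (use f h in \<open>auto simp: lp_outside\<close>)
  qed (use p C D in auto)
  show "(\<lambda>s. f s + h s) \<in> carrier (lp G p)"
    using main[of "nrm (lp G p) f + 1" "nrm (lp G p) h + 1"] lp_nrm_nonneg[of G p f] lp_nrm_nonneg[of G p h] by linarith
  show "nrm (lp G p) (\<lambda>s. f s + h s) \<le> nrm (lp G p) f + nrm (lp G p) h"
  proof (rule field_le_epsilon)
    fix e :: real assume "e > 0"
    then show "nrm (lp G p) (\<lambda>s. f s + h s) \<le> nrm (lp G p) f + nrm (lp G p) h + e"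
      using main[of "nrm (lp G p) f + e/2" "nrm (lp G p) h + e/2"] lp_nrm_nonneg[of G p f] lp_nrm_nonneg[of G p h]
      by (simp add: algebra_simps)
  qed
qed

lemma lp_mult:
  assumes p: "p > 0" and f: "f \<in> carrier (lp G p)" and u: "\<And>s. s \<in> carrier G \<Longrightarrow> cmod (u s) \<le> K" and K: "K \<ge> 0"
  shows "(\<lambda>s. u s * f s) \<in> carrier (lp G p)" "nrm (lp G p) (\<lambda>s. u s * f s) \<le> K * nrm (lp G p) f"
proof -
  have "(\<Sum>s\<in>F. cmod (u s * f s) powr p) \<le> (K * nrm (lp G p) f) powr p"
    if F: "finite F" "F \<subseteq> carrier G" for F
  proof -
    have "(\<Sum>s\<in>F. cmod (u s * f s) powr p) \<le> (\<Sum>s\<in>F. K powr p * cmod (f s) powr p)"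
      using F u K p by (intro sum_mono) (auto simp: norm_mult powr_mult intro!: mult_right_mono powr_mono2)
    also have "\<dots> \<le> K powr p * nrm (lp G p) f powr p"
      using lp_leD[OF p f order_refl F] by (simp add: sum_distrib_left[symmetric] mult_left_mono)
    finally show ?thesis using K by (simp add: powr_mult)
  qed
  then show "(\<lambda>s. u s * f s) \<in> carrier (lp G p)" "nrm (lp G p) (\<lambda>s. u s * f s) \<le> K * nrm (lp G p) f"
    using lp_leI[OF p, of "K * nrm (lp G p) f" G "\<lambda>s. u s * f s"] K f by (auto simp: lp_outside)
qed

text \<open>By injectivity, a finite sum of the reindexed function is a finite sum for
  \<open>f\<close> over the image. Left and right translations are the instances needed.\<close>

lemma lp_reindex:
  assumes p: "p > 0" and f: "f \<in> carrier (lp G p)" and \<phi>: "\<phi> \<in> carrier G \<rightarrow> carrier G" "inj_on \<phi> (carrier G)"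
  shows "(\<lambda>s. if s \<in> carrier G then f (\<phi> s) else 0) \<in> carrier (lp G p)"
    "nrm (lp G p) (\<lambda>s. if s \<in> carrier G then f (\<phi> s) else 0) \<le> nrm (lp G p) f"
proof -
  have "(\<Sum>s\<in>F. cmod (if s \<in> carrier G then f (\<phi> s) else 0) powr p) \<le> nrm (lp G p) f powr p"
    if F: "finite F" "F \<subseteq> carrier G" for F
  proof -
    have "(\<Sum>s\<in>F. cmod (if s \<in> carrier G then f (\<phi> s) else 0) powr p) = (\<Sum>s\<in>F. cmod (f (\<phi> s)) powr p)"
      using F by (intro sum.cong) auto
    also have "\<dots> = (\<Sum>s\<in>\<phi> ` F. cmod (f s) powr p)"
      using inj_on_subset[OF \<phi>(2) F(2)] by (simp add: sum.reindex)
    also have "\<dots> \<le> nrm (lp G p) f powr p"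
      using F \<phi>(1) by (intro lp_leD[OF p f order_refl]) auto
    finally show ?thesis .
  qed
  then show "(\<lambda>s. if s \<in> carrier G then f (\<phi> s) else 0) \<in> carrier (lp G p)"
    "nrm (lp G p) (\<lambda>s. if s \<in> carrier G then f (\<phi> s) else 0) \<le> nrm (lp G p) f"
    using lp_leI[OF p, of "nrm (lp G p) f" G] by auto
qed

text \<open>Fatou's lemma: a finite sum sees finitely many coordinates, so pointwise convergence
  suffices for the bound to pass to the limit. The general filter covers both sequences, for
  completeness, and nets of finite partial sums, for convolutions.\<close>

lemma lp_fatou:
  assumes p: "p > 0" and F: "F \<noteq> bot" and C: "C \<ge> 0"
    and u: "\<forall>\<^sub>F i in F. u i \<in> carrier (lp G p) \<and> nrm (lp G p) (u i) \<le> C"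
    and lim: "\<And>s. ((\<lambda>i. u i s) \<longlongrightarrow> f s) F"
  shows "f \<in> carrier (lp G p)" "nrm (lp G p) f \<le> C"
proof -
  have out: "f s = 0" if "s \<notin> carrier G" for s
  proof -
    have "\<forall>\<^sub>F i in F. u i s = 0"
      using u by eventually_elim (rule lp_outside[OF conjunct1 that])
    then show ?thesis by (intro tendsto_unique[OF F lim[of s]] tendsto_eventually)
  qed
  have le: "(\<Sum>s\<in>E. cmod (f s) powr p) \<le> C powr p" if E: "finite E" "E \<subseteq> carrier G" for E
  proof (rule tendsto_upperbound[OF _ _ F])
    show "((\<lambda>i. \<Sum>s\<in>E. cmod (u i s) powr p) \<longlongrightarrow> (\<Sum>s\<in>E. cmod (f s) powr p)) F"
    proof (intro tendsto_sum)
      fix s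
      show "((\<lambda>i. cmod (u i s) powr p) \<longlongrightarrow> cmod (f s) powr p) F"
        using p by (intro tendsto_powr' tendsto_norm lim tendsto_const) auto
    qed
    show "\<forall>\<^sub>F i in F. (\<Sum>s\<in>E. cmod (u i s) powr p) \<le> C powr p"
      using u by eventually_elim (rule lp_leD[OF p conjunct1 conjunct2 E])
  qed
  show "f \<in> carrier (lp G p)" "nrm (lp G p) f \<le> C"
    using lp_leI[OF p C, of G f] out le by auto
qed

lemma lp_normed:
  assumes p: "p \<ge> 1"
  shows "complex_normed_space (lp G p)"
proof (rule complex_normed_spaceI)
  have p0: "p > 0" using p by simp
  have mem: "(\<lambda>s. c * f s) \<in> carrier (lp G p)" "nrm (lp G p) (\<lambda>s. c * f s) \<le> cmod c * nrm (lp G p) f"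
    if "f \<in> carrier (lp G p)" for c f
    using lp_mult[OF p0 that, of "\<lambda>_. c" "cmod c"] by auto
  show "\<zero>\<^bsub>lp G p\<^esub> \<in> carrier (lp G p)"
    by (simp add: lp_def)
  show "c \<odot>\<^bsub>lp G p\<^esub> f \<in> carrier (lp G p)" if "f \<in> carrier (lp G p)" for c f
    using mem that by simp
  show "nrm (lp G p) (c \<odot>\<^bsub>lp G p\<^esub> f) \<le> cmod c * nrm (lp G p) f" if "f \<in> carrier (lp G p)" for c f
    using mem(2)[OF that] by simp
  show "f = \<zero>\<^bsub>lp G p\<^esub>" if "f \<in> carrier (lp G p)" "nrm (lp G p) f = 0" for f
    using lp_coordinate_le[OF p0 that(1)] that(2) by (auto simp: fun_eq_iff)
qed (use lp_add[OF p] in \<open>auto simp: algebra_simps\<close>)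

lemma lp_minus:
  assumes p: "p \<ge> 1" and "f \<in> carrier (lp G p)" "h \<in> carrier (lp G p)"
  shows "f \<ominus>\<^bsub>lp G p\<^esub> h = (\<lambda>s. f s - h s)"
proof -
  interpret L: complex_normed_space "lp G p" using p by (rule lp_normed)
  show ?thesis using assms by (simp add: L.M.minus_eq L.uminus_smult)
qed

lemma lp_banach:
  assumes p: "p \<ge> 1"
  shows "complex_banach_space (lp G p)"
proof -
  interpret L: complex_normed_space "lp G p" using p by (rule lp_normed)
  have p0: "p > 0" using p by simp
  show ?thesis
  proof (rule L.banachI)
    fix \<sigma> assume c: "L.ncauchy \<sigma>"
    then have mem: "\<sigma> n \<in> carrier (lp G p)" for n by (simp add: L.ncauchy_def)
    have N: "\<exists>N. \<forall>m\<ge>N. \<forall>n\<ge>N. nrm (lp G p) (\<lambda>s. \<sigma> m s - \<sigma> n s) < e" if "e > 0" for e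
      using c that mem by (simp add: L.ncauchy_def lp_minus[OF p])
    have mem2: "(\<lambda>s. \<sigma> m s - \<sigma> n s) \<in> carrier (lp G p)" for m n
      using L.minus_mem[OF mem mem, of m n] by (simp add: lp_minus[OF p] mem)
    have "convergent (\<lambda>n. \<sigma> n s)" for s
    proof (rule Cauchy_convergent, unfold Cauchy_def dist_norm, intro allI impI)
      fix e :: real assume "e > 0"
      then obtain N where "\<forall>m\<ge>N. \<forall>n\<ge>N. nrm (lp G p) (\<lambda>s. \<sigma> m s - \<sigma> n s) < e" using N by blast
      then show "\<exists>M. \<forall>m\<ge>M. \<forall>n\<ge>M. cmod (\<sigma> m s - \<sigma> n s) < e"
        using lp_coordinate_le[OF p0 mem2] by (meson order_le_less_trans)
    qed
    then obtain f where f: "(\<lambda>n. \<sigma> n s) \<longlonglongrightarrow> f s" for s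
      unfolding convergent_def by metis
    have tail: "\<exists>N. \<forall>m\<ge>N. (\<lambda>s. \<sigma> m s - f s) \<in> carrier (lp G p) \<and> nrm (lp G p) (\<lambda>s. \<sigma> m s - f s) \<le> e"
      if e: "e > 0" for e
    proof -
      obtain N where N: "\<forall>m\<ge>N. \<forall>n\<ge>N. nrm (lp G p) (\<lambda>s. \<sigma> m s - \<sigma> n s) < e" using N[OF e] by blast
      have "(\<lambda>s. \<sigma> m s - f s) \<in> carrier (lp G p) \<and> nrm (lp G p) (\<lambda>s. \<sigma> m s - f s) \<le> e" if "m \<ge> N" for m
      proof (intro conjI; rule lp_fatou[OF p0 sequentially_bot less_imp_le[OF e]])
        show "\<forall>\<^sub>F n in sequentially. (\<lambda>s. \<sigma> m s - \<sigma> n s) \<in> carrier (lp G p) \<and> nrm (lp G p) (\<lambda>s. \<sigma> m s - \<sigma> n s) \<le> e"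
          using N that mem2 by (auto simp: eventually_sequentially intro!: exI[of _ N] less_imp_le)
        then show "\<forall>\<^sub>F n in sequentially. (\<lambda>s. \<sigma> m s - \<sigma> n s) \<in> carrier (lp G p) \<and> nrm (lp G p) (\<lambda>s. \<sigma> m s - \<sigma> n s) \<le> e" .
      qed (intro tendsto_diff tendsto_const f)+
      then show ?thesis by blast
    qed
    obtain N where "(\<lambda>s. \<sigma> N s - f s) \<in> carrier (lp G p)" using tail[of 1] by auto
    from L.minus_mem[OF mem[of N] this] have fmem: "f \<in> carrier (lp G p)"
      using lp_minus[OF p mem[of N] \<open>(\<lambda>s. \<sigma> N s - f s) \<in> carrier (lp G p)\<close>] by simp
    have "nconv (lp G p) \<sigma> f"
      unfolding nconv_def
    proof (intro conjI allI LIMSEQ_I)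
      fix e :: real assume "e > 0"
      then obtain N where "\<forall>m\<ge>N. nrm (lp G p) (\<lambda>s. \<sigma> m s - f s) \<le> e/2" using tail[of "e/2"] by auto
      then show "\<exists>N. \<forall>n\<ge>N. norm (nrm (lp G p) (\<sigma> n \<ominus>\<^bsub>lp G p\<^esub> f) - 0) < e"
        using \<open>e > 0\<close> by (intro exI[of _ N]) (force simp: lp_minus[OF p mem fmem])
    qed (use mem fmem in auto)
    then show "\<exists>f. nconv (lp G p) \<sigma> f" by (intro exI)
  qed
qed

section \<open>Convolution operators and translations\<close>

definition delta :: "'g \<Rightarrow> 'g \<Rightarrow> complex" where
  "delta g = (\<lambda>s. if s = g then 1 else 0)"

definition lam :: "('g, 'b) monoid_scheme \<Rightarrow> real \<Rightarrow> 'g \<Rightarrow> 'g operator" where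
  "lam G p g = left_regular G p (delta g)"

lemma PF_simps [simp]:
  "zero (PF G p) = zero (bounded_maps (lp G p) (lp G p))"
  "add (PF G p) = add (bounded_maps (lp G p) (lp G p))"
  "smult (PF G p) = smult (bounded_maps (lp G p) (lp G p))"
  "nrm (PF G p) = nrm (bounded_maps (lp G p) (lp G p))"
  "mult (PF G p) = (\<circ>)"
  "one (PF G p) = (\<lambda>h. if h \<in> carrier (lp G p) then h else (\<lambda>_. 0))"
  by (simp_all add: PF_def fun_eq_iff)

lemma l1_iff: "f \<in> carrier (lp G 1) \<longleftrightarrow> (\<forall>s. s \<notin> carrier G \<longrightarrow> f s = 0) \<and> (\<lambda>s. cmod (f s)) summable_on carrier G"
  by (simp add: lp_def)

lemma l1_add:
  assumes "f \<in> carrier (lp G 1)" "h \<in> carrier (lp G 1)"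
  shows "(\<lambda>s. f s + h s) \<in> carrier (lp G 1)"
  using lp_add(1)[OF order_refl assms] .

lemma l1_smult:
  assumes "f \<in> carrier (lp G 1)"
  shows "(\<lambda>s. c * f s) \<in> carrier (lp G 1)"
  using lp_mult(1)[OF zero_less_one assms, of "\<lambda>_. c" "cmod c"] by simp

lemma l1_finite:
  assumes "finite F" "F \<subseteq> carrier G"
  shows "(\<lambda>s. if s \<in> F then f s else 0) \<in> carrier (lp G 1)"
proof -
  have "(\<lambda>s. cmod (if s \<in> F then f s else 0)) summable_on F" by (rule summable_on_finite) fact
  then have "(\<lambda>s. cmod (if s \<in> F then f s else 0)) summable_on carrier G"
    by (rule summable_on_cong_neutral[THEN iffD1, rotated -1]) (use assms in auto)
  then show ?thesis using assms by (auto simp: l1_iff)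
qed

locale pseudofunctions = group G for G :: "('g, 'b) monoid_scheme" (structure) +
  fixes p :: real
  assumes p: "p > 1"
begin

abbreviation L where "L \<equiv> lp G p"
abbreviation B where "B \<equiv> bounded_maps L L"
abbreviation A where "A \<equiv> PF G p"

lemma p01: "p > 0" "p \<ge> 1" using p by auto

sublocale L: complex_banach_space "lp G p"
  by (rule lp_banach) (rule p01)

sublocale P: normed_pair "lp G p" "lp G p" ..

sublocale BO: banach_algebra "bounded_operators (lp G p)"
  by (rule L.bounded_operators_banach_algebra)

definition translate :: "'g \<Rightarrow> ('g \<Rightarrow> complex) \<Rightarrow> 'g \<Rightarrow> complex" where
  "translate t h = (\<lambda>s. if s \<in> carrier G then h (inv t \<otimes> s) else 0)"

lemma translate_lp:
  assumes "t \<in> carrier G" "h \<in> carrier L"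
  shows "translate t h \<in> carrier L" "nrm L (translate t h) \<le> nrm L h"
proof -
  have "(\<lambda>s. inv t \<otimes> s) \<in> carrier G \<rightarrow> carrier G" "inj_on (\<lambda>s. inv t \<otimes> s) (carrier G)"
    using assms by (auto intro: inj_onI)
  from lp_reindex[OF p01(1) assms(2) this]
  show "translate t h \<in> carrier L" "nrm L (translate t h) \<le> nrm L h"
    by (simp_all add: translate_def)
qed

lemma finite_convolution_lp:
  assumes "finite E" "E \<subseteq> carrier G" "h \<in> carrier L"
  shows "(\<lambda>s. \<Sum>t\<in>E. f t * translate t h s) \<in> carrier L \<and>
    nrm L (\<lambda>s. \<Sum>t\<in>E. f t * translate t h s) \<le> (\<Sum>t\<in>E. cmod (f t)) * nrm L h"
  using assms(1,2)
proof (induction E rule: finite_induct)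
  case empty
  then show ?case using L.M.zero_closed L.nrm_zero by simp
next
  case (insert t E)
  have t: "t \<in> carrier G" using insert by simp
  note m = lp_mult[OF p01(1) translate_lp(1)[OF t assms(3)], of "\<lambda>_. f t" "cmod (f t)", simplified]
  have "nrm L (\<lambda>s. f t * translate t h s) \<le> cmod (f t) * nrm L h"
    using m(2) mult_left_mono[OF translate_lp(2)[OF t assms(3)] norm_ge_zero[of "f t"]] by linarith
  then show ?case
    using insert lp_add[OF p01(2) m(1), of "\<lambda>s. \<Sum>t\<in>E. f t * translate t h s"]
    by (auto simp: distrib_right)
qed

text \<open>Every coordinate of \<open>h\<close> is bounded by its norm, so the series is dominated
  by a multiple of the summable \<open>f\<close>.\<close>

lemma convolution_summable:
  assumes "f \<in> carrier (lp G 1)" "h \<in> carrier L"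
  shows "(\<lambda>t. cmod (f t * h (inv t \<otimes> s))) summable_on carrier G"
proof (rule summable_on_comparison_test)
  show "(\<lambda>t. cmod (f t) * nrm L h) summable_on carrier G"
    using assms(1) by (intro summable_on_cmult_left) (simp add: l1_iff)
qed (auto simp: norm_mult intro!: mult_left_mono lp_coordinate_le[OF p01(1) assms(2)])

text \<open>Young's inequality for an \<open>\<ell>^1\<close> factor. Finite partial sums of the
  convolution are combinations of translates of \<open>h\<close>, whose norms do not exceed that of
  \<open>h\<close>; the bound passes to the pointwise limit by \<open>lp_fatou\<close>.\<close>

lemma left_regular_lp:
  assumes f: "f \<in> carrier (lp G 1)" and h: "h \<in> carrier L"
  shows "left_regular G p f h \<in> carrier L"
    "nrm L (left_regular G p f h) \<le> (\<Sum>\<^sub>\<infinity>t\<in>carrier G. cmod (f t)) * nrm L h"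
proof -
  let ?N = "\<Sum>\<^sub>\<infinity>t\<in>carrier G. cmod (f t)"
  let ?u = "\<lambda>E s. \<Sum>t\<in>E. f t * translate t h s"
  have sm: "(\<lambda>t. cmod (f t)) summable_on carrier G" using f by (simp add: l1_iff)
  have C: "0 \<le> ?N * nrm L h" by (intro mult_nonneg_nonneg infsum_nonneg) auto
  have ev: "\<forall>\<^sub>F E in finite_subsets_at_top (carrier G). ?u E \<in> carrier L \<and> nrm L (?u E) \<le> ?N * nrm L h"
  proof (rule eventually_finite_subsets_at_top_weakI)
    fix E assume E: "finite E" "E \<subseteq> carrier G"
    have "(\<Sum>t\<in>E. cmod (f t)) * nrm L h \<le> ?N * nrm L h"
      using E by (intro mult_right_mono finite_sum_le_infsum sm) auto
    then show "?u E \<in> carrier L \<and> nrm L (?u E) \<le> ?N * nrm L h"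
      using finite_convolution_lp[OF E h, of f] by linarith
  qed
  have lim: "((\<lambda>E. ?u E s) \<longlongrightarrow> left_regular G p f h s) (finite_subsets_at_top (carrier G))" for s
  proof (cases "s \<in> carrier G")
    case True
    then show ?thesis
      using infsum_tendsto[OF abs_summable_summable[OF convolution_summable[OF f h, of s]]] h
      by (simp add: left_regular_def convolution_def translate_def)
  qed (use h in \<open>simp add: left_regular_def convolution_def translate_def\<close>)
  show "left_regular G p f h \<in> carrier L" "nrm L (left_regular G p f h) \<le> ?N * nrm L h"
    using lp_fatou[OF p01(1) finite_subsets_at_top_neq_bot C ev lim] by auto
qed

lemma left_regular_bounded:
  assumes f: "f \<in> carrier (lp G 1)"
  shows "left_regular G p f \<in> carrier B"
    "nrm B (left_regular G p f) \<le> (\<Sum>\<^sub>\<infinity>t\<in>carrier G. cmod (f t))"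
proof -
  show "left_regular G p f \<in> carrier B"
  proof (rule bounded_maps_carrierI)
    show "left_regular G p f (x \<oplus>\<^bsub>L\<^esub> y) = left_regular G p f x \<oplus>\<^bsub>L\<^esub> left_regular G p f y"
      if xy: "x \<in> carrier L" "y \<in> carrier L" for x y
    proof
      fix s
      show "left_regular G p f (x \<oplus>\<^bsub>L\<^esub> y) s = (left_regular G p f x \<oplus>\<^bsub>L\<^esub> left_regular G p f y) s"
        using xy lp_add(1)[OF p01(2) xy]
          infsum_add[OF convolution_summable[OF f xy(1), of s, THEN abs_summable_summable] convolution_summable[OF f xy(2), of s, THEN abs_summable_summable]]
        by (simp add: left_regular_def convolution_def distrib_left)
    qed
    show "left_regular G p f (c \<odot>\<^bsub>L\<^esub> x) = c \<odot>\<^bsub>L\<^esub> left_regular G p f x" if x: "x \<in> carrier L" for c x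
      using x L.smult_mem[OF x, of c]
      by (simp add: left_regular_def convolution_def mult.left_commute[of _ c] fun_eq_iff infsum_cmult_right')
    show "left_regular G p f x = \<zero>\<^bsub>L\<^esub>" if "x \<notin> carrier L" for x
      using that by (simp add: left_regular_def)
  qed (use left_regular_lp[OF f] in auto)
  show "nrm B (left_regular G p f) \<le> (\<Sum>\<^sub>\<infinity>t\<in>carrier G. cmod (f t))"
    using left_regular_lp[OF f] by (intro P.bounded_maps_nrm_le infsum_nonneg) auto
qed

lemma left_regular_add:
  assumes "f \<in> carrier (lp G 1)" "f' \<in> carrier (lp G 1)"
  shows "left_regular G p (\<lambda>s. f s + f' s) = (\<lambda>h s. left_regular G p f h s + left_regular G p f' h s)"
proof (intro ext)
  fix h s
  show "left_regular G p (\<lambda>s. f s + f' s) h s = left_regular G p f h s + left_regular G p f' h s"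
  proof (cases "h \<in> carrier L")
    case True
    then show ?thesis
      using infsum_add[OF convolution_summable[OF assms(1) True, of s, THEN abs_summable_summable] convolution_summable[OF assms(2) True, of s, THEN abs_summable_summable]]
      by (simp add: left_regular_def convolution_def distrib_right)
  qed (simp add: left_regular_def)
qed

lemma left_regular_smult:
  "left_regular G p (\<lambda>s. c * f s) = (\<lambda>h s. c * left_regular G p f h s)"
  by (auto simp: left_regular_def convolution_def mult.assoc fun_eq_iff infsum_cmult_right')

lemma delta_l1: "g \<in> carrier G \<Longrightarrow> delta g \<in> carrier (lp G 1)"
  using l1_finite[of "{g}" G "\<lambda>_. 1"] by (simp add: delta_def)

lemma lam_bounded: "g \<in> carrier G \<Longrightarrow> lam G p g \<in> carrier B"
  unfolding lam_def by (intro left_regular_bounded delta_l1)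

lemma lam_apply:
  assumes g: "g \<in> carrier G" and h: "h \<in> carrier L"
  shows "lam G p g h = translate g h"
proof
  fix s
  have "(\<Sum>\<^sub>\<infinity>t\<in>carrier G. delta g t * h (inv t \<otimes> s)) = (\<Sum>\<^sub>\<infinity>t\<in>{g}. delta g t * h (inv t \<otimes> s))"
    using g by (intro infsum_cong_neutral) (auto simp: delta_def)
  then show "lam G p g h s = translate g h s"
    using h by (simp add: lam_def left_regular_def convolution_def translate_def delta_def)
qed

lemma lam_nrm: "g \<in> carrier G \<Longrightarrow> nrm B (lam G p g) \<le> 1"
  by (rule P.bounded_maps_nrm_le) (use lam_apply translate_lp in auto)

lemma lam_mult:
  assumes "g \<in> carrier G" "k \<in> carrier G"
  shows "lam G p g \<circ> lam G p k = lam G p (g \<otimes> k)"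
proof
  fix h
  show "(lam G p g \<circ> lam G p k) h = lam G p (g \<otimes> k) h"
  proof (cases "h \<in> carrier L")
    case True
    then show ?thesis
      using assms translate_lp[OF assms(2) True]
      by (auto simp: lam_apply translate_def inv_mult_group m_assoc)
  next
    case False
    then show ?thesis
      using bounded_mapsD(2)[OF lam_bounded, of _ h] P.bounded_maps_zero[OF lam_bounded, of g] assms by simp
  qed
qed

lemma lam_one: "lam G p \<one> = (\<lambda>h. if h \<in> carrier L then h else (\<lambda>_. 0))"
proof
  fix h
  show "lam G p \<one> h = (if h \<in> carrier L then h else (\<lambda>_. 0))"
    using lam_apply[of \<one> h] bounded_mapsD(2)[OF lam_bounded, of \<one> h] lp_outside[of h G p]
    by (auto simp: translate_def fun_eq_iff)
qed

lemma left_regular_finite_approx: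
  assumes f: "f \<in> carrier (lp G 1)" and e: "e > 0"
  obtains F where "finite F" "F \<subseteq> carrier G"
    "nrm B (left_regular G p f \<ominus>\<^bsub>B\<^esub> left_regular G p (\<lambda>s. if s \<in> F then f s else 0)) < e"
proof -
  have sm: "(\<lambda>s. cmod (f s)) summable_on carrier G" using f by (simp add: l1_iff)
  obtain F where F: "finite F" "F \<subseteq> carrier G"
    "dist (\<Sum>s\<in>F. cmod (f s)) (\<Sum>\<^sub>\<infinity>s\<in>carrier G. cmod (f s)) \<le> e/2"
    using infsum_finite_approximation[OF sm, of "e/2"] e by auto
  define u where "u = (\<lambda>s. if s \<in> F then f s else 0)"
  define r where "r = (\<lambda>s. if s \<in> F then 0 else f s)"
  have u: "u \<in> carrier (lp G 1)" unfolding u_def by (rule l1_finite) fact+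
  have "r = (\<lambda>s. f s + (- 1) * u s)" by (auto simp: r_def u_def)
  then have r: "r \<in> carrier (lp G 1)" using l1_add[OF f l1_smult[OF u, of "- 1"]] by simp
  have fur: "f = (\<lambda>s. u s + r s)" by (auto simp: r_def u_def)
  have "(\<Sum>\<^sub>\<infinity>s\<in>carrier G. cmod (u s)) = (\<Sum>\<^sub>\<infinity>s\<in>F. cmod (f s))"
    using F by (intro infsum_cong_neutral) (auto simp: u_def)
  moreover have "(\<Sum>\<^sub>\<infinity>s\<in>carrier G. cmod (f s)) = (\<Sum>\<^sub>\<infinity>s\<in>carrier G. cmod (u s)) + (\<Sum>\<^sub>\<infinity>s\<in>carrier G. cmod (r s))"
    using u r by (subst infsum_add[symmetric]) (auto simp: l1_iff u_def r_def intro!: infsum_cong)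
  ultimately have "(\<Sum>\<^sub>\<infinity>s\<in>carrier G. cmod (r s)) < e"
    using F e by (auto simp: dist_real_def)
  moreover have "left_regular G p f \<ominus>\<^bsub>B\<^esub> left_regular G p u = left_regular G p r"
    using left_regular_add[OF u r] left_regular_bounded(1)[OF f] left_regular_bounded(1)[OF u]
      P.bounded_maps_value[OF left_regular_bounded(1)[OF u]]
      P.bounded_maps_value[OF left_regular_bounded(1)[OF f]]
    by (auto simp: fur[symmetric] P.bounded_maps_minus_apply lp_minus[OF p01(2)] fun_eq_iff)
  ultimately show ?thesis
    using that[OF F(1,2)] left_regular_bounded(2)[OF r] by (simp add: u_def)
qed

section \<open>The pseudofunctions as a closed subalgebra of the bounded operators\<close>

lemma PF_iff:
  "a \<in> carrier A \<longleftrightarrow> a \<in> carrier B \<and> (\<forall>e>0. \<exists>f\<in>carrier (lp G 1). nrm B (a \<ominus>\<^bsub>B\<^esub> left_regular G p f) < e)"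
proof -
  have "left_regular G p ` carrier (lp G 1) \<subseteq> carrier (bounded_operators L)"
    using left_regular_bounded by auto
  then show ?thesis
    unfolding PF_def by (simp add: BO.mem_norm_closure_iff)
qed

lemma PF_B: "a \<in> carrier A \<Longrightarrow> a \<in> carrier B"
  by (simp add: PF_iff)

lemma left_regular_PF: "f \<in> carrier (lp G 1) \<Longrightarrow> left_regular G p f \<in> carrier A"
  using left_regular_bounded(1) P.bm.nrm_zero unfolding PF_iff
  by (intro conjI allI impI bexI[of _ f]) (simp_all del: bounded_maps_simps)

lemma lam_PF [simp, intro]: "g \<in> carrier G \<Longrightarrow> lam G p g \<in> carrier A"
  unfolding lam_def by (intro left_regular_PF delta_l1)

lemma PF_zero: "(\<lambda>_ _. 0) \<in> carrier A"
  using left_regular_PF[OF l1_smult[OF delta_l1[OF one_closed], of 0]] left_regular_smult[of 0 "delta \<one>"] by simp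

lemma PF_add:
  assumes "a \<in> carrier A" "b \<in> carrier A"
  shows "a \<oplus>\<^bsub>B\<^esub> b \<in> carrier A"
  unfolding PF_iff
proof (intro conjI allI impI)
  show ab: "a \<oplus>\<^bsub>B\<^esub> b \<in> carrier B" using assms PF_B by blast
  fix e :: real assume "e > 0"
  then have "e/2 > 0" by simp
  with assms obtain f h where fh: "f \<in> carrier (lp G 1)" "h \<in> carrier (lp G 1)"
    "nrm B (a \<ominus>\<^bsub>B\<^esub> left_regular G p f) < e/2" "nrm B (b \<ominus>\<^bsub>B\<^esub> left_regular G p h) < e/2"
    unfolding PF_iff by metis
  have m: "a \<in> carrier B" "b \<in> carrier B" "left_regular G p f \<in> carrier B" "left_regular G p h \<in> carrier B"
    using assms fh PF_B left_regular_bounded by auto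
  have "left_regular G p (\<lambda>s. f s + h s) = left_regular G p f \<oplus>\<^bsub>B\<^esub> left_regular G p h"
    using left_regular_add[OF fh(1,2)] by simp
  then have "nrm B (a \<oplus>\<^bsub>B\<^esub> b \<ominus>\<^bsub>B\<^esub> left_regular G p (\<lambda>s. f s + h s)) \<le>
      nrm B (a \<ominus>\<^bsub>B\<^esub> left_regular G p f) + nrm B (b \<ominus>\<^bsub>B\<^esub> left_regular G p h)"
    using P.bm.minus_add_add[OF m] P.bm.nrm_triangle[OF P.bm.minus_mem[OF m(1,3)] P.bm.minus_mem[OF m(2,4)]] by simp
  with fh l1_add[OF fh(1,2)]
  show "\<exists>f\<in>carrier (lp G 1). nrm B (a \<oplus>\<^bsub>B\<^esub> b \<ominus>\<^bsub>B\<^esub> left_regular G p f) < e"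
    by (intro bexI[of _ "\<lambda>s. f s + h s"]) auto
qed

lemma PF_smult:
  assumes a: "a \<in> carrier A"
  shows "c \<odot>\<^bsub>B\<^esub> a \<in> carrier A"
  unfolding PF_iff
proof (intro conjI allI impI)
  show "c \<odot>\<^bsub>B\<^esub> a \<in> carrier B" using assms PF_B by blast
  fix e :: real assume "e > 0"
  then have "e/(cmod c + 1) > 0" by (simp add: add_nonneg_pos)
  with assms obtain f where f: "f \<in> carrier (lp G 1)" "nrm B (a \<ominus>\<^bsub>B\<^esub> left_regular G p f) < e/(cmod c + 1)"
    unfolding PF_iff by metis
  have m: "a \<in> carrier B" "left_regular G p f \<in> carrier B"
    using assms f PF_B left_regular_bounded by auto
  have "left_regular G p (\<lambda>s. c * f s) = c \<odot>\<^bsub>B\<^esub> left_regular G p f"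
    using left_regular_smult by simp
  then have "nrm B (c \<odot>\<^bsub>B\<^esub> a \<ominus>\<^bsub>B\<^esub> left_regular G p (\<lambda>s. c * f s)) = cmod c * nrm B (a \<ominus>\<^bsub>B\<^esub> left_regular G p f)"
    using m P.bm.smult_minus[OF m, of c] P.bm.nrm_smult[OF P.bm.minus_mem[OF m], of c] by simp
  also have "\<dots> \<le> (cmod c + 1) * nrm B (a \<ominus>\<^bsub>B\<^esub> left_regular G p f)"
    using m by (intro mult_right_mono P.bm.nrm_nonneg) auto
  also have "\<dots> < e"
    using f(2) pos_less_divide_eq[of "cmod c + 1"] by (simp add: add_nonneg_pos mult.commute)
  finally show "\<exists>f\<in>carrier (lp G 1). nrm B (c \<odot>\<^bsub>B\<^esub> a \<ominus>\<^bsub>B\<^esub> left_regular G p f) < e"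
    using l1_smult[OF f(1)] by (intro bexI[of _ "\<lambda>s. c * f s"]) auto
qed

lemma PF_closed:
  assumes "a \<in> carrier B" "\<And>e. e > 0 \<Longrightarrow> \<exists>b\<in>carrier A. nrm B (a \<ominus>\<^bsub>B\<^esub> b) < e"
  shows "a \<in> carrier A"
  unfolding PF_iff
proof (intro conjI allI impI)
  fix e :: real assume "e > 0"
  then obtain b where b: "b \<in> carrier A" "nrm B (a \<ominus>\<^bsub>B\<^esub> b) < e/2"
    using assms(2)[of "e/2"] by auto
  then obtain f where f: "f \<in> carrier (lp G 1)" "nrm B (b \<ominus>\<^bsub>B\<^esub> left_regular G p f) < e/2"
    using \<open>e > 0\<close> unfolding PF_iff by (meson half_gt_zero)
  show "\<exists>f\<in>carrier (lp G 1). nrm B (a \<ominus>\<^bsub>B\<^esub> left_regular G p f) < e"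
    using f b P.bm.nrm_minus_trans[OF assms(1) PF_B[OF b(1)] left_regular_bounded(1)[OF f(1)]]
    by (intro bexI[of _ f]) auto
qed fact

lemma PF_minus:
  assumes "a \<in> carrier A" "b \<in> carrier A"
  shows "a \<ominus>\<^bsub>A\<^esub> b = a \<ominus>\<^bsub>B\<^esub> b" "a \<ominus>\<^bsub>A\<^esub> b \<in> carrier A"
proof -
  have "a \<ominus>\<^bsub>bounded_operators L\<lparr>carrier := carrier A\<rparr>\<^esub> b = a \<ominus>\<^bsub>bounded_operators L\<^esub> b"
    by (rule BO.subspace_minus) (use PF_B PF_zero PF_add PF_smult assms in auto)
  also have "a \<ominus>\<^bsub>bounded_operators L\<lparr>carrier := carrier A\<rparr>\<^esub> b = a \<ominus>\<^bsub>A\<^esub> b"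
    by (simp add: PF_def)
  finally show eq: "a \<ominus>\<^bsub>A\<^esub> b = a \<ominus>\<^bsub>B\<^esub> b" by simp
  show "a \<ominus>\<^bsub>A\<^esub> b \<in> carrier A"
    unfolding eq using PF_add[OF assms(1) PF_smult[OF assms(2), of "- 1"]] PF_B assms
    by (simp add: P.bm.M.minus_eq P.bm.uminus_smult)
qed

text \<open>Translations span a dense subspace: finitely supported functions approximate
  \<open>\<ell>^1\<close>, whose image is dense by definition. The rule carries identities and
  closure properties from translations to all pseudofunctions; in \<open>limit\<close> the
  approximants themselves satisfy \<open>Q\<close>, so a continuity estimate is all that
  remains.\<close>

lemma PF_induct [consumes 1, case_names lam add smult limit]:
  assumes a: "a \<in> carrier A"
    and lam: "\<And>g. g \<in> carrier G \<Longrightarrow> Q (lam G p g)"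
    and add: "\<And>a b. \<lbrakk>a \<in> carrier A; b \<in> carrier A; Q a; Q b\<rbrakk> \<Longrightarrow> Q (a \<oplus>\<^bsub>A\<^esub> b)"
    and smult: "\<And>c a. \<lbrakk>a \<in> carrier A; Q a\<rbrakk> \<Longrightarrow> Q (c \<odot>\<^bsub>A\<^esub> a)"
    and limit: "\<And>a. \<lbrakk>a \<in> carrier A; \<And>e. e > 0 \<Longrightarrow> \<exists>b\<in>carrier A. Q b \<and> nrm A (a \<ominus>\<^bsub>A\<^esub> b) < e\<rbrakk> \<Longrightarrow> Q a"
  shows "Q a"
proof -
  have fin: "Q (left_regular G p (\<lambda>s. if s \<in> F then f s else 0))" if "finite F" "F \<subseteq> carrier G" for F f
    using that
  proof (induction F rule: finite_induct)
    case empty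
    \<comment> \<open>The rule has no case for zero; the empty sum is obtained as 0 times a
      translation.\<close>
    have eq: "left_regular G p (\<lambda>s. if s \<in> {} then f s else 0) = 0 \<odot>\<^bsub>A\<^esub> lam G p \<one>"
      using left_regular_smult[of 0 "delta \<one>"] by (simp add: lam_def)
    show ?case
      unfolding eq by (intro smult lam_PF lam one_closed)
  next
    case (insert g F)
    have g: "g \<in> carrier G" and F: "F \<subseteq> carrier G" using insert by auto
    have "(\<lambda>s. if s \<in> insert g F then f s else 0) = (\<lambda>s. f g * delta g s + (if s \<in> F then f s else 0))"
      using insert by (auto simp: delta_def)
    then have eq: "left_regular G p (\<lambda>s. if s \<in> insert g F then f s else 0) =
       f g \<odot>\<^bsub>A\<^esub> lam G p g \<oplus>\<^bsub>A\<^esub> left_regular G p (\<lambda>s. if s \<in> F then f s else 0)"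
      using left_regular_add[OF l1_smult[OF delta_l1[OF g]] l1_finite[OF insert(1) F], of "f g" f]
      by (simp add: left_regular_smult lam_def)
    show ?case
      unfolding eq
    proof (rule add)
      show "f g \<odot>\<^bsub>A\<^esub> lam G p g \<in> carrier A"
        using PF_smult[OF lam_PF[OF g], of "f g"] by simp
    qed (intro smult lam_PF lam g left_regular_PF l1_finite insert.IH insert.hyps F)+
  qed
  have l1: "Q (left_regular G p f)" if f: "f \<in> carrier (lp G 1)" for f
  proof (rule limit[OF left_regular_PF[OF f]])
    fix e :: real assume "e > 0"
    obtain F where F: "finite F" "F \<subseteq> carrier G"
      "nrm B (left_regular G p f \<ominus>\<^bsub>B\<^esub> left_regular G p (\<lambda>s. if s \<in> F then f s else 0)) < e"
      by (rule left_regular_finite_approx[OF f \<open>e > 0\<close>])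
    note m = left_regular_PF[OF l1_finite[OF F(1,2), of f]]
    show "\<exists>b\<in>carrier A. Q b \<and> nrm A (left_regular G p f \<ominus>\<^bsub>A\<^esub> b) < e"
      using F(3) PF_minus(1)[OF left_regular_PF[OF f] m]
      by (intro bexI[OF _ m] conjI fin[OF F(1,2)]) simp
  qed
  show ?thesis
  proof (rule limit[OF a])
    fix e :: real assume "e > 0"
    then obtain f where f: "f \<in> carrier (lp G 1)" "nrm B (a \<ominus>\<^bsub>B\<^esub> left_regular G p f) < e"
      using a unfolding PF_iff by meson
    show "\<exists>b\<in>carrier A. Q b \<and> nrm A (a \<ominus>\<^bsub>A\<^esub> b) < e"
      using f l1[OF f(1)] PF_minus(1)[OF a left_regular_PF[OF f(1)]]
      by (intro bexI[OF _ left_regular_PF[OF f(1)]]) simp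
  qed
qed

lemma comp_minus_left:
  assumes "a \<in> carrier B" "b \<in> carrier B" "c \<in> carrier B"
  shows "(a \<circ> c) \<ominus>\<^bsub>B\<^esub> (b \<circ> c) = (a \<ominus>\<^bsub>B\<^esub> b) \<circ> c"
  using assms L.comp_bounded(1) by (simp add: fun_eq_iff P.bounded_maps_minus_apply)

lemma comp_minus_right:
  assumes "a \<in> carrier B" "b \<in> carrier B" "c \<in> carrier B"
  shows "(c \<circ> a) \<ominus>\<^bsub>B\<^esub> (c \<circ> b) = c \<circ> (a \<ominus>\<^bsub>B\<^esub> b)"
  using assms L.comp_bounded(1) P.bounded_maps_value
  by (simp add: fun_eq_iff P.bounded_maps_minus_apply P.bounded_maps_apply_minus)

text \<open>Continuity of multiplication by a fixed operator, in the shape that the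
  \<open>limit\<close> case of \<open>PF_induct\<close> provides.\<close>

lemma PF_comp_limit:
  assumes a: "a \<in> carrier B" and c: "c \<in> carrier B"
    and ex: "\<And>e. e > 0 \<Longrightarrow> \<exists>b\<in>carrier A. (b \<circ> c \<in> carrier A) \<and> nrm B (a \<ominus>\<^bsub>B\<^esub> b) < e"
  shows "a \<circ> c \<in> carrier A"
proof (rule PF_closed)
  show "a \<circ> c \<in> carrier B" by (intro L.comp_bounded a c)
  fix e :: real assume "e > 0"
  define K where "K = nrm B c + 1"
  have K: "K > 0" "nrm B c \<le> K" using P.bm.nrm_nonneg[OF c] by (auto simp: K_def)
  then obtain b where b: "b \<in> carrier A" "b \<circ> c \<in> carrier A" "nrm B (a \<ominus>\<^bsub>B\<^esub> b) < e / K"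
    using ex[of "e / K"] \<open>e > 0\<close> by auto
  have "nrm B ((a \<circ> c) \<ominus>\<^bsub>B\<^esub> (b \<circ> c)) \<le> nrm B (a \<ominus>\<^bsub>B\<^esub> b) * nrm B c"
    unfolding comp_minus_left[OF a PF_B[OF b(1)] c] by (intro L.comp_bounded P.bm.minus_mem a c PF_B b)
  also have "\<dots> \<le> nrm B (a \<ominus>\<^bsub>B\<^esub> b) * K"
    using K PF_B[OF b(1)] a by (intro mult_left_mono P.bm.nrm_nonneg) auto
  also have "\<dots> < e" using b(3) K by (simp add: field_simps)
  finally show "\<exists>b\<in>carrier A. nrm B ((a \<circ> c) \<ominus>\<^bsub>B\<^esub> b) < e" using b(2) by blast
qed

lemma PF_comp_limit':
  assumes a: "a \<in> carrier B" and c: "c \<in> carrier B"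
    and ex: "\<And>e. e > 0 \<Longrightarrow> \<exists>b\<in>carrier A. (c \<circ> b \<in> carrier A) \<and> nrm B (a \<ominus>\<^bsub>B\<^esub> b) < e"
  shows "c \<circ> a \<in> carrier A"
proof (rule PF_closed)
  show "c \<circ> a \<in> carrier B" by (intro L.comp_bounded a c)
  fix e :: real assume "e > 0"
  define K where "K = nrm B c + 1"
  have K: "K > 0" "nrm B c \<le> K" using P.bm.nrm_nonneg[OF c] by (auto simp: K_def)
  then obtain b where b: "b \<in> carrier A" "c \<circ> b \<in> carrier A" "nrm B (a \<ominus>\<^bsub>B\<^esub> b) < e / K"
    using ex[of "e / K"] \<open>e > 0\<close> by auto
  have "nrm B ((c \<circ> a) \<ominus>\<^bsub>B\<^esub> (c \<circ> b)) \<le> nrm B c * nrm B (a \<ominus>\<^bsub>B\<^esub> b)"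
    unfolding comp_minus_right[OF a PF_B[OF b(1)] c] by (intro L.comp_bounded P.bm.minus_mem a c PF_B b)
  also have "\<dots> \<le> K * nrm B (a \<ominus>\<^bsub>B\<^esub> b)"
    using K PF_B[OF b(1)] a by (intro mult_right_mono P.bm.nrm_nonneg) auto
  also have "\<dots> < e" using b(3) K by (simp add: field_simps)
  finally show "\<exists>b\<in>carrier A. nrm B ((c \<circ> a) \<ominus>\<^bsub>B\<^esub> b) < e" using b(2) by blast
qed

text \<open>Two nested inductions: a product of translations is a translation, which is extended to
  arbitrary right factors first and to arbitrary left factors afterwards.\<close>

lemma PF_mult:
  assumes a: "a \<in> carrier A" and b: "b \<in> carrier A"
  shows "a \<circ> b \<in> carrier A"
proof -
  have lam_comp: "lam G p g \<circ> b \<in> carrier A" if g: "g \<in> carrier G" for g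
    using b
  proof (induction b rule: PF_induct)
    case (lam k)
    then show ?case using g by (simp add: lam_mult)
  next
    case (add a b)
    have "lam G p g \<circ> (a \<oplus>\<^bsub>A\<^esub> b) = (lam G p g \<circ> a) \<oplus>\<^bsub>B\<^esub> (lam G p g \<circ> b)"
      using bounded_mapsD(3)[OF lam_bounded[OF g] P.bounded_maps_value[OF PF_B[OF add(1)]] P.bounded_maps_value[OF PF_B[OF add(2)]]]
      by (simp add: fun_eq_iff)
    then show ?case using PF_add[OF add(3,4)] by simp
  next
    case (smult c a)
    have "lam G p g \<circ> (c \<odot>\<^bsub>A\<^esub> a) = c \<odot>\<^bsub>B\<^esub> (lam G p g \<circ> a)"
      using bounded_mapsD(4)[OF lam_bounded[OF g] P.bounded_maps_value[OF PF_B[OF smult(1)]]]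
      by (simp add: fun_eq_iff)
    then show ?case using PF_smult[OF smult(2)] by simp
  next
    case (limit a)
    show ?case
    proof (rule PF_comp_limit'[OF PF_B[OF limit(1)] lam_bounded[OF g]])
      fix e :: real assume "e > 0"
      then obtain b where *: "b \<in> carrier A" "lam G p g \<circ> b \<in> carrier A" "nrm A (a \<ominus>\<^bsub>A\<^esub> b) < e"
        using limit(2) by blast
      then have "nrm B (a \<ominus>\<^bsub>B\<^esub> b) < e"
        using PF_minus(1)[OF limit(1) *(1)] by simp
      with * show "\<exists>b\<in>carrier A. lam G p g \<circ> b \<in> carrier A \<and> nrm B (a \<ominus>\<^bsub>B\<^esub> b) < e"
        by blast
    qed
  qed
  show ?thesis
    using a
  proof (induction a rule: PF_induct)
    case (lam g)
    then show ?case by (rule lam_comp)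
  next
    case (add a a')
    have "(a \<oplus>\<^bsub>A\<^esub> a') \<circ> b = (a \<circ> b) \<oplus>\<^bsub>B\<^esub> (a' \<circ> b)" by (simp add: fun_eq_iff)
    then show ?case using PF_add[OF add(3,4)] by simp
  next
    case (smult c a)
    have "(c \<odot>\<^bsub>A\<^esub> a) \<circ> b = c \<odot>\<^bsub>B\<^esub> (a \<circ> b)" by (simp add: fun_eq_iff)
    then show ?case using PF_smult[OF smult(2)] by simp
  next
    case (limit a)
    show ?case
    proof (rule PF_comp_limit[OF PF_B[OF limit(1)] PF_B[OF b]])
      fix e :: real assume "e > 0"
      then obtain a' where *: "a' \<in> carrier A" "a' \<circ> b \<in> carrier A" "nrm A (a \<ominus>\<^bsub>A\<^esub> a') < e"
        using limit(2) by blast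
      then have "nrm B (a \<ominus>\<^bsub>B\<^esub> a') < e"
        using PF_minus(1)[OF limit(1) *(1)] by simp
      with * show "\<exists>a'\<in>carrier A. a' \<circ> b \<in> carrier A \<and> nrm B (a \<ominus>\<^bsub>B\<^esub> a') < e"
        by blast
    qed
  qed
qed

sublocale A: banach_algebra "PF G p"
proof -
  interpret S: complex_banach_space "bounded_operators L\<lparr>carrier := carrier A\<rparr>"
  proof (rule BO.closed_subspace_banach)
    fix \<sigma> x assume c: "nconv (bounded_operators L) \<sigma> x" and m: "\<And>n. \<sigma> n \<in> carrier A"
    note cm = BO.nconv_mem[OF c, simplified]
    show "x \<in> carrier A"
    proof (rule PF_closed)
      fix e :: real assume "e > 0"
      have "(\<lambda>n. nrm B (\<sigma> n \<ominus>\<^bsub>B\<^esub> x)) \<longlonglongrightarrow> 0" using BO.nconv_null[OF c] by simp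
      then have "\<forall>\<^sub>F n in sequentially. nrm B (\<sigma> n \<ominus>\<^bsub>B\<^esub> x) < e"
        using \<open>e > 0\<close> by (rule order_tendstoD)
      then obtain n where "nrm B (\<sigma> n \<ominus>\<^bsub>B\<^esub> x) < e" by (auto simp: eventually_sequentially)
      then show "\<exists>b\<in>carrier A. nrm B (x \<ominus>\<^bsub>B\<^esub> b) < e"
        using m P.bm.nrm_minus_commute[OF cm(2) cm(1)] by (intro bexI[of _ "\<sigma> n"]) auto
    qed (use cm in simp)
  qed (use PF_B PF_zero PF_add PF_smult in auto)
  have eq: "PF G p = bounded_operators L\<lparr>carrier := carrier A\<rparr>"
    by (simp add: PF_def)
  interpret complex_banach_space "PF G p"
    using S.complex_banach_space_axioms eq by simp
  show "banach_algebra (PF G p)"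
  proof (intro banach_algebra.intro complex_banach_space_axioms banach_algebra_axioms.intro)
    fix R S T assume m: "R \<in> carrier A" "S \<in> carrier A" "T \<in> carrier A"
    show "R \<otimes>\<^bsub>A\<^esub> (S \<oplus>\<^bsub>A\<^esub> T) = R \<otimes>\<^bsub>A\<^esub> S \<oplus>\<^bsub>A\<^esub> R \<otimes>\<^bsub>A\<^esub> T"
      using BO.mult_distrib_left[of R S T] m PF_B by simp
  next
    fix R S k assume m: "R \<in> carrier A" "S \<in> carrier A"
    show "R \<otimes>\<^bsub>A\<^esub> (k \<odot>\<^bsub>A\<^esub> S) = k \<odot>\<^bsub>A\<^esub> (R \<otimes>\<^bsub>A\<^esub> S)"
      using BO.mult_smult_right[of R S k] m PF_B by simp
    show "nrm A (R \<otimes>\<^bsub>A\<^esub> S) \<le> nrm A R * nrm A S"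
      using BO.nrm_mult[of R S] m PF_B by simp
  qed (simp_all add: PF_mult fun_eq_iff)
qed

end

section \<open>Hahn--Banach separation\<close>

text \<open>Separation is needed in two quite different spaces, bounded functions on the group and
  finitely supported functions on pairs. Both are sets of real functions with pointwise
  operations.\<close>

definition fun_subspace :: "('i \<Rightarrow> real) set \<Rightarrow> bool" where
  "fun_subspace V \<longleftrightarrow> (\<lambda>_. 0) \<in> V \<and> (\<forall>x\<in>V. \<forall>y\<in>V. (\<lambda>i. x i + y i) \<in> V) \<and>
     (\<forall>c. \<forall>x\<in>V. (\<lambda>i. c * x i) \<in> V)"

text \<open>An inequality is enough for positive scalars, since scaling back turns it into an
  equality. This keeps the verification short for functionals defined as infima.\<close>

definition sublinear_on :: "('i \<Rightarrow> real) set \<Rightarrow> (('i \<Rightarrow> real) \<Rightarrow> real) \<Rightarrow> bool" where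
  "sublinear_on V q \<longleftrightarrow> (\<forall>x\<in>V. \<forall>y\<in>V. q (\<lambda>i. x i + y i) \<le> q x + q y) \<and>
     (\<forall>c>0. \<forall>x\<in>V. q (\<lambda>i. c * x i) \<le> c * q x)"

definition linear_form_on :: "('i \<Rightarrow> real) set \<Rightarrow> (('i \<Rightarrow> real) \<Rightarrow> real) \<Rightarrow> bool" where
  "linear_form_on V f \<longleftrightarrow> (\<forall>x\<in>V. \<forall>y\<in>V. f (\<lambda>i. x i + y i) = f x + f y) \<and>
     (\<forall>c. \<forall>x\<in>V. f (\<lambda>i. c * x i) = c * f x)"

lemma fun_subspaceD:
  assumes "fun_subspace V"
  shows "(\<lambda>_. 0) \<in> V" "\<lbrakk>x \<in> V; y \<in> V\<rbrakk> \<Longrightarrow> (\<lambda>i. x i + y i) \<in> V" "x \<in> V \<Longrightarrow> (\<lambda>i. c * x i) \<in> V"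
  using assms by (auto simp: fun_subspace_def)

lemma sublinear_onD:
  assumes "sublinear_on V q"
  shows "\<lbrakk>x \<in> V; y \<in> V\<rbrakk> \<Longrightarrow> q (\<lambda>i. x i + y i) \<le> q x + q y"
    "\<lbrakk>c > 0; x \<in> V\<rbrakk> \<Longrightarrow> q (\<lambda>i. c * x i) \<le> c * q x"
  using assms by (auto simp: sublinear_on_def)

lemma sublinear_on_scale:
  assumes V: "fun_subspace V" and q: "sublinear_on V q"
  shows "q (\<lambda>_. 0) = 0" "\<lbrakk>c \<ge> 0; x \<in> V\<rbrakk> \<Longrightarrow> q (\<lambda>i. c * x i) = c * q x"
proof -
  have eq: "q (\<lambda>i. c * x i) = c * q x" if "c > 0" "x \<in> V" for c x
  proof (rule order_antisym[OF sublinear_onD(2)[OF q that]])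
    have "q (\<lambda>i. inverse c * (c * x i)) \<le> inverse c * q (\<lambda>i. c * x i)"
      using that by (intro sublinear_onD(2)[OF q] fun_subspaceD(3)[OF V]) auto
    moreover have "(\<lambda>i. inverse c * (c * x i)) = x"
      using that by (simp add: fun_eq_iff flip: mult.assoc)
    ultimately show "c * q x \<le> q (\<lambda>i. c * x i)"
      using that by (simp add: field_simps)
  qed
  show 0: "q (\<lambda>_. 0) = 0"
    using eq[of 2 "\<lambda>_. 0"] fun_subspaceD(1)[OF V] by simp
  show "q (\<lambda>i. c * x i) = c * q x" if "c \<ge> 0" "x \<in> V"
    using eq[of c x] that 0 by (cases "c = 0") auto
qed

lemma sublinear_on_uminus:
  assumes V: "fun_subspace V" and q: "sublinear_on V q" and x: "x \<in> V"
  shows "- q (\<lambda>i. - x i) \<le> q x"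
  using sublinear_onD(1)[OF q x fun_subspaceD(3)[OF V x, of "-1"]] sublinear_on_scale(1)[OF V q] by simp

text \<open>The competitor in the minimality argument: \<open>t = 0\<close> shows that
  \<open>r\<close> lies below \<open>q\<close>, and \<open>t = 1\<close> bounds \<open>r x\<close>
  by \<open>q (x + y) - q y\<close>. If \<open>q\<close> is minimal, then \<open>r = q\<close>, and
  additivity follows.\<close>

lemma sublinear_on_translate:
  assumes V: "fun_subspace V" and q: "sublinear_on V q" and y: "y \<in> V"
  defines "r \<equiv> \<lambda>x. INF t\<in>{0..}. q (\<lambda>i. x i + t * y i) - t * q y"
  shows "sublinear_on V r" "\<And>x t. \<lbrakk>x \<in> V; t \<ge> 0\<rbrakk> \<Longrightarrow> r x \<le> q (\<lambda>i. x i + t * y i) - t * q y"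
proof -
  note Vr = fun_subspaceD[OF V]
  \<comment> \<open>The infimum is finite because \<open>t * q y = q (t y)\<close>, where
    \<open>t y\<close> is the sum of \<open>x + t y\<close> and \<open>- x\<close>.\<close>
  have bdd: "bdd_below ((\<lambda>t. q (\<lambda>i. x i + t * y i) - t * q y) ` {0..})" if x: "x \<in> V" for x
  proof (rule bdd_belowI2[of _ "- q (\<lambda>i. - x i)"])
    fix t :: real assume "t \<in> {0..}"
    then have "t * q y = q (\<lambda>i. t * y i)" using sublinear_on_scale(2)[OF V q _ y] by simp
    also have "(\<lambda>i. t * y i) = (\<lambda>i. (x i + t * y i) + - x i)" by auto
    also have "q \<dots> \<le> q (\<lambda>i. x i + t * y i) + q (\<lambda>i. - x i)"
      using Vr(2)[OF x Vr(3)[OF y, of t]] Vr(3)[OF x, of "-1"] by (intro sublinear_onD(1)[OF q]) auto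
    finally show "- q (\<lambda>i. - x i) \<le> q (\<lambda>i. x i + t * y i) - t * q y" by simp
  qed
  show le: "r x \<le> q (\<lambda>i. x i + t * y i) - t * q y" if "x \<in> V" "t \<ge> 0" for x t
    unfolding r_def using that by (intro cINF_lower bdd) auto
  have ge: "b \<le> r x" if "\<And>t. t \<ge> 0 \<Longrightarrow> b \<le> q (\<lambda>i. x i + t * y i) - t * q y" for x b
    unfolding r_def using that by (intro cINF_greatest) auto
  show "sublinear_on V r"
    unfolding sublinear_on_def
  proof (intro conjI ballI allI impI)
    fix x x' assume x: "x \<in> V" "x' \<in> V"
    have "r (\<lambda>i. x i + x' i) - (q (\<lambda>i. x' i + t * y i) - t * q y) \<le> r x" if t: "t \<ge> 0" for t
    proof (rule ge)
      fix s :: real assume s: "s \<ge> 0"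
      have "r (\<lambda>i. x i + x' i) \<le> q (\<lambda>i. (x i + x' i) + (s + t) * y i) - (s + t) * q y"
        using s t by (intro le Vr x) auto
      also have "(\<lambda>i. (x i + x' i) + (s + t) * y i) = (\<lambda>i. (x i + s * y i) + (x' i + t * y i))"
        by (auto simp: algebra_simps)
      also have "q \<dots> \<le> q (\<lambda>i. x i + s * y i) + q (\<lambda>i. x' i + t * y i)"
        by (intro sublinear_onD(1)[OF q] Vr x y)
      finally show "r (\<lambda>i. x i + x' i) - (q (\<lambda>i. x' i + t * y i) - t * q y) \<le> q (\<lambda>i. x i + s * y i) - s * q y"
        by (simp add: algebra_simps)
    qed
    then have "r (\<lambda>i. x i + x' i) - r x \<le> r x'"
      by (intro ge) (simp add: algebra_simps)
    then show "r (\<lambda>i. x i + x' i) \<le> r x + r x'" by simp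
  next
    fix c :: real and x assume c: "c > 0" and x: "x \<in> V"
    have "r (\<lambda>i. c * x i) / c \<le> r x"
    proof (rule ge)
      fix t :: real assume t: "t \<ge> 0"
      have "r (\<lambda>i. c * x i) \<le> q (\<lambda>i. c * x i + (c * t) * y i) - (c * t) * q y"
        using c t by (intro le Vr x) auto
      also have "(\<lambda>i. c * x i + (c * t) * y i) = (\<lambda>i. c * (x i + t * y i))"
        by (auto simp: algebra_simps)
      also have "q \<dots> \<le> c * q (\<lambda>i. x i + t * y i)"
        by (intro sublinear_onD(2)[OF q] Vr x y c)
      finally show "r (\<lambda>i. c * x i) / c \<le> q (\<lambda>i. x i + t * y i) - t * q y"
        using c by (simp add: field_simps)
    qed
    then show "r (\<lambda>i. c * x i) \<le> c * r x" using c by (simp add: field_simps)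
  qed
qed

text \<open>Subadditivity of an infimum needs one functional that serves both arguments; in a chain
  it is the smaller of the two. The bound below is \<open>- p (- x)\<close>, the same for all
  members.\<close>

lemma sublinear_chain_inf:
  assumes V: "fun_subspace V" and C: "C \<noteq> {}"
    and sub': "\<forall>q\<in>C. sublinear_on V q \<and> (\<forall>x\<in>V. q x \<le> p x)"
    and chain': "\<forall>q\<in>C. \<forall>r\<in>C. (\<forall>x\<in>V. q x \<le> r x) \<or> (\<forall>x\<in>V. r x \<le> q x)"
  defines "u \<equiv> \<lambda>x. INF q\<in>C. q x"
  shows "sublinear_on V u" "\<And>x q. \<lbrakk>x \<in> V; q \<in> C\<rbrakk> \<Longrightarrow> u x \<le> q x"
proof -
  note Vr = fun_subspaceD[OF V] and sub = bspec[OF sub'] and chain = bspec[OF bspec[OF chain']]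
  have bdd: "bdd_below ((\<lambda>q. q x) ` C)" if x: "x \<in> V" for x
  proof (rule bdd_belowI2[of _ "- p (\<lambda>i. - x i)"])
    fix q assume q: "q \<in> C"
    have "q (\<lambda>i. - x i) \<le> p (\<lambda>i. - x i)"
      using sub[OF q] Vr(3)[OF x, of "-1"] by auto
    then show "- p (\<lambda>i. - x i) \<le> q x"
      using sublinear_on_uminus[OF V _ x, of q] sub[OF q] by linarith
  qed
  show le: "u x \<le> q x" if "x \<in> V" "q \<in> C" for x q
    unfolding u_def using that by (intro cINF_lower bdd) auto
  have ge: "b \<le> u x" if "\<And>q. q \<in> C \<Longrightarrow> b \<le> q x" for x b
    unfolding u_def using that C by (intro cINF_greatest) auto
  show "sublinear_on V u"
    unfolding sublinear_on_def
  proof (intro conjI ballI allI impI)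
    fix x y assume x: "x \<in> V" "y \<in> V"
    have "u (\<lambda>i. x i + y i) \<le> q x + r y" if qr: "q \<in> C" "r \<in> C" for q r
    proof -
      have u: "u (\<lambda>i. x i + y i) \<le> q x + q y" if "q \<in> C" for q
        using le[OF Vr(2)[OF x] that] sublinear_onD(1)[of V q, OF _ x] sub[OF that] by linarith
      show ?thesis
        using chain[OF qr] u[OF qr(1)] u[OF qr(2)] x by fastforce
    qed
    then have "u (\<lambda>i. x i + y i) - r y \<le> u x" if "r \<in> C" for r
      using that by (intro ge) (simp add: algebra_simps)
    then have "u (\<lambda>i. x i + y i) - u x \<le> u y"
      by (intro ge) (simp add: algebra_simps)
    then show "u (\<lambda>i. x i + y i) \<le> u x + u y" by simp
  next
    fix c :: real and x assume c: "c > 0" and x: "x \<in> V"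
    have "u (\<lambda>i. c * x i) / c \<le> u x"
    proof (rule ge)
      fix q assume q: "q \<in> C"
      have "u (\<lambda>i. c * x i) \<le> c * q x"
        using le[OF Vr(3)[OF x] q, of c] sublinear_onD(2)[of V q, OF _ c x] sub[OF q] by linarith
      then show "u (\<lambda>i. c * x i) / c \<le> q x" using c by (simp add: field_simps)
    qed
    then show "u (\<lambda>i. c * x i) \<le> c * u x" using c by (simp add: field_simps)
  qed
qed

text \<open>Additivity comes from comparison with the functional of
  \<open>sublinear_on_translate\<close>; additivity then settles the negative scalars, which
  sublinearity leaves open.\<close>

lemma minimal_sublinear_linear:
  assumes V: "fun_subspace V" and q: "sublinear_on V q"
    and min: "\<And>r. \<lbrakk>sublinear_on V r; \<forall>x\<in>V. r x \<le> q x\<rbrakk> \<Longrightarrow> \<forall>x\<in>V. r x = q x"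
  shows "linear_form_on V q"
proof -
  note Vr = fun_subspaceD[OF V]
  have add: "q (\<lambda>i. x i + y i) = q x + q y" if x: "x \<in> V" "y \<in> V" for x y
  proof (rule order_antisym[OF sublinear_onD(1)[OF q x]])
    let ?r = "\<lambda>x. INF t\<in>{0..}. q (\<lambda>i. x i + t * y i) - t * q y"
    note r = sublinear_on_translate[OF V q x(2)]
    have "?r x = q x"
      using min[OF r(1)] r(2)[of _ 0] x(1) by auto
    then show "q x + q y \<le> q (\<lambda>i. x i + y i)"
      using r(2)[OF x(1), of 1] by simp
  qed
  have "q (\<lambda>i. c * x i) = c * q x" if x: "x \<in> V" for c x
  proof (cases "c \<ge> 0")
    case True
    then show ?thesis using sublinear_on_scale(2)[OF V q] x by simp
  next
    case False
    have "q (\<lambda>i. c * x i + (- c) * x i) = q (\<lambda>i. c * x i) + q (\<lambda>i. (- c) * x i)"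
      by (intro add Vr x)
    then show ?thesis
      using sublinear_on_scale(2)[OF V q _ x, of "- c"] sublinear_on_scale(1)[OF V q] False by simp
  qed
  with add show ?thesis by (simp add: linear_form_on_def)
qed

text \<open>No extension from a subspace is performed: Zorn's lemma gives a minimal sublinear
  functional below \<open>p\<close>, and minimal ones are linear.\<close>

theorem hahn_banach_sublinear:
  assumes V: "fun_subspace V" and p: "sublinear_on V p"
  obtains f where "linear_form_on V f" "\<And>x. x \<in> V \<Longrightarrow> f x \<le> p x"
proof -
  \<comment> \<open>Fixing the value 0 off \<open>V\<close> turns equality on \<open>V\<close> into
    equality of functions, which antisymmetry of the order requires.\<close>
  define S where "S = {q. sublinear_on V q \<and> (\<forall>x\<in>V. q x \<le> p x) \<and> (\<forall>x. x \<notin> V \<longrightarrow> q x = 0)}"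
  \<comment> \<open>The pointwise order is reversed, so that a maximal element for \<open>R\<close>
    is a minimal functional.\<close>
  define R where "R = (\<lambda>q r :: ('a \<Rightarrow> real) \<Rightarrow> real. \<forall>x. r x \<le> q x)"
  have restrict: "sublinear_on V (\<lambda>x. if x \<in> V then q x else 0)" if "sublinear_on V q" for q
    using that fun_subspaceD[OF V] by (auto simp: sublinear_on_def)
  have "\<exists>m\<in>S. \<forall>a\<in>S. R m a \<longrightarrow> a = m"
  proof (rule predicate_Zorn)
    show "partial_order_on S (relation_of R S)"
      by (rule partial_order_on_relation_ofI) (auto simp: R_def fun_eq_iff intro: order_trans order_antisym)
  next
    fix C assume C: "C \<in> Chains (relation_of R S)"
    then have CS: "C \<subseteq> S" and ch: "\<And>q r. \<lbrakk>q \<in> C; r \<in> C\<rbrakk> \<Longrightarrow> R q r \<or> R r q"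
      by (auto simp: Chains_def relation_of_def)
    show "\<exists>u\<in>S. \<forall>a\<in>C. R a u"
    proof (cases "C = {}")
      case True
      have "(\<lambda>x. if x \<in> V then p x else 0) \<in> S"
        using restrict[OF p] by (simp add: S_def)
      then show ?thesis using True by blast
    next
      case False
      have sub: "\<forall>q\<in>C. sublinear_on V q \<and> (\<forall>x\<in>V. q x \<le> p x)"
        using CS by (auto simp: S_def)
      have chain: "\<forall>q\<in>C. \<forall>r\<in>C. (\<forall>x\<in>V. q x \<le> r x) \<or> (\<forall>x\<in>V. r x \<le> q x)"
        using ch by (force simp: R_def)
      note u = sublinear_chain_inf[OF V False sub chain]
      let ?u = "\<lambda>x. if x \<in> V then (INF q\<in>C. q x) else 0"
      obtain q where q: "q \<in> C" using False by blast
      have "?u \<in> S"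
        using restrict[OF u(1)] u(2)[OF _ q] bspec[OF sub q] by (fastforce simp: S_def)
      moreover have "\<forall>a\<in>C. R a ?u"
        using u(2) CS by (auto simp: R_def S_def)
      ultimately show ?thesis by blast
    qed
  qed
  then obtain m where m: "m \<in> S" and min: "\<And>a. \<lbrakk>a \<in> S; R m a\<rbrakk> \<Longrightarrow> a = m" by blast
  have "linear_form_on V m"
  proof (rule minimal_sublinear_linear[OF V])
    show "sublinear_on V m" using m by (simp add: S_def)
    fix r assume r: "sublinear_on V r" "\<forall>x\<in>V. r x \<le> m x"
    let ?r = "\<lambda>x. if x \<in> V then r x else 0"
    have "?r \<in> S" using restrict[OF r(1)] r(2) m by (fastforce simp: S_def)
    moreover have "R m ?r" using r(2) m by (auto simp: R_def S_def)
    ultimately have "?r = m" by (rule min)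
    then show "\<forall>x\<in>V. r x = m x" by (auto simp: fun_eq_iff split: if_splits)
  qed
  with m that show ?thesis by (auto simp: S_def)
qed

text \<open>The form is dominated by the infimum of \<open>N (x + t c) - t \<epsilon>\<close> over
  \<open>t \<ge> 0\<close> and \<open>c\<close> in \<open>C\<close>. There \<open>t = 0\<close>
  gives the bound by \<open>N\<close>, while \<open>t = 1\<close> at the point \<open>- c\<close>
  gives \<open>f (- c) \<le> - \<epsilon>\<close>.\<close>

theorem separation_from_convex:
  fixes N :: "('i \<Rightarrow> real) \<Rightarrow> real"
  assumes V: "fun_subspace V"
    and N_add: "\<And>x y. \<lbrakk>x \<in> V; y \<in> V\<rbrakk> \<Longrightarrow> N (\<lambda>i. x i + y i) \<le> N x + N y"
    and N_scale: "\<And>c x. x \<in> V \<Longrightarrow> N (\<lambda>i. c * x i) = \<bar>c\<bar> * N x"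
    and C: "C \<subseteq> V" "C \<noteq> {}"
    and convex: "\<And>x y t. \<lbrakk>x \<in> C; y \<in> C; 0 \<le> t; t \<le> 1\<rbrakk> \<Longrightarrow> (\<lambda>i. (1 - t) * x i + t * y i) \<in> C"
    and far: "\<And>x. x \<in> C \<Longrightarrow> \<epsilon> \<le> N x"
  obtains f where "linear_form_on V f" "\<And>x. x \<in> V \<Longrightarrow> f x \<le> N x" "\<And>x. x \<in> C \<Longrightarrow> \<epsilon> \<le> f x"
proof -
  note Vr = fun_subspaceD[OF V]
  have CV: "x \<in> V" if "x \<in> C" for x using that C by auto
  define E where "E = (\<lambda>x. {N (\<lambda>i. x i + t * c i) - t * \<epsilon> | t c. t \<ge> 0 \<and> c \<in> C})"
  define p where "p = (\<lambda>x. Inf (E x))"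
  \<comment> \<open>The distance hypothesis makes the infimum finite: \<open>t c\<close> has
    \<open>N\<close>-value at least \<open>t * \<epsilon>\<close>, and it differs from
    \<open>x + t c\<close> by \<open>x\<close>.\<close>
  have bdd: "bdd_below (E x)" if x: "x \<in> V" for x
  proof (rule bdd_belowI)
    fix b assume "b \<in> E x"
    then obtain t c where b: "b = N (\<lambda>i. x i + t * c i) - t * \<epsilon>" and t: "t \<ge> 0" and c: "c \<in> C"
      by (auto simp: E_def)
    have "t * \<epsilon> \<le> N (\<lambda>i. t * c i)"
      using far[OF c] t N_scale[OF CV[OF c], of t] by (simp add: mult_left_mono)
    also have "(\<lambda>i. t * c i) = (\<lambda>i. (x i + t * c i) + (- 1) * x i)" by auto
    also have "N \<dots> \<le> N (\<lambda>i. x i + t * c i) + N (\<lambda>i. (- 1) * x i)"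
      by (intro N_add Vr x CV c)
    also have "N (\<lambda>i. (- 1) * x i) = N x" using N_scale[OF x, of "-1"] by simp
    finally show "- N x \<le> b" by (simp add: b)
  qed
  have le: "p x \<le> N (\<lambda>i. x i + t * c i) - t * \<epsilon>" if "x \<in> V" "t \<ge> 0" "c \<in> C" for x t c
    unfolding p_def using that by (intro cInf_lower bdd) (auto simp: E_def)
  have ge: "b \<le> p x" if "\<And>t c. \<lbrakk>t \<ge> 0; c \<in> C\<rbrakk> \<Longrightarrow> b \<le> N (\<lambda>i. x i + t * c i) - t * \<epsilon>" for x b
    unfolding p_def
  proof (rule cInf_greatest)
    show "E x \<noteq> {}" using C(2) by (auto simp: E_def intro: exI[of _ 0])
  qed (use that in \<open>auto simp: E_def\<close>)
  have "sublinear_on V p"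
    unfolding sublinear_on_def
  proof (intro conjI ballI allI impI)
    fix x y assume x: "x \<in> V" "y \<in> V"
    have key: "p (\<lambda>i. x i + y i) \<le> (N (\<lambda>i. x i + s * c i) - s * \<epsilon>) + (N (\<lambda>i. y i + t * d i) - t * \<epsilon>)"
      if s: "s \<ge> 0" "c \<in> C" and t: "t \<ge> 0" "d \<in> C" for s c t d
    proof -
      \<comment> \<open>The point \<open>e\<close> is the average of \<open>c\<close> and
        \<open>d\<close> with weights proportional to \<open>s\<close> and \<open>t\<close>. This is
        where convexity of \<open>C\<close> gives subadditivity; if both weights vanish, any point
        of \<open>C\<close> serves.\<close>
      obtain e where e: "e \<in> C" "\<And>i. (s + t) * e i = s * c i + t * d i"
      proof (cases "s + t = 0")
        case True
        then have "s = 0" "t = 0" using s t by auto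
        then show ?thesis using s that[of c] by simp
      next
        case False
        then have pos: "s + t > 0" using s t by simp
        have "t / (s + t) \<le> 1" "0 \<le> t / (s + t)" using s t pos by auto
        from convex[OF s(2) t(2) this(2,1)] show ?thesis
        proof (rule that)
          fix i
          have "1 - t / (s + t) = s / (s + t)" using pos by (simp add: field_simps)
          then show "(s + t) * ((1 - t / (s + t)) * c i + t / (s + t) * d i) = s * c i + t * d i"
            using pos by (simp add: distrib_left)
        qed
      qed
      have "p (\<lambda>i. x i + y i) \<le> N (\<lambda>i. (x i + y i) + (s + t) * e i) - (s + t) * \<epsilon>"
        using s t by (intro le Vr x e) auto
      also have "(\<lambda>i. (x i + y i) + (s + t) * e i) = (\<lambda>i. (x i + s * c i) + (y i + t * d i))"
        by (auto simp: e(2))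
      also have "N \<dots> \<le> N (\<lambda>i. x i + s * c i) + N (\<lambda>i. y i + t * d i)"
        by (intro N_add Vr x CV s t)
      finally show ?thesis by (simp add: algebra_simps)
    qed
    have "p (\<lambda>i. x i + y i) - (N (\<lambda>i. y i + t * d i) - t * \<epsilon>) \<le> p x" if "t \<ge> 0" "d \<in> C" for t d
      using key[OF _ _ that] by (intro ge) (simp add: algebra_simps)
    then have "p (\<lambda>i. x i + y i) - p x \<le> p y"
      by (intro ge) (simp add: algebra_simps)
    then show "p (\<lambda>i. x i + y i) \<le> p x + p y" by simp
  next
    fix a :: real and x assume a: "a > 0" and x: "x \<in> V"
    have "p (\<lambda>i. a * x i) / a \<le> p x"
    proof (rule ge)
      fix t c assume t: "(t::real) \<ge> 0" and c: "c \<in> C"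
      have "p (\<lambda>i. a * x i) \<le> N (\<lambda>i. a * x i + (a * t) * c i) - (a * t) * \<epsilon>"
        using a t by (intro le Vr x c) auto
      also have "(\<lambda>i. a * x i + (a * t) * c i) = (\<lambda>i. a * (x i + t * c i))"
        by (auto simp: algebra_simps)
      also have "N \<dots> = a * N (\<lambda>i. x i + t * c i)"
        using N_scale[OF Vr(2)[OF x Vr(3)[OF CV[OF c]]], of a t] a by simp
      finally show "p (\<lambda>i. a * x i) / a \<le> N (\<lambda>i. x i + t * c i) - t * \<epsilon>"
        using a by (simp add: field_simps)
    qed
    then show "p (\<lambda>i. a * x i) \<le> a * p x" using a by (simp add: field_simps)
  qed
  then obtain f where f: "linear_form_on V f" "\<And>x. x \<in> V \<Longrightarrow> f x \<le> p x"
    using hahn_banach_sublinear[OF V] by blast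
  obtain c0 where c0: "c0 \<in> C" using C by blast
  show ?thesis
  proof (rule that[OF f(1)])
    show "f x \<le> N x" if "x \<in> V" for x
      using f(2)[OF that] le[OF that order_refl c0] by simp
    show "\<epsilon> \<le> f c" if c: "c \<in> C" for c
    proof -
      have "N (\<lambda>_. 0) = 0" using N_scale[OF Vr(1), of 0] by simp
      then have "f (\<lambda>i. (- 1) * c i) \<le> - \<epsilon>"
        using f(2)[OF Vr(3)[OF CV[OF c]], of "- 1"] le[OF Vr(3)[OF CV[OF c]] zero_le_one c, of "- 1"] by simp
      moreover have "f (\<lambda>i. (- 1) * c i) = - f c"
        using f(1) CV[OF c] unfolding linear_form_on_def by (metis mult_minus1)
      ultimately show ?thesis by simp
    qed
  qed
qed

section \<open>Invariant means\<close>

lemma linf_simps [simp]: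
  "zero (linf G) = (\<lambda>_. 0)" "add (linf G) f h = (\<lambda>s. f s + h s)" "smult (linf G) c f = (\<lambda>s. c * f s)"
  by (simp_all add: linf_def)

lemma linf_iff: "f \<in> carrier (linf G) \<longleftrightarrow>
    (\<forall>s. s \<notin> carrier G \<longrightarrow> f s = 0) \<and> (\<exists>K. \<forall>s\<in>carrier G. cmod (f s) \<le> K)"
  by (auto simp: linf_def bounded_iff)

lemma linfI:
  assumes "\<And>s. s \<notin> carrier G \<Longrightarrow> f s = 0" "\<And>s. s \<in> carrier G \<Longrightarrow> cmod (f s) \<le> K"
  shows "f \<in> carrier (linf G)"
  using assms by (auto simp: linf_iff)

lemma linf_zero: "(\<lambda>_. 0) \<in> carrier (linf G)"
  by (auto simp: linf_iff)

lemma linf_add: "\<lbrakk>f \<in> carrier (linf G); h \<in> carrier (linf G)\<rbrakk> \<Longrightarrow> (\<lambda>s. f s + h s) \<in> carrier (linf G)"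
  by (auto simp: linf_iff) (meson add_mono norm_triangle_le)

lemma linf_smult: "f \<in> carrier (linf G) \<Longrightarrow> (\<lambda>s. c * f s) \<in> carrier (linf G)"
  by (auto simp: linf_iff norm_mult) (meson mult_left_mono norm_ge_zero)

definition left_shift :: "('g, 'b) monoid_scheme \<Rightarrow> 'g \<Rightarrow> ('g \<Rightarrow> 'c::zero) \<Rightarrow> 'g \<Rightarrow> 'c" where
  "left_shift G g f = (\<lambda>s. if s \<in> carrier G then f (g \<otimes>\<^bsub>G\<^esub> s) else 0)"

definition const_one :: "('g, 'b) monoid_scheme \<Rightarrow> 'g \<Rightarrow> 'c::zero_neq_one" where
  "const_one G = (\<lambda>s. if s \<in> carrier G then 1 else 0)"

context group
begin

lemma linf_coordinate_le:
  assumes f: "f \<in> carrier (linf G)"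
  shows "cmod (f s) \<le> nrm (linf G) f"
proof -
  obtain K where "\<forall>s\<in>carrier G. cmod (f s) \<le> K" using f by (auto simp: linf_iff)
  then have "bdd_above ((\<lambda>s. cmod (f s)) ` carrier G)"
    by (intro bdd_aboveI2[of _ _ K]) auto
  then have le: "cmod (f s) \<le> nrm (linf G) f" if "s \<in> carrier G" for s
    using that by (auto simp: linf_def intro: cSUP_upper)
  have "0 \<le> nrm (linf G) f"
    using le[OF one_closed] norm_ge_zero order_trans by blast
  then show ?thesis
    using le f by (cases "s \<in> carrier G") (auto simp: linf_iff)
qed

lemma linf_nrm_le:
  assumes "\<And>s. s \<in> carrier G \<Longrightarrow> cmod (f s) \<le> K"
  shows "nrm (linf G) f \<le> K"
proof -
  have "carrier G \<noteq> {}" using one_closed by blast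
  then show ?thesis using assms by (auto simp: linf_def intro!: cSUP_least)
qed

lemma linf_normed: "complex_normed_space (linf G)"
proof (rule complex_normed_spaceI)
  show "0 \<le> nrm (linf G) f" if "f \<in> carrier (linf G)" for f
    using linf_coordinate_le[OF that, of \<one>] norm_ge_zero order_trans by blast
  show "f = \<zero>\<^bsub>linf G\<^esub>" if "f \<in> carrier (linf G)" "nrm (linf G) f = 0" for f
    using linf_coordinate_le[OF that(1)] that(2) by (auto simp: fun_eq_iff)
  show "nrm (linf G) (c \<odot>\<^bsub>linf G\<^esub> f) \<le> cmod c * nrm (linf G) f" if "f \<in> carrier (linf G)" for c f
    using linf_coordinate_le[OF that] by (intro linf_nrm_le) (simp add: norm_mult mult_left_mono)
  show "nrm (linf G) (f \<oplus>\<^bsub>linf G\<^esub> h) \<le> nrm (linf G) f + nrm (linf G) h"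
    if "f \<in> carrier (linf G)" "h \<in> carrier (linf G)" for f h
    using linf_coordinate_le[OF that(1)] linf_coordinate_le[OF that(2)]
    by (intro linf_nrm_le) (auto intro: order_trans[OF norm_triangle_ineq] add_mono)
qed (auto simp: linf_add linf_smult linf_zero algebra_simps)

lemma left_shift_linf: "\<lbrakk>f \<in> carrier (linf G); g \<in> carrier G\<rbrakk> \<Longrightarrow> left_shift G g f \<in> carrier (linf G)"
  by (auto simp: linf_iff left_shift_def)

lemma const_one_linf: "const_one G \<in> carrier (linf G)"
  by (rule linfI[of _ _ 1]) (auto simp: const_one_def)

lemma amenable_groupE:
  assumes "amenable_group G"
  obtains m where "\<And>f h. \<lbrakk>f \<in> carrier (linf G); h \<in> carrier (linf G)\<rbrakk> \<Longrightarrow> m (\<lambda>s. f s + h s) = m f + m h"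
    "\<And>c f. f \<in> carrier (linf G) \<Longrightarrow> m (\<lambda>s. c * f s) = c * m f"
    "\<And>f. f \<in> carrier (linf G) \<Longrightarrow> cmod (m f) \<le> nrm (linf G) f"
    "m (const_one G) = 1"
    "\<And>g f. \<lbrakk>g \<in> carrier G; f \<in> carrier (linf G)\<rbrakk> \<Longrightarrow> m (left_shift G g f) = m f"
proof -
  obtain m where m: "m \<in> carrier (bounded_maps (linf G) complex_alg)" "nrm (bounded_maps (linf G) complex_alg) m = 1"
    "m (const_one G) = 1" "\<forall>g\<in>carrier G. \<forall>f\<in>carrier (linf G). m (left_shift G g f) = m f"
    using assms unfolding amenable_group_def dual_space_def left_shift_def const_one_def by blast
  interpret N: normed_pair "linf G" complex_alg
    by (intro normed_pair.intro linf_normed complex_banach_space.axioms(1) complex_alg_banach)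
  show ?thesis
    using that[of m] m bounded_mapsD(3,4)[OF m(1)] N.nrm_apply_le[OF m(1)] by simp
qed

lemma amenable_groupI:
  assumes add: "\<And>f h. \<lbrakk>f \<in> carrier (linf G); h \<in> carrier (linf G)\<rbrakk> \<Longrightarrow> m (\<lambda>s. f s + h s) = m f + m h"
    and smult: "\<And>c f. f \<in> carrier (linf G) \<Longrightarrow> m (\<lambda>s. c * f s) = c * m f"
    and bound: "\<And>f. f \<in> carrier (linf G) \<Longrightarrow> cmod (m f) \<le> nrm (linf G) f"
    and one: "m (const_one G) = 1"
    and inv: "\<And>g f. \<lbrakk>g \<in> carrier G; f \<in> carrier (linf G)\<rbrakk> \<Longrightarrow> m (left_shift G g f) = m f"
  shows "amenable_group G"
proof -
  interpret N: normed_pair "linf G" complex_alg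
    by (intro normed_pair.intro linf_normed complex_banach_space.axioms(1) complex_alg_banach)
  \<comment> \<open>Elements of the dual space vanish off the carrier, hence the cut-off.\<close>
  define m' where "m' = (\<lambda>f. if f \<in> carrier (linf G) then m f else 0)"
  have mem: "m' \<in> carrier (bounded_maps (linf G) complex_alg)"
    by (rule bounded_maps_carrierI[of _ _ _ 1]) (use assms in \<open>auto simp: m'_def linf_add linf_smult\<close>)
  have "nrm (bounded_maps (linf G) complex_alg) m' \<le> 1"
    by (rule N.bounded_maps_nrm_le) (use bound in \<open>auto simp: m'_def\<close>)
  moreover have "nrm (linf G) (const_one G) \<le> 1"
    by (rule linf_nrm_le) (auto simp: const_one_def)
  then have "1 \<le> nrm (bounded_maps (linf G) complex_alg) m'"
    using N.nrm_apply_le[OF mem const_one_linf] one const_one_linf N.bounded_maps_nrm_nonneg[OF mem]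
    by (simp add: m'_def) (smt (verit) mult_left_le)
  ultimately have "nrm (bounded_maps (linf G) complex_alg) m' = 1" by simp
  then show ?thesis
    unfolding amenable_group_def dual_space_def left_shift_def[symmetric] const_one_def[symmetric]
    using mem one inv const_one_linf left_shift_linf by (intro bexI[of _ m']) (auto simp: m'_def)
qed

end

definition almost_invariant ::
    "('g, 'b) monoid_scheme \<Rightarrow> 'g set \<Rightarrow> real \<Rightarrow> (('g \<Rightarrow> complex) \<Rightarrow> complex) \<Rightarrow> bool" where
  "almost_invariant G S e m \<longleftrightarrow>
     (\<forall>f\<in>carrier (linf G). \<forall>h\<in>carrier (linf G). m (\<lambda>s. f s + h s) = m f + m h) \<and>
     (\<forall>c. \<forall>f\<in>carrier (linf G). m (\<lambda>s. c * f s) = c * m f) \<and>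
     (\<exists>K\<ge>0. \<forall>f\<in>carrier (linf G). cmod (m f) \<le> K * nrm (linf G) f) \<and>
     1 / 2 \<le> cmod (m (const_one G)) \<and>
     (\<forall>g\<in>S. \<forall>f\<in>carrier (linf G). cmod (m (left_shift G g f) - m f) \<le> e * nrm (linf G) f)"

definition bounded_cone :: "('g, 'b) monoid_scheme \<Rightarrow> ('g \<Rightarrow> real) set" where
  "bounded_cone G = {a. (\<forall>s. s \<notin> carrier G \<longrightarrow> a s = 0) \<and> (\<forall>s. 0 \<le> a s) \<and> (\<exists>K. \<forall>s. a s \<le> K)}"

definition dominated :: "('g, 'b) monoid_scheme \<Rightarrow> ('g \<Rightarrow> real) \<Rightarrow> ('g \<Rightarrow> complex) set" where
  "dominated G a = {h \<in> carrier (linf G). \<forall>s. cmod (h s) \<le> a s}"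

text \<open>The absolute value of \<open>m\<close> in the order dual, evaluated on nonnegative
  functions: additive and monotone there even though \<open>m\<close> is an arbitrary complex
  functional.\<close>

definition variation ::
    "('g, 'b) monoid_scheme \<Rightarrow> (('g \<Rightarrow> complex) \<Rightarrow> complex) \<Rightarrow> ('g \<Rightarrow> real) \<Rightarrow> real" where
  "variation G m a = (SUP h\<in>dominated G a. cmod (m h))"

lemma unit_rotation:
  obtains u :: complex where "cmod u = 1" "u * z = complex_of_real (cmod z)"
proof (cases "z = 0")
  case False
  then have "cnj z / cmod z * z = complex_of_real (cmod z)"
    by (simp add: field_simps complex_norm_square[symmetric] power2_eq_square mult.commute)
  with False show ?thesis by (intro that[of "cnj z / cmod z"]) (auto simp: norm_divide)
qed (auto intro: that[of 1])

lemma bounded_cone_add: "\<lbrakk>a \<in> bounded_cone G; b \<in> bounded_cone G\<rbrakk> \<Longrightarrow> (\<lambda>s. a s + b s) \<in> bounded_cone G"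
  unfolding bounded_cone_def by (auto simp: add_nonneg_nonneg) (meson add_mono)

section \<open>Total variation of an almost invariant functional\<close>

context group
begin

lemma left_shift_cone: "\<lbrakk>a \<in> bounded_cone G; g \<in> carrier G\<rbrakk> \<Longrightarrow> left_shift G g a \<in> bounded_cone G"
proof -
  assume a: "a \<in> bounded_cone G" and g: "g \<in> carrier G"
  then obtain K where "\<forall>s. a s \<le> K" "\<forall>s. 0 \<le> a s" by (auto simp: bounded_cone_def)
  moreover from this have "0 \<le> K" by (meson order_trans)
  ultimately show ?thesis
    using a g by (auto simp: bounded_cone_def left_shift_def intro!: exI[of _ K])
qed

context
  fixes m S e
  assumes m: "almost_invariant G S e m"
begin

lemma m_add: "\<lbrakk>f \<in> carrier (linf G); h \<in> carrier (linf G)\<rbrakk> \<Longrightarrow> m (\<lambda>s. f s + h s) = m f + m h"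
  and m_smult: "f \<in> carrier (linf G) \<Longrightarrow> m (\<lambda>s. c * f s) = c * m f"
  and m_shift: "\<lbrakk>g \<in> S; f \<in> carrier (linf G)\<rbrakk> \<Longrightarrow> cmod (m (left_shift G g f) - m f) \<le> e * nrm (linf G) f"
  using m by (auto simp: almost_invariant_def)

lemma variation_bdd:
  assumes "a \<in> bounded_cone G"
  shows "bdd_above ((\<lambda>h. cmod (m h)) ` dominated G a)"
proof -
  obtain K where K: "K \<ge> 0" "\<And>f. f \<in> carrier (linf G) \<Longrightarrow> cmod (m f) \<le> K * nrm (linf G) f"
    using m by (auto simp: almost_invariant_def)
  obtain R where R: "\<forall>s. a s \<le> R" using assms by (auto simp: bounded_cone_def)
  show ?thesis
  proof (rule bdd_aboveI2)
    fix h assume h: "h \<in> dominated G a"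
    have "nrm (linf G) h \<le> R"
      using h R by (intro linf_nrm_le) (auto simp: dominated_def intro: order_trans)
    then show "cmod (m h) \<le> K * R"
      using K h by (auto simp: dominated_def intro!: order_trans[OF K(2)] mult_left_mono)
  qed
qed

lemma variation_upper: "\<lbrakk>a \<in> bounded_cone G; h \<in> dominated G a\<rbrakk> \<Longrightarrow> cmod (m h) \<le> variation G m a"
  unfolding variation_def by (rule cSUP_upper[OF _ variation_bdd])

lemma variation_least:
  assumes "a \<in> bounded_cone G" "\<And>h. h \<in> dominated G a \<Longrightarrow> cmod (m h) \<le> b"
  shows "variation G m a \<le> b"
proof -
  have "(\<lambda>_. 0) \<in> dominated G a" using assms(1) by (auto simp: dominated_def bounded_cone_def linf_iff)
  then show ?thesis unfolding variation_def using assms(2) by (intro cSUP_least) auto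
qed

text \<open>Riesz decomposition: a function dominated by \<open>a + b\<close> splits into parts
  proportional to \<open>a\<close> and \<open>b\<close>. For the other inequality, functions
  dominated by \<open>a\<close> and by \<open>b\<close> are rotated until their values under
  \<open>m\<close> are nonnegative and add up.\<close>

lemma variation_add:
  assumes a: "a \<in> bounded_cone G" and b: "b \<in> bounded_cone G"
  shows "variation G m (\<lambda>s. a s + b s) = variation G m a + variation G m b"
proof (rule order_antisym)
  note ab = bounded_cone_add[OF a b]
  have nn: "0 \<le> a s" "0 \<le> b s" for s using a b by (auto simp: bounded_cone_def)
  show "variation G m (\<lambda>s. a s + b s) \<le> variation G m a + variation G m b"
  proof (rule variation_least[OF ab])
    fix h assume h: "h \<in> dominated G (\<lambda>s. a s + b s)"
    \<comment> \<open>Where \<open>a + b\<close> vanishes, the quotients are 0 by convention;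
      \<open>h\<close> vanishes there as well, so the two parts still add up to
      \<open>h\<close>.\<close>
    define h1 h2 where "h1 = (\<lambda>s. of_real (a s / (a s + b s)) * h s)" and "h2 = (\<lambda>s. of_real (b s / (a s + b s)) * h s)"
    have hle: "cmod (h s) \<le> a s + b s" for s using h by (auto simp: dominated_def)
    have le: "cmod (h1 s) \<le> a s" "cmod (h2 s) \<le> b s" for s
    proof -
      have *: "x / (a s + b s) * cmod (h s) \<le> x" if "0 \<le> x" for x
      proof (cases "a s + b s = 0")
        case False
        then have pos: "a s + b s > 0" using nn[of s] by linarith
        have "x / (a s + b s) * cmod (h s) \<le> x / (a s + b s) * (a s + b s)"
          using that pos by (intro mult_left_mono hle) auto
        then show ?thesis using pos by simp
      qed (use that in simp)
      show "cmod (h1 s) \<le> a s" "cmod (h2 s) \<le> b s"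
        using *[of "a s"] *[of "b s"] nn[of s]
        by (auto simp: h1_def h2_def norm_mult norm_divide simp flip: of_real_add)
    qed
    have out: "h s = 0" if "s \<notin> carrier G" for s using h that by (auto simp: dominated_def linf_iff)
    obtain Ra Rb where R: "\<forall>s. a s \<le> Ra" "\<forall>s. b s \<le> Rb" using a b by (auto simp: bounded_cone_def)
    have "h1 \<in> carrier (linf G)"
      by (rule linfI[of _ _ Ra]) (use le(1) R(1) out in \<open>auto simp: h1_def intro: order_trans\<close>)
    moreover have "h2 \<in> carrier (linf G)"
      by (rule linfI[of _ _ Rb]) (use le(2) R(2) out in \<open>auto simp: h2_def intro: order_trans\<close>)
    ultimately have d: "h1 \<in> dominated G a" "h2 \<in> dominated G b"
      using le by (auto simp: dominated_def)
    have "h s = h1 s + h2 s" for s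
    proof (cases "a s + b s = 0")
      case True
      then show ?thesis using hle[of s] by (simp add: h1_def h2_def)
    next
      case False
      then have "complex_of_real (a s / (a s + b s)) + complex_of_real (b s / (a s + b s)) = 1"
        by (simp only: of_real_add[symmetric] add_divide_distrib[symmetric]) simp
      then show ?thesis by (simp only: h1_def h2_def distrib_right[symmetric]) simp
    qed
    then have "h = (\<lambda>s. h1 s + h2 s)" by auto
    then have mh: "m h = m h1 + m h2" using m_add d by (auto simp: dominated_def)
    show "cmod (m h) \<le> variation G m a + variation G m b"
      unfolding mh using variation_upper[OF a d(1)] variation_upper[OF b d(2)] norm_triangle_ineq[of "m h1" "m h2"] by linarith
  qed
  have "cmod (m h1) + cmod (m h2) \<le> variation G m (\<lambda>s. a s + b s)"
    if h1: "h1 \<in> dominated G a" and h2: "h2 \<in> dominated G b" for h1 h2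
  proof -
    \<comment> \<open>Unimodular factors preserve domination and make the sum of the moduli the
      value of \<open>m\<close> at a single function.\<close>
    obtain u1 where u1: "cmod u1 = 1" "u1 * m h1 = complex_of_real (cmod (m h1))" by (rule unit_rotation)
    obtain u2 where u2: "cmod u2 = 1" "u2 * m h2 = complex_of_real (cmod (m h2))" by (rule unit_rotation)
    have mem: "h1 \<in> carrier (linf G)" "h2 \<in> carrier (linf G)" using h1 h2 by (auto simp: dominated_def)
    have "m (\<lambda>s. u1 * h1 s + u2 * h2 s) = complex_of_real (cmod (m h1) + cmod (m h2))"
      using m_add[OF linf_smult[OF mem(1)] linf_smult[OF mem(2)]] m_smult mem u1 u2 by simp
    moreover have "(\<lambda>s. u1 * h1 s + u2 * h2 s) \<in> dominated G (\<lambda>s. a s + b s)"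
      using h1 h2 u1 u2 unfolding dominated_def
      by (auto intro!: linf_add linf_smult order_trans[OF norm_triangle_ineq] add_mono simp: norm_mult)
    ultimately show ?thesis using variation_upper[OF ab] by (metis abs_of_nonneg add_nonneg_nonneg norm_ge_zero norm_of_real)
  qed
  then have "variation G m a \<le> variation G m (\<lambda>s. a s + b s) - cmod (m h2)" if "h2 \<in> dominated G b" for h2
    using that by (intro variation_least[OF a]) (simp add: algebra_simps)
  then have "variation G m b \<le> variation G m (\<lambda>s. a s + b s) - variation G m a"
    by (intro variation_least[OF b]) (simp add: algebra_simps)
  then show "variation G m a + variation G m b \<le> variation G m (\<lambda>s. a s + b s)" by simp
qed

lemma variation_mono:
  assumes "a \<in> bounded_cone G" "b \<in> bounded_cone G" "\<And>s. a s \<le> b s"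
  shows "variation G m a \<le> variation G m b"
proof (rule variation_least[OF assms(1)])
  fix h assume "h \<in> dominated G a"
  then have "h \<in> dominated G b" using assms(3) by (auto simp: dominated_def intro: order_trans)
  then show "cmod (m h) \<le> variation G m b" by (rule variation_upper[OF assms(2)])
qed

lemma variation_const:
  assumes "c \<ge> 0"
  shows "c / 2 \<le> variation G m (\<lambda>s. c * const_one G s)"
proof -
  have "(\<lambda>s. complex_of_real c * const_one G s) \<in> dominated G (\<lambda>s. c * const_one G s)"
    using assms linf_smult[OF const_one_linf] by (auto simp: dominated_def const_one_def)
  moreover have "(\<lambda>s. c * const_one G s) \<in> bounded_cone G"
    using assms by (auto simp: bounded_cone_def const_one_def intro!: exI[of _ c])
  ultimately have "cmod (m (\<lambda>s. complex_of_real c * const_one G s)) \<le> variation G m (\<lambda>s. c * const_one G s)"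
    using variation_upper by blast
  moreover have "cmod (m (\<lambda>s. complex_of_real c * const_one G s)) = c * cmod (m (const_one G))"
    using assms by (simp add: m_smult[OF const_one_linf] norm_mult)
  moreover have "c * (1 / 2) \<le> c * cmod (m (const_one G))"
    using m assms by (intro mult_left_mono) (auto simp: almost_invariant_def)
  ultimately show ?thesis by simp
qed

text \<open>Shifting by \<open>g\<close> maps the functions dominated by \<open>a\<close> onto those
  dominated by the shift of \<open>a\<close>, and each value of \<open>m\<close> moves by at most
  \<open>e * R\<close>. The error does not involve the norm of \<open>m\<close>.\<close>

lemma variation_shift:
  assumes a: "a \<in> bounded_cone G" and R: "\<And>s. a s \<le> R" and g: "g \<in> S" "g \<in> carrier G" and e: "e \<ge> 0"
  shows "\<bar>variation G m (left_shift G g a) - variation G m a\<bar> \<le> e * R"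
proof -
  note sa = left_shift_cone[OF a g(2)]
  have close: "cmod (m (left_shift G g h) - m h) \<le> e * R" if "h \<in> dominated G a" for h
  proof -
    have "nrm (linf G) h \<le> R"
      using that R by (intro linf_nrm_le) (auto simp: dominated_def intro: order_trans)
    then have "e * nrm (linf G) h \<le> e * R" using e by (rule mult_left_mono)
    then show ?thesis using m_shift[OF g(1), of h] that by (auto simp: dominated_def)
  qed
  have "variation G m (left_shift G g a) \<le> variation G m a + e * R"
  proof (rule variation_least[OF sa])
    fix h assume h: "h \<in> dominated G (left_shift G g a)"
    define h' where "h' = left_shift G (inv g) h"
    have h': "h' \<in> dominated G a"
      unfolding dominated_def
    proof (safe)
      show "h' \<in> carrier (linf G)"
        using h g(2) by (auto simp: h'_def dominated_def intro: left_shift_linf)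
      fix s
      have "cmod (h (inv g \<otimes> s)) \<le> left_shift G g a (inv g \<otimes> s)" using h by (simp add: dominated_def)
      moreover have "0 \<le> a s" using a by (simp add: bounded_cone_def)
      ultimately show "cmod (h' s) \<le> a s"
        using g(2) by (auto simp: h'_def left_shift_def m_assoc[symmetric])
    qed
    have "left_shift G g h' = h"
      using h g(2) by (auto simp: h'_def left_shift_def m_assoc[symmetric] dominated_def linf_iff fun_eq_iff)
    then have "cmod (m h) \<le> cmod (m h') + e * R"
      using close[OF h'] norm_triangle_ineq2[of "m h" "m h'"] by simp
    then show "cmod (m h) \<le> variation G m a + e * R"
      using variation_upper[OF a h'] by simp
  qed
  moreover have "variation G m a \<le> variation G m (left_shift G g a) + e * R"
  proof (rule variation_least[OF a])
    fix h assume h: "h \<in> dominated G a"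
    then have "left_shift G g h \<in> dominated G (left_shift G g a)"
      using left_shift_linf[OF _ g(2), of h] by (auto simp: dominated_def left_shift_def)
    from variation_upper[OF sa this] close[OF h]
    show "cmod (m h) \<le> variation G m (left_shift G g a) + e * R"
      using norm_triangle_ineq2[of "m h" "m (left_shift G g h)"] by (simp add: norm_minus_commute)
  qed
  ultimately show ?thesis by linarith
qed

end

end

section \<open>Shift coboundaries and the construction of an invariant mean\<close>

definition real_linf :: "('g, 'b) monoid_scheme \<Rightarrow> ('g \<Rightarrow> real) set" where
  "real_linf G = {x. (\<forall>s. s \<notin> carrier G \<longrightarrow> x s = 0) \<and> (\<exists>K. \<forall>s. \<bar>x s\<bar> \<le> K)}"

text \<open>Finite sums of shift differences. Generating them one difference at a time lets
  induction collect the finitely many group elements on which almost invariance has to be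
  requested.\<close>

inductive_set shift_coboundaries :: "('g, 'b) monoid_scheme \<Rightarrow> ('g \<Rightarrow> real) set" for G where
  zero: "(\<lambda>_. 0) \<in> shift_coboundaries G"
| add: "\<lbrakk>w \<in> shift_coboundaries G; g \<in> carrier G; x \<in> real_linf G\<rbrakk> \<Longrightarrow>
    (\<lambda>s. w s + (left_shift G g x s - x s)) \<in> shift_coboundaries G"

lemma real_linf_subspace: "fun_subspace (real_linf G)"
  unfolding fun_subspace_def real_linf_def
proof (safe)
  fix x y :: "'a \<Rightarrow> real" and K R assume "\<forall>s. \<bar>x s\<bar> \<le> K" "\<forall>s. \<bar>y s\<bar> \<le> R"
  then have "\<forall>s. \<bar>x s + y s\<bar> \<le> K + R" by (meson abs_triangle_ineq add_mono order_trans)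
  then show "\<exists>K. \<forall>s. \<bar>x s + y s\<bar> \<le> K" ..
next
  fix c :: real and x :: "'a \<Rightarrow> real" and K assume "\<forall>s. \<bar>x s\<bar> \<le> K"
  then have "\<forall>s. \<bar>c * x s\<bar> \<le> \<bar>c\<bar> * K" by (simp add: abs_mult mult_left_mono)
  then show "\<exists>K. \<forall>s. \<bar>c * x s\<bar> \<le> K" ..
qed auto

context group
begin

lemma real_linf_shift: "\<lbrakk>x \<in> real_linf G; g \<in> carrier G\<rbrakk> \<Longrightarrow> left_shift G g x \<in> real_linf G"
proof -
  assume x: "x \<in> real_linf G" and g: "g \<in> carrier G"
  then obtain K where "\<forall>s. \<bar>x s\<bar> \<le> K" by (auto simp: real_linf_def)
  moreover from this have "0 \<le> K" by (meson abs_ge_zero order_trans)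
  ultimately show ?thesis
    using x g by (auto simp: real_linf_def left_shift_def intro!: exI[of _ K])
qed

lemma const_one_real_linf: "const_one G \<in> real_linf G"
  by (auto simp: real_linf_def const_one_def intro!: exI[of _ 1])

lemma shift_coboundaries_real_linf: "w \<in> shift_coboundaries G \<Longrightarrow> w \<in> real_linf G"
proof (induction rule: shift_coboundaries.induct)
  case zero
  show ?case using fun_subspaceD(1)[OF real_linf_subspace] .
next
  case (add w g x)
  note V = fun_subspaceD[OF real_linf_subspace]
  show ?case
    using V(2)[OF add.IH V(2)[OF real_linf_shift[OF add.hyps(3,2)] V(3)[OF add.hyps(3), of "- 1"]]] by simp
qed

lemma shift_coboundaries_scale:
  "w \<in> shift_coboundaries G \<Longrightarrow> (\<lambda>s. c * w s) \<in> shift_coboundaries G"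
proof (induction rule: shift_coboundaries.induct)
  case zero
  show ?case using shift_coboundaries.zero[of G] by simp
next
  case (add w g x)
  have "(\<lambda>s. c * (w s + (left_shift G g x s - x s))) =
      (\<lambda>s. c * w s + (left_shift G g (\<lambda>s. c * x s) s - c * x s))"
    by (auto simp: left_shift_def algebra_simps)
  then show ?case
    using shift_coboundaries.add[OF add.IH add.hyps(2) fun_subspaceD(3)[OF real_linf_subspace add.hyps(3), of c]] by simp
qed

lemma shift_coboundaries_add:
  assumes v: "v \<in> shift_coboundaries G"
  shows "w \<in> shift_coboundaries G \<Longrightarrow> (\<lambda>s. v s + w s) \<in> shift_coboundaries G"
proof (induction rule: shift_coboundaries.induct)
  case zero
  show ?case using v by simp
next
  case (add w g x)
  show ?case using shift_coboundaries.add[OF add.IH add.hyps(2,3)] by (simp add: add.assoc)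
qed

text \<open>Variation makes sense on nonnegative functions only, hence the difference
  \<open>a - b\<close>. The order of the quantifiers is essential: \<open>S\<close> and
  \<open>K\<close> depend on \<open>w\<close> alone, so the tolerance can be chosen after
  them.\<close>

lemma shift_coboundary_decomposition:
  assumes "w \<in> shift_coboundaries G"
  shows "\<exists>S K a b. finite S \<and> S \<subseteq> carrier G \<and> 0 \<le> K \<and> a \<in> bounded_cone G \<and> b \<in> bounded_cone G \<and>
    (\<forall>s. w s = a s - b s) \<and>
    (\<forall>m e. 0 \<le> e \<longrightarrow> almost_invariant G S e m \<longrightarrow> \<bar>variation G m a - variation G m b\<bar> \<le> e * K)"
  using assms
proof (induction rule: shift_coboundaries.induct)
  case zero
  show ?case
    by (rule exI[of _ "{}"], rule exI[of _ 0], rule exI[of _ "\<lambda>_. 0"], rule exI[of _ "\<lambda>_. 0"])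
      (auto simp: bounded_cone_def)
next
  case (add w g x)
  then obtain S K a b where S: "finite S" "S \<subseteq> carrier G" and K: "0 \<le> K"
    and ab: "a \<in> bounded_cone G" "b \<in> bounded_cone G" "\<And>s. w s = a s - b s"
    and bd: "\<And>m e. \<lbrakk>0 \<le> e; almost_invariant G S e m\<rbrakk> \<Longrightarrow> \<bar>variation G m a - variation G m b\<bar> \<le> e * K"
    by blast
  obtain R where R: "\<forall>s. \<bar>x s\<bar> \<le> R" using add by (auto simp: real_linf_def)
  then have R0: "0 \<le> R" by (meson abs_ge_zero order_trans)
  \<comment> \<open>Adding the constant \<open>R\<close> makes \<open>x\<close> nonnegative and does
    not change its shift difference. It also explains the bound \<open>2 * R\<close>.\<close>
  define y where "y = (\<lambda>s. x s + R * const_one G s)"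
  have yb: "0 \<le> y s" "y s \<le> 2 * R" for s
    using R[rule_format, of s] add.hyps(3) R0 by (auto simp: y_def const_one_def real_linf_def)
  moreover have "y s = 0" if "s \<notin> carrier G" for s
    using that add.hyps(3) by (simp add: y_def const_one_def real_linf_def)
  ultimately have y: "y \<in> bounded_cone G"
    by (auto simp: bounded_cone_def)
  note sy = left_shift_cone[OF y add.hyps(2)]
  have w: "w s + (left_shift G g x s - x s) = (a s + left_shift G g y s) - (b s + y s)" for s
    using add.hyps(2,3) by (auto simp: ab(3) y_def left_shift_def const_one_def)
  have "\<bar>variation G m (\<lambda>s. a s + left_shift G g y s) - variation G m (\<lambda>s. b s + y s)\<bar> \<le> e * (K + 2 * R)"
    if e: "0 \<le> e" and m: "almost_invariant G (insert g S) e m" for m e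
  proof -
    have "almost_invariant G S e m" using m by (auto simp: almost_invariant_def)
    then have "\<bar>variation G m a - variation G m b\<bar> \<le> e * K" by (rule bd[OF e])
    moreover have "\<bar>variation G m (left_shift G g y) - variation G m y\<bar> \<le> e * (2 * R)"
      by (rule variation_shift[OF m y yb(2) _ add.hyps(2) e]) simp
    ultimately show ?thesis
      unfolding variation_add[OF m ab(1) sy] variation_add[OF m ab(2) y] by (simp add: distrib_left)
  qed
  then show ?case
    using S K R0 add.hyps(2) w bounded_cone_add[OF ab(1) sy] bounded_cone_add[OF ab(2) y]
    by (intro exI[of _ "insert g S"] exI[of _ "K + 2 * R"] exI[of _ "\<lambda>s. a s + left_shift G g y s"]
        exI[of _ "\<lambda>s. b s + y s"]) auto
qed

text \<open>If \<open>w = a - b\<close> were at most \<open>- c\<close>, then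
  \<open>a + c \<le> b\<close>, so the variations of \<open>a\<close> and \<open>b\<close> would
  differ by at least \<open>c / 2\<close>. Almost invariance allows a difference of at most
  \<open>e * K\<close>.\<close>

lemma coboundary_not_negative:
  assumes AI: "\<And>S e. \<lbrakk>finite S; S \<subseteq> carrier G; e > 0\<rbrakk> \<Longrightarrow> \<exists>m. almost_invariant G S e m"
    and w: "w \<in> shift_coboundaries G" and c: "c > 0" and neg: "\<And>s. s \<in> carrier G \<Longrightarrow> w s \<le> - c"
  shows False
proof -
  obtain S K a b where S: "finite S" "S \<subseteq> carrier G" and K: "0 \<le> K"
    and ab: "a \<in> bounded_cone G" "b \<in> bounded_cone G" "\<And>s. w s = a s - b s"
    and bd: "\<And>m e. \<lbrakk>0 \<le> e; almost_invariant G S e m\<rbrakk> \<Longrightarrow> \<bar>variation G m a - variation G m b\<bar> \<le> e * K"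
    using shift_coboundary_decomposition[OF w] by blast
  \<comment> \<open>Chosen to make \<open>e * K\<close> smaller than \<open>c / 2\<close>; the
    summand 1 covers \<open>K = 0\<close>.\<close>
  define e where "e = c / (2 * (K + 1))"
  have e: "e > 0" "e * K < c / 2" using c K by (auto simp: e_def field_simps)
  obtain m where m: "almost_invariant G S e m" using AI[OF S e(1)] by blast
  have cc: "(\<lambda>s. c * const_one G s) \<in> bounded_cone G"
    using c by (auto simp: bounded_cone_def const_one_def intro!: exI[of _ c])
  have "a s + c * const_one G s \<le> b s" for s
    using neg[of s] ab(3)[of s] ab(1,2) by (cases "s \<in> carrier G") (auto simp: const_one_def bounded_cone_def)
  then have "variation G m (\<lambda>s. a s + c * const_one G s) \<le> variation G m b"
    by (rule variation_mono[OF m bounded_cone_add[OF ab(1) cc] ab(2)])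
  then show False
    using variation_add[OF m ab(1) cc] variation_const[OF m less_imp_le[OF c]] bd[OF _ m] e by simp
qed

text \<open>The affine set of all \<open>1 + w\<close> with \<open>w\<close> a coboundary stays at
  distance at least 1 from 0: if the norm \<open>N x\<close> of \<open>x = 1 + w\<close> were below
  1, then \<open>w \<le> - (1 - N x)\<close> on the group. A separating form of norm at most 1 is
  the real part of the mean.\<close>

theorem amenable_if_almost_invariant:
  assumes AI: "\<And>S e. \<lbrakk>finite S; S \<subseteq> carrier G; e > 0\<rbrakk> \<Longrightarrow> \<exists>m. almost_invariant G S e m"
  shows "amenable_group G"
proof -
  let ?V = "real_linf G" and ?W = "shift_coboundaries G"
  note V = fun_subspaceD[OF real_linf_subspace[of G]]
  define N where "N = (\<lambda>x::'a \<Rightarrow> real. SUP s. \<bar>x s\<bar>)"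
  have bdd: "bdd_above (range (\<lambda>s. \<bar>x s\<bar>))" if x: "x \<in> ?V" for x
  proof -
    obtain K where "\<forall>s. \<bar>x s\<bar> \<le> K" using x by (auto simp: real_linf_def)
    then show ?thesis by (intro bdd_aboveI2[of _ _ K]) auto
  qed
  have Nge: "\<bar>x s\<bar> \<le> N x" if "x \<in> ?V" for x s
    unfolding N_def by (rule cSUP_upper[OF _ bdd[OF that]]) simp
  have Nle: "N x \<le> K" if "\<And>s. \<bar>x s\<bar> \<le> K" for x K
    unfolding N_def using that by (intro cSUP_least) auto
  have N_scale_le: "N (\<lambda>s. c * x s) \<le> \<bar>c\<bar> * N x" if "x \<in> ?V" for c x
    using Nge[OF that] by (intro Nle) (simp add: abs_mult mult_left_mono)
  define C where "C = {(\<lambda>s. const_one G s + w s) | w. w \<in> ?W}"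
  obtain f where f: "linear_form_on ?V f" "\<And>x. x \<in> ?V \<Longrightarrow> f x \<le> N x" "\<And>x. x \<in> C \<Longrightarrow> 1 \<le> f x"
  proof (rule separation_from_convex[OF real_linf_subspace[of G], of N C 1])
    show "N (\<lambda>s. x s + y s) \<le> N x + N y" if "x \<in> ?V" "y \<in> ?V" for x y
      using Nge[OF that(1)] Nge[OF that(2)] by (intro Nle) (meson abs_triangle_ineq add_mono order_trans)
    show "N (\<lambda>s. c * x s) = \<bar>c\<bar> * N x" if x: "x \<in> ?V" for c x
    proof (cases "c = 0")
      case True
      then show ?thesis by (simp add: N_def)
    next
      case False
      have "(\<lambda>s. inverse c * (c * x s)) = x" using False by (simp add: fun_eq_iff flip: mult.assoc)
      then have "N x \<le> \<bar>inverse c\<bar> * N (\<lambda>s. c * x s)"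
        using N_scale_le[OF V(3)[OF x], of "inverse c" c] by simp
      from mult_left_mono[OF this abs_ge_zero[of c]]
      have "\<bar>c\<bar> * N x \<le> N (\<lambda>s. c * x s)"
        using False by (simp only: abs_inverse mult.assoc[symmetric]) simp
      with N_scale_le[OF x, of c] show ?thesis by simp
    qed
    show "C \<subseteq> ?V"
      using V(2)[OF const_one_real_linf shift_coboundaries_real_linf] by (auto simp: C_def)
    show "C \<noteq> {}" using shift_coboundaries.zero[of G] by (auto simp: C_def)
    show "(\<lambda>s. (1 - t) * x s + t * y s) \<in> C" if "x \<in> C" "y \<in> C" for x y t
    proof -
      obtain v w where vw: "v \<in> ?W" "w \<in> ?W" "x = (\<lambda>s. const_one G s + v s)" "y = (\<lambda>s. const_one G s + w s)"
        using \<open>x \<in> C\<close> \<open>y \<in> C\<close> by (auto simp: C_def)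
      have "(\<lambda>s. (1 - t) * x s + t * y s) = (\<lambda>s. const_one G s + ((1 - t) * v s + t * w s))"
        by (auto simp: vw algebra_simps)
      moreover have "(\<lambda>s. (1 - t) * v s + t * w s) \<in> ?W"
        by (intro shift_coboundaries_add shift_coboundaries_scale vw)
      ultimately show ?thesis unfolding C_def mem_Collect_eq by (intro exI conjI)
    qed
    show "1 \<le> N x" if "x \<in> C" for x
    proof (rule ccontr)
      assume "\<not> 1 \<le> N x"
      obtain w where w: "w \<in> ?W" "x = (\<lambda>s. const_one G s + w s)" using \<open>x \<in> C\<close> by (auto simp: C_def)
      then have x: "x \<in> ?V" using V(2)[OF const_one_real_linf shift_coboundaries_real_linf] by auto
      have "w s \<le> - (1 - N x)" if "s \<in> carrier G" for s
        using Nge[OF x, of s] that by (simp add: w const_one_def)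
      then show False
        using coboundary_not_negative[OF AI w(1), of "1 - N x"] \<open>\<not> 1 \<le> N x\<close> by auto
    qed
  next
    fix f assume "linear_form_on ?V f" "\<And>x. x \<in> ?V \<Longrightarrow> f x \<le> N x" "\<And>x. x \<in> C \<Longrightarrow> 1 \<le> f x"
    then show thesis by (rule that)
  qed
  have f_add: "f (\<lambda>s. x s + y s) = f x + f y" if "x \<in> ?V" "y \<in> ?V" for x y
    using f(1) that by (auto simp: linear_form_on_def)
  have f_scale: "f (\<lambda>s. c * x s) = c * f x" if "x \<in> ?V" for c x
    using f(1) that by (auto simp: linear_form_on_def)
  have f_diff: "f (\<lambda>s. x s - y s) = f x - f y" if "x \<in> ?V" "y \<in> ?V" for x y
    using f_add[OF that(1) V(3)[OF that(2), of "- 1"]] f_scale[OF that(2), of "- 1"] by simp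
  have "N (const_one G) \<le> 1" by (rule Nle) (simp add: const_one_def)
  \<comment> \<open>Coboundaries can be scaled by any real \<open>t\<close> inside the separated
    set. This forces the form to vanish on them and to take the value 1 at the constant
    function.\<close>
  moreover have fC: "1 \<le> f (const_one G) + t * f w" if w: "w \<in> ?W" for w t
  proof -
    have "(\<lambda>s. const_one G s + t * w s) \<in> C"
      unfolding C_def mem_Collect_eq
      by (intro exI[of _ "\<lambda>s. t * w s"] conjI refl shift_coboundaries_scale w)
    from f(3)[OF this] show ?thesis
      using f_add[OF const_one_real_linf V(3)[OF shift_coboundaries_real_linf[OF w], of t]]
        f_scale[OF shift_coboundaries_real_linf[OF w], of t] by simp
  qed
  ultimately have f1: "f (const_one G) = 1"
    using f(2)[OF const_one_real_linf] fC[OF shift_coboundaries.zero, of 0] by simp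
  have fW: "f w = 0" if "w \<in> ?W" for w
  proof -
    have "0 \<le> t * f w" for t using fC[OF that, of t] f1 by simp
    from this[of 1] this[of "- 1"] show ?thesis by simp
  qed
  have f_shift: "f (left_shift G g x) = f x" if "g \<in> carrier G" "x \<in> ?V" for g x
    using fW[OF shift_coboundaries.add[OF shift_coboundaries.zero that]] f_diff[OF real_linf_shift[OF that(2,1)] that(2)] by simp
  have ReIm: "(\<lambda>s. Re (h s)) \<in> ?V" "(\<lambda>s. Im (h s)) \<in> ?V" if h: "h \<in> carrier (linf G)" for h
    using h linf_coordinate_le[OF h] abs_Re_le_cmod abs_Im_le_cmod
    by (auto simp: real_linf_def linf_iff intro!: exI[of _ "nrm (linf G) h"] intro: order_trans)
  \<comment> \<open>Complexification of the real form; its norm does not grow, because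
    \<open>m h\<close> can first be rotated onto the nonnegative axis, where only the real part
    counts.\<close>
  define m where "m = (\<lambda>h. Complex (f (\<lambda>s. Re (h s))) (f (\<lambda>s. Im (h s))))"
  have m_smult: "m (\<lambda>s. c * h s) = c * m h" if h: "h \<in> carrier (linf G)" for c h
    using f_add[OF V(3)[OF ReIm(1)[OF h]] V(3)[OF ReIm(2)[OF h]], of "Im c" "Re c"]
      f_diff[OF V(3)[OF ReIm(1)[OF h]] V(3)[OF ReIm(2)[OF h]], of "Re c" "Im c"]
      f_add[OF V(3)[OF ReIm(2)[OF h]] V(3)[OF ReIm(1)[OF h]], of "Re c" "Im c"]
    by (simp add: m_def complex_eq_iff f_scale[OF ReIm(1)[OF h]] f_scale[OF ReIm(2)[OF h]] add.commute)
  show ?thesis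
  proof (rule amenable_groupI[of m])
    show "m (\<lambda>s. h s + k s) = m h + m k" if "h \<in> carrier (linf G)" "k \<in> carrier (linf G)" for h k
      using f_add[OF ReIm(1)[OF that(1)] ReIm(1)[OF that(2)]] f_add[OF ReIm(2)[OF that(1)] ReIm(2)[OF that(2)]]
      by (simp add: m_def complex_eq_iff)
    show "cmod (m h) \<le> nrm (linf G) h" if h: "h \<in> carrier (linf G)" for h
    proof -
      obtain u where u: "cmod u = 1" "u * m h = complex_of_real (cmod (m h))" by (rule unit_rotation)
      have uh: "(\<lambda>s. u * h s) \<in> carrier (linf G)" by (rule linf_smult[OF h])
      have "cmod (m h) = Re (m (\<lambda>s. u * h s))" using u m_smult[OF h, of u] by simp
      also have "\<dots> = f (\<lambda>s. Re (u * h s))" by (simp add: m_def)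
      also have "\<dots> \<le> N (\<lambda>s. Re (u * h s))" by (rule f(2)[OF ReIm(1)[OF uh]])
      also have "\<dots> \<le> nrm (linf G) h"
      proof (rule Nle)
        fix s
        have "\<bar>Re (u * h s)\<bar> \<le> cmod (u * h s)" by (rule abs_Re_le_cmod)
        also have "\<dots> = cmod (h s)" using u by (simp add: norm_mult)
        finally show "\<bar>Re (u * h s)\<bar> \<le> nrm (linf G) h" using linf_coordinate_le[OF h, of s] by simp
      qed
      finally show ?thesis .
    qed
    have "(\<lambda>s. Re (const_one G s)) = const_one G" "(\<lambda>s. Im (const_one G s)) = (\<lambda>_. 0)"
      by (auto simp: const_one_def)
    then show "m (const_one G) = 1"
      using f1 fW[OF shift_coboundaries.zero] by (simp add: m_def complex_eq_iff)
    show "m (left_shift G g h) = m h" if "g \<in> carrier G" "h \<in> carrier (linf G)" for g h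
    proof -
      have "(\<lambda>s. Re (left_shift G g h s)) = left_shift G g (\<lambda>s. Re (h s))"
        "(\<lambda>s. Im (left_shift G g h s)) = left_shift G g (\<lambda>s. Im (h s))"
        by (auto simp: left_shift_def)
      then show ?thesis using f_shift[OF that(1)] ReIm[OF that(2)] by (simp add: m_def)
    qed
  qed (rule m_smult)
qed

end

section \<open>Almost invariant finitely supported probabilities\<close>

lemma linear_form_onD:
  assumes "linear_form_on V f"
  shows "\<lbrakk>x \<in> V; y \<in> V\<rbrakk> \<Longrightarrow> f (\<lambda>i. x i + y i) = f x + f y" "x \<in> V \<Longrightarrow> f (\<lambda>i. c * x i) = c * f x"
  using assms by (auto simp: linear_form_on_def)

lemma linear_form_on_sum:
  assumes V: "fun_subspace V" and f: "linear_form_on V f" and S: "finite S" and x: "\<And>g. g \<in> S \<Longrightarrow> x g \<in> V"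
  shows "(\<lambda>i. \<Sum>g\<in>S. x g i) \<in> V \<and> f (\<lambda>i. \<Sum>g\<in>S. x g i) = (\<Sum>g\<in>S. f (x g))"
  using S x
proof (induction S rule: finite_induct)
  case empty
  show ?case using linear_form_onD(2)[OF f fun_subspaceD(1)[OF V], of 0] fun_subspaceD(1)[OF V] by simp
next
  case (insert g S)
  have IH: "(\<lambda>i. \<Sum>g\<in>S. x g i) \<in> V" "f (\<lambda>i. \<Sum>g\<in>S. x g i) = (\<Sum>g\<in>S. f (x g))"
    using insert.IH insert.prems by auto
  have g: "x g \<in> V" using insert.prems by simp
  show ?case
    using linear_form_onD(1)[OF f g IH(1)] fun_subspaceD(2)[OF V g IH(1)] IH(2) insert.hyps by simp
qed

definition finite_probability :: "('g, 'b) monoid_scheme \<Rightarrow> 'g set \<Rightarrow> ('g \<Rightarrow> real) \<Rightarrow> bool" where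
  "finite_probability G F \<phi> \<longleftrightarrow> finite F \<and> F \<subseteq> carrier G \<and> (\<forall>s. 0 \<le> \<phi> s) \<and> (\<forall>s. s \<notin> F \<longrightarrow> \<phi> s = 0) \<and> sum \<phi> F = 1"

lemma finite_probability_mono:
  assumes "finite_probability G F \<phi>" "F \<subseteq> F'" "finite F'" "F' \<subseteq> carrier G"
  shows "finite_probability G F' \<phi>"
  using assms sum.mono_neutral_left[of F' F \<phi>] by (auto simp: finite_probability_def)

context group
begin

lemma mean_sum:
  assumes add: "\<And>f h. \<lbrakk>f \<in> carrier (linf G); h \<in> carrier (linf G)\<rbrakk> \<Longrightarrow> m (\<lambda>s. f s + h s) = m f + m h"
    and smult: "\<And>c f. f \<in> carrier (linf G) \<Longrightarrow> m (\<lambda>s. c * f s) = c * m f"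
    and S: "finite S" and f: "\<And>g. g \<in> S \<Longrightarrow> f g \<in> carrier (linf G)"
  shows "(\<lambda>s. \<Sum>g\<in>S. f g s) \<in> carrier (linf G) \<and> m (\<lambda>s. \<Sum>g\<in>S. f g s) = (\<Sum>g\<in>S. (m (f g) :: complex))"
  using S f
proof (induction S rule: finite_induct)
  case empty
  then show ?case using smult[OF linf_zero, of 0] linf_zero[of G] by simp
next
  case (insert g S)
  have IH: "(\<lambda>s. \<Sum>g\<in>S. f g s) \<in> carrier (linf G)" "m (\<lambda>s. \<Sum>g\<in>S. f g s) = (\<Sum>g\<in>S. m (f g))"
    using insert.IH insert.prems by auto
  have g: "f g \<in> carrier (linf G)" using insert.prems by simp
  show ?case
    using add[OF g IH(1)] linf_add[OF g IH(1)] IH(2) insert.hyps by simp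
qed

text \<open>Otherwise the tuples of differences between the \<open>g\<close>-translate of
  \<open>\<phi>\<close> and \<open>\<phi>\<close>, for \<open>g\<close> in \<open>S\<close>, form a
  convex set at \<open>\<ell>^1\<close>-distance at least \<open>e\<close> from 0. A separating form
  is a bounded function for each \<open>g\<close>; the sum of the shift differences of these
  functions has mean 0 although it is at least \<open>e\<close> everywhere. The
  \<open>\<ell>^1\<close> norm in the claim is expressed by its finite partial sums.\<close>

theorem reiter:
  assumes am: "amenable_group G" and S: "finite S" "S \<subseteq> carrier G" and e: "e > 0"
  shows "\<exists>F \<phi>. finite_probability G F \<phi> \<and>
    (\<forall>g\<in>S. \<forall>T. finite T \<longrightarrow> T \<subseteq> carrier G \<longrightarrow> (\<Sum>s\<in>T. \<bar>\<phi> (inv g \<otimes> s) - \<phi> s\<bar>) \<le> e)"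
proof (rule ccontr)
  assume contra: "\<not> ?thesis"
  have no: "\<exists>g\<in>S. \<exists>T. finite T \<and> T \<subseteq> carrier G \<and> e < (\<Sum>s\<in>T. \<bar>\<phi> (inv g \<otimes> s) - \<phi> s\<bar>)"
    if "finite_probability G F \<phi>" for F \<phi>
    using that contra by (meson not_le)
  obtain m where m: "\<And>f h. \<lbrakk>f \<in> carrier (linf G); h \<in> carrier (linf G)\<rbrakk> \<Longrightarrow> m (\<lambda>s. f s + h s) = m f + m h"
    "\<And>c f. f \<in> carrier (linf G) \<Longrightarrow> m (\<lambda>s. c * f s) = c * m f"
    "\<And>f. f \<in> carrier (linf G) \<Longrightarrow> cmod (m f) \<le> nrm (linf G) f"
    "m (const_one G) = 1"
    "\<And>g f. \<lbrakk>g \<in> carrier G; f \<in> carrier (linf G)\<rbrakk> \<Longrightarrow> m (left_shift G g f) = m f"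
    by (rule amenable_groupE[OF am]) (rule that)
  define supp where "supp = (\<lambda>x::'a \<times> 'a \<Rightarrow> real. {i. x i \<noteq> 0})"
  \<comment> \<open>One copy of the finitely supported functions for each \<open>g\<close> in
    \<open>S\<close>, so that a single separation treats all of \<open>S\<close> at once.\<close>
  define V where "V = {x::'a \<times> 'a \<Rightarrow> real. finite (supp x) \<and> supp x \<subseteq> S \<times> carrier G}"
  define N where "N = (\<lambda>x. \<Sum>i\<in>supp x. \<bar>x i\<bar>)"
  have N_eq: "N x = (\<Sum>i\<in>T. \<bar>x i\<bar>)" if "finite T" "supp x \<subseteq> T" for x T
    unfolding N_def by (rule sum.mono_neutral_left) (use that in \<open>auto simp: supp_def\<close>)
  have supp_add: "supp (\<lambda>i. x i + y i) \<subseteq> supp x \<union> supp y" for x y by (auto simp: supp_def)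
  have supp_scale: "supp (\<lambda>i. c * x i) \<subseteq> supp x" for c x by (auto simp: supp_def)
  have V: "fun_subspace V"
    unfolding fun_subspace_def
  proof (intro conjI ballI allI)
    show "(\<lambda>_. 0) \<in> V" by (simp add: V_def supp_def)
    show "(\<lambda>i. x i + y i) \<in> V" if "x \<in> V" "y \<in> V" for x y
      using that finite_subset[OF supp_add[of x y]] supp_add[of x y] by (auto simp: V_def)
    show "(\<lambda>i. c * x i) \<in> V" if "x \<in> V" for c x
      using that finite_subset[OF supp_scale[of c x]] supp_scale[of c x] by (auto simp: V_def)
  qed
  define cb where "cb = (\<lambda>\<phi> (g, s). if g \<in> S \<and> s \<in> carrier G then \<phi> (inv g \<otimes> s) - \<phi> s else (0::real))"
  have cb_V: "cb \<phi> \<in> V" if P: "finite_probability G F \<phi>" for F \<phi>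
  proof -
    let ?T = "S \<times> (F \<union> (\<lambda>(g, s). g \<otimes> s) ` (S \<times> F))"
    have "(g, s) \<in> ?T" if gs: "cb \<phi> (g, s) \<noteq> 0" for g s
    proof -
      have g: "g \<in> S" "g \<in> carrier G" "s \<in> carrier G" and ne: "\<phi> (inv g \<otimes> s) \<noteq> 0 \<or> \<phi> s \<noteq> 0"
        using gs S by (auto simp: cb_def split: if_splits)
      have "inv g \<otimes> s \<in> F \<or> s \<in> F" using ne P by (auto simp: finite_probability_def)
      moreover have "g \<otimes> (inv g \<otimes> s) = s" using g by (simp add: m_assoc[symmetric])
      ultimately show ?thesis using g by force
    qed
    then have "supp (cb \<phi>) \<subseteq> ?T" by (auto simp: supp_def)
    moreover have "finite ?T" using S P by (auto simp: finite_probability_def)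
    ultimately have "finite (supp (cb \<phi>))" by (rule finite_subset)
    then show ?thesis by (auto simp: V_def supp_def cb_def split: if_splits)
  qed
  define C where "C = {cb \<phi> | \<phi> F. finite_probability G F \<phi>}"
  define pt where "pt = (\<lambda>t s::'a. if s = t then 1 else 0 :: real)"
  have pt: "finite_probability G {t} (pt t)" if "t \<in> carrier G" for t
    using that by (auto simp: finite_probability_def pt_def)
  obtain f where f: "linear_form_on V f" "\<And>x. x \<in> V \<Longrightarrow> f x \<le> N x" "\<And>x. x \<in> C \<Longrightarrow> e \<le> f x"
  proof (rule separation_from_convex[OF V, of N C e])
    show "N (\<lambda>i. x i + y i) \<le> N x + N y" if "x \<in> V" "y \<in> V" for x y
    proof -
      let ?T = "supp x \<union> supp y"
      have T: "finite ?T" using that by (auto simp: V_def)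
      have "N (\<lambda>i. x i + y i) = (\<Sum>i\<in>?T. \<bar>x i + y i\<bar>)" by (rule N_eq[OF T supp_add])
      also have "\<dots> \<le> (\<Sum>i\<in>?T. \<bar>x i\<bar> + \<bar>y i\<bar>)" by (intro sum_mono abs_triangle_ineq)
      also have "\<dots> = N x + N y" using N_eq[OF T, of x] N_eq[OF T, of y] by (simp add: sum.distrib)
      finally show ?thesis .
    qed
    show "N (\<lambda>i. c * x i) = \<bar>c\<bar> * N x" if "x \<in> V" for c x
      using N_eq[of "supp x" "\<lambda>i. c * x i", OF _ supp_scale] that
      by (simp add: V_def N_def abs_mult sum_distrib_left)
    show "C \<subseteq> V" using cb_V by (auto simp: C_def)
    show "C \<noteq> {}" using pt[OF one_closed] by (auto simp: C_def)
    show "(\<lambda>i. (1 - t) * x i + t * y i) \<in> C" if xy: "x \<in> C" "y \<in> C" and t: "0 \<le> t" "t \<le> 1" for x y t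
    proof -
      obtain \<phi> \<psi> F F' where P: "finite_probability G F \<phi>" "finite_probability G F' \<psi>" "x = cb \<phi>" "y = cb \<psi>"
        using xy by (auto simp: C_def)
      have FF: "finite (F \<union> F')" "F \<union> F' \<subseteq> carrier G"
        using P(1,2) by (auto simp: finite_probability_def)
      note P' = finite_probability_mono[OF P(1) Un_upper1 FF] finite_probability_mono[OF P(2) Un_upper2 FF]
      have "finite_probability G (F \<union> F') (\<lambda>s. (1 - t) * \<phi> s + t * \<psi> s)"
        using P' t unfolding finite_probability_def
        by (auto simp: sum.distrib intro!: add_nonneg_nonneg) (simp flip: sum_distrib_left)
      moreover have "(\<lambda>i. (1 - t) * x i + t * y i) = cb (\<lambda>s. (1 - t) * \<phi> s + t * \<psi> s)"
        by (auto simp: P(3,4) cb_def algebra_simps)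
      ultimately show ?thesis by (auto simp: C_def)
    qed
    show "e \<le> N x" if x: "x \<in> C" for x
    proof -
      obtain \<phi> F where P: "finite_probability G F \<phi>" "x = cb \<phi>" using x by (auto simp: C_def)
      obtain g T where g: "g \<in> S" and T: "finite T" "T \<subseteq> carrier G" "e < (\<Sum>s\<in>T. \<bar>\<phi> (inv g \<otimes> s) - \<phi> s\<bar>)"
        using no[OF P(1)] by blast
      have fin: "finite (supp x)" using cb_V[OF P(1)] P(2) by (simp add: V_def)
      have "(\<Sum>s\<in>T. \<bar>\<phi> (inv g \<otimes> s) - \<phi> s\<bar>) = (\<Sum>s\<in>T. \<bar>x (g, s)\<bar>)"
        using T g by (intro sum.cong) (auto simp: P(2) cb_def)
      also have "\<dots> = (\<Sum>i\<in>Pair g ` T. \<bar>x i\<bar>)" by (simp add: sum.reindex inj_on_def)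
      also have "\<dots> \<le> (\<Sum>i\<in>supp x \<union> Pair g ` T. \<bar>x i\<bar>)" using T fin by (intro sum_mono2) auto
      also have "\<dots> = N x" using T fin by (intro N_eq[symmetric]) auto
      finally show ?thesis using T by simp
    qed
  next
    fix f assume "linear_form_on V f" "\<And>x. x \<in> V \<Longrightarrow> f x \<le> N x" "\<And>x. x \<in> C \<Longrightarrow> e \<le> f x"
    then show thesis by (rule that)
  qed
  define ind where "ind = (\<lambda>i j::'a \<times> 'a. if j = i then 1 else 0 :: real)"
  have supp_ind: "supp (ind i) = {i}" for i by (auto simp: supp_def ind_def)
  have ind_V: "ind (g, s) \<in> V" if "g \<in> S" "s \<in> carrier G" for g s
    using that by (simp add: V_def supp_ind)
  \<comment> \<open>Values of the form at unit vectors. As the form is dominated by the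
    \<open>\<ell>^1\<close> norm, they are bounded by 1 and define elements of
    \<open>linf G\<close>.\<close>
  define H where "H = (\<lambda>g s. if s \<in> carrier G then complex_of_real (f (ind (g, s))) else 0)"
  have f_bd: "\<bar>f (ind (g, s))\<bar> \<le> 1" if "g \<in> S" "s \<in> carrier G" for g s
  proof -
    have "N (ind (g, s)) = 1" by (simp add: N_def supp_ind) (simp add: ind_def)
    moreover have "N (\<lambda>i. (- 1) * ind (g, s) i) = 1"
      using N_eq[of "{(g, s)}" "\<lambda>i. (- 1) * ind (g, s) i"] supp_scale[of "- 1" "ind (g, s)"]
      by (simp add: supp_ind) (simp add: ind_def)
    moreover have "f (\<lambda>i. (- 1) * ind (g, s) i) = (- 1) * f (ind (g, s))"
      by (rule linear_form_onD(2)[OF f(1) ind_V[OF that]])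
    ultimately show ?thesis
      using f(2)[OF ind_V[OF that]] f(2)[OF fun_subspaceD(3)[OF V ind_V[OF that]], of "- 1"] by simp
  qed
  have H: "H g \<in> carrier (linf G)" if "g \<in> S" for g
    by (rule linfI[of _ _ 1]) (use f_bd[OF that] in \<open>auto simp: H_def\<close>)
  define d where "d = (\<lambda>g s. left_shift G g (H g) s + (- 1) * H g s)"
  have d: "d g \<in> carrier (linf G)" "m (d g) = 0" if "g \<in> S" for g
    using linf_add[OF left_shift_linf[OF H[OF that]] linf_smult[OF H[OF that], of "- 1"]]
      m(1)[OF left_shift_linf[OF H[OF that]] linf_smult[OF H[OF that], of "- 1"]]
      m(2)[OF H[OF that], of "- 1"] m(5)[OF _ H[OF that], of g] that S
    by (auto simp: d_def)
  define h where "h = (\<lambda>s. \<Sum>g\<in>S. d g s)"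
  have "(\<lambda>s. \<Sum>g\<in>S. d g s) \<in> carrier (linf G) \<and> m (\<lambda>s. \<Sum>g\<in>S. d g s) = (\<Sum>g\<in>S. m (d g))"
    by (rule mean_sum) (fact m(1) m(2) S(1) d(1))+
  then have h: "h \<in> carrier (linf G)" "m h = 0"
    using d(2) by (simp_all add: h_def)
  \<comment> \<open>Point masses belong to the convex set: the tuple attached to the point mass at
    \<open>t\<close> is a sum of differences of unit vectors, and the form takes the value
    \<open>h t\<close> on it.\<close>
  have h_ge: "\<exists>r\<ge>e. h t = complex_of_real r" if t: "t \<in> carrier G" for t
  proof -
    let ?x = "\<lambda>g i. ind (g, g \<otimes> t) i + (- 1) * ind (g, t) i"
    have xV: "?x g \<in> V" if "g \<in> S" for g
      using that S t by (intro fun_subspaceD(2)[OF V] fun_subspaceD(3)[OF V] ind_V) auto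
    have fx: "complex_of_real (f (?x g)) = d g t" if "g \<in> S" for g
    proof -
      have iv: "ind (g, g \<otimes> t) \<in> V" "ind (g, t) \<in> V" using that S t by (auto intro!: ind_V)
      have "f (?x g) = f (ind (g, g \<otimes> t)) + f (\<lambda>i. (- 1) * ind (g, t) i)"
        by (rule linear_form_onD(1)[OF f(1) iv(1) fun_subspaceD(3)[OF V iv(2)]])
      also have "f (\<lambda>i. (- 1) * ind (g, t) i) = (- 1) * f (ind (g, t))"
        by (rule linear_form_onD(2)[OF f(1) iv(2)])
      finally show ?thesis using that S t by (auto simp: d_def H_def left_shift_def)
    qed
    have "cb (pt t) = (\<lambda>i. \<Sum>g\<in>S. ?x g i)"
    proof
      fix i :: "'a \<times> 'a"
      obtain g s where i: "i = (g, s)" by fastforce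
      have "(\<Sum>k\<in>S. ?x k (g, s)) = (\<Sum>k\<in>S. if k = g then (if s = g \<otimes> t then 1 else 0) - (if s = t then 1 else 0) else 0)"
        by (intro sum.cong) (auto simp: ind_def)
      also have "\<dots> = (if g \<in> S then (if s = g \<otimes> t then 1 else 0) - (if s = t then 1 else 0) else 0)"
        using S by (simp add: sum.delta)
      also have "\<dots> = cb (pt t) (g, s)"
      proof (cases "g \<in> S \<and> s \<in> carrier G")
        case True
        then have "inv g \<otimes> s = t \<longleftrightarrow> s = g \<otimes> t" using S t by (metis inv_solve_left' subsetD)
        then show ?thesis using True by (simp add: cb_def pt_def)
      next
        case False
        then show ?thesis using S t by (auto simp: cb_def)
      qed
      finally show "cb (pt t) i = (\<Sum>g\<in>S. ?x g i)" by (simp add: i)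
    qed
    moreover have "cb (pt t) \<in> C" using pt[OF t] by (auto simp: C_def)
    ultimately have "e \<le> f (\<lambda>i. \<Sum>g\<in>S. ?x g i)" using f(3) by metis
    moreover have "f (\<lambda>i. \<Sum>g\<in>S. ?x g i) = (\<Sum>g\<in>S. f (?x g))"
      by (rule linear_form_on_sum[OF V f(1) S(1), THEN conjunct2]) (rule xV)
    ultimately show ?thesis
      using fx by (intro exI[of _ "\<Sum>g\<in>S. f (?x g)"]) (simp add: h_def)
  qed
  \<comment> \<open>Bound against mean, without appeal to positivity: since \<open>h\<close> takes
    values between \<open>e\<close> and \<open>K\<close>, the function \<open>h - K\<close> has norm
    at most \<open>K - e\<close>, whereas its mean is \<open>- K\<close>.\<close>
  define K where "K = nrm (linf G) h + e"
  have "0 \<le> nrm (linf G) h" using linf_coordinate_le[OF h(1), of \<one>] norm_ge_zero order_trans by blast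
  then have K: "K > 0" using e by (simp add: K_def)
  let ?k = "\<lambda>s. h s + (- complex_of_real K) * const_one G s"
  have k: "?k \<in> carrier (linf G)" by (intro linf_add h linf_smult const_one_linf)
  have "m ?k = - complex_of_real K"
    using m(1)[OF h(1) linf_smult[OF const_one_linf], of "- complex_of_real K"] m(2)[OF const_one_linf, of "- complex_of_real K"] h m(4) by simp
  moreover have "nrm (linf G) ?k \<le> K - e"
  proof (rule linf_nrm_le)
    fix s assume s: "s \<in> carrier G"
    obtain r where r: "r \<ge> e" "h s = complex_of_real r" using h_ge[OF s] by blast
    have "r \<le> nrm (linf G) h" using linf_coordinate_le[OF h(1), of s] r e by simp
    then have "r \<le> K" using e by (simp add: K_def)
    have "?k s = complex_of_real (r - K)" using s r by (simp add: const_one_def)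
    then show "cmod (?k s) \<le> K - e" using r \<open>r \<le> K\<close> by (simp only: norm_of_real)
  qed
  ultimately show False using m(3)[OF k] K e by simp
qed

end

section \<open>Derivations\<close>

lemma dual_bimodule_simps [simp]:
  "carrier (dual_bimodule X) = carrier (bounded_maps X complex_alg)"
  "zero (dual_bimodule X) = (\<lambda>_. 0)"
  "add (dual_bimodule X) f h = (\<lambda>x. f x + h x)"
  "smult (dual_bimodule X) c f = (\<lambda>x. c * f x)"
  "nrm (dual_bimodule X) = nrm (bounded_maps X complex_alg)"
  "lact (dual_bimodule X) a f = (\<lambda>x. if x \<in> carrier X then f (ract X x a) else 0)"
  "ract (dual_bimodule X) f a = (\<lambda>x. if x \<in> carrier X then f (lact X a x) else 0)"
  by (simp_all add: dual_bimodule_def normed_module.extend_def bimodule.fields_def dual_space_def)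

context complex_normed_space
begin

lemma functionals: "normed_pair X complex_alg"
  by (intro normed_pair.intro complex_normed_space_axioms complex_banach_space.axioms(1) complex_alg_banach)

lemma functionalsD:
  assumes "f \<in> carrier (bounded_maps X complex_alg)"
  shows "x \<notin> carrier X \<Longrightarrow> f x = 0"
    "\<lbrakk>x \<in> carrier X; y \<in> carrier X\<rbrakk> \<Longrightarrow> f (x \<oplus> y) = f x + f y"
    "x \<in> carrier X \<Longrightarrow> f (c \<odot> x) = c * f x"
    "x \<in> carrier X \<Longrightarrow> cmod (f x) \<le> nrm (bounded_maps X complex_alg) f * nrm X x"
  using bounded_mapsD(2-4)[OF assms] normed_pair.nrm_apply_le[OF functionals assms] by simp_all

lemma functional_comp:
  assumes f: "f \<in> carrier (bounded_maps X complex_alg)"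
    and mem: "\<And>x. x \<in> carrier X \<Longrightarrow> R x \<in> carrier X"
    and add: "\<And>x y. \<lbrakk>x \<in> carrier X; y \<in> carrier X\<rbrakk> \<Longrightarrow> R (x \<oplus> y) = R x \<oplus> R y"
    and smult: "\<And>c x. x \<in> carrier X \<Longrightarrow> R (c \<odot> x) = c \<odot> R x"
    and bound: "\<And>x. x \<in> carrier X \<Longrightarrow> nrm X (R x) \<le> K * nrm X x"
  shows "(\<lambda>x. if x \<in> carrier X then f (R x) else 0) \<in> carrier (bounded_maps X complex_alg)"
proof (rule bounded_maps_carrierI)
  note fD = functionalsD[OF f]
  fix x assume x: "x \<in> carrier X"
  have "cmod (f (R x)) \<le> nrm (bounded_maps X complex_alg) f * (K * nrm X x)"
    using fD(4)[OF mem[OF x]] mult_left_mono[OF bound[OF x] normed_pair.bounded_maps_nrm_nonneg[OF functionals f]]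
    by linarith
  then show "nrm complex_alg (if x \<in> carrier X then f (R x) else 0) \<le> (nrm (bounded_maps X complex_alg) f * K) * nrm X x"
    using x by (simp add: mult.assoc)
qed (auto simp: add smult functionalsD(2,3)[OF f] mem)

end

context banach_bimodule
begin

lemma dual_normed: "complex_normed_space (dual_bimodule X)"
proof -
  interpret F: normed_pair X complex_alg by (rule X.functionals)
  show ?thesis
    by (rule complex_normed_space_cong[OF F.bm.complex_normed_space_axioms]) (simp_all add: fun_eq_iff)
qed

lemma dual_minus:
  assumes "f \<in> carrier (bounded_maps X complex_alg)" "h \<in> carrier (bounded_maps X complex_alg)"
  shows "(f \<ominus>\<^bsub>dual_bimodule X\<^esub> h) x = f x - h x"
proof -
  interpret F: normed_pair X complex_alg by (rule X.functionals)
  have "a_minus (dual_bimodule X) = a_minus (bounded_maps X complex_alg)"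
    by (rule a_minus_cong) (simp_all add: fun_eq_iff)
  then show ?thesis using F.bounded_maps_minus_apply[OF assms] by simp
qed

lemma act_bound_pos:
  obtains K where "K > 0"
    "\<And>a x. \<lbrakk>a \<in> carrier A; x \<in> carrier X\<rbrakk> \<Longrightarrow> nrm X (lact X a x) \<le> K * nrm A a * nrm X x"
    "\<And>a x. \<lbrakk>a \<in> carrier A; x \<in> carrier X\<rbrakk> \<Longrightarrow> nrm X (ract X x a) \<le> K * nrm A a * nrm X x"
proof -
  obtain K where K: "\<forall>a\<in>carrier A. \<forall>x\<in>carrier X.
      nrm X (lact X a x) \<le> K * nrm A a * nrm X x \<and> nrm X (ract X x a) \<le> K * nrm A a * nrm X x"
    using act_bounded by blast
  have le: "K * nrm A a * nrm X x \<le> (\<bar>K\<bar> + 1) * nrm A a * nrm X x" if "a \<in> carrier A" "x \<in> carrier X" for a x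
    using A.nrm_nonneg[OF that(1)] X.nrm_nonneg[OF that(2)] by (intro mult_right_mono) auto
  show ?thesis
  proof (rule that[of "\<bar>K\<bar> + 1"])
    fix a x assume ax: "a \<in> carrier A" "x \<in> carrier X"
    show "nrm X (lact X a x) \<le> (\<bar>K\<bar> + 1) * nrm A a * nrm X x" "nrm X (ract X x a) \<le> (\<bar>K\<bar> + 1) * nrm A a * nrm X x"
      using K[rule_format, OF ax] le[OF ax] by linarith+
  qed simp
qed

lemma dual_lact:
  assumes f: "f \<in> carrier (bounded_maps X complex_alg)" and a: "a \<in> carrier A"
  shows "(\<lambda>x. if x \<in> carrier X then f (ract X x a) else 0) \<in> carrier (bounded_maps X complex_alg)"
proof -
  obtain K where K: "K > 0" "\<And>a x. \<lbrakk>a \<in> carrier A; x \<in> carrier X\<rbrakk> \<Longrightarrow> nrm X (lact X a x) \<le> K * nrm A a * nrm X x"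
    "\<And>a x. \<lbrakk>a \<in> carrier A; x \<in> carrier X\<rbrakk> \<Longrightarrow> nrm X (ract X x a) \<le> K * nrm A a * nrm X x"
    by (rule act_bound_pos) (rule that)
  show ?thesis
    by (rule X.functional_comp[OF f, where K = "K * nrm A a"]) (use a K(3) in \<open>simp_all add: ract_add_left ract_smult_left ract_closed\<close>)
qed

lemma dual_ract:
  assumes f: "f \<in> carrier (bounded_maps X complex_alg)" and a: "a \<in> carrier A"
  shows "(\<lambda>x. if x \<in> carrier X then f (lact X a x) else 0) \<in> carrier (bounded_maps X complex_alg)"
proof -
  obtain K where K: "K > 0" "\<And>a x. \<lbrakk>a \<in> carrier A; x \<in> carrier X\<rbrakk> \<Longrightarrow> nrm X (lact X a x) \<le> K * nrm A a * nrm X x"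
    "\<And>a x. \<lbrakk>a \<in> carrier A; x \<in> carrier X\<rbrakk> \<Longrightarrow> nrm X (ract X x a) \<le> K * nrm A a * nrm X x"
    by (rule act_bound_pos) (rule that)
  show ?thesis
    by (rule X.functional_comp[OF f, where K = "K * nrm A a"]) (use a K(2) in \<open>simp_all add: lact_add_right lact_smult_right lact_closed\<close>)
qed

lemma derivation_pair: "normed_pair A (dual_bimodule X)"
  by (intro normed_pair.intro dual_normed A.complex_normed_space_axioms)

lemma bounded_derivationD:
  assumes "bounded_derivation A (dual_bimodule X) D"
  shows "a \<in> carrier A \<Longrightarrow> D a \<in> carrier (bounded_maps X complex_alg)"
    "\<lbrakk>a \<in> carrier A; b \<in> carrier A\<rbrakk> \<Longrightarrow> D (a \<oplus>\<^bsub>A\<^esub> b) = (\<lambda>x. D a x + D b x)"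
    "a \<in> carrier A \<Longrightarrow> D (c \<odot>\<^bsub>A\<^esub> a) = (\<lambda>x. c * D a x)"
    "\<lbrakk>a \<in> carrier A; b \<in> carrier A; x \<in> carrier X\<rbrakk> \<Longrightarrow>
      D (a \<otimes>\<^bsub>A\<^esub> b) x = D b (ract X x a) + D a (lact X b x)"
    "\<lbrakk>a \<in> carrier A; x \<in> carrier X\<rbrakk> \<Longrightarrow>
      cmod (D a x) \<le> nrm (bounded_maps A (dual_bimodule X)) D * nrm A a * nrm X x"
proof -
  interpret P: normed_pair A "dual_bimodule X" by (rule derivation_pair)
  have D: "D \<in> carrier (bounded_maps A (dual_bimodule X))"
    and der: "\<And>a b. \<lbrakk>a \<in> carrier A; b \<in> carrier A\<rbrakk> \<Longrightarrow>
      D (a \<otimes>\<^bsub>A\<^esub> b) = lact (dual_bimodule X) a (D b) \<oplus>\<^bsub>dual_bimodule X\<^esub> ract (dual_bimodule X) (D a) b"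
    using assms by (auto simp: bounded_derivation_def)
  show mem: "a \<in> carrier A \<Longrightarrow> D a \<in> carrier (bounded_maps X complex_alg)" for a
    using bounded_mapsD(1)[OF D] by simp
  show "\<lbrakk>a \<in> carrier A; b \<in> carrier A\<rbrakk> \<Longrightarrow> D (a \<oplus>\<^bsub>A\<^esub> b) = (\<lambda>x. D a x + D b x)"
    "a \<in> carrier A \<Longrightarrow> D (c \<odot>\<^bsub>A\<^esub> a) = (\<lambda>x. c * D a x)"
    using bounded_mapsD(3,4)[OF D] by simp_all
  show "\<lbrakk>a \<in> carrier A; b \<in> carrier A; x \<in> carrier X\<rbrakk> \<Longrightarrow>
      D (a \<otimes>\<^bsub>A\<^esub> b) x = D b (ract X x a) + D a (lact X b x)"
    by (simp add: der)
  show "cmod (D a x) \<le> nrm (bounded_maps A (dual_bimodule X)) D * nrm A a * nrm X x"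
    if "a \<in> carrier A" "x \<in> carrier X"
  proof -
    have "cmod (D a x) \<le> nrm (bounded_maps X complex_alg) (D a) * nrm X x"
      by (intro X.functionalsD mem that)
    also have "\<dots> \<le> (nrm (bounded_maps A (dual_bimodule X)) D * nrm A a) * nrm X x"
      using P.nrm_apply_le[OF D that(1)] X.nrm_nonneg[OF that(2)] by (intro mult_right_mono) auto
    finally show ?thesis .
  qed
qed

lemma inner_derivationI:
  assumes D: "bounded_derivation A (dual_bimodule X) D" and z: "z \<in> carrier (bounded_maps X complex_alg)"
    and eq: "\<And>a x. \<lbrakk>a \<in> carrier A; x \<in> carrier X\<rbrakk> \<Longrightarrow> D a x = z (ract X x a) - z (lact X a x)"
  shows "inner_derivation A (dual_bimodule X) D"
  unfolding inner_derivation_def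
proof (intro conjI bexI[of _ z] ballI)
  fix a assume a: "a \<in> carrier A"
  show "D a = lact (dual_bimodule X) a z \<ominus>\<^bsub>dual_bimodule X\<^esub> ract (dual_bimodule X) z a"
  proof
    fix x
    show "D a x = (lact (dual_bimodule X) a z \<ominus>\<^bsub>dual_bimodule X\<^esub> ract (dual_bimodule X) z a) x"
      using dual_minus[OF dual_lact[OF z a] dual_ract[OF z a], of x] eq[OF a, of x]
        X.functionalsD(1)[OF bounded_derivationD(1)[OF D a], of x]
      by (cases "x \<in> carrier X") simp_all
  qed
qed (use D z in simp_all)

text \<open>
  If \<open>e\<close> is a unit of the algebra and \<open>D\<close> is inner after multiplication by \<open>e\<close>, then \<open>D\<close> is inner:
  \<open>D a - (D a) e = a (D e)\<close> is implemented by \<open>D e - (D e) e\<close>, because \<open>e (D e) e = 0\<close>.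
\<close>

lemma inner_derivation_if_unital_part_inner:
  assumes D: "bounded_derivation A (dual_bimodule X) D"
    and e: "e \<in> carrier A" "\<And>a. a \<in> carrier A \<Longrightarrow> e \<otimes>\<^bsub>A\<^esub> a = a" "\<And>a. a \<in> carrier A \<Longrightarrow> a \<otimes>\<^bsub>A\<^esub> e = a"
    and y: "y \<in> carrier (bounded_maps X complex_alg)"
    and eq: "\<And>a x. \<lbrakk>a \<in> carrier A; x \<in> carrier X\<rbrakk> \<Longrightarrow> D a (lact X e x) = y (lact X a x) - y (ract X x a)"
  shows "inner_derivation A (dual_bimodule X) D"
proof -
  interpret F: normed_pair X complex_alg by (rule X.functionals)
  note DD = bounded_derivationD[OF D]
  define w where "w = (\<lambda>x. D e x + (- 1) * (if x \<in> carrier X then D e (lact X e x) else 0))"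
  define z where "z = (\<lambda>x. w x + (- 1) * y x)"
  have "w \<in> carrier (bounded_maps X complex_alg)"
    unfolding w_def
    using F.bounded_maps_add(1)[OF DD(1)[OF e(1)] F.bounded_maps_smult(1)[OF dual_ract[OF DD(1)[OF e(1)] e(1)], of "- 1"]]
    by simp
  then have z: "z \<in> carrier (bounded_maps X complex_alg)"
    unfolding z_def using F.bounded_maps_add(1)[OF _ F.bounded_maps_smult(1)[OF y, of "- 1"]] by simp
  show ?thesis
  proof (rule inner_derivationI[OF D z])
    fix a x assume a: "a \<in> carrier A" and x: "x \<in> carrier X"
    let ?u = "lact X e (ract X x a)"
    have u: "?u \<in> carrier X" by (intro lact_closed ract_closed a e x)
    have "ract X ?u e = ?u"
      using a e x by (simp add: lact_ract ract_closed e(3) flip: ract_assoc)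
    moreover have "lact X e ?u = ?u"
      using e ract_closed[OF a x] by (simp add: e(2) flip: lact_assoc)
    ultimately have "D e ?u = D e ?u + D e ?u"
      using DD(4)[OF e(1) e(1) u] e by simp
    then have "D e ?u = 0" by simp
    then have w1: "w (ract X x a) = D e (ract X x a)"
      using ract_closed[OF a x] by (simp add: w_def)
    have "lact X e (lact X a x) = lact X a x"
      using e a x by (simp flip: lact_assoc)
    then have w2: "w (lact X a x) = 0"
      using lact_closed[OF a x] by (simp add: w_def)
    have "D a x = D e (ract X x a) + D a (lact X e x)"
      using DD(4)[OF a e(1) x] e(3)[OF a] by simp
    then show "D a x = z (ract X x a) - z (lact X a x)"
      by (simp add: z_def w1 w2 eq[OF a x])
  qed
qed

end

section \<open>Averaging a derivation over an amenable group\<close>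

context pseudofunctions
begin

lemma one_PF: "lam G p \<one> \<in> carrier A"
  "a \<in> carrier A \<Longrightarrow> lam G p \<one> \<circ> a = a" "a \<in> carrier A \<Longrightarrow> a \<circ> lam G p \<one> = a"
proof -
  show "lam G p \<one> \<in> carrier A" by simp
  show "lam G p \<one> \<circ> a = a" if "a \<in> carrier A"
    using P.bounded_maps_value[OF PF_B[OF that]] by (simp add: lam_one fun_eq_iff)
  show "a \<circ> lam G p \<one> = a" if "a \<in> carrier A"
    using bounded_mapsD(2)[OF PF_B[OF that]] P.bounded_maps_zero[OF PF_B[OF that]] by (auto simp: lam_one fun_eq_iff)
qed

text \<open>The mean of the functionals
  \<open>D (\<lambda> s) \<cdot> \<lambda> (s\<inverse>)\<close> implements \<open>D\<close> on
  translations by invariance, and then on all pseudofunctions by density. Since the unit need not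
  act as the identity on \<open>X\<close>, the average sees only \<open>D a (e x)\<close>;
  \<open>inner_derivation_if_unital_part_inner\<close> closes this gap.\<close>

theorem derivation_inner_if_amenable:
  assumes am: "amenable_group G" and bm: "banach_bimodule A X" and D: "bounded_derivation A (dual_bimodule X) D"
  shows "inner_derivation A (dual_bimodule X) D"
proof -
  interpret M: banach_bimodule A X by fact
  interpret F: normed_pair X complex_alg by (rule M.X.functionals)
  interpret DP: normed_pair A "dual_bimodule X" by (rule M.derivation_pair)
  note DD = M.bounded_derivationD[OF D, unfolded PF_simps(5)]
  note lact_assoc = M.lact_assoc[unfolded PF_simps(5)] and ract_assoc = M.ract_assoc[unfolded PF_simps(5)]
  define KD where "KD = nrm (bounded_maps A (dual_bimodule X)) D"
  have KD: "0 \<le> KD" using D unfolding KD_def by (intro DP.bounded_maps_nrm_nonneg) (simp add: bounded_derivation_def)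
  obtain K where K: "K > 0" "\<And>a x. \<lbrakk>a \<in> carrier A; x \<in> carrier X\<rbrakk> \<Longrightarrow> nrm X (lact X a x) \<le> K * nrm A a * nrm X x"
    "\<And>a x. \<lbrakk>a \<in> carrier A; x \<in> carrier X\<rbrakk> \<Longrightarrow> nrm X (ract X x a) \<le> K * nrm A a * nrm X x"
    by (rule M.act_bound_pos) (rule that)
  obtain m where m_add: "\<And>f h. \<lbrakk>f \<in> carrier (linf G); h \<in> carrier (linf G)\<rbrakk> \<Longrightarrow> m (\<lambda>s. f s + h s) = m f + m h"
    and m_smult: "\<And>c f. f \<in> carrier (linf G) \<Longrightarrow> m (\<lambda>s. c * f s) = c * m f"
    and m_bound: "\<And>f. f \<in> carrier (linf G) \<Longrightarrow> cmod (m f) \<le> nrm (linf G) f"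
    and m_one: "m (const_one G) = 1"
    and m_shift: "\<And>g f. \<lbrakk>g \<in> carrier G; f \<in> carrier (linf G)\<rbrakk> \<Longrightarrow> m (left_shift G g f) = m f"
    by (rule amenable_groupE[OF am]) (rule that)
  define f where "f = (\<lambda>x s. if s \<in> carrier G then D (lam G p s) (lact X (lam G p (inv s)) x) else 0)"
  have f_bd: "cmod (f x s) \<le> KD * K * nrm X x" if x: "x \<in> carrier X" for x s
  proof (cases "s \<in> carrier G")
    case True
    have lx: "lact X (lam G p (inv s)) x \<in> carrier X" using True x by (intro M.lact_closed) auto
    have "nrm X (lact X (lam G p (inv s)) x) \<le> K * nrm A (lam G p (inv s)) * nrm X x"
      using True x by (intro K) auto
    also have "\<dots> \<le> K * 1 * nrm X x"
      using lam_nrm[of "inv s"] True K(1) M.X.nrm_nonneg[OF x] by (intro mult_mono) (auto intro: P.bm.nrm_nonneg lam_bounded)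
    finally have l: "nrm X (lact X (lam G p (inv s)) x) \<le> K * nrm X x" by simp
    have "cmod (f x s) \<le> KD * nrm A (lam G p s) * nrm X (lact X (lam G p (inv s)) x)"
      using True DD(5)[OF lam_PF lx] by (simp add: f_def KD_def)
    also have "\<dots> \<le> KD * 1 * (K * nrm X x)"
      using l lam_nrm[OF True] True KD M.X.nrm_nonneg[OF lx]
      by (intro mult_mono mult_left_mono) (auto intro!: mult_nonneg_nonneg P.bm.nrm_nonneg lam_bounded)
    finally show ?thesis by (simp add: mult.assoc)
  next
    case False
    then show ?thesis using KD K M.X.nrm_nonneg[OF x] by (simp add: f_def)
  qed
  have f_linf: "f x \<in> carrier (linf G)" if "x \<in> carrier X" for x
    by (rule linfI[OF _ f_bd[OF that]]) (simp add: f_def)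
  define y where "y = (\<lambda>x. if x \<in> carrier X then m (f x) else 0)"
  have y: "y \<in> carrier (bounded_maps X complex_alg)"
  proof (rule bounded_maps_carrierI)
    fix x assume x: "x \<in> carrier X"
    show "nrm complex_alg (y x) \<le> (KD * K) * nrm X x"
      using order_trans[OF m_bound[OF f_linf[OF x]] linf_nrm_le[OF f_bd[OF x]]] x by (simp add: y_def)
    fix c
    have "f (c \<odot>\<^bsub>X\<^esub> x) = (\<lambda>s. c * f x s)"
    proof
      fix s
      show "f (c \<odot>\<^bsub>X\<^esub> x) s = c * f x s"
      proof (cases "s \<in> carrier G")
        case True
        then show ?thesis
          using M.X.functionalsD(3)[OF DD(1)[OF lam_PF[OF True]] M.lact_closed[OF lam_PF[OF inv_closed[OF True]] x], of c]
            M.lact_smult_right[OF lam_PF[OF inv_closed[OF True]] x, of c] by (simp add: f_def)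
      qed (simp add: f_def)
    qed
    then show "y (c \<odot>\<^bsub>X\<^esub> x) = c \<odot>\<^bsub>complex_alg\<^esub> y x"
      using m_smult[OF f_linf[OF x]] x by (simp add: y_def)
  next
    fix x x' assume x: "x \<in> carrier X" "x' \<in> carrier X"
    have "f (x \<oplus>\<^bsub>X\<^esub> x') = (\<lambda>s. f x s + f x' s)"
    proof
      fix s
      show "f (x \<oplus>\<^bsub>X\<^esub> x') s = f x s + f x' s"
      proof (cases "s \<in> carrier G")
        case True
        note l = lam_PF[OF inv_closed[OF True]]
        show ?thesis
          using True M.X.functionalsD(2)[OF DD(1)[OF lam_PF[OF True]] M.lact_closed[OF l x(1)] M.lact_closed[OF l x(2)]]
            M.lact_add_right[OF l x] by (simp add: f_def)
      qed (simp add: f_def)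
    qed
    then show "y (x \<oplus>\<^bsub>X\<^esub> x') = y x \<oplus>\<^bsub>complex_alg\<^esub> y x'"
      using m_add[OF f_linf[OF x(1)] f_linf[OF x(2)]] x by (simp add: y_def)
  qed (simp_all add: y_def)
  note yD = M.X.functionalsD[OF y]
  let ?e = "lam G p \<one>"
  \<comment> \<open>Invariance replaces \<open>s\<close> by \<open>g \<otimes> s\<close>, and the
    product rule splits \<open>D (\<lambda> g \<lambda> s)\<close>. One summand is the integrand at
    \<open>x \<lambda> g\<close>; the other is \<open>D (\<lambda> g) (e x)\<close>, constant in
    \<open>s\<close>, which the mean returns unchanged.\<close>
  have lamD: "D (lam G p g) (lact X ?e x) = y (lact X (lam G p g) x) - y (ract X x (lam G p g))"
    if g: "g \<in> carrier G" and x: "x \<in> carrier X" for g x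
  proof -
    note lg = lam_PF[OF g]
    let ?c = "D (lam G p g) (lact X ?e x)"
    have "left_shift G g (f (lact X (lam G p g) x)) = (\<lambda>s. f (ract X x (lam G p g)) s + ?c * const_one G s)"
    proof
      fix s
      show "left_shift G g (f (lact X (lam G p g) x)) s = f (ract X x (lam G p g)) s + ?c * const_one G s"
      proof (cases "s \<in> carrier G")
        case True
        note ls = lam_PF[OF True] and ls' = lam_PF[OF inv_closed[OF True]]
        let ?z = "lact X (lam G p (inv s)) x"
        have z: "?z \<in> carrier X" by (intro M.lact_closed ls' x)
        have gs: "g \<otimes> s \<in> carrier G" using g True by simp
        have "lact X (lam G p (inv (g \<otimes> s))) (lact X (lam G p g) x) = lact X (lam G p (inv (g \<otimes> s)) \<circ> lam G p g) x"
          using lact_assoc[OF lam_PF[OF inv_closed[OF gs]] lg x] by simp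
        also have "lam G p (inv (g \<otimes> s)) \<circ> lam G p g = lam G p (inv s)"
          using lam_mult[OF inv_closed[OF gs] g] g True by (simp add: inv_mult_group m_assoc)
        finally have "left_shift G g (f (lact X (lam G p g) x)) s = D (lam G p (g \<otimes> s)) ?z"
          using True gs by (simp add: left_shift_def f_def)
        also have "\<dots> = D (lam G p g \<circ> lam G p s) ?z"
          using lam_mult[OF g True] by simp
        also have "\<dots> = D (lam G p s) (ract X ?z (lam G p g)) + D (lam G p g) (lact X (lam G p s) ?z)"
          by (rule DD(4)[OF lg ls z])
        also have "ract X ?z (lam G p g) = lact X (lam G p (inv s)) (ract X x (lam G p g))"
          by (rule M.lact_ract[OF ls' lg x])
        also have "lact X (lam G p s) ?z = lact X ?e x"
          using lact_assoc[OF ls ls' x] lam_mult[OF True inv_closed[OF True]] True by simp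
        finally show ?thesis using True by (simp add: f_def const_one_def)
      qed (simp add: left_shift_def f_def const_one_def)
    qed
    then have "m (f (lact X (lam G p g) x)) = m (f (ract X x (lam G p g))) + ?c"
      using m_shift[OF g f_linf[OF M.lact_closed[OF lg x]]] m_smult[OF const_one_linf] m_one
        m_add[OF f_linf[OF M.ract_closed[OF lg x]] linf_smult[OF const_one_linf]] by simp
    then show ?thesis
      using M.lact_closed[OF lg x] M.ract_closed[OF lg x] by (simp add: y_def)
  qed
  have allD: "\<forall>x\<in>carrier X. D a (lact X ?e x) = y (lact X a x) - y (ract X x a)" if "a \<in> carrier A" for a
    using that
  proof (induction a rule: PF_induct)
    case (lam g)
    then show ?case using lamD by blast
  next
    case (add a b)
    then show ?case
      using DD(2)[OF add(1,2)] M.lact_add_left[OF add(1,2)] M.ract_add_right[OF add(1,2)]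
      by (auto simp: yD(2) M.lact_closed M.ract_closed simp del: PF_simps)
  next
    case (smult c a)
    then show ?case
      using DD(3)[OF smult(1)] M.lact_smult_left[OF smult(1)] M.ract_smult_right[OF smult(1)]
      by (auto simp: yD(3) M.lact_closed M.ract_closed right_diff_distrib simp del: PF_simps)
  next
    case (limit a)
    show ?case
    proof
      fix x assume x: "x \<in> carrier X"
      \<comment> \<open>The defect of the identity: additive in the algebra element and bounded by
        \<open>C\<close> times its norm, hence 0 at a limit of elements where it vanishes.\<close>
      define dd where "dd = (\<lambda>a. D a (lact X ?e x) - (y (lact X a x) - y (ract X x a)))"
      define ny where "ny = nrm (bounded_maps X complex_alg) y"
      have ny: "0 \<le> ny" unfolding ny_def by (rule F.bounded_maps_nrm_nonneg[OF y])
      let ?ex = "lact X ?e x"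
      have ex: "?ex \<in> carrier X" by (intro M.lact_closed one_PF x)
      define C where "C = KD * nrm X ?ex + 2 * ny * K * nrm X x + 1"
      have C: "C > 0" unfolding C_def using KD ny K M.X.nrm_nonneg[OF x] M.X.nrm_nonneg[OF ex]
        by (intro add_nonneg_pos add_nonneg_nonneg mult_nonneg_nonneg) auto
      have dd_bd: "cmod (dd b) \<le> C * nrm A b" if b: "b \<in> carrier A" for b
      proof -
        have "cmod (y (lact X b x)) \<le> ny * (K * nrm A b * nrm X x)"
          unfolding ny_def using order_trans[OF yD(4)[OF M.lact_closed[OF b x]] mult_left_mono[OF K(2)[OF b x]]] ny by (simp add: ny_def)
        moreover have "cmod (y (ract X x b)) \<le> ny * (K * nrm A b * nrm X x)"
          unfolding ny_def using order_trans[OF yD(4)[OF M.ract_closed[OF b x]] mult_left_mono[OF K(3)[OF b x]]] ny by (simp add: ny_def)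
        moreover have "cmod (D b ?ex) \<le> KD * nrm A b * nrm X ?ex"
          unfolding KD_def by (rule DD(5)[OF b ex])
        moreover have "cmod (dd b) \<le> cmod (D b ?ex) + (cmod (y (lact X b x)) + cmod (y (ract X x b)))"
          unfolding dd_def by (intro order_trans[OF norm_triangle_ineq4] add_left_mono norm_triangle_ineq4)
        ultimately show ?thesis
          using A.nrm_nonneg[OF b] by (simp add: C_def algebra_simps)
      qed
      have "cmod (dd a) \<le> 0"
      proof (rule field_le_epsilon)
        fix e :: real assume "e > 0"
        then have "e / C > 0" using C by simp
        then obtain b where b: "b \<in> carrier A" "nrm A (a \<ominus>\<^bsub>A\<^esub> b) < e / C"
          and Qb: "\<forall>x\<in>carrier X. D b (lact X ?e x) = y (lact X b x) - y (ract X x b)"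
          using limit(2) by blast
        have ab: "a \<ominus>\<^bsub>A\<^esub> b \<in> carrier A" by (rule A.minus_mem[OF limit(1) b(1)])
        have a_eq: "a = (a \<ominus>\<^bsub>A\<^esub> b) \<oplus>\<^bsub>A\<^esub> b" using A.minus_add_cancel[OF limit(1) b(1)] by metis
        have "dd a = dd (a \<ominus>\<^bsub>A\<^esub> b) + dd b"
          unfolding dd_def
          by (subst (1 2 3) a_eq) (simp add: DD(2)[OF ab b(1)] M.lact_add_left[OF ab b(1) x] M.ract_add_right[OF ab b(1) x]
            yD(2)[OF M.lact_closed[OF ab x] M.lact_closed[OF b(1) x]] yD(2)[OF M.ract_closed[OF ab x] M.ract_closed[OF b(1) x]] del: PF_simps)
        also have "dd b = 0" using Qb x by (simp add: dd_def)
        finally have "cmod (dd a) \<le> C * nrm A (a \<ominus>\<^bsub>A\<^esub> b)" using dd_bd[OF ab] by simp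
        also have "\<dots> \<le> C * (e / C)" using b(2) C by (intro mult_left_mono) auto
        finally show "cmod (dd a) \<le> 0 + e" using C by simp
      qed
      then show "D a (lact X ?e x) = y (lact X a x) - y (ract X x a)" by (simp add: dd_def)
    qed
  qed
  show ?thesis
    by (rule M.inner_derivation_if_unital_part_inner[OF D one_PF(1) _ _ y]) (use one_PF allD in auto)
qed

end

section \<open>Transport of bimodules along injections, and approximate implementation of
  derivations\<close>

definition transport_bimodule :: "('x \<Rightarrow> 'y) \<Rightarrow> ('a, 'x) bimodule \<Rightarrow> ('a, 'y) bimodule" where
  "transport_bimodule i X = (let j = inv_into UNIV i in
     \<lparr>carrier = i ` carrier X, mult = undefined, one = undefined, zero = i \<zero>\<^bsub>X\<^esub>,
      add = (\<lambda>u v. i (j u \<oplus>\<^bsub>X\<^esub> j v)), smult = (\<lambda>c u. i (c \<odot>\<^bsub>X\<^esub> j u)), nrm = (\<lambda>u. nrm X (j u)),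
      lact = (\<lambda>a u. i (lact X a (j u))), ract = (\<lambda>u a. i (ract X (j u) a))\<rparr>)"

lemma transport_bimodule_simps:
  "carrier (transport_bimodule i X) = i ` carrier X"
  "zero (transport_bimodule i X) = i \<zero>\<^bsub>X\<^esub>"
  "add (transport_bimodule i X) u v = i (inv_into UNIV i u \<oplus>\<^bsub>X\<^esub> inv_into UNIV i v)"
  "smult (transport_bimodule i X) c u = i (c \<odot>\<^bsub>X\<^esub> inv_into UNIV i u)"
  "nrm (transport_bimodule i X) u = nrm X (inv_into UNIV i u)"
  "lact (transport_bimodule i X) a u = i (lact X a (inv_into UNIV i u))"
  "ract (transport_bimodule i X) u a = i (ract X (inv_into UNIV i u) a)"
  by (simp_all add: transport_bimodule_def Let_def)

text \<open>Approximate amenability speaks only of bimodules with carrier in one given type. A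
  bimodule from elsewhere is moved there along an injection, with all operations conjugated by
  it.\<close>

lemma transport_banach_bimodule:
  fixes X :: "('a, 'x) bimodule" and i :: "'x \<Rightarrow> 'y"
  assumes i: "inj i" and X: "banach_bimodule A X"
  shows "banach_bimodule A (transport_bimodule i X)"
proof -
  interpret M: banach_bimodule A X by fact
  let ?T = "transport_bimodule i X"
  note ts = transport_bimodule_simps
  interpret T: complex_normed_space ?T
    by (rule complex_normed_spaceI)
      (auto simp: ts inv_f_f[OF i] M.X.M.a_ac M.X.smult_add_left M.X.smult_add_right M.X.smult_mult
        M.X.nrm_nonneg M.X.nrm_eq_zero M.X.nrm_smult M.X.nrm_triangle M.X.M.l_neg M.X.M.r_neg simp flip: M.X.uminus_smult)
  have minus: "i x \<ominus>\<^bsub>?T\<^esub> i y = i (x \<ominus>\<^bsub>X\<^esub> y)" if "x \<in> carrier X" "y \<in> carrier X" for x y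
    using that by (simp add: T.M.minus_eq T.uminus_smult M.X.M.minus_eq M.X.uminus_smult ts inv_f_f[OF i])
  interpret T: complex_banach_space ?T
  proof (rule T.banachI)
    fix \<sigma> assume c: "T.ncauchy \<sigma>"
    then have "\<exists>x\<in>carrier X. \<sigma> n = i x" for n by (auto simp: T.ncauchy_def ts)
    then obtain \<tau> where \<tau>: "\<And>n. \<tau> n \<in> carrier X" "\<And>n. \<sigma> n = i (\<tau> n)" by metis
    then have "M.X.ncauchy \<tau>"
      using c unfolding T.ncauchy_def M.X.ncauchy_def by (simp add: minus) (simp add: ts inv_f_f[OF i])
    then obtain x where x: "nconv X \<tau> x" by (rule M.X.ncauchy_nconv)
    have "nconv ?T \<sigma> (i x)"
      using x M.X.nconv_mem[OF x] by (simp add: nconv_def \<tau> minus) (auto simp: ts inv_f_f[OF i] \<tau>(1))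
    then show "\<exists>x. nconv ?T \<sigma> x" by (intro exI)
  qed
  show ?thesis
  proof (intro banach_bimodule.intro M.A.banach_algebra_axioms T.complex_banach_space_axioms banach_bimodule_axioms.intro)
    show "\<exists>K. \<forall>a\<in>carrier A. \<forall>x\<in>carrier ?T.
        nrm ?T (lact ?T a x) \<le> K * nrm A a * nrm ?T x \<and> nrm ?T (ract ?T x a) \<le> K * nrm A a * nrm ?T x"
      using M.act_bounded by (simp add: ts inv_f_f[OF i])
  qed (auto simp: ts inv_f_f[OF i] M.lact_closed M.ract_closed M.lact_add_left M.lact_add_right M.ract_add_left
      M.ract_add_right M.lact_smult_left M.lact_smult_right M.ract_smult_left M.ract_smult_right M.lact_assoc M.ract_assoc M.lact_ract)
qed

text \<open>Reduces a net to a single functional: far enough in the net, finitely many norm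
  conditions hold together. Finitely many elements are enough because almost invariance concerns
  finitely many translations.\<close>

lemma approximately_amenable_almost_inner:
  fixes X :: "('a, 'x) bimodule" and i :: "'x \<Rightarrow> 'y"
  assumes aa: "approximately_amenable TYPE('y) A" and i: "inj i"
    and X: "banach_bimodule A X" and D: "bounded_derivation A (dual_bimodule X) D"
    and S: "finite S" "S \<subseteq> carrier A" and \<epsilon>: "\<epsilon> > 0"
  shows "\<exists>z\<in>carrier (bounded_maps X complex_alg). \<forall>a\<in>S. \<forall>x\<in>carrier X.
    cmod (z (ract X x a) - z (lact X a x) - D a x) \<le> \<epsilon> * nrm X x"
proof -
  interpret M: banach_bimodule A X by fact
  let ?T = "transport_bimodule i X"
  interpret T: banach_bimodule A ?T by (rule transport_banach_bimodule[OF i X])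
  interpret TF: normed_pair ?T complex_alg by (rule T.X.functionals)
  interpret DT: complex_normed_space "dual_bimodule ?T" by (rule T.dual_normed)
  note ts = transport_bimodule_simps
  note DD = M.bounded_derivationD[OF D]
  define KD where "KD = nrm (bounded_maps A (dual_bimodule X)) D"
  define D' where "D' = (\<lambda>a u. if u \<in> carrier ?T then D a (inv_into UNIV i u) else 0)"
  have KD: "0 \<le> KD"
    using D normed_pair.bounded_maps_nrm_nonneg[OF M.derivation_pair] unfolding KD_def bounded_derivation_def by blast
  have Dbd: "cmod (D' a u) \<le> KD * nrm A a * nrm ?T u" if a: "a \<in> carrier A" and u: "u \<in> carrier ?T" for a u
    using u DD(5)[OF a] by (auto simp: D'_def ts inv_f_f[OF i] KD_def)
  have Dmem: "D' a \<in> carrier (bounded_maps ?T complex_alg)" if a: "a \<in> carrier A" for a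
    by (rule bounded_maps_carrierI[where K = "KD * nrm A a"])
      (use Dbd[OF a] M.X.functionalsD(2,3)[OF DD(1)[OF a]] in \<open>auto simp: D'_def ts inv_f_f[OF i]\<close>)
  have Dout: "D a = (\<lambda>_. 0)" if "a \<notin> carrier A" for a
    using D that by (auto simp: bounded_derivation_def bounded_maps_carrier_iff)
  have "D' \<in> carrier (bounded_maps A (dual_bimodule ?T))"
  proof (rule bounded_maps_carrierI[where K = KD])
    fix a assume a: "a \<in> carrier A"
    show "nrm (dual_bimodule ?T) (D' a) \<le> KD * nrm A a"
      using TF.bounded_maps_nrm_le[of "KD * nrm A a" "D' a"] Dbd[OF a] KD M.A.nrm_nonneg[OF a] by simp
  qed (auto simp: D'_def Dmem[unfolded D'_def] DD(2,3) Dout fun_eq_iff)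
  moreover have "D' (a \<otimes>\<^bsub>A\<^esub> b) = lact (dual_bimodule ?T) a (D' b) \<oplus>\<^bsub>dual_bimodule ?T\<^esub> ract (dual_bimodule ?T) (D' a) b"
    if ab: "a \<in> carrier A" "b \<in> carrier A" for a b
    using DD(4)[OF ab] M.lact_closed[OF ab(2)] M.ract_closed[OF ab(1)]
    by (auto simp: D'_def fun_eq_iff ts inv_f_f[OF i])
  ultimately have D': "bounded_derivation A (dual_bimodule ?T) D'"
    by (simp add: bounded_derivation_def)
  obtain F where F: "F \<noteq> bot" "\<forall>\<^sub>F E in F. inner_derivation A (dual_bimodule ?T) E"
    "\<And>a. a \<in> carrier A \<Longrightarrow> ((\<lambda>E. nrm (dual_bimodule ?T) (E a \<ominus>\<^bsub>dual_bimodule ?T\<^esub> D' a)) \<longlongrightarrow> 0) F"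
    using aa T.banach_bimodule_axioms D' unfolding approximately_amenable_def by blast
  have "\<forall>\<^sub>F E in F. \<forall>a\<in>S. nrm (dual_bimodule ?T) (E a \<ominus>\<^bsub>dual_bimodule ?T\<^esub> D' a) < \<epsilon>"
    using S \<epsilon> F(3) by (intro eventually_ball_finite ballI order_tendstoD(2)[where y = 0]) auto
  with F(2) have "\<forall>\<^sub>F E in F. inner_derivation A (dual_bimodule ?T) E \<and>
      (\<forall>a\<in>S. nrm (dual_bimodule ?T) (E a \<ominus>\<^bsub>dual_bimodule ?T\<^esub> D' a) < \<epsilon>)"
    by (rule eventually_conj)
  then obtain E where E: "inner_derivation A (dual_bimodule ?T) E"
    "\<And>a. a \<in> S \<Longrightarrow> nrm (dual_bimodule ?T) (E a \<ominus>\<^bsub>dual_bimodule ?T\<^esub> D' a) < \<epsilon>"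
    using eventually_happens'[OF F(1)] by blast
  then obtain z' where z': "z' \<in> carrier (bounded_maps ?T complex_alg)"
    "\<And>a. a \<in> carrier A \<Longrightarrow> E a = lact (dual_bimodule ?T) a z' \<ominus>\<^bsub>dual_bimodule ?T\<^esub> ract (dual_bimodule ?T) z' a"
    unfolding inner_derivation_def by (metis dual_bimodule_simps(1))
  have Emem: "E a \<in> carrier (bounded_maps ?T complex_alg)" if "a \<in> carrier A" for a
    using E(1) T.bounded_derivationD(1)[OF _ that] unfolding inner_derivation_def by blast
  define z where "z = (\<lambda>x. if x \<in> carrier X then z' (i x) else 0)"
  note zD = T.X.functionalsD[OF z'(1)]
  have iT: "i x \<in> carrier ?T" if "x \<in> carrier X" for x using that by (simp add: ts)
  have "z \<in> carrier (bounded_maps X complex_alg)"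
  proof (rule bounded_maps_carrierI[where K = "nrm (bounded_maps ?T complex_alg) z'"])
    show "z (x \<oplus>\<^bsub>X\<^esub> y) = z x \<oplus>\<^bsub>complex_alg\<^esub> z y" if "x \<in> carrier X" "y \<in> carrier X" for x y
      using that zD(2)[OF iT[OF that(1)] iT[OF that(2)]] by (simp add: z_def ts inv_f_f[OF i])
    show "z (c \<odot>\<^bsub>X\<^esub> x) = c \<odot>\<^bsub>complex_alg\<^esub> z x" if "x \<in> carrier X" for c x
      using that zD(3)[OF iT[OF that], of c] by (simp add: z_def ts inv_f_f[OF i])
    show "nrm complex_alg (z x) \<le> nrm (bounded_maps ?T complex_alg) z' * nrm X x" if "x \<in> carrier X" for x
      using that zD(4)[OF iT[OF that]] by (simp add: z_def ts inv_f_f[OF i])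
  qed (auto simp: z_def)
  moreover have "cmod (z (ract X x a) - z (lact X a x) - D a x) \<le> \<epsilon> * nrm X x" if a: "a \<in> S" and x: "x \<in> carrier X" for a x
  proof -
    have aA: "a \<in> carrier A" using a S by auto
    let ?d = "E a \<ominus>\<^bsub>dual_bimodule ?T\<^esub> D' a"
    have d: "?d \<in> carrier (bounded_maps ?T complex_alg)"
      using DT.minus_mem[of "E a" "D' a"] Emem[OF aA] Dmem[OF aA] by simp
    have "E a (i x) = z' (i (ract X x a)) - z' (i (lact X a x))"
      using z'(2)[OF aA] T.dual_minus[OF T.dual_lact[OF z'(1) aA] T.dual_ract[OF z'(1) aA]] x
      by (simp add: ts inv_f_f[OF i])
    moreover have "D' a (i x) = D a x" using x by (simp add: D'_def ts inv_f_f[OF i])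
    ultimately have "z (ract X x a) - z (lact X a x) - D a x = ?d (i x)"
      using T.dual_minus[OF Emem[OF aA] Dmem[OF aA]] M.ract_closed[OF aA x] M.lact_closed[OF aA x] by (simp add: z_def)
    also have "cmod \<dots> \<le> nrm (bounded_maps ?T complex_alg) ?d * nrm ?T (i x)"
      by (rule T.X.functionalsD(4)[OF d iT[OF x]])
    also have "\<dots> \<le> \<epsilon> * nrm X x"
      using E(2)[OF a] M.X.nrm_nonneg[OF x] by (simp add: ts inv_f_f[OF i] mult_right_mono)
    finally show ?thesis .
  qed
  ultimately show ?thesis by blast
qed

section \<open>Normalized bilinear forms and the derivation
  \<open>a \<otimes> e - e \<otimes> a\<close>\<close>

locale unital_banach_algebra = banach_algebra A for A :: "('a, 'm) normed_module_scheme" (structure) +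
  fixes e
  assumes e_mem: "e \<in> carrier A" and e_left: "a \<in> carrier A \<Longrightarrow> e \<otimes> a = a" and e_right: "a \<in> carrier A \<Longrightarrow> a \<otimes> e = a"
begin

text \<open>
  The bilinear forms on \<open>A\<close> that vanish on \<open>e \<otimes> A\<close>: since \<open>e \<otimes> A\<close> is a complement of the kernel of
  the product map, they are a model of its dual, and \<open>normalized_ract\<close> is the action that restriction to the
  kernel induces.
\<close>

definition normalized_forms :: "('a \<Rightarrow> 'a \<Rightarrow> complex) set" where
  "normalized_forms = {T \<in> carrier (bounded_maps A (bounded_maps A complex_alg)). \<forall>b\<in>carrier A. T e b = 0}"

definition normalized_lact :: "'a \<Rightarrow> ('a \<Rightarrow> 'a \<Rightarrow> complex) \<Rightarrow> 'a \<Rightarrow> 'a \<Rightarrow> complex" where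
  "normalized_lact c T = (\<lambda>a b. if a \<in> carrier A \<and> b \<in> carrier A then T a (b \<otimes> c) else 0)"

definition normalized_ract :: "('a \<Rightarrow> 'a \<Rightarrow> complex) \<Rightarrow> 'a \<Rightarrow> 'a \<Rightarrow> 'a \<Rightarrow> complex" where
  "normalized_ract T c = (\<lambda>a b. if a \<in> carrier A \<and> b \<in> carrier A then T (c \<otimes> a) b - T c (a \<otimes> b) else 0)"

definition normalized_module :: "('a, 'a \<Rightarrow> 'a \<Rightarrow> complex) bimodule" where
  "normalized_module =
     \<lparr>carrier = normalized_forms, mult = undefined, one = undefined,
      zero = (\<lambda>_ _. 0), add = (\<lambda>S T a b. S a b + T a b), smult = (\<lambda>c T a b. c * T a b),
      nrm = nrm (bounded_maps A (bounded_maps A complex_alg)), lact = normalized_lact, ract = normalized_ract\<rparr>"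

lemma normalized_module_simps [simp]:
  "carrier normalized_module = normalized_forms"
  "zero normalized_module = (\<lambda>_ _. 0)"
  "add normalized_module S T = (\<lambda>a b. S a b + T a b)"
  "smult normalized_module c T = (\<lambda>a b. c * T a b)"
  "nrm normalized_module = nrm (bounded_maps A (bounded_maps A complex_alg))"
  "lact normalized_module = normalized_lact"
  "ract normalized_module = normalized_ract"
  by (simp_all add: normalized_module_def)

text \<open>Bilinear forms are curried into maps from \<open>A\<close> to its dual, so their
  completeness is that of spaces of bounded maps, applied twice.\<close>

abbreviation BF where "BF \<equiv> bounded_maps A (bounded_maps A complex_alg)"

sublocale F: normed_pair A complex_alg by (rule functionals)

sublocale BF: normed_pair A "bounded_maps A complex_alg" ..

lemma formsD:
  assumes T: "T \<in> carrier BF"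
  shows "a \<notin> carrier A \<Longrightarrow> T a b = 0" "b \<notin> carrier A \<Longrightarrow> T a b = 0"
    "\<lbrakk>a \<in> carrier A; a' \<in> carrier A\<rbrakk> \<Longrightarrow> T (a \<oplus> a') b = T a b + T a' b"
    "\<lbrakk>b \<in> carrier A; b' \<in> carrier A\<rbrakk> \<Longrightarrow> T a (b \<oplus> b') = T a b + T a b'"
    "a \<in> carrier A \<Longrightarrow> T (c \<odot> a) b = c * T a b"
    "b \<in> carrier A \<Longrightarrow> T a (c \<odot> b) = c * T a b"
    "\<lbrakk>a \<in> carrier A; b \<in> carrier A\<rbrakk> \<Longrightarrow> cmod (T a b) \<le> nrm BF T * nrm A a * nrm A b"
proof -
  note V = BF.bounded_maps_value[OF T]
  show "a \<notin> carrier A \<Longrightarrow> T a b = 0" "b \<notin> carrier A \<Longrightarrow> T a b = 0"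
    "\<lbrakk>a \<in> carrier A; a' \<in> carrier A\<rbrakk> \<Longrightarrow> T (a \<oplus> a') b = T a b + T a' b"
    "a \<in> carrier A \<Longrightarrow> T (c \<odot> a) b = c * T a b"
    using bounded_mapsD(2-4)[OF T] functionalsD(1)[OF V] by simp_all
  show "\<lbrakk>b \<in> carrier A; b' \<in> carrier A\<rbrakk> \<Longrightarrow> T a (b \<oplus> b') = T a b + T a b'"
    "b \<in> carrier A \<Longrightarrow> T a (c \<odot> b) = c * T a b"
    using functionalsD(2,3)[OF V] by simp_all
  show "cmod (T a b) \<le> nrm BF T * nrm A a * nrm A b" if "a \<in> carrier A" "b \<in> carrier A"
    using functionalsD(4)[OF V that(2), of a] mult_right_mono[OF BF.nrm_apply_le[OF T that(1)] nrm_nonneg[OF that(2)]] by linarith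
qed

lemma formsI:
  assumes "\<And>a b. a \<notin> carrier A \<Longrightarrow> T a b = 0" "\<And>a b. b \<notin> carrier A \<Longrightarrow> T a b = 0"
    "\<And>a a' b. \<lbrakk>a \<in> carrier A; a' \<in> carrier A; b \<in> carrier A\<rbrakk> \<Longrightarrow> T (a \<oplus> a') b = T a b + T a' b"
    "\<And>a b b'. \<lbrakk>a \<in> carrier A; b \<in> carrier A; b' \<in> carrier A\<rbrakk> \<Longrightarrow> T a (b \<oplus> b') = T a b + T a b'"
    "\<And>c a b. \<lbrakk>a \<in> carrier A; b \<in> carrier A\<rbrakk> \<Longrightarrow> T (c \<odot> a) b = c * T a b"
    "\<And>c a b. \<lbrakk>a \<in> carrier A; b \<in> carrier A\<rbrakk> \<Longrightarrow> T a (c \<odot> b) = c * T a b"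
    "0 \<le> K" "\<And>a b. \<lbrakk>a \<in> carrier A; b \<in> carrier A\<rbrakk> \<Longrightarrow> cmod (T a b) \<le> K * nrm A a * nrm A b"
  shows "T \<in> carrier BF" "nrm BF T \<le> K"
proof -
  have m: "T a \<in> carrier (bounded_maps A complex_alg)" if "a \<in> carrier A" for a
    by (rule bounded_maps_carrierI[where K = "K * nrm A a"]) (use assms that in auto)
  have n: "nrm (bounded_maps A complex_alg) (T a) \<le> K * nrm A a" if "a \<in> carrier A" for a
    by (rule F.bounded_maps_nrm_le) (use assms(7,8) that nrm_nonneg in auto)
  have ext: "T a = T' " if "\<And>b. b \<in> carrier A \<Longrightarrow> T a b = T' b" "\<And>b. b \<notin> carrier A \<Longrightarrow> T' b = 0" for a T'
    using that assms(2) by (intro ext) metis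
  show "T \<in> carrier BF"
  proof (rule bounded_maps_carrierI[where K = K])
    show "T (x \<oplus> y) = T x \<oplus>\<^bsub>bounded_maps A complex_alg\<^esub> T y" if "x \<in> carrier A" "y \<in> carrier A" for x y
      by (rule ext) (use assms(2,3) that in auto)
    show "T (c \<odot> x) = c \<odot>\<^bsub>bounded_maps A complex_alg\<^esub> T x" if "x \<in> carrier A" for c x
      by (rule ext) (use assms(2,5) that in auto)
  qed (use assms(1) m n in auto)
  show "nrm BF T \<le> K" by (rule BF.bounded_maps_nrm_le[OF assms(7) n])
qed

lemma normalized_lact_forms:
  assumes T: "T \<in> normalized_forms" and c: "c \<in> carrier A"
  shows "normalized_lact c T \<in> normalized_forms" "nrm BF (normalized_lact c T) \<le> nrm BF T * nrm A c"
proof -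
  have TB: "T \<in> carrier BF" and Te: "\<And>b. b \<in> carrier A \<Longrightarrow> T e b = 0" using T by (auto simp: normalized_forms_def)
  note D = formsD[OF TB]
  have nn: "0 \<le> nrm BF T * nrm A c" using BF.bounded_maps_nrm_nonneg[OF TB] nrm_nonneg[OF c] by simp
  have bd: "cmod (normalized_lact c T a b) \<le> nrm BF T * nrm A c * nrm A a * nrm A b" if "a \<in> carrier A" "b \<in> carrier A" for a b
  proof -
    have "cmod (T a (b \<otimes> c)) \<le> nrm BF T * nrm A a * nrm A (b \<otimes> c)" by (intro D mult_closed that c)
    also have "\<dots> \<le> nrm BF T * nrm A a * (nrm A b * nrm A c)"
      by (intro mult_left_mono nrm_mult that c mult_nonneg_nonneg BF.bounded_maps_nrm_nonneg TB nrm_nonneg)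
    finally show ?thesis using that by (simp add: normalized_lact_def mult_ac)
  qed
  have "normalized_lact c T \<in> carrier BF \<and> nrm BF (normalized_lact c T) \<le> nrm BF T * nrm A c"
    by (intro conjI; rule formsI[OF _ _ _ _ _ _ nn bd])
      (auto simp: normalized_lact_def D(3-6) mult_closed c mult_distrib_right mult_smult_left)
  moreover have "normalized_lact c T e b = 0" if "b \<in> carrier A" for b
    using that c Te[OF mult_closed[OF that c]] by (simp add: normalized_lact_def)
  ultimately show "normalized_lact c T \<in> normalized_forms" "nrm BF (normalized_lact c T) \<le> nrm BF T * nrm A c"
    by (auto simp: normalized_forms_def)
qed

text \<open>The tensor \<open>a \<otimes> b - e \<otimes> a b\<close> is the projection of
  \<open>a \<otimes> b\<close> to the kernel of the product map; multiplied by \<open>c\<close> from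
  the left it becomes \<open>c a \<otimes> b - c \<otimes> a b\<close>. These two terms account for
  the factor 2, and they coincide for \<open>a = e\<close>.\<close>

lemma normalized_ract_forms:
  assumes T: "T \<in> normalized_forms" and c: "c \<in> carrier A"
  shows "normalized_ract T c \<in> normalized_forms" "nrm BF (normalized_ract T c) \<le> 2 * nrm BF T * nrm A c"
proof -
  have TB: "T \<in> carrier BF" using T by (auto simp: normalized_forms_def)
  note D = formsD[OF TB]
  have nn: "0 \<le> 2 * nrm BF T * nrm A c" using BF.bounded_maps_nrm_nonneg[OF TB] nrm_nonneg[OF c] by simp
  have bd: "cmod (normalized_ract T c a b) \<le> 2 * nrm BF T * nrm A c * nrm A a * nrm A b" if ab: "a \<in> carrier A" "b \<in> carrier A" for a b
  proof -
    have "cmod (T (c \<otimes> a) b) \<le> nrm BF T * nrm A (c \<otimes> a) * nrm A b" by (intro D mult_closed ab c)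
    also have "\<dots> \<le> nrm BF T * (nrm A c * nrm A a) * nrm A b"
      by (intro mult_left_mono mult_right_mono nrm_mult ab c BF.bounded_maps_nrm_nonneg TB nrm_nonneg)
    finally have 1: "cmod (T (c \<otimes> a) b) \<le> nrm BF T * (nrm A c * nrm A a) * nrm A b" .
    have "cmod (T c (a \<otimes> b)) \<le> nrm BF T * nrm A c * nrm A (a \<otimes> b)" by (intro D mult_closed ab c)
    also have "\<dots> \<le> nrm BF T * nrm A c * (nrm A a * nrm A b)"
      by (intro mult_left_mono nrm_mult ab c mult_nonneg_nonneg BF.bounded_maps_nrm_nonneg TB nrm_nonneg)
    finally have 2: "cmod (T c (a \<otimes> b)) \<le> nrm BF T * nrm A c * (nrm A a * nrm A b)" .
    show ?thesis
      using norm_triangle_ineq4[of "T (c \<otimes> a) b" "T c (a \<otimes> b)"] 1 2 ab by (simp add: normalized_ract_def mult_ac)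
  qed
  have "normalized_ract T c \<in> carrier BF \<and> nrm BF (normalized_ract T c) \<le> 2 * nrm BF T * nrm A c"
    by (intro conjI; rule formsI[OF _ _ _ _ _ _ nn bd])
      (auto simp: normalized_ract_def D(3-6) mult_closed c mult_distrib_right mult_distrib_left mult_smult_left mult_smult_right algebra_simps)
  moreover have "normalized_ract T c e b = 0" if "b \<in> carrier A" for b
    using that c by (simp add: normalized_ract_def e_mem e_left e_right)
  ultimately show "normalized_ract T c \<in> normalized_forms" "nrm BF (normalized_ract T c) \<le> 2 * nrm BF T * nrm A c"
    by (auto simp: normalized_forms_def)
qed

text \<open>Evaluation at \<open>e\<close> is continuous, so the condition that cuts out the
  normalized forms is closed.\<close>

lemma normalized_banach: "complex_banach_space normalized_module"
proof -
  interpret FB: complex_banach_space BF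
    by (intro BF.bounded_maps_banach F.bounded_maps_banach complex_alg_banach)
  have S: "complex_banach_space (BF\<lparr>carrier := normalized_forms\<rparr>)"
  proof (rule FB.closed_subspace_banach)
    fix \<sigma> T assume c: "nconv BF \<sigma> T" and m: "\<And>n. \<sigma> n \<in> normalized_forms"
    have T: "T \<in> carrier BF" using BF.bm.nconv_mem(2)[OF c] .
    have z: "\<sigma> n e = (\<lambda>_. 0)" for n
      using m[of n] formsD(2)[of "\<sigma> n"] by (auto simp: normalized_forms_def fun_eq_iff)
    have "nconv (bounded_maps A complex_alg) (\<lambda>n. \<sigma> n e) (T e)"
      by (rule BF.nconv_apply[OF c e_mem])
    moreover have "nconv (bounded_maps A complex_alg) (\<lambda>n. \<sigma> n e) (\<lambda>_. 0)"
      unfolding z using F.bm.nconv_const[OF F.bm.M.zero_closed] by simp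
    ultimately have "T e = (\<lambda>_. 0)" by (rule F.bm.nconv_unique)
    then show "T \<in> normalized_forms" using T by (simp add: normalized_forms_def)
  qed (auto simp: normalized_forms_def BF.bounded_maps_add(1)[simplified] BF.bounded_maps_smult(1)[simplified] BF.bounded_maps_zero_mem[simplified])
  show ?thesis
    by (rule complex_banach_space_cong[OF S]) (auto simp: fun_eq_iff)
qed

lemma normalized_bimodule: "banach_bimodule A normalized_module"
proof -
  have TD: "T \<in> carrier BF" if "T \<in> normalized_forms" for T using that by (auto simp: normalized_forms_def)
  show ?thesis
  proof (intro banach_bimodule.intro banach_algebra_axioms normalized_banach banach_bimodule_axioms.intro, simp_all only: normalized_module_simps)
    show "\<exists>K. \<forall>a\<in>carrier A. \<forall>x\<in>normalized_forms.
        nrm BF (normalized_lact a x) \<le> K * nrm A a * nrm BF x \<and> nrm BF (normalized_ract x a) \<le> K * nrm A a * nrm BF x"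
    proof (intro exI[of _ 2] ballI conjI)
      fix a x assume ax: "a \<in> carrier A" "x \<in> normalized_forms"
      have "0 \<le> nrm BF x * nrm A a"
        using BF.bounded_maps_nrm_nonneg[OF TD[OF ax(2)]] nrm_nonneg[OF ax(1)] by simp
      then show "nrm BF (normalized_lact a x) \<le> 2 * nrm A a * nrm BF x"
        using normalized_lact_forms(2)[OF ax(2,1)] by (simp only: mult.assoc mult.commute[of "nrm A a"])
      show "nrm BF (normalized_ract x a) \<le> 2 * nrm A a * nrm BF x"
        using normalized_ract_forms(2)[OF ax(2,1)] by (simp add: mult_ac)
    qed
  next
    fix a b T assume ab: "a \<in> carrier A" "b \<in> carrier A" and T: "T \<in> normalized_forms"
    note D = formsD[OF TD[OF T]]
    show "normalized_lact (a \<oplus> b) T = (\<lambda>x y. normalized_lact a T x y + normalized_lact b T x y)"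
      using ab by (auto simp: normalized_lact_def fun_eq_iff mult_distrib_left D(4) mult_closed)
    show "normalized_ract T (a \<oplus> b) = (\<lambda>x y. normalized_ract T a x y + normalized_ract T b x y)"
      using ab by (auto simp: normalized_ract_def fun_eq_iff mult_distrib_right D(3) mult_closed)
    show "normalized_lact (a \<otimes> b) T = normalized_lact a (normalized_lact b T)"
      using ab by (auto simp: normalized_lact_def fun_eq_iff mult_closed mult_assoc)
    \<comment> \<open>On the right, the terms \<open>T a\<close> evaluated at the product of
      \<open>b\<close>, \<open>x\<close> and \<open>y\<close> occur with opposite signs and
      cancel.\<close>
    show "normalized_ract T (a \<otimes> b) = normalized_ract (normalized_ract T a) b"
      using ab by (auto simp: normalized_ract_def fun_eq_iff mult_closed mult_assoc)
    show "normalized_ract (normalized_lact a T) b = normalized_lact a (normalized_ract T b)"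
      using ab by (auto simp: normalized_ract_def normalized_lact_def fun_eq_iff mult_closed mult_assoc)
  next
    fix a c T assume a: "a \<in> carrier A" and T: "T \<in> normalized_forms"
    note D = formsD[OF TD[OF T]]
    show "normalized_lact a T \<in> normalized_forms" "normalized_ract T a \<in> normalized_forms"
      using normalized_lact_forms(1)[OF T a] normalized_ract_forms(1)[OF T a] .
    show "normalized_lact (c \<odot> a) T = (\<lambda>x y. c * normalized_lact a T x y)"
      using a by (auto simp: normalized_lact_def fun_eq_iff mult_smult_right D(6) mult_closed)
    show "normalized_ract T (c \<odot> a) = (\<lambda>x y. c * normalized_ract T a x y)"
      using a by (auto simp: normalized_ract_def fun_eq_iff mult_smult_left D(5) mult_closed right_diff_distrib)
  qed (auto simp: normalized_lact_def normalized_ract_def fun_eq_iff algebra_simps)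
qed

text \<open>A normalized form vanishes on \<open>e \<otimes> a\<close>, so its value on
  \<open>a \<otimes> e - e \<otimes> a\<close> is just \<open>T a e\<close>. The product rule
  amounts to \<open>T (a b) e = (T (a b) e - T a b) + T a b\<close>.\<close>

lemma evaluation_derivation:
  "bounded_derivation A (dual_bimodule normalized_module)
     (\<lambda>a T. if a \<in> carrier A \<and> T \<in> normalized_forms then T a e else 0)" (is "bounded_derivation _ _ ?D")
proof -
  interpret M: banach_bimodule A normalized_module by (rule normalized_bimodule)
  interpret MF: normed_pair normalized_module complex_alg by (rule M.X.functionals)
  have TD: "T \<in> carrier BF" if "T \<in> normalized_forms" for T using that by (auto simp: normalized_forms_def)
  have bd: "cmod (?D a T) \<le> nrm A e * nrm A a * nrm BF T" if "a \<in> carrier A" "T \<in> normalized_forms" for a T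
    using formsD(7)[OF TD[OF that(2)] that(1) e_mem] that by (simp add: mult_ac)
  have mem: "?D a \<in> carrier (bounded_maps normalized_module complex_alg)" if a: "a \<in> carrier A" for a
  proof (rule bounded_maps_carrierI[where K = "nrm A e * nrm A a"])
    show "nrm complex_alg (?D a x) \<le> nrm A e * nrm A a * nrm normalized_module x" if "x \<in> carrier normalized_module" for x
      using bd[OF a, of x] that by simp
  qed (use a M.X.M.a_closed M.X.smult_mem in auto)
  have "?D \<in> carrier (bounded_maps A (dual_bimodule normalized_module))"
  proof (rule bounded_maps_carrierI[where K = "nrm A e"])
    show "?D a \<in> carrier (dual_bimodule normalized_module)" if "a \<in> carrier A" for a
      using mem[OF that] by simp
    show "nrm (dual_bimodule normalized_module) (?D a) \<le> nrm A e * nrm A a" if a: "a \<in> carrier A" for a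
      using MF.bounded_maps_nrm_le[of "nrm A e * nrm A a" "?D a"] bd[OF a] nrm_nonneg[OF a] nrm_nonneg[OF e_mem] by simp
  qed (auto simp: fun_eq_iff formsD(3,5)[OF TD])
  moreover have "?D (a \<otimes> b) = lact (dual_bimodule normalized_module) a (?D b) \<oplus>\<^bsub>dual_bimodule normalized_module\<^esub>
      ract (dual_bimodule normalized_module) (?D a) b" if ab: "a \<in> carrier A" "b \<in> carrier A" for a b
  proof
    fix T
    show "?D (a \<otimes> b) T = (lact (dual_bimodule normalized_module) a (?D b) \<oplus>\<^bsub>dual_bimodule normalized_module\<^esub>
      ract (dual_bimodule normalized_module) (?D a) b) T"
    proof (cases "T \<in> normalized_forms")
      case True
      have "normalized_ract T a b e = T (a \<otimes> b) e - T a b" "normalized_lact b T a e = T a b"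
        using ab e_mem by (simp_all add: normalized_ract_def normalized_lact_def e_left e_right)
      then show ?thesis
        using True ab mult_closed[OF ab] normalized_lact_forms(1)[OF True ab(2)] normalized_ract_forms(1)[OF True ab(1)] by simp
    qed simp
  qed
  ultimately show ?thesis by (simp add: bounded_derivation_def)
qed

lemma approximately_amenable_functional:
  fixes i :: "('a \<Rightarrow> 'a \<Rightarrow> complex) \<Rightarrow> 'y"
  assumes aa: "approximately_amenable TYPE('y) A" and i: "inj i"
    and S: "finite S" "S \<subseteq> carrier A" and \<epsilon>: "\<epsilon> > 0"
  shows "\<exists>y\<in>carrier (bounded_maps normalized_module complex_alg). \<forall>a\<in>S. \<forall>T\<in>normalized_forms.
    cmod (y (normalized_ract T a) - y (normalized_lact a T) - T a e) \<le> \<epsilon> * nrm BF T"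
proof -
  obtain y where y: "y\<in>carrier (bounded_maps normalized_module complex_alg)"
    "\<And>a T. \<lbrakk>a \<in> S; T \<in> normalized_forms\<rbrakk> \<Longrightarrow> cmod (y (normalized_ract T a) - y (normalized_lact a T) -
      (if a \<in> carrier A \<and> T \<in> normalized_forms then T a e else 0)) \<le> \<epsilon> * nrm BF T"
    using approximately_amenable_almost_inner[OF aa i normalized_bimodule evaluation_derivation S \<epsilon>] by auto
  show ?thesis
  proof (intro bexI[OF _ y(1)] ballI)
    fix a T assume "a \<in> S" "T \<in> normalized_forms"
    then show "cmod (y (normalized_ract T a) - y (normalized_lact a T) - T a e) \<le> \<epsilon> * nrm BF T"
      using y(2)[of a T] S by auto
  qed
qed

end

section \<open>Coefficient forms of bounded functions, and the invariance they encode\<close>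

context pseudofunctions
begin

sublocale U: unital_banach_algebra "PF G p" "lam G p \<one>"
  by unfold_locales (use one_PF in simp_all)

lemma delta_lp:
  assumes g: "g \<in> carrier G"
  shows "delta g \<in> carrier L" "nrm L (delta g) \<le> 1"
proof -
  have le: "(\<Sum>s\<in>F. cmod (delta g s) powr p) \<le> 1 powr p" if "finite F" for F
  proof -
    have "(\<Sum>s\<in>F. cmod (delta g s) powr p) = (\<Sum>s\<in>F. if s = g then 1 else 0)"
      by (intro sum.cong) (auto simp: delta_def)
    then show ?thesis using that by (simp add: sum.delta)
  qed
  have z: "delta g s = 0" if "s \<notin> carrier G" for s using that g by (auto simp: delta_def)
  show "delta g \<in> carrier L" "nrm L (delta g) \<le> 1"
    using lp_leI[OF p01(1) zero_le_one z le] by auto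
qed

definition right_translate :: "'g \<Rightarrow> ('g \<Rightarrow> complex) \<Rightarrow> 'g \<Rightarrow> complex" where
  "right_translate g h = (\<lambda>s. if s \<in> carrier G then h (s \<otimes> g) else 0)"

lemma right_translate_lp: "\<lbrakk>g \<in> carrier G; h \<in> carrier L\<rbrakk> \<Longrightarrow> right_translate g h \<in> carrier L"
  unfolding right_translate_def by (rule lp_reindex(1)[OF p01(1)]) (auto intro: inj_onI)

text \<open>Left and right translations commute, and commuting with a fixed bounded operator
  survives limits; the latter is checked coordinate by coordinate.\<close>

lemma PF_commutes_right_translate:
  assumes a: "a \<in> carrier A" and g: "g \<in> carrier G" and h: "h \<in> carrier L"
  shows "a (right_translate g h) = right_translate g (a h)"
  using a
proof (induction a rule: PF_induct)
  case (lam k)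
  then show ?case
    using g h right_translate_lp[OF g h] by (auto simp: lam_apply translate_def right_translate_def m_assoc fun_eq_iff)
next
  case (limit a)
  define d where "d = (\<lambda>a s. a (right_translate g h) s - right_translate g (a h) s)"
  define C where "C = nrm L (right_translate g h) + nrm L h + 1"
  have C: "C > 0" unfolding C_def by (intro add_nonneg_pos add_nonneg_nonneg lp_nrm_nonneg) simp
  have "cmod (d a s) \<le> 0" for s
  proof (rule field_le_epsilon)
    fix e :: real assume "e > 0"
    then have "e / C > 0" using C by simp
    then obtain b where b: "b \<in> carrier A" "b (right_translate g h) = right_translate g (b h)" "nrm A (a \<ominus>\<^bsub>A\<^esub> b) < e / C"
      using limit(2) by blast
    let ?c = "a \<ominus>\<^bsub>A\<^esub> b"
    have c: "?c \<in> carrier B" using PF_minus(2)[OF limit(1) b(1)] by (rule PF_B)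
    have cv: "?c k t = a k t - b k t" for k t
      using PF_minus(1)[OF limit(1) b(1)] P.bounded_maps_minus_apply[OF PF_B[OF limit(1)] PF_B[OF b(1)], of k]
        lp_minus[OF p01(2) P.bounded_maps_value[OF PF_B[OF limit(1)]] P.bounded_maps_value[OF PF_B[OF b(1)]], of k k] by simp
    have le: "cmod (?c k t) \<le> nrm B ?c * nrm L k" if "k \<in> carrier L" for k t
      using order_trans[OF lp_coordinate_le[OF p01(1) P.bounded_maps_value[OF c]] P.nrm_apply_le[OF c that]] .
    have "d a s = ?c (right_translate g h) s - right_translate g (?c h) s"
      using fun_cong[OF b(2), of s] by (auto simp: d_def cv right_translate_def)
    also have "cmod \<dots> \<le> cmod (?c (right_translate g h) s) + cmod (right_translate g (?c h) s)"
      by (rule norm_triangle_ineq4)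
    also have "\<dots> \<le> nrm B ?c * nrm L (right_translate g h) + nrm B ?c * nrm L h"
      using le[OF right_translate_lp[OF g h]] le[OF h] P.bounded_maps_nrm_nonneg[OF c]
      by (intro add_mono) (auto simp: right_translate_def)
    also have "\<dots> \<le> nrm B ?c * C"
      using P.bounded_maps_nrm_nonneg[OF c] by (simp add: C_def distrib_left)
    also have "\<dots> \<le> (e / C) * C" using b(3) C by (intro mult_right_mono) auto
    finally show "cmod (d a s) \<le> 0 + e" using C by simp
  qed
  then show ?case by (auto simp: d_def fun_eq_iff)
qed (auto simp: right_translate_def fun_eq_iff)

text \<open>
  \<open>reflected_mult f\<close> multiplies by \<open>f\<close> composed with inversion, which turns the right translations
  that commute with \<open>A\<close> into left translations of \<open>f\<close>; the coefficient form of \<open>f\<close> is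
  \<open>(a, b) \<mapsto> \<Sum>s. f s * a s * b (inv s)\<close>, with \<open>a\<close>, \<open>b\<close> identified with \<open>a (delta \<one>)\<close>, \<open>b (delta \<one>)\<close>.
\<close>

definition reflected_mult :: "('g \<Rightarrow> complex) \<Rightarrow> ('g \<Rightarrow> complex) \<Rightarrow> 'g \<Rightarrow> complex" where
  "reflected_mult f h = (\<lambda>s. f (inv s) * h s)"

definition coefficient_form :: "('g \<Rightarrow> complex) \<Rightarrow> 'g operator \<Rightarrow> 'g operator \<Rightarrow> complex" where
  "coefficient_form f a b =
     (if a \<in> carrier A \<and> b \<in> carrier A then a (reflected_mult f (b (delta \<one>))) \<one> else 0)"

lemma reflected_mult_lp:
  assumes f: "f \<in> carrier (linf G)" and h: "h \<in> carrier L"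
  shows "reflected_mult f h \<in> carrier L" "nrm L (reflected_mult f h) \<le> nrm (linf G) f * nrm L h"
  unfolding reflected_mult_def
  using linf_coordinate_le[OF f] order_trans[OF norm_ge_zero linf_coordinate_le[OF f]]
  by (auto intro!: lp_mult[OF p01(1) h])

lemma coefficient_form_BF:
  assumes f: "f \<in> carrier (linf G)"
  shows "coefficient_form f \<in> carrier U.BF" "nrm U.BF (coefficient_form f) \<le> nrm (linf G) f"
proof -
  note d = delta_lp[OF one_closed]
  have nn: "0 \<le> nrm (linf G) f" using order_trans[OF norm_ge_zero linf_coordinate_le[OF f]] .
  have bl: "b (delta \<one>) \<in> carrier L" if "b \<in> carrier A" for b
    using P.bounded_maps_value[OF PF_B[OF that]] .
  have bd: "cmod (coefficient_form f a b) \<le> nrm (linf G) f * nrm A a * nrm A b"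
    if a: "a \<in> carrier A" and b: "b \<in> carrier A" for a b
  proof -
    note r = reflected_mult_lp[OF f bl[OF b]]
    have na: "0 \<le> nrm B a" using P.bounded_maps_nrm_nonneg[OF PF_B[OF a]] .
    have nb: "0 \<le> nrm B b" using P.bounded_maps_nrm_nonneg[OF PF_B[OF b]] .
    have "nrm L (b (delta \<one>)) \<le> nrm B b"
      using P.nrm_apply_le[OF PF_B[OF b] d(1)] mult_left_mono[OF d(2) nb] by simp
    then have "nrm L (reflected_mult f (b (delta \<one>))) \<le> nrm (linf G) f * nrm B b"
      using r(2) nn by (meson mult_left_mono order_trans)
    then have "nrm B a * nrm L (reflected_mult f (b (delta \<one>))) \<le> nrm B a * (nrm (linf G) f * nrm B b)"
      using na by (rule mult_left_mono)
    moreover have "cmod (a (reflected_mult f (b (delta \<one>))) \<one>) \<le> nrm B a * nrm L (reflected_mult f (b (delta \<one>)))"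
      using order_trans[OF lp_coordinate_le[OF p01(1) P.bounded_maps_value[OF PF_B[OF a]]] P.nrm_apply_le[OF PF_B[OF a] r(1)]] .
    ultimately show ?thesis using a b by (simp add: coefficient_form_def mult_ac)
  qed
  have add: "coefficient_form f a (b \<oplus>\<^bsub>A\<^esub> b') = coefficient_form f a b + coefficient_form f a b'"
    if ab: "a \<in> carrier A" "b \<in> carrier A" "b' \<in> carrier A" for a b b'
  proof -
    have "reflected_mult f ((b \<oplus>\<^bsub>A\<^esub> b') (delta \<one>)) = reflected_mult f (b (delta \<one>)) \<oplus>\<^bsub>L\<^esub> reflected_mult f (b' (delta \<one>))"
      by (simp add: reflected_mult_def distrib_left)
    then show ?thesis
      using ab A.M.a_closed[OF ab(2,3)] bounded_mapsD(3)[OF PF_B[OF ab(1)] reflected_mult_lp(1)[OF f bl[OF ab(2)]] reflected_mult_lp(1)[OF f bl[OF ab(3)]]]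
      by (simp add: coefficient_form_def del: PF_simps; simp add: fun_eq_iff)
  qed
  have smult: "coefficient_form f a (c \<odot>\<^bsub>A\<^esub> b) = c * coefficient_form f a b"
    if ab: "a \<in> carrier A" "b \<in> carrier A" for a b c
  proof -
    have "reflected_mult f ((c \<odot>\<^bsub>A\<^esub> b) (delta \<one>)) = c \<odot>\<^bsub>L\<^esub> reflected_mult f (b (delta \<one>))"
      by (simp add: reflected_mult_def mult.left_commute)
    then show ?thesis
      using ab A.smult_mem[OF ab(2)] bounded_mapsD(4)[OF PF_B[OF ab(1)] reflected_mult_lp(1)[OF f bl[OF ab(2)]]]
      by (simp add: coefficient_form_def del: PF_simps; simp add: fun_eq_iff)
  qed
  have add': "coefficient_form f (a \<oplus>\<^bsub>A\<^esub> a') b = coefficient_form f a b + coefficient_form f a' b"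
    if "a \<in> carrier A" "a' \<in> carrier A" "b \<in> carrier A" for a a' b
    using that A.M.a_closed[OF that(1,2)] by (simp add: coefficient_form_def)
  have smult': "coefficient_form f (c \<odot>\<^bsub>A\<^esub> a) b = c * coefficient_form f a b"
    if "a \<in> carrier A" "b \<in> carrier A" for a b c
    using that A.smult_mem[OF that(1), of c] by (simp add: coefficient_form_def)
  have "coefficient_form f \<in> carrier U.BF \<and> nrm U.BF (coefficient_form f) \<le> nrm (linf G) f"
    by (intro conjI; rule U.formsI[OF _ _ add' add smult' smult nn bd]) (simp_all add: coefficient_form_def)
  then show "coefficient_form f \<in> carrier U.BF" "nrm U.BF (coefficient_form f) \<le> nrm (linf G) f" by auto
qed

lemma coefficient_form_add:
  assumes f: "f \<in> carrier (linf G)" and h: "h \<in> carrier (linf G)"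
  shows "coefficient_form (\<lambda>s. f s + h s) a b = coefficient_form f a b + coefficient_form h a b"
proof (cases "a \<in> carrier A \<and> b \<in> carrier A")
  case True
  then have bl: "b (delta \<one>) \<in> carrier L"
    using P.bounded_maps_value[OF PF_B] by blast
  have "reflected_mult (\<lambda>s. f s + h s) (b (delta \<one>)) = reflected_mult f (b (delta \<one>)) \<oplus>\<^bsub>L\<^esub> reflected_mult h (b (delta \<one>))"
    by (simp add: reflected_mult_def distrib_right)
  then show ?thesis
    using True bounded_mapsD(3)[OF PF_B reflected_mult_lp(1)[OF f bl] reflected_mult_lp(1)[OF h bl], of a]
    by (simp add: coefficient_form_def)
qed (auto simp: coefficient_form_def)

lemma coefficient_form_smult:
  assumes f: "f \<in> carrier (linf G)"
  shows "coefficient_form (\<lambda>s. c * f s) a b = c * coefficient_form f a b"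
proof (cases "a \<in> carrier A \<and> b \<in> carrier A")
  case True
  then have bl: "b (delta \<one>) \<in> carrier L"
    using P.bounded_maps_value[OF PF_B] by blast
  have "reflected_mult (\<lambda>s. c * f s) (b (delta \<one>)) = c \<odot>\<^bsub>L\<^esub> reflected_mult f (b (delta \<one>))"
    by (simp add: reflected_mult_def mult.assoc)
  then show ?thesis
    using True bounded_mapsD(4)[OF PF_B reflected_mult_lp(1)[OF f bl], of a]
    by (simp add: coefficient_form_def)
qed (auto simp: coefficient_form_def)

text \<open>For the constant function the form factors through the product. This ties the value of
  the later functionals at 1 to the image under the product map.\<close>

lemma coefficient_form_one:
  assumes "a \<in> carrier A" "b \<in> carrier A"
  shows "coefficient_form (const_one G) a b = (a \<circ> b) (delta \<one>) \<one>"
proof -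
  have "b (delta \<one>) \<in> carrier L" using P.bounded_maps_value[OF PF_B[OF assms(2)]] .
  then have "reflected_mult (const_one G) (b (delta \<one>)) = b (delta \<one>)"
    using lp_outside[of "b (delta \<one>)" G p] by (auto simp: reflected_mult_def const_one_def fun_eq_iff)
  then show ?thesis using assms by (simp add: coefficient_form_def)
qed

lemma coefficient_form_units: "coefficient_form f (lam G p \<one>) (lam G p \<one>) = f \<one>"
proof -
  have d: "delta \<one> \<in> carrier L" by (simp add: delta_lp)
  have "reflected_mult f (delta \<one>) = (\<lambda>s. f \<one> * delta \<one> s)" by (auto simp: reflected_mult_def delta_def)
  moreover have "(\<lambda>s. f \<one> * delta \<one> s) \<in> carrier L" using L.smult_mem[OF d, of "f \<one>"] by simp
  moreover have "lam G p \<one> h = h" if "h \<in> carrier L" for h using that by (simp add: lam_one)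
  ultimately show ?thesis using d one_PF(1) by (simp add: coefficient_form_def) (simp add: delta_def)
qed

text \<open>Multiplication by the shifted function is multiplication by the original one conjugated
  by a right translation. The two right translations pass through \<open>b\<close> and
  \<open>a\<close>; at the two ends, on the point mass and in the coordinate at the identity, they
  can be replaced by left translations.\<close>

lemma coefficient_form_shift:
  assumes f: "f \<in> carrier (linf G)" and a: "a \<in> carrier A" and b: "b \<in> carrier A" and g: "g \<in> carrier G"
  shows "coefficient_form (left_shift G g f) a b = coefficient_form f (lam G p g \<circ> a) (b \<circ> lam G p (inv g))"
proof -
  let ?d = "delta \<one> :: 'g \<Rightarrow> complex"
  have d: "?d \<in> carrier L" by (simp add: delta_lp)
  have bd: "b ?d \<in> carrier L" using P.bounded_maps_value[OF PF_B[OF b]] .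
  have ig: "inv g \<in> carrier G" using g by simp
  \<comment> \<open>Both translates of the point mass at the identity are the point mass at
    \<open>inv g\<close>.\<close>
  have "g \<otimes> s = \<one> \<longleftrightarrow> s \<otimes> g = \<one>" if "s \<in> carrier G" for s
    using inv_comm[of g s] inv_comm[of s g] g that by blast
  then have "lam G p (inv g) ?d = right_translate g ?d"
    unfolding lam_apply[OF ig d] using g by (auto simp: translate_def right_translate_def delta_def fun_eq_iff)
  then have bl: "b (lam G p (inv g) ?d) = right_translate g (b ?d)"
    using PF_commutes_right_translate[OF b g d] by simp
  define h where "h = reflected_mult f (right_translate g (b ?d))"
  have h: "h \<in> carrier L" unfolding h_def by (intro reflected_mult_lp f right_translate_lp g bd)
  have "right_translate (inv g) h = reflected_mult (left_shift G g f) (b ?d)"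
  proof
    fix s
    show "right_translate (inv g) h s = reflected_mult (left_shift G g f) (b ?d) s"
      using g lp_outside[OF bd, of s]
      by (cases "s \<in> carrier G") (auto simp: right_translate_def h_def reflected_mult_def left_shift_def inv_mult_group m_assoc)
  qed
  then have "a (reflected_mult (left_shift G g f) (b ?d)) \<one> = right_translate (inv g) (a h) \<one>"
    using PF_commutes_right_translate[OF a ig h] by simp
  also have "\<dots> = lam G p g (a h) \<one>"
    using g lam_apply[OF g P.bounded_maps_value[OF PF_B[OF a]]] by (simp add: right_translate_def translate_def)
  finally show ?thesis
    using a b PF_mult[OF lam_PF[OF g] a] PF_mult[OF b lam_PF[OF ig]] by (simp add: coefficient_form_def bl h_def)
qed

lemma lam_right_inv: "g \<in> carrier G \<Longrightarrow> lam G p g \<circ> lam G p (inv g) = lam G p \<one>"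
  by (simp add: lam_mult)

text \<open>If \<open>a y - y a\<close> is close to \<open>a \<otimes> e - e \<otimes> a\<close>,
  then \<open>e \<otimes> e - y\<close> almost commutes with \<open>a\<close> and has product
  exactly \<open>e\<close>, so it behaves like an approximate diagonal. The functional
  \<open>m\<close> evaluates it at coefficient forms.\<close>

theorem amenable_if_approximately_amenable:
  fixes i :: "('g operator \<Rightarrow> 'g operator \<Rightarrow> complex) \<Rightarrow> 'y"
  assumes aa: "approximately_amenable TYPE('y) A" and i: "inj i"
  shows "amenable_group G"
proof (rule amenable_if_almost_invariant)
  fix S and \<epsilon> :: real assume S: "finite S" "S \<subseteq> carrier G" and \<epsilon>: "\<epsilon> > 0"
  let ?e = "lam G p \<one>"
  let ?N = U.normalized_module
  interpret M: banach_bimodule A ?N by (rule U.normalized_bimodule)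
  interpret MF: normed_pair ?N complex_alg by (rule M.X.functionals)
  have "finite ((\<lambda>g. lam G p (inv g)) ` S)" "(\<lambda>g. lam G p (inv g)) ` S \<subseteq> carrier A"
    using S by auto
  \<comment> \<open>The tolerance anticipates \<open>nrm U.BF T \<le> 4 * nrm (linf G) f\<close>: a
    factor 2 from normalizing the form and a factor 2 from the right action.\<close>
  then obtain y where y: "y \<in> carrier (bounded_maps ?N complex_alg)"
    and app: "\<And>g T. \<lbrakk>g \<in> S; T \<in> U.normalized_forms\<rbrakk> \<Longrightarrow>
      cmod (y (U.normalized_ract T (lam G p (inv g))) - y (U.normalized_lact (lam G p (inv g)) T) - T (lam G p (inv g)) ?e) \<le> \<epsilon> / 4 * nrm U.BF T"
    using U.approximately_amenable_functional[OF aa i, of "(\<lambda>g. lam G p (inv g)) ` S" "\<epsilon> / 4"] \<epsilon> by auto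
  note yD = M.X.functionalsD[OF y, simplified]
  \<comment> \<open>The normalized form that agrees with the coefficient form on the kernel of the
    product map: its value on \<open>a \<otimes> b - e \<otimes> a b\<close>.\<close>
  define x where "x = (\<lambda>f a b. if a \<in> carrier A \<and> b \<in> carrier A
     then coefficient_form f a b - coefficient_form f ?e (a \<circ> b) else 0)"
  have x: "x f \<in> U.normalized_forms" "nrm U.BF (x f) \<le> 2 * nrm (linf G) f" if f: "f \<in> carrier (linf G)" for f
  proof -
    note D = U.formsD[OF coefficient_form_BF(1)[OF f]]
    have nn: "0 \<le> nrm (linf G) f" using order_trans[OF norm_ge_zero linf_coordinate_le[OF f]] .
    have bd: "cmod (x f a b) \<le> 2 * nrm (linf G) f * nrm A a * nrm A b" if ab: "a \<in> carrier A" "b \<in> carrier A" for a b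
    proof -
      have c: "cmod (coefficient_form f a b) \<le> nrm (linf G) f * nrm A a * nrm A b" if "a \<in> carrier A" "b \<in> carrier A" for a b
        using order_trans[OF D(7)[OF that]] coefficient_form_BF(2)[OF f] A.nrm_nonneg[OF that(1)] A.nrm_nonneg[OF that(2)]
        by (meson mult_right_mono)
      have "cmod (coefficient_form f ?e (a \<circ> b)) \<le> nrm (linf G) f * nrm A ?e * nrm A (a \<circ> b)"
        by (intro c PF_mult ab one_PF)
      also have "\<dots> \<le> nrm (linf G) f * 1 * (nrm A a * nrm A b)"
        using A.nrm_mult[OF ab] lam_nrm[OF one_closed] nn A.nrm_nonneg[OF PF_mult[OF ab]] A.nrm_nonneg[OF one_PF(1)]
        by (intro mult_mono mult_left_mono mult_nonneg_nonneg) auto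
      finally show ?thesis
        using c[OF ab] norm_triangle_ineq4[of "coefficient_form f a b" "coefficient_form f ?e (a \<circ> b)"] ab
        by (simp add: x_def mult_ac)
    qed
    have nn2: "0 \<le> 2 * nrm (linf G) f" using nn by simp
    have cl: "a \<circ> b \<in> carrier A" if "a \<in> carrier A" "b \<in> carrier A" for a b using PF_mult that .
    have ds: "(a \<oplus>\<^bsub>A\<^esub> a') \<circ> b = (a \<circ> b) \<oplus>\<^bsub>A\<^esub> (a' \<circ> b)" "b \<circ> (a \<oplus>\<^bsub>A\<^esub> a') = (b \<circ> a) \<oplus>\<^bsub>A\<^esub> (b \<circ> a')"
       "(c \<odot>\<^bsub>A\<^esub> a) \<circ> b = c \<odot>\<^bsub>A\<^esub> (a \<circ> b)" "b \<circ> (c \<odot>\<^bsub>A\<^esub> a) = c \<odot>\<^bsub>A\<^esub> (b \<circ> a)"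
      if "a \<in> carrier A" "a' \<in> carrier A" "b \<in> carrier A" for a a' b c
      using A.mult_distrib_right[OF that] A.mult_distrib_left[OF that(3,1,2)] A.mult_smult_left[OF that(1,3)] A.mult_smult_right[OF that(3,1)]
      by (simp_all only: PF_simps(5))
    have "x f \<in> carrier U.BF \<and> nrm U.BF (x f) \<le> 2 * nrm (linf G) f"
      by (intro conjI; rule U.formsI[OF _ _ _ _ _ _ nn2 bd])
        (simp_all add: x_def ds cl D(3-6) A.M.a_closed A.smult_mem right_diff_distrib del: PF_simps)
    moreover have "x f ?e b = 0" if "b \<in> carrier A" for b
      using that one_PF by (simp add: x_def)
    ultimately show "x f \<in> U.normalized_forms" "nrm U.BF (x f) \<le> 2 * nrm (linf G) f"
      by (auto simp: U.normalized_forms_def)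
  qed
  have x_add: "x (\<lambda>s. f s + h s) = (\<lambda>a b. x f a b + x h a b)" if "f \<in> carrier (linf G)" "h \<in> carrier (linf G)" for f h
    using coefficient_form_add[OF that] by (auto simp: x_def fun_eq_iff)
  have x_smult: "x (\<lambda>s. c * f s) = (\<lambda>a b. c * x f a b)" if "f \<in> carrier (linf G)" for f c
    using coefficient_form_smult[OF that] by (auto simp: x_def fun_eq_iff right_diff_distrib)
  \<comment> \<open>The value \<open>f \<one>\<close> is that of the coefficient form on
    \<open>e \<otimes> e\<close>.\<close>
  define m where "m = (\<lambda>f. f \<one> - y (x f))"
  define Ny where "Ny = nrm (bounded_maps ?N complex_alg) y"
  have Ny: "0 \<le> Ny" unfolding Ny_def by (rule MF.bounded_maps_nrm_nonneg[OF y])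
  have "almost_invariant G S \<epsilon> m"
    unfolding almost_invariant_def
  proof (intro conjI ballI allI)
    show "m (\<lambda>s. f s + h s) = m f + m h" if "f \<in> carrier (linf G)" "h \<in> carrier (linf G)" for f h
      using yD(2)[OF x(1)[OF that(1)] x(1)[OF that(2)]] by (simp add: m_def x_add[OF that])
    show "m (\<lambda>s. c * f s) = c * m f" if "f \<in> carrier (linf G)" for c f
      using yD(3)[OF x(1)[OF that], of c] by (simp add: m_def x_smult[OF that] right_diff_distrib)
    show "\<exists>K\<ge>0. \<forall>f\<in>carrier (linf G). cmod (m f) \<le> K * nrm (linf G) f"
    proof (intro exI[of _ "1 + Ny * 2"] conjI ballI)
      fix f assume f: "f \<in> carrier (linf G)"
      have "cmod (y (x f)) \<le> Ny * (2 * nrm (linf G) f)"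
        unfolding Ny_def using order_trans[OF yD(4)[OF x(1)[OF f]] mult_left_mono[OF x(2)[OF f]]] Ny by (simp add: Ny_def)
      then show "cmod (m f) \<le> (1 + Ny * 2) * nrm (linf G) f"
        using norm_triangle_ineq4[of "f \<one>" "y (x f)"] linf_coordinate_le[OF f, of \<one>] by (simp add: m_def algebra_simps)
    qed (use Ny in simp)
    \<comment> \<open>The form of the constant function factors through the product and so vanishes
      on its kernel.\<close>
    have "x (const_one G) = (\<lambda>_ _. 0)"
      using one_PF PF_mult by (auto simp: x_def fun_eq_iff coefficient_form_one)
    then have "y (x (const_one G)) = 0"
      using MF.bounded_maps_zero[OF y] by simp
    then show "1 / 2 \<le> cmod (m (const_one G))" by (simp add: m_def const_one_def)
    fix g f assume g': "g \<in> S" and f: "f \<in> carrier (linf G)"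
    have g: "g \<in> carrier G" using g' S by auto
    let ?g = "lam G p g" and ?g' = "lam G p (inv g)"
    have lg: "?g \<in> carrier A" "?g' \<in> carrier A" using g by auto
    \<comment> \<open>Acting with \<open>g\<close> in advance makes the commutator with
      \<open>inv g\<close> produce exactly the two forms to be compared: from the right it returns
      \<open>x f\<close>, from the left it gives \<open>x\<close> of the shifted function.\<close>
    define T where "T = U.normalized_ract (x f) ?g"
    have T: "T \<in> U.normalized_forms" "nrm U.BF T \<le> 4 * nrm (linf G) f"
    proof -
      show "T \<in> U.normalized_forms" unfolding T_def by (rule U.normalized_ract_forms[OF x(1)[OF f] lg(1)])
      have nx: "0 \<le> nrm U.BF (x f)" using M.X.nrm_nonneg[of "x f"] x(1)[OF f] by simp
      have "nrm U.BF T \<le> 2 * nrm U.BF (x f) * nrm A ?g" unfolding T_def by (rule U.normalized_ract_forms[OF x(1)[OF f] lg(1)])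
      also have "\<dots> \<le> 2 * nrm U.BF (x f) * 1" using lam_nrm[OF g] nx by (intro mult_left_mono) auto
      finally show "nrm U.BF T \<le> 4 * nrm (linf G) f" using x(2)[OF f] by simp
    qed
    have xf: "x f \<in> carrier U.BF" using x(1)[OF f] by (simp add: U.normalized_forms_def)
    have "U.normalized_ract T ?g' = U.normalized_ract (x f) (?g \<circ> ?g')"
      using M.ract_assoc[OF lg, of "x f"] x(1)[OF f] by (simp add: T_def)
    also have "\<dots> = x f"
    proof (intro ext)
      fix a b
      show "U.normalized_ract (x f) (?g \<circ> ?g') a b = x f a b"
        using one_PF PF_mult[of a b] U.formsD(1,2)[OF xf] by (auto simp: lam_right_inv[OF g] U.normalized_ract_def x_def)
    qed
    finally have ract_T: "U.normalized_ract T ?g' = x f" .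
    have lact_T: "U.normalized_lact ?g' T = x (left_shift G g f)"
    proof (intro ext)
      fix a b
      show "U.normalized_lact ?g' T a b = x (left_shift G g f) a b"
      proof (cases "a \<in> carrier A \<and> b \<in> carrier A")
        case True
        then have ab: "a \<in> carrier A" "b \<in> carrier A" by auto
        note cl = PF_mult[OF lg(1) ab(1)] PF_mult[OF ab(2) lg(2)] PF_mult[OF ab] PF_mult[OF ab(1) PF_mult[OF ab(2) lg(2)]]
        have "U.normalized_lact ?g' T a b = x f (?g \<circ> a) (b \<circ> ?g') - x f ?g (a \<circ> (b \<circ> ?g'))"
          using ab cl by (simp add: U.normalized_lact_def T_def U.normalized_ract_def)
        also have "\<dots> = coefficient_form f (?g \<circ> a) (b \<circ> ?g') - coefficient_form f ?g (a \<circ> (b \<circ> ?g'))"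
          using ab cl lg by (simp add: x_def o_assoc)
        also have "coefficient_form f ?g (a \<circ> (b \<circ> ?g')) = coefficient_form f (?g \<circ> ?e) ((a \<circ> b) \<circ> ?g')"
          using one_PF(3)[OF lg(1)] by (simp add: o_assoc)
        finally have "U.normalized_lact ?g' T a b =
            coefficient_form (left_shift G g f) a b - coefficient_form (left_shift G g f) ?e (a \<circ> b)"
          by (simp only: coefficient_form_shift[OF f ab g] coefficient_form_shift[OF f one_PF(1) cl(3) g])
        then show ?thesis
          using ab by (simp only: x_def) simp
      qed (auto simp: U.normalized_lact_def x_def)
    qed
    have "T ?g' ?e = x f (?g \<circ> ?g') ?e - x f ?g (?g' \<circ> ?e)"
      using lg one_PF(1) by (simp add: T_def U.normalized_ract_def)
    also have "x f (?g \<circ> ?g') ?e = 0"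
      using x(1)[OF f] one_PF(1) by (simp add: lam_right_inv[OF g] U.normalized_forms_def)
    also have "x f ?g (?g' \<circ> ?e) = coefficient_form f ?g ?g' - coefficient_form f ?e ?e"
      using lg one_PF by (simp add: x_def lam_right_inv[OF g])
    also have "coefficient_form f ?g ?g' = coefficient_form (left_shift G g f) ?e ?e"
      using coefficient_form_shift[OF f one_PF(1) one_PF(1) g] one_PF lg by simp
    finally have "T ?g' ?e = f \<one> - left_shift G g f \<one>" by (simp add: coefficient_form_units)
    then have "m (left_shift G g f) - m f = y (U.normalized_ract T ?g') - y (U.normalized_lact ?g' T) - T ?g' ?e"
      by (simp add: m_def ract_T lact_T)
    also have "cmod \<dots> \<le> \<epsilon> / 4 * nrm U.BF T" by (rule app[OF g' T(1)])
    also have "\<dots> \<le> \<epsilon> / 4 * (4 * nrm (linf G) f)" using T(2) \<epsilon> by (intro mult_left_mono) auto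
    finally show "cmod (m (left_shift G g f) - m f) \<le> \<epsilon> * nrm (linf G) f" by simp
  qed
  then show "\<exists>m. almost_invariant G S \<epsilon> m" by (intro exI)
qed

end

section \<open>Projective tensor squares\<close>

lemma projective_tensor_simps:
  "carrier (projective_tensor X Y) = {tensor_series X Y x y | x y. (x, y) \<in> tensor_sequences X Y}"
  "zero (projective_tensor X Y) = (\<lambda>_. 0)"
  "add (projective_tensor X Y) u v = (\<lambda>\<phi>. u \<phi> + v \<phi>)"
  "smult (projective_tensor X Y) c u = (\<lambda>\<phi>. c * u \<phi>)"
  "nrm (projective_tensor X Y) u = Inf {(\<Sum>n. nrm X (x n) * nrm Y (y n)) | x y.
        (x, y) \<in> tensor_sequences X Y \<and> tensor_series X Y x y = u}"
  by (simp_all add: projective_tensor_def)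

lemma sums_if_complex:
  fixes f g :: "nat \<Rightarrow> complex"
  assumes "g sums x" "f sums y"
  shows "(\<lambda>n. if even n then f (n div 2) else g ((n - 1) div 2)) sums (x + y)"
proof -
  have re: "(\<lambda>n. Re (if even n then f (n div 2) else g ((n - 1) div 2))) =
      (\<lambda>n. if even n then Re (f (n div 2)) else Re (g ((n - 1) div 2)))"
    and im: "(\<lambda>n. Im (if even n then f (n div 2) else g ((n - 1) div 2))) =
      (\<lambda>n. if even n then Im (f (n div 2)) else Im (g ((n - 1) div 2)))"
    by auto
  show ?thesis
    using assms sums_if[of "\<lambda>n. Re (g n)" "Re x" "\<lambda>n. Re (f n)" "Re y"]
      sums_if[of "\<lambda>n. Im (g n)" "Im x" "\<lambda>n. Im (f n)" "Im y"]
    unfolding sums_complex_iff re im by simp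
qed

context normed_pair
begin

abbreviation PT where "PT \<equiv> projective_tensor X Y"
abbreviation forms where "forms \<equiv> bounded_bilinear_forms X Y"

lemma bilinearD:
  assumes "\<phi> \<in> forms"
  shows "\<lbrakk>x \<in> carrier X; x' \<in> carrier X; y \<in> carrier Y\<rbrakk> \<Longrightarrow> \<phi> (x \<oplus>\<^bsub>X\<^esub> x') y = \<phi> x y + \<phi> x' y"
    "\<lbrakk>x \<in> carrier X; y \<in> carrier Y; y' \<in> carrier Y\<rbrakk> \<Longrightarrow> \<phi> x (y \<oplus>\<^bsub>Y\<^esub> y') = \<phi> x y + \<phi> x y'"
    "\<lbrakk>x \<in> carrier X; y \<in> carrier Y\<rbrakk> \<Longrightarrow> \<phi> (c \<odot>\<^bsub>X\<^esub> x) y = c * \<phi> x y"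
    "\<lbrakk>x \<in> carrier X; y \<in> carrier Y\<rbrakk> \<Longrightarrow> \<phi> x (c \<odot>\<^bsub>Y\<^esub> y) = c * \<phi> x y"
  using assms by (auto simp: bounded_bilinear_forms_def)

lemma bilinear_bound:
  assumes "\<phi> \<in> forms"
  obtains K where "K \<ge> 0" "\<And>x y. \<lbrakk>x \<in> carrier X; y \<in> carrier Y\<rbrakk> \<Longrightarrow> cmod (\<phi> x y) \<le> K * nrm X x * nrm Y y"
proof -
  obtain K where K: "\<forall>x\<in>carrier X. \<forall>y\<in>carrier Y. cmod (\<phi> x y) \<le> K * nrm X x * nrm Y y"
    using assms unfolding bounded_bilinear_forms_def by blast
  have "cmod (\<phi> x y) \<le> \<bar>K\<bar> * nrm X x * nrm Y y" if "x \<in> carrier X" "y \<in> carrier Y" for x y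
  proof -
    have "K * nrm X x * nrm Y y \<le> \<bar>K\<bar> * nrm X x * nrm Y y"
      using X.nrm_nonneg[OF that(1)] Y.nrm_nonneg[OF that(2)] by (intro mult_right_mono) auto
    then show ?thesis using K that by fastforce
  qed
  then show ?thesis by (intro that[of "\<bar>K\<bar>"]) auto
qed

lemma forms_add:
  assumes \<phi>: "\<phi> \<in> forms" and \<psi>: "\<psi> \<in> forms"
  shows "(\<lambda>x y. \<phi> x y + \<psi> x y) \<in> forms"
proof -
  obtain K where K: "\<And>x y. \<lbrakk>x \<in> carrier X; y \<in> carrier Y\<rbrakk> \<Longrightarrow> cmod (\<phi> x y) \<le> K * nrm X x * nrm Y y"
    by (rule bilinear_bound[OF \<phi>]) (rule that)
  obtain K' where K': "\<And>x y. \<lbrakk>x \<in> carrier X; y \<in> carrier Y\<rbrakk> \<Longrightarrow> cmod (\<psi> x y) \<le> K' * nrm X x * nrm Y y"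
    by (rule bilinear_bound[OF \<psi>]) (rule that)
  have "cmod (\<phi> x y + \<psi> x y) \<le> (K + K') * nrm X x * nrm Y y" if "x \<in> carrier X" "y \<in> carrier Y" for x y
    using norm_triangle_ineq[of "\<phi> x y" "\<psi> x y"] K[OF that] K'[OF that] by (simp add: distrib_right)
  then have "\<exists>K. \<forall>x\<in>carrier X. \<forall>y\<in>carrier Y. cmod (\<phi> x y + \<psi> x y) \<le> K * nrm X x * nrm Y y"
    by blast
  then show ?thesis
    unfolding bounded_bilinear_forms_def mem_Collect_eq
    by (intro conjI ballI allI) (simp_all add: bilinearD[OF \<phi>] bilinearD[OF \<psi>] distrib_left)
qed

lemma forms_smult:
  assumes \<phi>: "\<phi> \<in> forms"
  shows "(\<lambda>x y. c * \<phi> x y) \<in> forms"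
proof -
  obtain K where K: "\<And>x y. \<lbrakk>x \<in> carrier X; y \<in> carrier Y\<rbrakk> \<Longrightarrow> cmod (\<phi> x y) \<le> K * nrm X x * nrm Y y"
    by (rule bilinear_bound[OF \<phi>]) (rule that)
  have "cmod (c * \<phi> x y) \<le> (cmod c * K) * nrm X x * nrm Y y" if "x \<in> carrier X" "y \<in> carrier Y" for x y
    using mult_left_mono[OF K[OF that] norm_ge_zero[of c]] by (simp add: norm_mult mult.assoc)
  then have "\<exists>K. \<forall>x\<in>carrier X. \<forall>y\<in>carrier Y. cmod (c * \<phi> x y) \<le> K * nrm X x * nrm Y y"
    by blast
  then show ?thesis
    unfolding bounded_bilinear_forms_def mem_Collect_eq
    by (intro conjI ballI allI) (simp_all add: bilinearD[OF \<phi>] distrib_left mult.left_commute)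
qed

lemma tensor_sequencesD:
  assumes "(x, y) \<in> tensor_sequences X Y"
  shows "x n \<in> carrier X" "y n \<in> carrier Y" "summable (\<lambda>n. nrm X (x n) * nrm Y (y n))"
    "0 \<le> nrm X (x n) * nrm Y (y n)"
  using assms by (auto simp: tensor_sequences_def intro!: mult_nonneg_nonneg X.nrm_nonneg Y.nrm_nonneg)

lemma tensor_summable:
  assumes xy: "(x, y) \<in> tensor_sequences X Y" and \<phi>: "\<phi> \<in> forms"
  shows "summable (\<lambda>n. cmod (\<phi> (x n) (y n)))"
proof -
  obtain K where K: "K \<ge> 0" "\<And>x y. \<lbrakk>x \<in> carrier X; y \<in> carrier Y\<rbrakk> \<Longrightarrow> cmod (\<phi> x y) \<le> K * nrm X x * nrm Y y"
    by (rule bilinear_bound[OF \<phi>]) (rule that)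
  show ?thesis
  proof (rule summable_comparison_test')
    show "summable (\<lambda>n. K * (nrm X (x n) * nrm Y (y n)))"
      by (intro summable_mult tensor_sequencesD[OF xy])
    show "norm (cmod (\<phi> (x n) (y n))) \<le> K * (nrm X (x n) * nrm Y (y n))" for n
      using K(2)[OF tensor_sequencesD(1,2)[OF xy], of n n] by (simp add: mult.assoc)
  qed
qed

lemma tensor_series_sums:
  assumes xy: "(x, y) \<in> tensor_sequences X Y" and \<phi>: "\<phi> \<in> forms"
  shows "(\<lambda>n. \<phi> (x n) (y n)) sums tensor_series X Y x y \<phi>"
  using summable_sums[OF summable_norm_cancel[OF tensor_summable[OF assms]]] \<phi> by (simp add: tensor_series_def)

lemma PT_cases:
  assumes "u \<in> carrier PT"
  obtains x y where "(x, y) \<in> tensor_sequences X Y" "u = tensor_series X Y x y"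
  using assms by (auto simp: projective_tensor_simps)

lemma PT_mem: "(x, y) \<in> tensor_sequences X Y \<Longrightarrow> tensor_series X Y x y \<in> carrier PT"
  by (auto simp: projective_tensor_simps(1))

lemma PT_off_forms: "\<lbrakk>u \<in> carrier PT; \<phi> \<notin> forms\<rbrakk> \<Longrightarrow> u \<phi> = 0"
  by (auto simp: projective_tensor_simps tensor_series_def)

lemma PT_nrm_le:
  assumes "(x, y) \<in> tensor_sequences X Y"
  shows "nrm PT (tensor_series X Y x y) \<le> (\<Sum>n. nrm X (x n) * nrm Y (y n))"
  unfolding projective_tensor_simps
proof (rule cInf_lower)
  show "bdd_below {(\<Sum>n. nrm X (x' n) * nrm Y (y' n)) | x' y'.
      (x', y') \<in> tensor_sequences X Y \<and> tensor_series X Y x' y' = tensor_series X Y x y}"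
    by (rule bdd_belowI[of _ 0]) (auto intro!: suminf_nonneg tensor_sequencesD)
qed (use assms in blast)

lemma PT_nrm_greatest:
  assumes u: "u \<in> carrier PT"
    and b: "\<And>x y. \<lbrakk>(x, y) \<in> tensor_sequences X Y; u = tensor_series X Y x y\<rbrakk> \<Longrightarrow> b \<le> (\<Sum>n. nrm X (x n) * nrm Y (y n))"
  shows "b \<le> nrm PT u"
  unfolding projective_tensor_simps
proof (rule cInf_greatest)
  show "{(\<Sum>n. nrm X (x n) * nrm Y (y n)) | x y. (x, y) \<in> tensor_sequences X Y \<and> tensor_series X Y x y = u} \<noteq> {}"
    using u by (auto simp: projective_tensor_simps)
qed (use b in auto)

lemma PT_nrm_nonneg: "u \<in> carrier PT \<Longrightarrow> 0 \<le> nrm PT u"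
  by (rule PT_nrm_greatest) (auto intro!: suminf_nonneg tensor_sequencesD)

text \<open>Each representing series bounds the value at a form, so the infimum over all
  representations does too. The case \<open>K = 0\<close> is separate because the bound is divided
  by \<open>K\<close>.\<close>

lemma PT_apply_le:
  assumes u: "u \<in> carrier PT" and \<phi>: "\<phi> \<in> forms" and K: "K \<ge> 0"
    and bound: "\<And>x y. \<lbrakk>x \<in> carrier X; y \<in> carrier Y\<rbrakk> \<Longrightarrow> cmod (\<phi> x y) \<le> K * nrm X x * nrm Y y"
  shows "cmod (u \<phi>) \<le> K * nrm PT u"
proof (cases "K = 0")
  case True
  obtain x y where xy: "(x, y) \<in> tensor_sequences X Y" "u = tensor_series X Y x y" by (rule PT_cases[OF u])
  have "\<phi> (x n) (y n) = 0" for n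
    using bound[OF tensor_sequencesD(1,2)[OF xy(1)], of n n] True by simp
  then show ?thesis using True \<phi> by (simp add: xy(2) tensor_series_def)
next
  case False
  then have K: "K > 0" using K by simp
  have "cmod (u \<phi>) / K \<le> nrm PT u"
  proof (rule PT_nrm_greatest[OF u])
    fix x y assume xy: "(x, y) \<in> tensor_sequences X Y" "u = tensor_series X Y x y"
    have "cmod (u \<phi>) = cmod (\<Sum>n. \<phi> (x n) (y n))" using \<phi> by (simp add: xy(2) tensor_series_def)
    also have "\<dots> \<le> (\<Sum>n. cmod (\<phi> (x n) (y n)))" by (rule summable_norm[OF tensor_summable[OF xy(1) \<phi>]])
    also have "\<dots> \<le> (\<Sum>n. K * (nrm X (x n) * nrm Y (y n)))"
      using bound[OF tensor_sequencesD(1,2)[OF xy(1)]]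
      by (intro suminf_le tensor_summable[OF xy(1) \<phi>] summable_mult tensor_sequencesD[OF xy(1)]) (simp add: mult.assoc)
    also have "\<dots> = K * (\<Sum>n. nrm X (x n) * nrm Y (y n))"
      by (rule suminf_mult[OF tensor_sequencesD(3)[OF xy(1)]])
    finally show "cmod (u \<phi>) / K \<le> (\<Sum>n. nrm X (x n) * nrm Y (y n))" using K by (simp add: field_simps)
  qed
  then show ?thesis using K by (simp add: field_simps)
qed

text \<open>The conditions on a bilinear form concern the carriers only, so different functions can
  represent the same form. Tensors do not distinguish them, because their terms stay in the
  carriers.\<close>

lemma PT_cong:
  assumes u: "u \<in> carrier PT" and "\<phi> \<in> forms" "\<psi> \<in> forms"
    and eq: "\<And>x y. \<lbrakk>x \<in> carrier X; y \<in> carrier Y\<rbrakk> \<Longrightarrow> \<phi> x y = \<psi> x y"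
  shows "u \<phi> = u \<psi>"
proof -
  obtain x y where xy: "(x, y) \<in> tensor_sequences X Y" "u = tensor_series X Y x y" by (rule PT_cases[OF u])
  show ?thesis
    using assms(2,3) eq[OF tensor_sequencesD(1,2)[OF xy(1)]] by (simp add: xy(2) tensor_series_def)
qed

lemma PT_form_add:
  assumes u: "u \<in> carrier PT" and f: "\<phi> \<in> forms" "\<psi> \<in> forms"
  shows "u (\<lambda>x y. \<phi> x y + \<psi> x y) = u \<phi> + u \<psi>"
proof -
  obtain x y where xy: "(x, y) \<in> tensor_sequences X Y" "u = tensor_series X Y x y" by (rule PT_cases[OF u])
  show ?thesis
    using sums_unique2[OF tensor_series_sums[OF xy(1) forms_add[OF f]] sums_add[OF tensor_series_sums[OF xy(1) f(1)] tensor_series_sums[OF xy(1) f(2)]]]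
    by (simp add: xy(2))
qed

lemma PT_form_smult:
  assumes u: "u \<in> carrier PT" and f: "\<phi> \<in> forms"
  shows "u (\<lambda>x y. c * \<phi> x y) = c * u \<phi>"
proof -
  obtain x y where xy: "(x, y) \<in> tensor_sequences X Y" "u = tensor_series X Y x y" by (rule PT_cases[OF u])
  show ?thesis
    using sums_unique2[OF tensor_series_sums[OF xy(1) forms_smult[OF f]] sums_mult[OF tensor_series_sums[OF xy(1) f]]]
    by (simp add: xy(2))
qed

text \<open>A sum of two tensors must again be presented as one series; alternating the terms adds
  the series and the sums of norms alike.\<close>

lemma tensor_interleave:
  assumes xy: "(x, y) \<in> tensor_sequences X Y" and xy': "(x', y') \<in> tensor_sequences X Y"
  defines "v \<equiv> \<lambda>n. if even n then x (n div 2) else x' ((n - 1) div 2)"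
    and "w \<equiv> \<lambda>n. if even n then y (n div 2) else y' ((n - 1) div 2)"
  shows "(v, w) \<in> tensor_sequences X Y"
    "tensor_series X Y v w = (\<lambda>\<phi>. tensor_series X Y x y \<phi> + tensor_series X Y x' y' \<phi>)"
    "(\<Sum>n. nrm X (v n) * nrm Y (w n)) = (\<Sum>n. nrm X (x n) * nrm Y (y n)) + (\<Sum>n. nrm X (x' n) * nrm Y (y' n))"
proof -
  note s = tensor_sequencesD[OF xy] and s' = tensor_sequencesD[OF xy']
  have eq: "(\<lambda>n. nrm X (v n) * nrm Y (w n)) =
     (\<lambda>n. if even n then nrm X (x (n div 2)) * nrm Y (y (n div 2)) else nrm X (x' ((n - 1) div 2)) * nrm Y (y' ((n - 1) div 2)))"
    by (auto simp: v_def w_def)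
  have sm: "(\<lambda>n. nrm X (v n) * nrm Y (w n)) sums ((\<Sum>n. nrm X (x' n) * nrm Y (y' n)) + (\<Sum>n. nrm X (x n) * nrm Y (y n)))"
    unfolding eq by (rule sums_if[OF summable_sums[OF s'(3)] summable_sums[OF s(3)]])
  then show "(\<Sum>n. nrm X (v n) * nrm Y (w n)) = (\<Sum>n. nrm X (x n) * nrm Y (y n)) + (\<Sum>n. nrm X (x' n) * nrm Y (y' n))"
    using sums_unique by fastforce
  show vw: "(v, w) \<in> tensor_sequences X Y"
    using sums_summable[OF sm] s(1,2) s'(1,2) by (auto simp: tensor_sequences_def v_def w_def)
  show "tensor_series X Y v w = (\<lambda>\<phi>. tensor_series X Y x y \<phi> + tensor_series X Y x' y' \<phi>)"
  proof
    fix \<phi>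
    show "tensor_series X Y v w \<phi> = tensor_series X Y x y \<phi> + tensor_series X Y x' y' \<phi>"
    proof (cases "\<phi> \<in> forms")
      case True
      have eq: "(\<lambda>n. \<phi> (v n) (w n)) =
         (\<lambda>n. if even n then \<phi> (x (n div 2)) (y (n div 2)) else \<phi> (x' ((n - 1) div 2)) (y' ((n - 1) div 2)))"
        by (auto simp: v_def w_def)
      have "(\<lambda>n. \<phi> (v n) (w n)) sums (tensor_series X Y x' y' \<phi> + tensor_series X Y x y \<phi>)"
        unfolding eq by (rule sums_if_complex[OF tensor_series_sums[OF xy' True] tensor_series_sums[OF xy True]])
      then show ?thesis using sums_unique2[OF tensor_series_sums[OF vw True]] by fastforce
    qed (simp add: tensor_series_def)
  qed
qed

lemma elementary_tensor:
  assumes x: "x \<in> carrier X" and y: "y \<in> carrier Y"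
  shows "(\<lambda>\<phi>. if \<phi> \<in> forms then \<phi> x y else 0) \<in> carrier PT"
    "nrm PT (\<lambda>\<phi>. if \<phi> \<in> forms then \<phi> x y else 0) \<le> nrm X x * nrm Y y"
proof -
  let ?v = "\<lambda>n::nat. if n = 0 then x else \<zero>\<^bsub>X\<^esub>" and ?w = "\<lambda>n::nat. if n = 0 then y else \<zero>\<^bsub>Y\<^esub>"
  have "(\<lambda>n. nrm X (?v n) * nrm Y (?w n)) = (\<lambda>n. if n = 0 then nrm X x * nrm Y y else 0)" by auto
  then have s: "(\<lambda>n. nrm X (?v n) * nrm Y (?w n)) sums (nrm X x * nrm Y y)"
    using sums_single[of 0 "\<lambda>_. nrm X x * nrm Y y"] by simp
  then have vw: "(?v, ?w) \<in> tensor_sequences X Y"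
    using x y sums_summable[OF s] by (auto simp: tensor_sequences_def)
  have "tensor_series X Y ?v ?w = (\<lambda>\<phi>. if \<phi> \<in> forms then \<phi> x y else 0)"
  proof
    fix \<phi>
    show "tensor_series X Y ?v ?w \<phi> = (if \<phi> \<in> forms then \<phi> x y else 0)"
    proof (cases "\<phi> \<in> forms")
      case True
      have "\<phi> \<zero>\<^bsub>X\<^esub> \<zero>\<^bsub>Y\<^esub> = 0" using bilinearD(3)[OF True X.M.zero_closed Y.M.zero_closed, of 0] by simp
      then have "(\<lambda>n. \<phi> (?v n) (?w n)) = (\<lambda>n. if n = 0 then \<phi> x y else 0)" by auto
      then have "(\<lambda>n. \<phi> (?v n) (?w n)) sums (\<phi> x y)"
        using sums_single[of 0 "\<lambda>_. \<phi> x y"] by simp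
      then show ?thesis using sums_unique2[OF tensor_series_sums[OF vw True]] True by fastforce
    qed (simp add: tensor_series_def)
  qed
  then show "(\<lambda>\<phi>. if \<phi> \<in> forms then \<phi> x y else 0) \<in> carrier PT"
    "nrm PT (\<lambda>\<phi>. if \<phi> \<in> forms then \<phi> x y else 0) \<le> nrm X x * nrm Y y"
    using PT_mem[OF vw] PT_nrm_le[OF vw] sums_unique[OF s] by simp_all
qed

lemma PT_smult_le:
  assumes u: "u \<in> carrier PT"
  shows "(\<lambda>\<phi>. c * u \<phi>) \<in> carrier PT" "nrm PT (\<lambda>\<phi>. c * u \<phi>) \<le> cmod c * nrm PT u"
proof -
  have main: "(\<lambda>\<phi>. c * u \<phi>) \<in> carrier PT \<and> nrm PT (\<lambda>\<phi>. c * u \<phi>) \<le> cmod c * (\<Sum>n. nrm X (x n) * nrm Y (y n))"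
    if xy: "(x, y) \<in> tensor_sequences X Y" "u = tensor_series X Y x y" for x y
  proof -
    note s = tensor_sequencesD[OF xy(1)]
    let ?x = "\<lambda>n. c \<odot>\<^bsub>X\<^esub> x n"
    have n: "nrm X (?x n) * nrm Y (y n) = cmod c * (nrm X (x n) * nrm Y (y n))" for n
      using X.nrm_smult[OF s(1)] by simp
    have t: "(?x, y) \<in> tensor_sequences X Y"
      using s(1,2) summable_mult[OF s(3), of "cmod c"] by (auto simp: tensor_sequences_def n)
    have eq: "tensor_series X Y ?x y = (\<lambda>\<phi>. c * u \<phi>)"
    proof
      fix \<phi>
      show "tensor_series X Y ?x y \<phi> = c * u \<phi>"
      proof (cases "\<phi> \<in> forms")
        case True
        have "(\<lambda>n. \<phi> (?x n) (y n)) sums (c * u \<phi>)"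
          using sums_mult[OF tensor_series_sums[OF xy(1) True], of c] bilinearD(3)[OF True s(1,2)] by (simp add: xy(2))
        then show ?thesis using sums_unique2[OF tensor_series_sums[OF t True]] by blast
      qed (simp add: tensor_series_def xy(2))
    qed
    show ?thesis
      using PT_mem[OF t] PT_nrm_le[OF t] suminf_mult[OF s(3), of "cmod c"] unfolding eq n by simp
  qed
  obtain x y where "(x, y) \<in> tensor_sequences X Y" "u = tensor_series X Y x y" by (rule PT_cases[OF u])
  then show "(\<lambda>\<phi>. c * u \<phi>) \<in> carrier PT" using main by blast
  show "nrm PT (\<lambda>\<phi>. c * u \<phi>) \<le> cmod c * nrm PT u"
  \<comment> \<open>The infimum argument divides by the modulus of \<open>c\<close>; the zero tensor
    is bounded by an explicit representation instead.\<close>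
  proof (cases "c = 0")
    case True
    have "(\<lambda>\<phi>. 0 * u \<phi>) = (\<lambda>\<phi>. if \<phi> \<in> forms then \<phi> \<zero>\<^bsub>X\<^esub> \<zero>\<^bsub>Y\<^esub> else 0)"
      using bilinearD(3)[OF _ X.M.zero_closed Y.M.zero_closed, of _ 0] by (auto simp: fun_eq_iff)
    then show ?thesis using elementary_tensor(2)[OF X.M.zero_closed Y.M.zero_closed] True by simp
  next
    case False
    have "nrm PT (\<lambda>\<phi>. c * u \<phi>) / cmod c \<le> nrm PT u"
      using main False by (intro PT_nrm_greatest[OF u]) (simp add: field_simps)
    then show ?thesis using False by (simp add: field_simps)
  qed
qed

lemma PT_add_le:
  assumes u: "u \<in> carrier PT" and v: "v \<in> carrier PT"
  shows "(\<lambda>\<phi>. u \<phi> + v \<phi>) \<in> carrier PT" "nrm PT (\<lambda>\<phi>. u \<phi> + v \<phi>) \<le> nrm PT u + nrm PT v"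
proof -
  have main: "(\<lambda>\<phi>. u \<phi> + v \<phi>) \<in> carrier PT \<and> nrm PT (\<lambda>\<phi>. u \<phi> + v \<phi>) \<le>
      (\<Sum>n. nrm X (x n) * nrm Y (y n)) + (\<Sum>n. nrm X (x' n) * nrm Y (y' n))"
    if "(x, y) \<in> tensor_sequences X Y" "u = tensor_series X Y x y" "(x', y') \<in> tensor_sequences X Y" "v = tensor_series X Y x' y'" for x y x' y'
    using PT_mem[OF tensor_interleave(1)[OF that(1,3)]] PT_nrm_le[OF tensor_interleave(1)[OF that(1,3)]]
    unfolding tensor_interleave(2,3)[OF that(1,3)] that(2,4) by simp
  obtain x y where xy: "(x, y) \<in> tensor_sequences X Y" "u = tensor_series X Y x y" by (rule PT_cases[OF u])
  obtain x' y' where xy': "(x', y') \<in> tensor_sequences X Y" "v = tensor_series X Y x' y'" by (rule PT_cases[OF v])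
  show "(\<lambda>\<phi>. u \<phi> + v \<phi>) \<in> carrier PT" using main[OF xy xy'] by blast
  have "nrm PT (\<lambda>\<phi>. u \<phi> + v \<phi>) - (\<Sum>n. nrm X (x n) * nrm Y (y n)) \<le> nrm PT v"
    if "(x, y) \<in> tensor_sequences X Y" "u = tensor_series X Y x y" for x y
    using main[OF that] by (intro PT_nrm_greatest[OF v]) (simp add: algebra_simps)
  then have "nrm PT (\<lambda>\<phi>. u \<phi> + v \<phi>) - nrm PT v \<le> nrm PT u"
    by (intro PT_nrm_greatest[OF u]) (simp add: algebra_simps)
  then show "nrm PT (\<lambda>\<phi>. u \<phi> + v \<phi>) \<le> nrm PT u + nrm PT v" by simp
qed

text \<open>Definiteness is where the encoding as functions of forms pays off: a tensor of norm 0
  takes the value 0 at every form, hence is zero.\<close>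

lemma PT_normed: "complex_normed_space PT"
proof (rule complex_normed_spaceI)
  show "\<zero>\<^bsub>PT\<^esub> \<in> carrier PT"
    using PT_smult_le(1)[OF elementary_tensor(1)[OF X.M.zero_closed Y.M.zero_closed], of 0] by (simp add: projective_tensor_simps(2))
  show "u = \<zero>\<^bsub>PT\<^esub>" if u: "u \<in> carrier PT" "nrm PT u = 0" for u
  proof
    fix \<phi>
    show "u \<phi> = \<zero>\<^bsub>PT\<^esub> \<phi>"
    proof (cases "\<phi> \<in> forms")
      case True
      obtain K where K: "K \<ge> 0" "\<And>x y. \<lbrakk>x \<in> carrier X; y \<in> carrier Y\<rbrakk> \<Longrightarrow> cmod (\<phi> x y) \<le> K * nrm X x * nrm Y y"
        by (rule bilinear_bound[OF True]) (rule that)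
      have "cmod (u \<phi>) \<le> K * nrm PT u" by (rule PT_apply_le[OF u(1) True K])
      then show ?thesis using u(2) by (simp add: projective_tensor_simps(2))
    qed (simp add: projective_tensor_simps(2) PT_off_forms[OF u(1)])
  qed
  show "nrm PT (c \<odot>\<^bsub>PT\<^esub> u) \<le> cmod c * nrm PT u" if "u \<in> carrier PT" for c u
    using PT_smult_le(2)[OF that] by (simp only: projective_tensor_simps(4))
  show "nrm PT (u \<oplus>\<^bsub>PT\<^esub> v) \<le> nrm PT u + nrm PT v" if "u \<in> carrier PT" "v \<in> carrier PT" for u v
    using PT_add_le(2)[OF that] by (simp only: projective_tensor_simps(3))
qed (simp_all add: PT_add_le(1) PT_smult_le(1) PT_nrm_nonneg projective_tensor_simps(2-4) algebra_simps fun_eq_iff)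

lemma bilinear_comp:
  assumes \<phi>: "\<phi> \<in> forms" and R: "R \<in> carrier (bounded_maps X X)" and T: "T \<in> carrier (bounded_maps Y Y)"
  shows "(\<lambda>x y. \<phi> (R x) (T y)) \<in> forms"
proof -
  interpret XX: normed_pair X X ..
  interpret YY: normed_pair Y Y ..
  note D = bilinearD[OF \<phi>] and RD = bounded_mapsD[OF R] and TD = bounded_mapsD[OF T]
  obtain K where K: "K \<ge> 0" "\<And>x y. \<lbrakk>x \<in> carrier X; y \<in> carrier Y\<rbrakk> \<Longrightarrow> cmod (\<phi> x y) \<le> K * nrm X x * nrm Y y"
    by (rule bilinear_bound[OF \<phi>]) (rule that)
  let ?K = "K * nrm (bounded_maps X X) R * nrm (bounded_maps Y Y) T"
  have "cmod (\<phi> (R x) (T y)) \<le> ?K * nrm X x * nrm Y y" if x: "x \<in> carrier X" and y: "y \<in> carrier Y" for x y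
  proof -
    have "cmod (\<phi> (R x) (T y)) \<le> K * nrm X (R x) * nrm Y (T y)" by (intro K RD(1) TD(1) x y)
    also have "\<dots> \<le> K * (nrm (bounded_maps X X) R * nrm X x) * (nrm (bounded_maps Y Y) T * nrm Y y)"
      by (intro mult_mono order_refl XX.nrm_apply_le YY.nrm_apply_le R T x y mult_nonneg_nonneg K
          X.nrm_nonneg Y.nrm_nonneg RD(1) TD(1) XX.bounded_maps_nrm_nonneg)
    finally show ?thesis by (simp add: mult_ac)
  qed
  then have "\<exists>K. \<forall>x\<in>carrier X. \<forall>y\<in>carrier Y. cmod (\<phi> (R x) (T y)) \<le> K * nrm X x * nrm Y y"
    by blast
  then show ?thesis
    unfolding bounded_bilinear_forms_def mem_Collect_eq
    by (intro conjI ballI allI) (simp_all add: RD(1,3,4) TD(1,3,4) D)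
qed

text \<open>The constant is a parameter instead of a product of operator norms. For multiplication
  in one factor and the identity in the other it can then be the norm of the algebra
  element.\<close>

lemma tensor_map:
  assumes u: "u \<in> carrier PT" and R: "R \<in> carrier (bounded_maps X X)" and T: "T \<in> carrier (bounded_maps Y Y)"
    and C: "C \<ge> 0" "\<forall>x\<in>carrier X. \<forall>y\<in>carrier Y. nrm X (R x) * nrm Y (T y) \<le> C * (nrm X x * nrm Y y)"
  defines "v \<equiv> \<lambda>\<phi>. if \<phi> \<in> forms then u (\<lambda>x y. \<phi> (R x) (T y)) else 0"
  shows "v \<in> carrier PT" "nrm PT v \<le> C * nrm PT u"
proof -
  have main: "v \<in> carrier PT \<and> nrm PT v \<le> C * (\<Sum>n. nrm X (x n) * nrm Y (y n))"
    if xy: "(x, y) \<in> tensor_sequences X Y" "u = tensor_series X Y x y" for x y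
  proof -
    note s = tensor_sequencesD[OF xy(1)]
    have m: "R (x n) \<in> carrier X" "T (y n) \<in> carrier Y" for n
      by (rule bounded_mapsD(1)[OF R s(1)], rule bounded_mapsD(1)[OF T s(2)])
    have le: "nrm X (R (x n)) * nrm Y (T (y n)) \<le> C * (nrm X (x n) * nrm Y (y n))" for n
      by (rule C(2)[rule_format, OF s(1,2)])
    have sm: "summable (\<lambda>n. nrm X (R (x n)) * nrm Y (T (y n)))"
    proof (rule summable_comparison_test')
      show "summable (\<lambda>n. C * (nrm X (x n) * nrm Y (y n)))" by (rule summable_mult[OF s(3)])
      show "norm (nrm X (R (x n)) * nrm Y (T (y n))) \<le> C * (nrm X (x n) * nrm Y (y n))" for n
        using le[of n] X.nrm_nonneg[OF m(1), of n] Y.nrm_nonneg[OF m(2), of n] by (simp add: abs_mult)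
    qed
    then have t: "(\<lambda>n. R (x n), \<lambda>n. T (y n)) \<in> tensor_sequences X Y"
      using m by (auto simp: tensor_sequences_def)
    have eq: "tensor_series X Y (\<lambda>n. R (x n)) (\<lambda>n. T (y n)) = v"
      using bilinear_comp[OF _ R T] by (auto simp: v_def xy(2) tensor_series_def fun_eq_iff)
    have "(\<Sum>n. nrm X (R (x n)) * nrm Y (T (y n))) \<le> C * (\<Sum>n. nrm X (x n) * nrm Y (y n))"
      using suminf_le[OF le sm summable_mult[OF s(3)]] suminf_mult[OF s(3), of C] by simp
    then show ?thesis
      using PT_mem[OF t] PT_nrm_le[OF t] unfolding eq by simp
  qed
  obtain x y where xy: "(x, y) \<in> tensor_sequences X Y" "u = tensor_series X Y x y" by (rule PT_cases[OF u])
  then show "v \<in> carrier PT" using main by blast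
  show "nrm PT v \<le> C * nrm PT u"
  proof (cases "C = 0")
    case True
    then show ?thesis using main[OF xy] by simp
  next
    case False
    then have pos: "C > 0" using C(1) by simp
    have "nrm PT v / C \<le> nrm PT u"
      using main pos by (intro PT_nrm_greatest[OF u]) (simp add: field_simps)
    then show ?thesis using pos by (simp add: field_simps)
  qed
qed

lemma finite_tensor:
  assumes I: "finite I" and xy: "\<And>i. i \<in> I \<Longrightarrow> x i \<in> carrier X" "\<And>i. i \<in> I \<Longrightarrow> y i \<in> carrier Y"
  shows "(\<lambda>\<phi>. if \<phi> \<in> forms then \<Sum>i\<in>I. \<phi> (x i) (y i) else 0) \<in> carrier PT \<and>
    nrm PT (\<lambda>\<phi>. if \<phi> \<in> forms then \<Sum>i\<in>I. \<phi> (x i) (y i) else 0) \<le> (\<Sum>i\<in>I. nrm X (x i) * nrm Y (y i))"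
  using I xy
proof (induction I rule: finite_induct)
  case empty
  interpret N: complex_normed_space PT by (rule PT_normed)
  have "(\<lambda>\<phi>. if \<phi> \<in> forms then \<Sum>i\<in>{}. \<phi> (x i) (y i) else 0) = \<zero>\<^bsub>PT\<^esub>" by (simp add: projective_tensor_simps(2) fun_eq_iff)
  then show ?case using N.M.zero_closed N.nrm_zero by simp
next
  case (insert i I)
  let ?u = "\<lambda>\<phi>. if \<phi> \<in> forms then \<Sum>i\<in>I. \<phi> (x i) (y i) else 0"
  let ?v = "\<lambda>\<phi>. if \<phi> \<in> forms then \<phi> (x i) (y i) else 0"
  have i: "x i \<in> carrier X" "y i \<in> carrier Y" using insert.prems by auto
  have u: "?u \<in> carrier PT" "nrm PT ?u \<le> (\<Sum>i\<in>I. nrm X (x i) * nrm Y (y i))" using insert.IH insert.prems by auto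
  have eq: "(\<lambda>\<phi>. if \<phi> \<in> forms then \<Sum>i\<in>insert i I. \<phi> (x i) (y i) else 0) = (\<lambda>\<phi>. ?v \<phi> + ?u \<phi>)"
    using insert.hyps by (auto simp: fun_eq_iff)
  show ?case
    unfolding eq using PT_add_le[OF elementary_tensor(1)[OF i] u(1)] elementary_tensor(2)[OF i] u(2) insert.hyps by auto
qed

end

section \<open>Module actions on the projective tensor square\<close>

context banach_algebra
begin

sublocale Sq: normed_pair A A ..

lemma tensor_square_simps:
  "carrier (tensor_square A) = carrier (projective_tensor A A)"
  "zero (tensor_square A) = zero (projective_tensor A A)"
  "add (tensor_square A) = add (projective_tensor A A)"
  "smult (tensor_square A) = smult (projective_tensor A A)"
  "nrm (tensor_square A) = nrm (projective_tensor A A)"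
  "lact (tensor_square A) c u = (\<lambda>\<phi>. if \<phi> \<in> bounded_bilinear_forms A A then u (\<lambda>a b. \<phi> (c \<otimes> a) b) else 0)"
  "ract (tensor_square A) u c = (\<lambda>\<phi>. if \<phi> \<in> bounded_bilinear_forms A A then u (\<lambda>a b. \<phi> a (b \<otimes> c)) else 0)"
  by (simp_all add: tensor_square_def normed_module.extend_def bimodule.fields_def projective_tensor_def)

lemma tensor_square_minus:
  assumes "u \<in> carrier (projective_tensor A A)" "v \<in> carrier (projective_tensor A A)"
  shows "u \<ominus>\<^bsub>tensor_square A\<^esub> v = (\<lambda>\<phi>. u \<phi> - v \<phi>)"
proof -
  interpret N: complex_normed_space "projective_tensor A A" by (rule Sq.PT_normed)
  have "u \<ominus>\<^bsub>tensor_square A\<^esub> v = u \<ominus>\<^bsub>projective_tensor A A\<^esub> v"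
    by (subst a_minus_cong[of "tensor_square A" "projective_tensor A A"]) (simp_all add: tensor_square_simps)
  then show ?thesis using assms by (simp add: N.M.minus_eq N.uminus_smult projective_tensor_simps(3,4))
qed

lemma mult_bounded:
  assumes c: "c \<in> carrier A"
  shows "(\<lambda>a. if a \<in> carrier A then c \<otimes> a else \<zero>) \<in> carrier (bounded_maps A A)"
    "(\<lambda>a. if a \<in> carrier A then a \<otimes> c else \<zero>) \<in> carrier (bounded_maps A A)"
proof -
  show "(\<lambda>a. if a \<in> carrier A then c \<otimes> a else \<zero>) \<in> carrier (bounded_maps A A)"
    by (rule bounded_maps_carrierI[where K = "nrm A c"])
      (use c in \<open>simp_all add: mult_closed mult_distrib_left mult_smult_right nrm_mult\<close>)
  show "(\<lambda>a. if a \<in> carrier A then a \<otimes> c else \<zero>) \<in> carrier (bounded_maps A A)"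
    by (rule bounded_maps_carrierI[where K = "nrm A c"])
      (use c in \<open>simp_all add: mult_closed mult_distrib_right mult_smult_left nrm_mult mult.commute[of "nrm A c"]\<close>)
qed

lemma id_bounded: "(\<lambda>a. if a \<in> carrier A then a else \<zero>) \<in> carrier (bounded_maps A A)"
  by (rule bounded_maps_carrierI[where K = 1]) simp_all

lemma form_lact:
  assumes \<phi>: "\<phi> \<in> bounded_bilinear_forms A A" and c: "c \<in> carrier A"
  shows "(\<lambda>a b. \<phi> (c \<otimes> a) b) \<in> bounded_bilinear_forms A A"
  using Sq.bilinear_comp[OF \<phi> mult_bounded(1)[OF c] id_bounded]
  by (simp add: bounded_bilinear_forms_def)

lemma form_ract:
  assumes \<phi>: "\<phi> \<in> bounded_bilinear_forms A A" and c: "c \<in> carrier A"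
  shows "(\<lambda>a b. \<phi> a (b \<otimes> c)) \<in> bounded_bilinear_forms A A"
  using Sq.bilinear_comp[OF \<phi> id_bounded mult_bounded(2)[OF c]]
  by (simp add: bounded_bilinear_forms_def)

lemma lact_tensor:
  assumes u: "u \<in> carrier (projective_tensor A A)" and c: "c \<in> carrier A"
  shows "lact (tensor_square A) c u \<in> carrier (projective_tensor A A)"
    "nrm (projective_tensor A A) (lact (tensor_square A) c u) \<le> nrm A c * nrm (projective_tensor A A) u"
proof -
  let ?R = "\<lambda>a. if a \<in> carrier A then c \<otimes> a else \<zero>" and ?T = "\<lambda>a. if a \<in> carrier A then a else \<zero>"
  have "u (\<lambda>a b. \<phi> (?R a) (?T b)) = u (\<lambda>a b. \<phi> (c \<otimes> a) b)" if \<phi>: "\<phi> \<in> bounded_bilinear_forms A A" for \<phi>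
    by (rule Sq.PT_cong[OF u Sq.bilinear_comp[OF \<phi> mult_bounded(1)[OF c] id_bounded] form_lact[OF \<phi> c]]) simp
  then have eq: "lact (tensor_square A) c u =
      (\<lambda>\<phi>. if \<phi> \<in> bounded_bilinear_forms A A then u (\<lambda>a b. \<phi> (?R a) (?T b)) else 0)"
    by (simp add: tensor_square_simps fun_eq_iff)
  have "\<forall>a\<in>carrier A. \<forall>b\<in>carrier A. nrm A (?R a) * nrm A (?T b) \<le> nrm A c * (nrm A a * nrm A b)"
    using mult_right_mono[OF nrm_mult[OF c] nrm_nonneg] by (simp add: mult.assoc)
  note t = Sq.tensor_map[OF u mult_bounded(1)[OF c] id_bounded nrm_nonneg[OF c] this]
  show "lact (tensor_square A) c u \<in> carrier (projective_tensor A A)"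
    unfolding eq by (rule t(1))
  show "nrm (projective_tensor A A) (lact (tensor_square A) c u) \<le> nrm A c * nrm (projective_tensor A A) u"
    unfolding eq by (rule t(2))
qed

lemma ract_tensor:
  assumes u: "u \<in> carrier (projective_tensor A A)" and c: "c \<in> carrier A"
  shows "ract (tensor_square A) u c \<in> carrier (projective_tensor A A)"
    "nrm (projective_tensor A A) (ract (tensor_square A) u c) \<le> nrm A c * nrm (projective_tensor A A) u"
proof -
  let ?R = "\<lambda>a. if a \<in> carrier A then a else \<zero>" and ?T = "\<lambda>a. if a \<in> carrier A then a \<otimes> c else \<zero>"
  have "u (\<lambda>a b. \<phi> (?R a) (?T b)) = u (\<lambda>a b. \<phi> a (b \<otimes> c))" if \<phi>: "\<phi> \<in> bounded_bilinear_forms A A" for \<phi>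
    by (rule Sq.PT_cong[OF u Sq.bilinear_comp[OF \<phi> id_bounded mult_bounded(2)[OF c]] form_ract[OF \<phi> c]]) simp
  then have eq: "ract (tensor_square A) u c =
      (\<lambda>\<phi>. if \<phi> \<in> bounded_bilinear_forms A A then u (\<lambda>a b. \<phi> (?R a) (?T b)) else 0)"
    by (simp add: tensor_square_simps fun_eq_iff)
  have "\<forall>a\<in>carrier A. \<forall>b\<in>carrier A. nrm A (?R a) * nrm A (?T b) \<le> nrm A c * (nrm A a * nrm A b)"
  proof (intro ballI)
    fix a b assume ab: "a \<in> carrier A" "b \<in> carrier A"
    then show "nrm A (?R a) * nrm A (?T b) \<le> nrm A c * (nrm A a * nrm A b)"
      using mult_left_mono[OF nrm_mult[OF ab(2) c] nrm_nonneg[OF ab(1)]] by (simp add: mult_ac)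
  qed
  note t = Sq.tensor_map[OF u id_bounded mult_bounded(2)[OF c] nrm_nonneg[OF c] this]
  show "ract (tensor_square A) u c \<in> carrier (projective_tensor A A)"
    unfolding eq by (rule t(1))
  show "nrm (projective_tensor A A) (ract (tensor_square A) u c) \<le> nrm A c * nrm (projective_tensor A A) u"
    unfolding eq by (rule t(2))
qed

end

lemma (in complex_banach_space) summable_nconv:
  assumes c: "\<And>n. c n \<in> carrier X" and sm: "summable (\<lambda>n. nrm X (c n))"
  shows "\<exists>z. nconv X (\<lambda>n. \<Oplus>k\<in>{..<n}. c k) z"
proof -
  let ?S = "\<lambda>n. \<Oplus>k\<in>{..<n::nat}. c k"
  have mem: "?S n \<in> carrier X" for n by (intro M.finsum_closed) (use c in auto)
  have S_Suc: "?S (Suc n) = c n \<oplus> ?S n" for n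
    unfolding lessThan_Suc by (intro M.finsum_insert) (use c in auto)
  have diff: "nrm X (?S (n + k) \<ominus> ?S n) \<le> (\<Sum>i\<in>{n..<n + k}. nrm X (c i))" for n k
  proof (induction k)
    case 0
    then show ?case using mem by simp
  next
    case (Suc k)
    have "?S (n + Suc k) \<ominus> ?S n = c (n + k) \<oplus> (?S (n + k) \<ominus> ?S n)"
      using S_Suc[of "n + k"] mem[of "n + k"] mem[of n] c[of "n + k"] by (simp add: M.minus_eq M.a_assoc)
    then show ?case
      using nrm_triangle[OF c[of "n + k"] minus_mem[OF mem[of "n + k"] mem[of n]]] Suc by simp
  qed
  have "ncauchy ?S"
    unfolding ncauchy_def
  proof (intro conjI allI impI mem)
    fix e :: real assume "e > 0"
    then obtain N where N: "\<And>m n. m \<ge> N \<Longrightarrow> norm (\<Sum>i\<in>{m..<n}. nrm X (c i)) < e"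
      using sm unfolding summable_Cauchy by blast
    have *: "nrm X (?S m \<ominus> ?S n) < e" if "n \<ge> N" "m \<ge> n" for m n
      using diff[of n "m - n"] N[OF that(1), of m] that(2) by simp
    have "nrm X (?S m \<ominus> ?S n) < e" if "m \<ge> N" "n \<ge> N" for m n
      using *[of n m] *[of m n] that nrm_minus_commute[OF mem[of m] mem[of n]] by (cases "m \<ge> n") auto
    then show "\<exists>N. \<forall>m\<ge>N. \<forall>n\<ge>N. nrm X (?S m \<ominus> ?S n) < e" by blast
  qed
  then obtain z where "nconv X ?S z" by (rule ncauchy_nconv)
  then show ?thesis by (intro exI)
qed

section \<open>From an approximate diagonal to an invariant mean\<close>

context pseudofunctions
begin

abbreviation AA where "AA \<equiv> projective_tensor A A"
abbreviation bforms where "bforms \<equiv> bounded_bilinear_forms A A"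

lemma BF_bilinear:
  assumes T: "T \<in> carrier U.BF"
  shows "T \<in> bforms"
  unfolding bounded_bilinear_forms_def mem_Collect_eq
proof (intro conjI ballI allI exI[of _ "nrm U.BF T"])
  fix a a' b b' c assume ab: "a \<in> carrier A" "b \<in> carrier A"
  note D = U.formsD[OF T]
  show "T (a \<oplus>\<^bsub>A\<^esub> a') b = T a b + T a' b" if "a' \<in> carrier A" by (rule D(3)[OF ab(1) that])
  show "T a (b \<oplus>\<^bsub>A\<^esub> b') = T a b + T a b'" if "b' \<in> carrier A" by (rule D(4)[OF ab(2) that])
  show "T (c \<odot>\<^bsub>A\<^esub> a) b = c * T a b" by (rule D(5)[OF ab(1)])
  show "T a (c \<odot>\<^bsub>A\<^esub> b) = c * T a b" by (rule D(6)[OF ab(2)])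
  show "cmod (T a b) \<le> nrm U.BF T * nrm A a * nrm A b" by (rule D(7)[OF ab])
qed

text \<open>The coordinates of the product \<open>a \<circ> b\<close>, seen as bounded bilinear
  forms; there are enough of them to determine an operator.\<close>

definition matrix_form :: "('g \<Rightarrow> complex) \<Rightarrow> 'g \<Rightarrow> 'g operator \<Rightarrow> 'g operator \<Rightarrow> complex" where
  "matrix_form h s a b = a (b h) s"

lemma matrix_form_bilinear:
  assumes h: "h \<in> carrier L"
  shows "matrix_form h s \<in> bforms"
proof -
  note v = P.bounded_maps_value[OF PF_B]
  have "cmod (a (b h) s) \<le> nrm L h * nrm A a * nrm A b" if a: "a \<in> carrier A" and b: "b \<in> carrier A" for a b
  proof -
    have "cmod (a (b h) s) \<le> nrm L (a (b h))" by (rule lp_coordinate_le[OF p01(1) v[OF a]])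
    also have "\<dots> \<le> nrm B a * nrm L (b h)" by (rule P.nrm_apply_le[OF PF_B[OF a] v[OF b]])
    also have "\<dots> \<le> nrm B a * (nrm B b * nrm L h)"
      by (intro mult_left_mono P.nrm_apply_le PF_B b h P.bounded_maps_nrm_nonneg a)
    finally show ?thesis by (simp add: mult_ac)
  qed
  then show ?thesis
    unfolding bounded_bilinear_forms_def matrix_form_def
    using bounded_mapsD(3)[OF PF_B v v] bounded_mapsD(4)[OF PF_B v] by auto
qed

lemma finsum_apply:
  assumes c: "\<And>n. c n \<in> carrier A"
  shows "(\<Oplus>\<^bsub>A\<^esub>k\<in>{..<n::nat}. c k) h s = (\<Sum>k<n. c k h s)"
proof (induction n)
  case 0
  have "(\<Oplus>\<^bsub>A\<^esub>k\<in>{}. c k) = \<zero>\<^bsub>A\<^esub>" by (rule A.M.finsum_empty)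
  then show ?case by simp
next
  case (Suc n)
  have "(\<Oplus>\<^bsub>A\<^esub>k\<in>{..<Suc n}. c k) = c n \<oplus>\<^bsub>A\<^esub> (\<Oplus>\<^bsub>A\<^esub>k\<in>{..<n}. c k)"
    unfolding lessThan_Suc by (intro A.M.finsum_insert) (use c in auto)
  then show ?case using Suc.IH by (simp add: add.commute)
qed

text \<open>Justifies the definite description. A limit exists by absolute convergence, and the
  coordinates of any limit, for any representing series, are the values of \<open>M\<close> at the
  matrix forms, which do not mention the series.\<close>

lemma tensor_product_map_spec:
  assumes M: "M \<in> carrier AA"
  shows "tensor_product_map A M \<in> carrier A"
    "h \<in> carrier L \<Longrightarrow> tensor_product_map A M h s = M (matrix_form h s)"
proof -
  define P where "P = (\<lambda>z. z \<in> carrier A \<and> (\<exists>a b. (a, b) \<in> tensor_sequences A A \<and> tensor_series A A a b = M \<and>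
        (\<lambda>n. nrm A ((\<Oplus>\<^bsub>A\<^esub>k\<in>{..<n}. a k \<otimes>\<^bsub>A\<^esub> b k) \<ominus>\<^bsub>A\<^esub> z)) \<longlonglongrightarrow> 0))"
  have val: "z h s = M (matrix_form h s)" if z: "P z" and h: "h \<in> carrier L" for z h s
  proof -
    obtain a b where zA: "z \<in> carrier A" and ab: "(a, b) \<in> tensor_sequences A A" "tensor_series A A a b = M"
      and lim: "(\<lambda>n. nrm A ((\<Oplus>\<^bsub>A\<^esub>k\<in>{..<n}. a k \<otimes>\<^bsub>A\<^esub> b k) \<ominus>\<^bsub>A\<^esub> z)) \<longlonglongrightarrow> 0"
      using z unfolding P_def by blast
    let ?S = "\<lambda>n. \<Oplus>\<^bsub>A\<^esub>k\<in>{..<n}. a k \<otimes>\<^bsub>A\<^esub> b k"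
    have cA: "a n \<otimes>\<^bsub>A\<^esub> b n \<in> carrier A" for n
      using A.Sq.tensor_sequencesD(1,2)[OF ab(1)] A.mult_closed by blast
    have SA: "?S n \<in> carrier A" for n by (intro A.M.finsum_closed) (use cA in auto)
    have "(\<lambda>n. ?S n h s - z h s) \<longlonglongrightarrow> 0"
    proof (rule Lim_null_comparison)
      show "(\<lambda>n. nrm A (?S n \<ominus>\<^bsub>A\<^esub> z) * nrm L h) \<longlonglongrightarrow> 0"
        using tendsto_mult_right[OF lim, of "nrm L h"] by simp
      have "cmod (?S n h s - z h s) \<le> nrm A (?S n \<ominus>\<^bsub>A\<^esub> z) * nrm L h" for n
      proof -
        note d = PF_minus[OF SA[of n] zA]
        have dB: "?S n \<ominus>\<^bsub>A\<^esub> z \<in> carrier B" by (rule PF_B[OF d(2)])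
        have "(?S n \<ominus>\<^bsub>A\<^esub> z) h s = ?S n h s - z h s"
          unfolding d(1) P.bounded_maps_minus_apply[OF PF_B[OF SA[of n]] PF_B[OF zA]]
            lp_minus[OF p01(2) P.bounded_maps_value[OF PF_B[OF SA[of n]]] P.bounded_maps_value[OF PF_B[OF zA]]] ..
        then show ?thesis
          using order_trans[OF lp_coordinate_le[OF p01(1) P.bounded_maps_value[OF dB], of h s] P.nrm_apply_le[OF dB h]] by simp
      qed
      then show "\<forall>\<^sub>F n in sequentially. norm (?S n h s - z h s) \<le> nrm A (?S n \<ominus>\<^bsub>A\<^esub> z) * nrm L h"
        by (intro always_eventually allI)
    qed
    then have "(\<lambda>n. ?S n h s) \<longlonglongrightarrow> z h s" by (rule LIM_zero_cancel)
    moreover have "?S n h s = (\<Sum>k<n. matrix_form h s (a k) (b k))" for n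
      unfolding finsum_apply[OF cA] by (simp add: matrix_form_def)
    ultimately have "(\<lambda>n. matrix_form h s (a n) (b n)) sums z h s" by (simp add: sums_def)
    from sums_unique2[OF this A.Sq.tensor_series_sums[OF ab(1) matrix_form_bilinear[OF h]]]
    show ?thesis by (simp only: ab(2))
  qed
  have unique: "z = z'" if "P z" "P z'" for z z'
  proof (intro ext)
    fix h s
    have "z \<in> carrier B" "z' \<in> carrier B" using that PF_B unfolding P_def by blast+
    then show "z h s = z' h s"
      using val[OF that(1)] val[OF that(2)] bounded_mapsD(2)[of z L L h] bounded_mapsD(2)[of z' L L h]
      by (cases "h \<in> carrier L") simp_all
  qed
  obtain a b where ab: "(a, b) \<in> tensor_sequences A A" "M = tensor_series A A a b" by (rule A.Sq.PT_cases[OF M])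
  note s = A.Sq.tensor_sequencesD[OF ab(1)]
  have cA: "a n \<otimes>\<^bsub>A\<^esub> b n \<in> carrier A" for n using s(1,2) A.mult_closed by blast
  have "summable (\<lambda>n. nrm A (a n \<otimes>\<^bsub>A\<^esub> b n))"
  proof (rule summable_comparison_test'[OF s(3)])
    show "norm (nrm A (a n \<otimes>\<^bsub>A\<^esub> b n)) \<le> nrm A (a n) * nrm A (b n)" for n
      using A.nrm_mult[OF s(1,2), of n n] A.nrm_nonneg[OF cA, of n] by simp
  qed
  then obtain z where "nconv A (\<lambda>n. \<Oplus>\<^bsub>A\<^esub>k\<in>{..<n}. a k \<otimes>\<^bsub>A\<^esub> b k) z"
    using A.summable_nconv[of "\<lambda>n. a n \<otimes>\<^bsub>A\<^esub> b n"] cA by blast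
  then have z: "P z" unfolding P_def nconv_def using ab by blast
  have "tensor_product_map A M = (THE z. P z)" by (simp only: tensor_product_map_def P_def)
  also have "\<dots> = z" using z unique by blast
  finally have eq: "tensor_product_map A M = z" .
  show "tensor_product_map A M \<in> carrier A" using z by (simp add: eq P_def)
  show "h \<in> carrier L \<Longrightarrow> tensor_product_map A M h s = M (matrix_form h s)"
    unfolding eq by (rule val[OF z])
qed

lemma lam_delta: "lam G p \<one> (delta \<one>) \<one> = 1"
  using delta_lp[OF one_closed] by (simp add: lam_one) (simp add: delta_def)

text \<open>The functional \<open>m\<close> evaluates a term \<open>M\<close> of the approximate
  diagonal at coefficient forms. Near-commutation of \<open>M\<close> with translations gives almost
  invariance, and the product condition controls the value at 1.\<close>

theorem amenable_if_pseudo_amenable: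
  assumes pa: "pseudo_amenable A"
  shows "amenable_group G"
proof (rule amenable_if_almost_invariant)
  fix S and \<epsilon> :: real assume S: "finite S" "S \<subseteq> carrier G" and \<epsilon>: "\<epsilon> > 0"
  let ?e = "lam G p \<one>" and ?T = "tensor_square A"
  let ?c = "\<lambda>a M. lact ?T a M \<ominus>\<^bsub>?T\<^esub> ract ?T M a"
  obtain F where F: "F \<noteq> bot" "\<forall>\<^sub>F M in F. M \<in> carrier ?T"
    "\<And>a. a \<in> carrier A \<Longrightarrow> ((\<lambda>M. nrm ?T (?c a M)) \<longlongrightarrow> 0) F"
    "\<And>a. a \<in> carrier A \<Longrightarrow> ((\<lambda>M. nrm A (a \<otimes>\<^bsub>A\<^esub> tensor_product_map A M \<ominus>\<^bsub>A\<^esub> a)) \<longlongrightarrow> 0) F"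
    using pa unfolding pseudo_amenable_def by blast
  have "\<forall>\<^sub>F M in F. \<forall>g\<in>S. nrm ?T (?c (lam G p g) M) < \<epsilon>"
    using S \<epsilon> F(3) by (intro eventually_ball_finite ballI order_tendstoD(2)[where y = 0]) auto
  \<comment> \<open>Taken at the unit, the product condition places the product of \<open>M\<close>
    within \<open>1 / 2\<close> of the unit, hence \<open>m 1\<close> within \<open>1 / 2\<close> of
    1.\<close>
  moreover have "\<forall>\<^sub>F M in F. nrm A (?e \<otimes>\<^bsub>A\<^esub> tensor_product_map A M \<ominus>\<^bsub>A\<^esub> ?e) < 1 / 2"
    by (rule order_tendstoD(2)[OF F(4)[OF one_PF(1)]]) simp
  ultimately have "\<forall>\<^sub>F M in F. M \<in> carrier ?T \<and> (\<forall>g\<in>S. nrm ?T (?c (lam G p g) M) < \<epsilon>) \<and>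
      nrm A (?e \<otimes>\<^bsub>A\<^esub> tensor_product_map A M \<ominus>\<^bsub>A\<^esub> ?e) < 1 / 2"
    using F(2) by (intro eventually_conj)
  then obtain M where M: "M \<in> carrier AA" "\<And>g. g \<in> S \<Longrightarrow> nrm AA (?c (lam G p g) M) < \<epsilon>"
    and piM: "nrm A (?e \<otimes>\<^bsub>A\<^esub> tensor_product_map A M \<ominus>\<^bsub>A\<^esub> ?e) < 1 / 2"
    using eventually_happens'[OF F(1)] unfolding A.tensor_square_simps by blast
  define m where "m = (\<lambda>f. M (coefficient_form f))"
  have cf: "coefficient_form f \<in> bforms" if "f \<in> carrier (linf G)" for f
    by (rule BF_bilinear[OF coefficient_form_BF(1)[OF that]])
  have cf_bd: "cmod (coefficient_form f a b) \<le> nrm (linf G) f * nrm A a * nrm A b"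
    if f: "f \<in> carrier (linf G)" and ab: "a \<in> carrier A" "b \<in> carrier A" for f a b
    using order_trans[OF U.formsD(7)[OF coefficient_form_BF(1)[OF f] ab]] coefficient_form_BF(2)[OF f]
      A.nrm_nonneg[OF ab(1)] A.nrm_nonneg[OF ab(2)] by (meson mult_right_mono)
  have nn: "0 \<le> nrm (linf G) f" if "f \<in> carrier (linf G)" for f
    using order_trans[OF norm_ge_zero linf_coordinate_le[OF that]] .
  have "almost_invariant G S \<epsilon> m"
    unfolding almost_invariant_def
  proof (intro conjI ballI allI)
    show "m (\<lambda>s. f s + h s) = m f + m h" if fh: "f \<in> carrier (linf G)" "h \<in> carrier (linf G)" for f h
    proof -
      have "coefficient_form (\<lambda>s. f s + h s) = (\<lambda>a b. coefficient_form f a b + coefficient_form h a b)"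
        using coefficient_form_add[OF fh] by (intro ext)
      then show ?thesis
        using A.Sq.PT_form_add[OF M(1) cf[OF fh(1)] cf[OF fh(2)]] by (simp add: m_def)
    qed
    show "m (\<lambda>s. c * f s) = c * m f" if f: "f \<in> carrier (linf G)" for c f
    proof -
      have "coefficient_form (\<lambda>s. c * f s) = (\<lambda>a b. c * coefficient_form f a b)"
        using coefficient_form_smult[OF f] by (intro ext)
      then show ?thesis
        using A.Sq.PT_form_smult[OF M(1) cf[OF f], of c] by (simp add: m_def)
    qed
    show "\<exists>K\<ge>0. \<forall>f\<in>carrier (linf G). cmod (m f) \<le> K * nrm (linf G) f"
    proof (intro exI[of _ "nrm AA M"] conjI ballI A.Sq.PT_nrm_nonneg M)
      fix f assume f: "f \<in> carrier (linf G)"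
      show "cmod (m f) \<le> nrm AA M * nrm (linf G) f"
        using A.Sq.PT_apply_le[OF M(1) cf[OF f] nn[OF f] cf_bd[OF f]] by (simp add: m_def mult.commute)
    qed
    have d: "delta \<one> \<in> carrier L" by (simp add: delta_lp)
    have "m (const_one G) = M (matrix_form (delta \<one>) \<one>)"
      unfolding m_def
      by (rule A.Sq.PT_cong[OF M(1) cf[OF const_one_linf] matrix_form_bilinear[OF d]])
        (simp add: coefficient_form_one matrix_form_def)
    also have "\<dots> = tensor_product_map A M (delta \<one>) \<one>"
      using tensor_product_map_spec(2)[OF M(1) d] by simp
    finally have m1: "m (const_one G) = tensor_product_map A M (delta \<one>) \<one>" .
    let ?z = "tensor_product_map A M"
    have z: "?z \<in> carrier A" by (rule tensor_product_map_spec(1)[OF M(1)])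
    have ez: "?e \<otimes>\<^bsub>A\<^esub> ?z = ?z" using one_PF(2)[OF z] by simp
    note dd = PF_minus[OF z one_PF(1)]
    have "cmod ((?z \<ominus>\<^bsub>A\<^esub> ?e) (delta \<one>) \<one>) \<le> nrm B (?z \<ominus>\<^bsub>A\<^esub> ?e) * nrm L (delta \<one>)"
      using order_trans[OF lp_coordinate_le[OF p01(1) P.bounded_maps_value[OF PF_B[OF dd(2)]]] P.nrm_apply_le[OF PF_B[OF dd(2)] d]] .
    also have "\<dots> \<le> nrm B (?z \<ominus>\<^bsub>A\<^esub> ?e) * 1"
      by (intro mult_left_mono delta_lp P.bounded_maps_nrm_nonneg PF_B dd) simp
    also have "\<dots> < 1 / 2" using piM by (simp only: ez) simp
    also have "(?z \<ominus>\<^bsub>A\<^esub> ?e) (delta \<one>) \<one> = ?z (delta \<one>) \<one> - 1"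
      unfolding dd(1) P.bounded_maps_minus_apply[OF PF_B[OF z] PF_B[OF one_PF(1)]]
        lp_minus[OF p01(2) P.bounded_maps_value[OF PF_B[OF z]] P.bounded_maps_value[OF PF_B[OF one_PF(1)]]]
      by (simp add: lam_delta)
    finally have "cmod (m (const_one G) - 1) < 1 / 2" by (simp add: m1)
    then show "1 / 2 \<le> cmod (m (const_one G))"
      using norm_triangle_ineq2[of 1 "1 - m (const_one G)"] by (simp add: norm_minus_commute)
    fix g f assume g': "g \<in> S" and f: "f \<in> carrier (linf G)"
    have g: "g \<in> carrier G" using g' S by auto
    let ?g = "lam G p g" and ?g' = "lam G p (inv g)"
    have lg: "?g \<in> carrier A" "?g' \<in> carrier A" using g by auto
    \<comment> \<open>Inserting \<open>inv g\<close> on the right makes the commutator of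
      \<open>M\<close> with \<open>g\<close> take the value
      \<open>m (left_shift G g f) - m f\<close> at this form: one action completes the shift, the
      other cancels the inserted element.\<close>
    define \<psi> where "\<psi> = (\<lambda>a b. coefficient_form f a (b \<circ> ?g'))"
    have \<psi>: "\<psi> \<in> bforms" using A.form_ract[OF cf[OF f] lg(2)] by (simp add: \<psi>_def)
    have \<psi>_bd: "cmod (\<psi> a b) \<le> nrm (linf G) f * nrm A a * nrm A b" if ab: "a \<in> carrier A" "b \<in> carrier A" for a b
    proof -
      have "cmod (\<psi> a b) \<le> nrm (linf G) f * nrm A a * nrm A (b \<circ> ?g')"
        unfolding \<psi>_def by (intro cf_bd f ab PF_mult lg)
      also have "nrm A (b \<circ> ?g') \<le> nrm A b * nrm A ?g'" using A.nrm_mult[OF ab(2) lg(2)] by simp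
      also have "nrm A b * nrm A ?g' \<le> nrm A b * 1"
        using lam_nrm[of "inv g"] g A.nrm_nonneg[OF ab(2)] by (intro mult_left_mono) auto
      finally show ?thesis using nn[OF f] A.nrm_nonneg[OF ab(1)] by (simp add: mult_left_mono)
    qed
    have "lact ?T ?g M \<psi> = m (left_shift G g f)"
      unfolding m_def A.tensor_square_simps(6) using \<psi>
      by (simp only: if_True, intro A.Sq.PT_cong[OF M(1) A.form_lact[OF \<psi> lg(1)] cf[OF left_shift_linf[OF f g]]])
        (simp add: \<psi>_def coefficient_form_shift[OF f _ _ g])
    moreover have "ract ?T M ?g \<psi> = m f"
      unfolding m_def A.tensor_square_simps(7) using \<psi>
      by (simp only: if_True, intro A.Sq.PT_cong[OF M(1) A.form_ract[OF \<psi> lg(1)] cf[OF f]])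
        (simp add: \<psi>_def o_assoc[symmetric] lam_right_inv[OF g] one_PF)
    ultimately have eq: "m (left_shift G g f) - m f = ?c ?g M \<psi>"
      using A.tensor_square_minus[OF A.lact_tensor(1)[OF M(1) lg(1)] A.ract_tensor(1)[OF M(1) lg(1)]] by simp
    have "cmod (m (left_shift G g f) - m f) \<le> nrm (linf G) f * nrm AA (?c ?g M)"
      unfolding eq
    proof (rule A.Sq.PT_apply_le[OF _ \<psi> nn[OF f] \<psi>_bd])
      interpret N: complex_normed_space ?T
        by (rule complex_normed_space_cong[OF A.Sq.PT_normed]) (simp_all add: A.tensor_square_simps)
      show "?c ?g M \<in> carrier AA"
        using N.minus_mem[of "lact ?T ?g M" "ract ?T M ?g"] A.lact_tensor(1)[OF M(1) lg(1)] A.ract_tensor(1)[OF M(1) lg(1)]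
        by (simp only: A.tensor_square_simps(1))
    qed
    also have "\<dots> \<le> nrm (linf G) f * \<epsilon>"
      by (rule mult_left_mono[OF less_imp_le[OF M(2)[OF g']] nn[OF f]])
    also have "\<dots> = \<epsilon> * nrm (linf G) f" by (rule mult.commute)
    finally show "cmod (m (left_shift G g f) - m f) \<le> \<epsilon> * nrm (linf G) f" .
  qed
  then show "\<exists>m. almost_invariant G S \<epsilon> m" by (rule exI[of _ m])
qed

section \<open>An approximate diagonal built from almost invariant probabilities\<close>

definition group_tensor :: "'g set \<Rightarrow> ('g \<Rightarrow> real) \<Rightarrow> ('g operator, 'g operator) tensor" where
  "group_tensor F \<phi> = (\<lambda>\<psi>. if \<psi> \<in> bforms then
     \<Sum>s\<in>F. \<psi> (complex_of_real (\<phi> s) \<odot>\<^bsub>A\<^esub> lam G p s) (lam G p (inv s)) else 0)"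

text \<open>Written pointwise on forms, where linearity in the algebra element can be computed
  directly; \<open>commutator_eq\<close> identifies it with the difference in the tensor
  square.\<close>

definition commutator :: "'g operator \<Rightarrow> ('g operator, 'g operator) tensor \<Rightarrow> ('g operator, 'g operator) tensor" where
  "commutator a M = (\<lambda>\<psi>. lact (tensor_square A) a M \<psi> - ract (tensor_square A) M a \<psi>)"

lemma commutator_eq:
  assumes "M \<in> carrier AA" "a \<in> carrier A"
  shows "lact (tensor_square A) a M \<ominus>\<^bsub>tensor_square A\<^esub> ract (tensor_square A) M a = commutator a M"
    "commutator a M \<in> carrier AA"
    "nrm AA (commutator a M) \<le> 2 * nrm A a * nrm AA M"
proof -
  note l = A.lact_tensor[OF assms] and r = A.ract_tensor[OF assms]
  interpret N: complex_normed_space "tensor_square A"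
    by (rule complex_normed_space_cong[OF A.Sq.PT_normed]) (simp_all add: A.tensor_square_simps)
  show eq: "lact (tensor_square A) a M \<ominus>\<^bsub>tensor_square A\<^esub> ract (tensor_square A) M a = commutator a M"
    by (simp add: A.tensor_square_minus[OF l(1) r(1)] commutator_def)
  show "commutator a M \<in> carrier AA"
    using N.minus_mem[of "lact (tensor_square A) a M" "ract (tensor_square A) M a"] l(1) r(1)
    by (simp only: A.tensor_square_simps(1) eq)
  have "nrm (tensor_square A) (commutator a M) \<le> nrm (tensor_square A) (lact (tensor_square A) a M) + nrm (tensor_square A) (ract (tensor_square A) M a)"
    using N.nrm_minus_le[of "lact (tensor_square A) a M" "ract (tensor_square A) M a"] l(1) r(1)
    by (simp only: A.tensor_square_simps(1) eq)
  then show "nrm AA (commutator a M) \<le> 2 * nrm A a * nrm AA M"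
    using l(2) r(2) by (simp add: A.tensor_square_simps(5))
qed

lemma commutator_add:
  assumes M: "M \<in> carrier AA" and a: "a \<in> carrier A" and b: "b \<in> carrier A"
  shows "commutator (a \<oplus>\<^bsub>A\<^esub> b) M = (\<lambda>\<psi>. commutator a M \<psi> + commutator b M \<psi>)"
proof
  fix \<psi>
  have ab: "a \<oplus>\<^bsub>A\<^esub> b \<in> carrier A" by (rule A.M.a_closed[OF a b])
  show "commutator (a \<oplus>\<^bsub>A\<^esub> b) M \<psi> = commutator a M \<psi> + commutator b M \<psi>"
  proof (cases "\<psi> \<in> bforms")
    case True
    note D = A.Sq.bilinearD[OF True] and l = A.form_lact[OF True] and r = A.form_ract[OF True]
    have "M (\<lambda>x y. \<psi> ((a \<oplus>\<^bsub>A\<^esub> b) \<otimes>\<^bsub>A\<^esub> x) y) = M (\<lambda>x y. \<psi> (a \<otimes>\<^bsub>A\<^esub> x) y + \<psi> (b \<otimes>\<^bsub>A\<^esub> x) y)"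
      by (rule A.Sq.PT_cong[OF M l[OF ab] A.Sq.forms_add[OF l[OF a] l[OF b]]])
        (simp only: A.mult_distrib_right[OF a b] D(1) A.mult_closed a b)
    moreover have "M (\<lambda>x y. \<psi> x (y \<otimes>\<^bsub>A\<^esub> (a \<oplus>\<^bsub>A\<^esub> b))) = M (\<lambda>x y. \<psi> x (y \<otimes>\<^bsub>A\<^esub> a) + \<psi> x (y \<otimes>\<^bsub>A\<^esub> b))"
      by (rule A.Sq.PT_cong[OF M r[OF ab] A.Sq.forms_add[OF r[OF a] r[OF b]]])
        (simp only: A.mult_distrib_left[OF _ a b] D(2) A.mult_closed a b)
    ultimately show ?thesis
      unfolding commutator_def A.tensor_square_simps
      using True by (simp only: A.Sq.PT_form_add[OF M l[OF a] l[OF b]] A.Sq.PT_form_add[OF M r[OF a] r[OF b]]) simp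
  qed (simp add: commutator_def A.tensor_square_simps)
qed

lemma commutator_smult:
  assumes M: "M \<in> carrier AA" and a: "a \<in> carrier A"
  shows "commutator (c \<odot>\<^bsub>A\<^esub> a) M = (\<lambda>\<psi>. c * commutator a M \<psi>)"
proof
  fix \<psi>
  have ca: "c \<odot>\<^bsub>A\<^esub> a \<in> carrier A" by (rule A.smult_mem[OF a])
  show "commutator (c \<odot>\<^bsub>A\<^esub> a) M \<psi> = c * commutator a M \<psi>"
  proof (cases "\<psi> \<in> bforms")
    case True
    note D = A.Sq.bilinearD[OF True] and l = A.form_lact[OF True] and r = A.form_ract[OF True]
    have "M (\<lambda>x y. \<psi> ((c \<odot>\<^bsub>A\<^esub> a) \<otimes>\<^bsub>A\<^esub> x) y) = M (\<lambda>x y. c * \<psi> (a \<otimes>\<^bsub>A\<^esub> x) y)"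
      by (rule A.Sq.PT_cong[OF M l[OF ca] A.Sq.forms_smult[OF l[OF a]]])
        (simp only: A.mult_smult_left[OF a] D(3) A.mult_closed a)
    moreover have "M (\<lambda>x y. \<psi> x (y \<otimes>\<^bsub>A\<^esub> (c \<odot>\<^bsub>A\<^esub> a))) = M (\<lambda>x y. c * \<psi> x (y \<otimes>\<^bsub>A\<^esub> a))"
      by (rule A.Sq.PT_cong[OF M r[OF ca] A.Sq.forms_smult[OF r[OF a]]])
        (simp only: A.mult_smult_right[OF _ a] D(4) A.mult_closed a)
    ultimately show ?thesis
      unfolding commutator_def A.tensor_square_simps
      using True by (simp only: A.Sq.PT_form_smult[OF M l[OF a]] A.Sq.PT_form_smult[OF M r[OF a]]) (simp add: right_diff_distrib)
  qed (simp add: commutator_def A.tensor_square_simps)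
qed

context
  fixes F \<phi>
  assumes \<phi>: "finite_probability G F \<phi>"
begin

lemma F: "finite F" "F \<subseteq> carrier G" "0 \<le> \<phi> s" "s \<notin> F \<Longrightarrow> \<phi> s = 0" "sum \<phi> F = 1"
  using \<phi> by (auto simp: finite_probability_def)

lemma group_tensor_AA: "group_tensor F \<phi> \<in> carrier AA" "nrm AA (group_tensor F \<phi>) \<le> 1"
proof -
  have s: "s \<in> carrier G" if "s \<in> F" for s using that F(2) by auto
  have m: "complex_of_real (\<phi> s) \<odot>\<^bsub>A\<^esub> lam G p s \<in> carrier A" "lam G p (inv s) \<in> carrier A" if "s \<in> F" for s
    using A.smult_mem[OF lam_PF[OF s[OF that]]] s[OF that] by auto
  have "(\<Sum>s\<in>F. nrm A (complex_of_real (\<phi> s) \<odot>\<^bsub>A\<^esub> lam G p s) * nrm A (lam G p (inv s))) \<le> (\<Sum>s\<in>F. \<phi> s)"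
  proof (rule sum_mono)
    fix s assume sF: "s \<in> F"
    have "nrm A (complex_of_real (\<phi> s) \<odot>\<^bsub>A\<^esub> lam G p s) = \<phi> s * nrm A (lam G p s)"
      using A.nrm_smult[OF lam_PF[OF s[OF sF]]] F(3) by simp
    also have "\<dots> * nrm A (lam G p (inv s)) \<le> (\<phi> s * 1) * 1"
      using lam_nrm[OF s[OF sF]] lam_nrm[OF inv_closed[OF s[OF sF]]] F(3) A.nrm_nonneg[OF lam_PF[OF s[OF sF]]]
        A.nrm_nonneg[OF lam_PF[OF inv_closed[OF s[OF sF]]]]
      by (intro mult_mono mult_left_mono) auto
    finally show "nrm A (complex_of_real (\<phi> s) \<odot>\<^bsub>A\<^esub> lam G p s) * nrm A (lam G p (inv s)) \<le> \<phi> s" by simp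
  qed
  then show "group_tensor F \<phi> \<in> carrier AA" "nrm AA (group_tensor F \<phi>) \<le> 1"
    using A.Sq.finite_tensor[OF F(1), of "\<lambda>s. complex_of_real (\<phi> s) \<odot>\<^bsub>A\<^esub> lam G p s" "\<lambda>s. lam G p (inv s)"] m F(5)
    unfolding group_tensor_def by (auto simp del: PF_simps)
qed

text \<open>Each pair of factors multiplies to the unit and the weights add up to 1, so the product
  condition for an approximate diagonal holds exactly.\<close>

lemma group_tensor_product: "tensor_product_map A (group_tensor F \<phi>) = lam G p \<one>"
proof (intro ext)
  fix h s
  show "tensor_product_map A (group_tensor F \<phi>) h s = lam G p \<one> h s"
  proof (cases "h \<in> carrier L")
    case True
    have "tensor_product_map A (group_tensor F \<phi>) h s =
        (\<Sum>t\<in>F. matrix_form h s (complex_of_real (\<phi> t) \<odot>\<^bsub>A\<^esub> lam G p t) (lam G p (inv t)))"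
      using tensor_product_map_spec(2)[OF group_tensor_AA(1) True, of s] matrix_form_bilinear[OF True, of s]
      by (simp add: group_tensor_def)
    also have "\<dots> = (\<Sum>t\<in>F. complex_of_real (\<phi> t) * h s)"
    proof (rule sum.cong[OF refl])
      fix t assume "t \<in> F"
      then have t: "t \<in> carrier G" using F(2) by auto
      have "lam G p t (lam G p (inv t) h) = h"
        using fun_cong[OF lam_right_inv[OF t], of h] True by (simp add: lam_one)
      then show "matrix_form h s (complex_of_real (\<phi> t) \<odot>\<^bsub>A\<^esub> lam G p t) (lam G p (inv t)) = complex_of_real (\<phi> t) * h s"
        by (simp add: matrix_form_def)
    qed
    also have "\<dots> = complex_of_real (sum \<phi> F) * h s" by (simp add: sum_distrib_right)
    finally show ?thesis using True F(5) by (simp add: lam_one)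
  next
    case False
    then show ?thesis
      using bounded_mapsD(2)[OF PF_B[OF tensor_product_map_spec(1)[OF group_tensor_AA(1)]]] by (simp add: lam_one)
  qed
qed

text \<open>With \<open>t = g \<otimes> s\<close>, both products become sums over the tensors
  \<open>\<lambda> t \<otimes> \<lambda> (t\<inverse> g)\<close>, with weights
  \<open>\<phi> (g\<inverse> t)\<close> and \<open>\<phi> t\<close>. As translations have norm at
  most 1, the \<open>\<ell>^1\<close> distance of the weights bounds the norm.\<close>

lemma group_tensor_commutator:
  assumes g: "g \<in> carrier G"
    and inv: "\<And>T. \<lbrakk>finite T; T \<subseteq> carrier G\<rbrakk> \<Longrightarrow> (\<Sum>s\<in>T. \<bar>\<phi> (inv g \<otimes> s) - \<phi> s\<bar>) \<le> \<delta>"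
  shows "nrm AA (commutator (lam G p g) (group_tensor F \<phi>)) \<le> \<delta>"
proof -
  define gF where "gF = (\<lambda>s. g \<otimes> s) ` F"
  \<comment> \<open>The supports of both weight functions lie in this set, so the two sums can be
    subtracted termwise.\<close>
  define T where "T = F \<union> gF"
  have T: "finite T" "T \<subseteq> carrier G" using F g by (auto simp: T_def gF_def)
  let ?x = "\<lambda>t. complex_of_real (\<phi> (inv g \<otimes> t) - \<phi> t) \<odot>\<^bsub>A\<^esub> lam G p t" and ?y = "\<lambda>t. lam G p (inv t \<otimes> g)"
  have Tc: "t \<in> carrier G" "inv t \<otimes> g \<in> carrier G" if "t \<in> T" for t using T that g by auto
  have xy: "?x t \<in> carrier A" "?y t \<in> carrier A" if "t \<in> T" for t
    using A.smult_mem[OF lam_PF[OF Tc(1)[OF that]]] lam_PF[OF Tc(2)[OF that]] by auto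
  have eq: "commutator (lam G p g) (group_tensor F \<phi>) = (\<lambda>\<psi>. if \<psi> \<in> bforms then \<Sum>t\<in>T. \<psi> (?x t) (?y t) else 0)"
  proof
    fix \<psi>
    show "commutator (lam G p g) (group_tensor F \<phi>) \<psi> = (if \<psi> \<in> bforms then \<Sum>t\<in>T. \<psi> (?x t) (?y t) else 0)"
    proof (cases "\<psi> \<in> bforms")
      case True
      note D = A.Sq.bilinearD[OF True]
      define k where "k = (\<lambda>t. \<psi> (lam G p t) (lam G p (inv t \<otimes> g)))"
      have Fc: "s \<in> carrier G" if "s \<in> F" for s using F(2) that by auto
      have "lact (tensor_square A) (lam G p g) (group_tensor F \<phi>) \<psi> =
          (\<Sum>s\<in>F. \<psi> (lam G p g \<otimes>\<^bsub>A\<^esub> (complex_of_real (\<phi> s) \<odot>\<^bsub>A\<^esub> lam G p s)) (lam G p (inv s)))"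
        unfolding A.tensor_square_simps(6) group_tensor_def
        using True A.form_lact[OF True lam_PF[OF g]] by simp
      also have "\<dots> = (\<Sum>s\<in>F. complex_of_real (\<phi> s) * k (g \<otimes> s))"
      proof (rule sum.cong[OF refl])
        fix s assume "s \<in> F"
        then have s: "s \<in> carrier G" by (rule Fc)
        have "lam G p g \<otimes>\<^bsub>A\<^esub> (complex_of_real (\<phi> s) \<odot>\<^bsub>A\<^esub> lam G p s) = complex_of_real (\<phi> s) \<odot>\<^bsub>A\<^esub> lam G p (g \<otimes> s)"
          using A.mult_smult_right[OF lam_PF[OF g] lam_PF[OF s], of "complex_of_real (\<phi> s)"] lam_mult[OF g s] by simp
        moreover have "inv (g \<otimes> s) \<otimes> g = inv s" using g s by (simp add: inv_mult_group m_assoc)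
        ultimately show "\<psi> (lam G p g \<otimes>\<^bsub>A\<^esub> (complex_of_real (\<phi> s) \<odot>\<^bsub>A\<^esub> lam G p s)) (lam G p (inv s)) = complex_of_real (\<phi> s) * k (g \<otimes> s)"
          using D(3)[OF lam_PF lam_PF, of "g \<otimes> s" "inv s"] g s by (simp add: k_def del: PF_simps)
      qed
      also have "\<dots> = (\<Sum>t\<in>gF. complex_of_real (\<phi> (inv g \<otimes> t)) * k t)"
        unfolding gF_def
      proof (subst sum.reindex)
        show "inj_on (\<lambda>s. g \<otimes> s) F" using g Fc by (auto intro: inj_onI)
        show "(\<Sum>s\<in>F. complex_of_real (\<phi> s) * k (g \<otimes> s)) = sum ((\<lambda>t. complex_of_real (\<phi> (inv g \<otimes> t)) * k t) \<circ> (\<lambda>s. g \<otimes> s)) F"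
          using g Fc by (intro sum.cong) (auto simp flip: m_assoc)
      qed
      also have "\<dots> = (\<Sum>t\<in>T. complex_of_real (\<phi> (inv g \<otimes> t)) * k t)"
      proof (rule sum.mono_neutral_left[OF T(1)])
        show "\<forall>t\<in>T - gF. complex_of_real (\<phi> (inv g \<otimes> t)) * k t = 0"
        proof
          fix t assume t: "t \<in> T - gF"
          have "inv g \<otimes> t \<notin> F"
          proof
            assume "inv g \<otimes> t \<in> F"
            then have "g \<otimes> (inv g \<otimes> t) \<in> gF" by (auto simp: gF_def)
            then show False using t g Tc(1)[of t] by (simp flip: m_assoc)
          qed
          then show "complex_of_real (\<phi> (inv g \<otimes> t)) * k t = 0" using F(4) by simp
        qed
      qed (auto simp: T_def)
      finally have l: "lact (tensor_square A) (lam G p g) (group_tensor F \<phi>) \<psi> = (\<Sum>t\<in>T. complex_of_real (\<phi> (inv g \<otimes> t)) * k t)" .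
      have "ract (tensor_square A) (group_tensor F \<phi>) (lam G p g) \<psi> =
          (\<Sum>s\<in>F. \<psi> (complex_of_real (\<phi> s) \<odot>\<^bsub>A\<^esub> lam G p s) (lam G p (inv s) \<otimes>\<^bsub>A\<^esub> lam G p g))"
        unfolding A.tensor_square_simps(7) group_tensor_def
        using True A.form_ract[OF True lam_PF[OF g]] by simp
      also have "\<dots> = (\<Sum>s\<in>F. complex_of_real (\<phi> s) * k s)"
      proof (rule sum.cong[OF refl])
        fix s assume "s \<in> F"
        then have s: "s \<in> carrier G" by (rule Fc)
        have "lam G p (inv s) \<otimes>\<^bsub>A\<^esub> lam G p g = lam G p (inv s \<otimes> g)" using lam_mult[OF inv_closed[OF s] g] by simp
        then show "\<psi> (complex_of_real (\<phi> s) \<odot>\<^bsub>A\<^esub> lam G p s) (lam G p (inv s) \<otimes>\<^bsub>A\<^esub> lam G p g) = complex_of_real (\<phi> s) * k s"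
          using D(3)[OF lam_PF lam_PF, of s "inv s \<otimes> g"] g s by (simp add: k_def del: PF_simps)
      qed
      also have "\<dots> = (\<Sum>t\<in>T. complex_of_real (\<phi> t) * k t)"
        using F(4) by (intro sum.mono_neutral_left[OF T(1)]) (auto simp: T_def)
      finally have r: "ract (tensor_square A) (group_tensor F \<phi>) (lam G p g) \<psi> = (\<Sum>t\<in>T. complex_of_real (\<phi> t) * k t)" .
      have "(\<Sum>t\<in>T. \<psi> (?x t) (?y t)) = (\<Sum>t\<in>T. complex_of_real (\<phi> (inv g \<otimes> t) - \<phi> t) * k t)"
        by (intro sum.cong refl) (use D(3)[OF lam_PF[OF Tc(1)] lam_PF[OF Tc(2)]] in \<open>simp add: k_def del: PF_simps\<close>)
      then show ?thesis
        using True by (simp add: commutator_def l r left_diff_distrib sum_subtractf)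
    qed (simp add: commutator_def A.tensor_square_simps)
  qed
  have "nrm AA (commutator (lam G p g) (group_tensor F \<phi>)) \<le> (\<Sum>t\<in>T. nrm A (?x t) * nrm A (?y t))"
    unfolding eq using A.Sq.finite_tensor[OF T(1), of ?x ?y] xy by blast
  also have "\<dots> \<le> (\<Sum>t\<in>T. \<bar>\<phi> (inv g \<otimes> t) - \<phi> t\<bar>)"
  proof (rule sum_mono)
    fix t assume t: "t \<in> T"
    have "nrm A (?x t) = \<bar>\<phi> (inv g \<otimes> t) - \<phi> t\<bar> * nrm A (lam G p t)"
      using A.nrm_smult[OF lam_PF[OF Tc(1)[OF t]], of "complex_of_real (\<phi> (inv g \<otimes> t) - \<phi> t)"]
      by (simp only: norm_of_real)
    also have "\<dots> * nrm A (?y t) \<le> (\<bar>\<phi> (inv g \<otimes> t) - \<phi> t\<bar> * 1) * 1"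
      using lam_nrm[OF Tc(1)[OF t]] lam_nrm[OF Tc(2)[OF t]] A.nrm_nonneg[OF lam_PF[OF Tc(1)[OF t]]] A.nrm_nonneg[OF lam_PF[OF Tc(2)[OF t]]]
      by (intro mult_mono mult_left_mono) auto
    finally show "nrm A (?x t) * nrm A (?y t) \<le> \<bar>\<phi> (inv g \<otimes> t) - \<phi> t\<bar>" by simp
  qed
  also have "\<dots> \<le> \<delta>" by (rule inv[OF T])
  finally show ?thesis .
qed

end

definition almost_fixed :: "'g set \<Rightarrow> real \<Rightarrow> 'g set \<Rightarrow> ('g \<Rightarrow> real) \<Rightarrow> bool" where
  "almost_fixed S \<delta> F \<phi> \<longleftrightarrow> finite_probability G F \<phi> \<and>
    (\<forall>g\<in>S. \<forall>T. finite T \<longrightarrow> T \<subseteq> carrier G \<longrightarrow> (\<Sum>s\<in>T. \<bar>\<phi> (inv g \<otimes> s) - \<phi> s\<bar>) \<le> \<delta>)"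

lemma almost_fixed_mono: "\<lbrakk>almost_fixed S \<delta> F \<phi>; S' \<subseteq> S; \<delta> \<le> \<delta>'\<rbrakk> \<Longrightarrow> almost_fixed S' \<delta>' F \<phi>"
  unfolding almost_fixed_def by (meson order_trans subsetD)

text \<open>The bound is uniform over all \<open>\<phi>\<close> that are invariant enough. Finitely
  many such requirements, for different elements, can thus be met by a single
  \<open>\<phi>\<close>.\<close>

definition nearly_central :: "'g set \<Rightarrow> real \<Rightarrow> real \<Rightarrow> 'g operator \<Rightarrow> bool" where
  "nearly_central S \<delta> \<epsilon> a \<longleftrightarrow> finite S \<and> S \<subseteq> carrier G \<and> \<delta> > 0 \<and>
    (\<forall>F \<phi>. almost_fixed S \<delta> F \<phi> \<longrightarrow> nrm AA (commutator a (group_tensor F \<phi>)) \<le> \<epsilon>)"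

lemma nearly_centralI:
  assumes "finite S" "S \<subseteq> carrier G" "\<delta> > 0"
    "\<And>F \<phi>. \<lbrakk>finite_probability G F \<phi>; almost_fixed S \<delta> F \<phi>\<rbrakk> \<Longrightarrow> nrm AA (commutator a (group_tensor F \<phi>)) \<le> \<epsilon>"
  shows "nearly_central S \<delta> \<epsilon> a"
  using assms by (simp add: nearly_central_def almost_fixed_def)

lemma nearly_centralD:
  assumes "nearly_central S \<delta> \<epsilon> a"
  shows "finite S" "S \<subseteq> carrier G" "\<delta> > 0"
    "almost_fixed S \<delta> F \<phi> \<Longrightarrow> nrm AA (commutator a (group_tensor F \<phi>)) \<le> \<epsilon>"
  using assms by (simp_all add: nearly_central_def)

text \<open>For a translation the tolerance itself serves as \<open>\<delta>\<close>; sums take the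
  union of the finite sets and the minimum of the tolerances. Limits work because all the group
  tensors have norm at most 1.\<close>

lemma PF_nearly_central:
  assumes "a \<in> carrier A"
  shows "\<forall>\<epsilon>>0. \<exists>S \<delta>. nearly_central S \<delta> \<epsilon> a"
  using assms
proof (induction a rule: PF_induct)
  case (lam g)
  have "nearly_central {g} \<epsilon> \<epsilon> (lam G p g)" if "\<epsilon> > 0" for \<epsilon>
    using that lam by (intro nearly_centralI group_tensor_commutator) (simp_all add: almost_fixed_def)
  then show ?case by blast
next
  case (add a b)
  show ?case
  proof (intro allI impI)
    fix \<epsilon> :: real assume "\<epsilon> > 0"
    then have e: "\<epsilon> / 2 > 0" by simp
    obtain S \<delta> where S: "nearly_central S \<delta> (\<epsilon> / 2) a" using add(3) e by blast
    obtain S' \<delta>' where S': "nearly_central S' \<delta>' (\<epsilon> / 2) b" using add(4) e by blast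
    have "nearly_central (S \<union> S') (min \<delta> \<delta>') \<epsilon> (a \<oplus>\<^bsub>A\<^esub> b)"
    proof (rule nearly_centralI)
      fix F \<phi> assume pr: "finite_probability G F \<phi>" and f: "almost_fixed (S \<union> S') (min \<delta> \<delta>') F \<phi>"
      note M = group_tensor_AA(1)[OF pr]
      have "nrm AA (commutator (a \<oplus>\<^bsub>A\<^esub> b) (group_tensor F \<phi>)) \<le>
          nrm AA (commutator a (group_tensor F \<phi>)) + nrm AA (commutator b (group_tensor F \<phi>))"
        unfolding commutator_add[OF M add(1,2)] by (intro A.Sq.PT_add_le commutator_eq M add(1,2))
      also have "\<dots> \<le> \<epsilon> / 2 + \<epsilon> / 2"
        by (intro add_mono nearly_centralD(4)[OF S] nearly_centralD(4)[OF S'] almost_fixed_mono[OF f]) auto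
      finally show "nrm AA (commutator (a \<oplus>\<^bsub>A\<^esub> b) (group_tensor F \<phi>)) \<le> \<epsilon>" by simp
    qed (use nearly_centralD(1-3)[OF S] nearly_centralD(1-3)[OF S'] in auto)
    then show "\<exists>S \<delta>. nearly_central S \<delta> \<epsilon> (a \<oplus>\<^bsub>A\<^esub> b)" by (intro exI)
  qed
next
  case (smult c a)
  show ?case
  proof (intro allI impI)
    fix \<epsilon> :: real assume "\<epsilon> > 0"
    have c: "cmod c + 1 > 0" by (intro add_nonneg_pos) auto
    then have "\<epsilon> / (cmod c + 1) > 0" using \<open>\<epsilon> > 0\<close> by (rule divide_pos_pos[rotated])
    then obtain S \<delta> where S: "nearly_central S \<delta> (\<epsilon> / (cmod c + 1)) a" using smult(2) by blast
    have "nearly_central S \<delta> \<epsilon> (c \<odot>\<^bsub>A\<^esub> a)"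
    proof (rule nearly_centralI)
      fix F \<phi> assume pr: "finite_probability G F \<phi>" and f: "almost_fixed S \<delta> F \<phi>"
      note M = group_tensor_AA(1)[OF pr]
      have "nrm AA (commutator (c \<odot>\<^bsub>A\<^esub> a) (group_tensor F \<phi>)) \<le> cmod c * nrm AA (commutator a (group_tensor F \<phi>))"
        unfolding commutator_smult[OF M smult(1)] by (intro A.Sq.PT_smult_le commutator_eq M smult(1))
      also have "\<dots> \<le> (cmod c + 1) * (\<epsilon> / (cmod c + 1))"
        by (intro mult_mono nearly_centralD(4)[OF S f] A.Sq.PT_nrm_nonneg commutator_eq M smult(1)) auto
      finally show "nrm AA (commutator (c \<odot>\<^bsub>A\<^esub> a) (group_tensor F \<phi>)) \<le> \<epsilon>" using c by simp
    qed (use nearly_centralD(1-3)[OF S] in auto)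
    then show "\<exists>S \<delta>. nearly_central S \<delta> \<epsilon> (c \<odot>\<^bsub>A\<^esub> a)" by (intro exI)
  qed
next
  case (limit a)
  show ?case
  proof (intro allI impI)
    fix \<epsilon> :: real assume "\<epsilon> > 0"
    then have "\<epsilon> / 4 > 0" "\<epsilon> / 2 > 0" by simp_all
    \<comment> \<open>The commutator with \<open>a - b\<close> costs at most twice the distance,
      that is \<open>\<epsilon> / 2\<close>; the other half is spent on \<open>b\<close>.\<close>
    then obtain b S \<delta> where b: "b \<in> carrier A" "nrm A (a \<ominus>\<^bsub>A\<^esub> b) < \<epsilon> / 4" and S: "nearly_central S \<delta> (\<epsilon> / 2) b"
      using limit(2) by blast
    have ab: "a \<ominus>\<^bsub>A\<^esub> b \<in> carrier A" by (rule A.minus_mem[OF limit(1) b(1)])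
    have "nearly_central S \<delta> \<epsilon> a"
    proof (rule nearly_centralI)
      fix F \<phi> assume pr: "finite_probability G F \<phi>" and f: "almost_fixed S \<delta> F \<phi>"
      note M = group_tensor_AA[OF pr]
      have "nrm AA (commutator a (group_tensor F \<phi>)) = nrm AA (commutator ((a \<ominus>\<^bsub>A\<^esub> b) \<oplus>\<^bsub>A\<^esub> b) (group_tensor F \<phi>))"
        by (simp only: A.minus_add_cancel[OF limit(1) b(1)])
      also have "\<dots> \<le> nrm AA (commutator (a \<ominus>\<^bsub>A\<^esub> b) (group_tensor F \<phi>)) + nrm AA (commutator b (group_tensor F \<phi>))"
        unfolding commutator_add[OF M(1) ab b(1)] by (intro A.Sq.PT_add_le commutator_eq M ab b(1))
      also have "nrm AA (commutator (a \<ominus>\<^bsub>A\<^esub> b) (group_tensor F \<phi>)) \<le> 2 * nrm A (a \<ominus>\<^bsub>A\<^esub> b) * nrm AA (group_tensor F \<phi>)"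
        by (rule commutator_eq(3)[OF M(1) ab])
      also have "\<dots> \<le> 2 * (\<epsilon> / 4) * 1"
        using b(2) M(2) A.nrm_nonneg[OF ab] A.Sq.PT_nrm_nonneg[OF M(1)] by (intro mult_mono) auto
      finally show "nrm AA (commutator a (group_tensor F \<phi>)) \<le> \<epsilon>" using nearly_centralD(4)[OF S f] by simp
    qed (use nearly_centralD(1-3)[OF S] in auto)
    then show "\<exists>S \<delta>. nearly_central S \<delta> \<epsilon> a" by (intro exI)
  qed
qed

text \<open>The net is indexed by finite sets of pairs \<open>(a, n)\<close>, each a demand that the
  commutator with \<open>a\<close> be at most \<open>1 / real (Suc n)\<close>; adding pairs tightens
  the demands for every element simultaneously.\<close>

theorem pseudo_amenable_if_amenable:
  assumes am: "amenable_group G"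
  shows "pseudo_amenable A"
proof -
  let ?T = "tensor_square A"
  have ex: "\<exists>M\<in>carrier AA. tensor_product_map A M = lam G p \<one> \<and> (\<forall>(a, n)\<in>Q. nrm AA (commutator a M) \<le> 1 / real (Suc n))"
    if Q: "finite Q" "Q \<subseteq> carrier A \<times> UNIV" for Q :: "('g operator \<times> nat) set"
  proof -
    have "\<forall>q\<in>Q. \<exists>S \<delta>. nearly_central S \<delta> (1 / real (Suc (snd q))) (fst q)"
    proof
      fix q assume "q \<in> Q"
      then have "fst q \<in> carrier A" using Q by auto
      then show "\<exists>S \<delta>. nearly_central S \<delta> (1 / real (Suc (snd q))) (fst q)"
        by (rule PF_nearly_central[rule_format]) simp
    qed
    then obtain S \<delta> where S: "\<And>q. q \<in> Q \<Longrightarrow> nearly_central (S q) (\<delta> q) (1 / real (Suc (snd q))) (fst q)"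
      by metis
    \<comment> \<open>The extra element 1 keeps the minimum positive and well defined when
      \<open>Q\<close> is empty.\<close>
    define d where "d = Min (insert 1 (\<delta> ` Q))"
    have d: "d > 0" "\<And>q. q \<in> Q \<Longrightarrow> d \<le> \<delta> q" using Q(1) nearly_centralD(3)[OF S] by (auto simp: d_def)
    have fin: "finite (\<Union>q\<in>Q. S q)" using Q(1) nearly_centralD(1)[OF S] by blast
    have sub: "(\<Union>q\<in>Q. S q) \<subseteq> carrier G" by (intro UN_least nearly_centralD(2)[OF S])
    have "\<exists>F \<phi>. almost_fixed (\<Union>q\<in>Q. S q) d F \<phi>"
      unfolding almost_fixed_def by (rule reiter[OF am fin sub d(1)])
    then obtain F \<phi> where af: "almost_fixed (\<Union>q\<in>Q. S q) d F \<phi>" by blast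
    then have pr: "finite_probability G F \<phi>" by (simp add: almost_fixed_def)
    have "nrm AA (commutator a (group_tensor F \<phi>)) \<le> 1 / real (Suc n)" if q: "(a, n) \<in> Q" for a n
    proof -
      have "almost_fixed (S (a, n)) (\<delta> (a, n)) F \<phi>"
        by (rule almost_fixed_mono[OF af _ d(2)[OF q]]) (use q in blast)
      then show ?thesis using nearly_centralD(4)[OF S[OF q]] by simp
    qed
    then show ?thesis
      using group_tensor_AA(1)[OF pr] group_tensor_product[OF pr] by (intro bexI[of _ "group_tensor F \<phi>"]) auto
  qed
  then obtain Mf where Mf: "\<And>Q. \<lbrakk>finite Q; Q \<subseteq> carrier A \<times> UNIV\<rbrakk> \<Longrightarrow> Mf Q \<in> carrier AA \<and>
      tensor_product_map A (Mf Q) = lam G p \<one> \<and> (\<forall>(a, n)\<in>Q. nrm AA (commutator a (Mf Q)) \<le> 1 / real (Suc n))"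
    by metis
  \<comment> \<open>Eventuality for inclusion of finite sets; its image under the choice
    \<open>Mf\<close> is the filter that renders the net.\<close>
  let ?F = "finite_subsets_at_top (carrier A \<times> (UNIV :: nat set))"
  have ev: "\<forall>\<^sub>F Q in ?F. Mf Q \<in> carrier AA \<and> tensor_product_map A (Mf Q) = lam G p \<one>"
    using Mf by (intro eventually_finite_subsets_at_top_weakI) blast
  show ?thesis
    unfolding pseudo_amenable_def
  proof (intro conjI A.banach_algebra_axioms exI[of _ "filtermap Mf ?F"] ballI)
    show "filtermap Mf ?F \<noteq> bot" by (simp add: filtermap_bot_iff)
    show "\<forall>\<^sub>F M in filtermap Mf ?F. M \<in> carrier ?T"
      unfolding eventually_filtermap A.tensor_square_simps(1) using ev by eventually_elim blast
    fix a assume a: "a \<in> carrier A"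
    have "((\<lambda>Q. nrm ?T (lact ?T a (Mf Q) \<ominus>\<^bsub>?T\<^esub> ract ?T (Mf Q) a)) \<longlongrightarrow> 0) ?F"
    proof (rule tendstoI)
      fix e :: real assume "e > 0"
      then obtain n where n: "1 / real (Suc n) < e" using reals_Archimedean by (auto simp: inverse_eq_divide)
      have "\<forall>\<^sub>F Q in ?F. finite Q \<and> Q \<subseteq> carrier A \<times> UNIV \<and> (a, n) \<in> Q"
        unfolding eventually_finite_subsets_at_top using a by (intro exI[of _ "{(a, n)}"]) auto
      then show "\<forall>\<^sub>F Q in ?F. dist (nrm ?T (lact ?T a (Mf Q) \<ominus>\<^bsub>?T\<^esub> ract ?T (Mf Q) a)) 0 < e"
      proof eventually_elim
        case (elim Q)
        then have M: "Mf Q \<in> carrier AA" "nrm AA (commutator a (Mf Q)) \<le> 1 / real (Suc n)"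
          using Mf[of Q] by auto
        then show ?case
          using n A.Sq.PT_nrm_nonneg[OF commutator_eq(2)[OF M(1) a]]
          by (simp add: commutator_eq(1)[OF M(1) a] A.tensor_square_simps(5))
      qed
    qed
    then show "((\<lambda>M. nrm ?T (lact ?T a M \<ominus>\<^bsub>?T\<^esub> ract ?T M a)) \<longlongrightarrow> 0) (filtermap Mf ?F)"
      by (simp add: filterlim_filtermap)
    have "((\<lambda>Q. nrm A (a \<otimes>\<^bsub>A\<^esub> tensor_product_map A (Mf Q) \<ominus>\<^bsub>A\<^esub> a)) \<longlongrightarrow> 0) ?F"
    proof (rule tendsto_eventually)
      show "\<forall>\<^sub>F Q in ?F. nrm A (a \<otimes>\<^bsub>A\<^esub> tensor_product_map A (Mf Q) \<ominus>\<^bsub>A\<^esub> a) = 0"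
        using ev
      proof eventually_elim
        case (elim Q)
        have "a \<otimes>\<^bsub>A\<^esub> lam G p \<one> \<ominus>\<^bsub>A\<^esub> a = \<zero>\<^bsub>A\<^esub>" using U.e_right[OF a] A.minus_self[OF a] by simp
        then show ?case using elim A.nrm_zero by simp
      qed
    qed
    then show "((\<lambda>M. nrm A (a \<otimes>\<^bsub>A\<^esub> tensor_product_map A M \<ominus>\<^bsub>A\<^esub> a)) \<longlongrightarrow> 0) (filtermap Mf ?F)"
      by (simp add: filterlim_filtermap)
  qed
qed

theorem amenable_PF:
  assumes am: "amenable_group G"
  shows "amenable TYPE('x) A"
  unfolding amenable_def using A.banach_algebra_axioms derivation_inner_if_amenable[OF am] by blast

end

section \<open>Constant nets, and the cycle of implications\<close>

lemma amenable_imp_approximately_amenable: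
  assumes am: "amenable TYPE('x) A"
  shows "approximately_amenable TYPE('x) A"
  unfolding approximately_amenable_def
proof (intro conjI allI impI)
  show "banach_algebra A" using am by (simp add: amenable_def)
  fix X :: "('a, 'x) bimodule" and D assume X: "banach_bimodule A X" and D: "bounded_derivation A (dual_bimodule X) D"
  interpret M: banach_bimodule A X by fact
  interpret Y: complex_normed_space "dual_bimodule X" by (rule M.dual_normed)
  have inner: "inner_derivation A (dual_bimodule X) D" using am X D unfolding amenable_def by blast
  show "\<exists>F. F \<noteq> bot \<and> (\<forall>\<^sub>F E in F. inner_derivation A (dual_bimodule X) E) \<and>
      (\<forall>a\<in>carrier A. ((\<lambda>E. nrm (dual_bimodule X) (E a \<ominus>\<^bsub>dual_bimodule X\<^esub> D a)) \<longlongrightarrow> 0) F)"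
  \<comment> \<open>The filter of the constant net at \<open>D\<close>, which is inner
    itself.\<close>
  proof (intro exI[of _ "principal {D}"] conjI ballI)
    fix a assume a: "a \<in> carrier A"
    have "D a \<in> carrier (dual_bimodule X)" using M.bounded_derivationD(1)[OF D a] by simp
    then have "nrm (dual_bimodule X) (D a \<ominus>\<^bsub>dual_bimodule X\<^esub> D a) = 0" by (simp only: Y.minus_self Y.nrm_zero)
    then show "((\<lambda>E. nrm (dual_bimodule X) (E a \<ominus>\<^bsub>dual_bimodule X\<^esub> D a)) \<longlongrightarrow> 0) (principal {D})"
      by (intro tendsto_eventually) (simp add: eventually_principal)
  qed (use inner in \<open>simp_all add: eventually_principal principal_eq_bot_iff\<close>)
qed

theorem theorem7p1:
  fixes G :: "('g, 'b) monoid_scheme"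
  assumes "group G"
  shows "(amenable_group G \<longleftrightarrow>
            (\<forall>p>1. amenable TYPE(('g operator, 'x) bimodule_universe) (PF G p))) \<and>
         (amenable_group G \<longleftrightarrow>
            (\<exists>p>1. approximately_amenable TYPE(('g operator, 'x) bimodule_universe) (PF G p))) \<and>
         (amenable_group G \<longleftrightarrow> (\<exists>p>1. pseudo_amenable (PF G p)))"
proof -
  have pf: "pseudofunctions G p" if "p > 1" for p :: real
    using assms that by (simp add: pseudofunctions_def pseudofunctions_axioms_def)
  \<comment> \<open>The bimodule used for the converse consists of bilinear forms; a form enters the
    universe as evaluation at it, a function on tensors.\<close>
  let ?i = "\<lambda>T :: 'g operator \<Rightarrow> 'g operator \<Rightarrow> complex. (Inr (\<lambda>t. t T) :: ('g operator, 'x) bimodule_universe)"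
  have i: "inj ?i"
  proof (rule injI)
    fix S T assume "?i S = ?i T"
    then have "(\<lambda>t :: ('g operator, 'g operator) tensor. t S) = (\<lambda>t. t T)" by simp
    \<comment> \<open>The indicator function of \<open>S\<close> is a legitimate argument, since
      \<open>tensor\<close> is the type of all functions on forms; it separates \<open>S\<close>
      from every other form.\<close>
    from fun_cong[OF this, of "\<lambda>x. if x = S then 1 else 0"]
    show "S = T" by (simp split: if_splits)
  qed
  have 1: "amenable TYPE(('g operator, 'x) bimodule_universe) (PF G p)" if "amenable_group G" "p > 1" for p
    using pseudofunctions.amenable_PF[OF pf[OF that(2)] that(1)] .
  have 2: "approximately_amenable TYPE(('g operator, 'x) bimodule_universe) (PF G p)"
    if "amenable TYPE(('g operator, 'x) bimodule_universe) (PF G p)" for p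
    by (rule amenable_imp_approximately_amenable[OF that])
  have 3: "amenable_group G" if "approximately_amenable TYPE(('g operator, 'x) bimodule_universe) (PF G p)" "p > 1" for p
    using pseudofunctions.amenable_if_approximately_amenable[OF pf[OF that(2)] that(1) i] .
  have 4: "amenable_group G" if "pseudo_amenable (PF G p)" "p > 1" for p
    using pseudofunctions.amenable_if_pseudo_amenable[OF pf[OF that(2)] that(1)] .
  have 5: "pseudo_amenable (PF G p)" if "amenable_group G" "p > 1" for p
    using pseudofunctions.pseudo_amenable_if_amenable[OF pf[OF that(2)] that(1)] .
  \<comment> \<open>A witness for the existential statements: amenability of the group gives each
    property for every exponent.\<close>
  have "(2::real) > 1" by simp
  with 1 2 3 4 5 show ?thesis by meson
qed

end
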